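(* Let $\alpha,\beta\ge-\tfrac12$. Assume $\{a_j\}_{j\in\mathbb Z}$ is a $\rho$-lacunary sequence in $(0,\infty)$ with $\rho>1$ and $\{b_j\}_{j\in\mathbb Z}$ is a bounded sequence of real numbers. Then the maximal operator $S_{\{a_j\},*}^{\{b_j\}}(\{W_t^{(\alpha,\beta)}\}_{t>0})$ is bounded from $\ell^p(\mathbb N_0,w)$ into itself for every $1<p<\infty$ and $w\in A_p(\mathbb N_0)$, and from $\ell^1(\mathbb N_0,w)$ into $\ell^{1,\infty}(\mathbb N_0,w)$ for every $w\in A_1(\mathbb N_0)$.
   Context: Let $\alpha,\beta>-1$, $d\mu_{\alpha,\beta}(x)=(1-x)^\alpha(1+x)^\beta dx$ on $(-1,1)$, $P_n^{(\alpha,\beta)}$ the Jacobi polynomials (Rodrigues formula $P_n^{(\alpha,\beta)}(x)=\frac{(-1)^n}{2^n n!}(1-x)^{-\alpha}(1+x)^{-\beta}\frac{d^n}{dx^n}((1-x)^{\alpha+n}(1+x)^{\beta+n})$), and $p_n^{(\alpha,\beta)}$ their positive multiples forming an orthonormal basis of $L^2((-1,1),\mu_{\alpha,\beta})$. The discrete Jacobi heat semigroup is $W_t^{(\alpha,\beta)}=e^{tJ^{(\alpha,\beta)}}$, where $J^{(\alpha,\beta)}$ is the Jacobi matrix with $J^{(\alpha,\beta)}(\{p_n^{(\alpha,\beta)}(x)\}_n)(n)=(x-1)p_n^{(\alpha,\beta)}(x)$; explicitly $W_t^{(\alpha,\beta)}f(n)=\sum_{m\ge0}f(m)K_t^{(\alpha,\beta)}(n,m)$,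 $K_t^{(\alpha,\beta)}(n,m)=\int_{-1}^1e^{-t(1-x)}p_n^{(\alpha,\beta)}(x)p_m^{(\alpha,\beta)}(x)d\mu_{\alpha,\beta}(x)$. A sequence $\{a_j\}_{j\in\mathbb Z}\subset(0,\infty)$ is $\rho$-lacunary ($\rho>1$) if $a_{j+1}/a_j\ge\rho$ for all $j$. For $N=(N_1,N_2)\in\mathbb Z^2$, $N_1<N_2$, set $S_{\{a_j\},N}^{\{b_j\}}(\{W_t^{(\alpha,\beta)}\})(f)=\sum_{j=N_1}^{N_2}b_j\big(W_{a_{j+1}}^{(\alpha,\beta)}f-W_{a_j}^{(\alpha,\beta)}f\big)$ and $S_{\{a_j\},*}^{\{b_j\}}(\{W_t^{(\alpha,\beta)}\})(f)=\sup_{N_1<N_2}|S_{\{a_j\},N}^{\{b_j\}}(\{W_t^{(\alpha,\beta)}\})(f)|$. Weights: $v\in A_p(\mathbb N_0)$ ($1<p<\infty$) if $\sup_{0\le n\le m}(m-n+1)^{-p}(\sum_{k=n}^mv_k)(\sum_{k=n}^mv_k^{-1/(p-1)})^{p-1}<\infty$; $v\in A_1(\mathbb N_0)$ if $\sup_{0\le n\le m}(m-n+1)^{-1}(\sum_{k=n}^mv_k)\max_{n\le k\le m}v_k^{-1}<\infty$. $\ell^p(\mathbb N_0,w)$ is the weighted $\ell^p$ space and $\ell^{1,\infty}(\mathbb N_0,w)$ the weighted weak-$\ell^1$ space with quasinorm $\sup_{s>0}s\sum_{|f(n)|>s}w_n$. *)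

theory Defs
  imports "HOL-Analysis.Analysis"
begin

definition jacobi_density :: "real \<Rightarrow> real \<Rightarrow> real \<Rightarrow> real" where
  "jacobi_density \<alpha> \<beta> x = (1 - x) powr \<alpha> * (1 + x) powr \<beta>"

text \<open>Jacobi polynomial via the Rodrigues formula (meaningful for x in (-1,1)).\<close>
definition jacobi_P :: "real \<Rightarrow> real \<Rightarrow> nat \<Rightarrow> real \<Rightarrow> real" where
  "jacobi_P \<alpha> \<beta> n x =
     (-1) ^ n / (2 ^ n * fact n) * (1 - x) powr (- \<alpha>) * (1 + x) powr (- \<beta>) *
     ((deriv ^^ n) (\<lambda>y. (1 - y) powr (\<alpha> + real n) * (1 + y) powr (\<beta> + real n)) x)"

definition jacobi_norm_sq :: "real \<Rightarrow> real \<Rightarrow> nat \<Rightarrow> real" where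
  "jacobi_norm_sq \<alpha> \<beta> n =
     (LBINT x:{-1<..<1}. (jacobi_P \<alpha> \<beta> n x)\<^sup>2 * jacobi_density \<alpha> \<beta> x)"

definition jacobi_p :: "real \<Rightarrow> real \<Rightarrow> nat \<Rightarrow> real \<Rightarrow> real" where
  "jacobi_p \<alpha> \<beta> n x = jacobi_P \<alpha> \<beta> n x / sqrt (jacobi_norm_sq \<alpha> \<beta> n)"

definition jacobi_heat_kernel :: "real \<Rightarrow> real \<Rightarrow> real \<Rightarrow> nat \<Rightarrow> nat \<Rightarrow> real" where
  "jacobi_heat_kernel \<alpha> \<beta> t n m =
     (LBINT x:{-1<..<1}. exp (- t * (1 - x)) * jacobi_p \<alpha> \<beta> n x * jacobi_p \<alpha> \<beta> m x
                          * jacobi_density \<alpha> \<beta> x)"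

definition jacobi_heat :: "real \<Rightarrow> real \<Rightarrow> real \<Rightarrow> (nat \<Rightarrow> real) \<Rightarrow> nat \<Rightarrow> real" where
  "jacobi_heat \<alpha> \<beta> t f n = (\<Sum>m. f m * jacobi_heat_kernel \<alpha> \<beta> t n m)"

definition diff_transform ::
  "real \<Rightarrow> real \<Rightarrow> (int \<Rightarrow> real) \<Rightarrow> (int \<Rightarrow> real) \<Rightarrow> int \<Rightarrow> int \<Rightarrow> (nat \<Rightarrow> real) \<Rightarrow> nat \<Rightarrow> real" where
  "diff_transform \<alpha> \<beta> a b N1 N2 f n =
     (\<Sum>j\<in>{N1..N2}. b j * (jacobi_heat \<alpha> \<beta> (a (j + 1)) f n - jacobi_heat \<alpha> \<beta> (a j) f n))"

text \<open>Maximal operator S_* (as a real supremum; its finiteness is asserted separately).\<close>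
definition diff_transform_max ::
  "real \<Rightarrow> real \<Rightarrow> (int \<Rightarrow> real) \<Rightarrow> (int \<Rightarrow> real) \<Rightarrow> (nat \<Rightarrow> real) \<Rightarrow> nat \<Rightarrow> real" where
  "diff_transform_max \<alpha> \<beta> a b f n =
     (SUP N\<in>{(N1, N2). N1 < N2}. \<bar>diff_transform \<alpha> \<beta> a b (fst N) (snd N) f n\<bar>)"

definition lacunary :: "real \<Rightarrow> (int \<Rightarrow> real) \<Rightarrow> bool" where
  "lacunary \<rho> a \<longleftrightarrow> (\<forall>j. a j > 0) \<and> (\<forall>j. a (j + 1) / a j \<ge> \<rho>)"

definition Ap_weight :: "real \<Rightarrow> (nat \<Rightarrow> real) \<Rightarrow> bool" where
  "Ap_weight p v \<longleftrightarrow> (\<forall>k. v k > 0) \<and>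
     (\<exists>K. \<forall>n m. n \<le> m \<longrightarrow>
        real (m - n + 1) powr (- p) * (\<Sum>k=n..m. v k) *
        (\<Sum>k=n..m. v k powr (- 1 / (p - 1))) powr (p - 1) \<le> K)"

definition A1_weight :: "(nat \<Rightarrow> real) \<Rightarrow> bool" where
  "A1_weight v \<longleftrightarrow> (\<forall>k. v k > 0) \<and>
     (\<exists>K. \<forall>n m. n \<le> m \<longrightarrow>
        (\<Sum>k=n..m. v k) / real (m - n + 1) * (MAX k\<in>{n..m}. 1 / v k) \<le> K)"

definition in_lp :: "real \<Rightarrow> (nat \<Rightarrow> real) \<Rightarrow> (nat \<Rightarrow> real) \<Rightarrow> bool" where
  "in_lp p w f \<longleftrightarrow> summable (\<lambda>n. \<bar>f n\<bar> powr p * w n)"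

definition lp_norm :: "real \<Rightarrow> (nat \<Rightarrow> real) \<Rightarrow> (nat \<Rightarrow> real) \<Rightarrow> real" where
  "lp_norm p w f = (\<Sum>n. \<bar>f n\<bar> powr p * w n) powr (1 / p)"

text \<open>Weighted measure of a level set (the set is asserted summable separately).\<close>
definition level_weight :: "(nat \<Rightarrow> real) \<Rightarrow> (nat \<Rightarrow> real) \<Rightarrow> real \<Rightarrow> real" where
  "level_weight w g s = (\<Sum>n. if \<bar>g n\<bar> > s then w n else 0)"

end

(* With T_s = sum_j b_j (W_{a_{j+1} + s} - W_{a_j + s}), the operator W_s composed with T_0, the bounds
   |d^k/dt^k K_t(n,m)| <= A sqrt(1+t) / ((1+t)^k (1 + t + (n-m)^2)) for k <= 2 say that a tail of the sum
   T_0 starting at N differs from T_{a_N} by a Poisson-type kernel, so the maximal operator is controlled by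
   the values of |T_s f| in the parabolic region |n - m|^2 <= s and by the maximal function. Composition
   with W_{r^2} at the scale r of each bad interval replaces kernel regularity in the Calderon-Zygmund
   decomposition and gives the weak type bounds; the strong weighted bounds follow by dominating
   the bilinear form of T_0 on dyadic intervals by a product of interval averages.
   The operator T_0 is bounded on l^2 as a Jacobi multiplier, since a_j increases and b_j is bounded.

   The kernel bounds need only the recurrence and the on-diagonal bound K_t(n,n) <= A / sqrt(1+t): a weighted
   l^2 energy argument for the tridiagonal matrix gives decay off the diagonal, and interpolation between
   K_t and its derivatives gives k = 1, 2. The on-diagonal bound follows from
   (1-x)^(alpha+1/2) (1+x)^(beta+1/2) p_n(x)^2 <= C near x = 1, an energy estimate for the
   Jacobi differential equation. *)
theory Submission
  imports Defs "HOL-Computational_Algebra.Polynomial"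
begin

text \<open>The kernel is controlled in time, not in space: no bound on its differences in n or m is
  proved. Every Calderon-Zygmund step therefore uses only size in |n - m| and increments in t, and a
  time shift by the squared length of an interval takes the place of a shift in space. Since |b_j|
  is bounded, the majorants of the terms telescope along the times a_j, which keeps all constants
  independent of the number of terms. The supremum is linearized: finitely many points x carry
  freely chosen limits N1 x and N2 x, and bounds uniform in this choice are proved for finitely
  supported f. Limits and suprema are taken only at the end. The tail comparison uses one operator
  with a fixed long range for all x, so the choice moves into the time parameter, where maximal
  functions control it. In the strong bound both interval averages lie below maximal functions, so
  Young's inequality reduces it to the maximal theorem for the weight and its dual. The off-diagonal
  decay starts with the power 8 of |n - m| because each of the two interpolations in time halves the
  power, and 2 must remain for the second derivative.\<close>

section \<open>Maximal functions\<close>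

text \<open>Riesz's rising sun lemma. If \<open>m\<close> is a good point and \<open>b\<close> is
  the first endpoint with positive sum, all proper initial sums of \<open>{m..b}\<close> are
  nonpositive, so every point of the block sees a positive sum up to \<open>b\<close> and is good.
  The block is removed and the rest is handled by induction.\<close>

lemma rising_sun_right:
  fixes c :: "nat \<Rightarrow> real"
  shows "0 \<le> sum c {x. m \<le> x \<and> x < N \<and> (\<exists>b. x \<le> b \<and> b < N \<and> 0 < sum c {x..b})}"
proof (induction "N - m" arbitrary: m rule: less_induct)
  case less
  define G where "G m = {x. m \<le> x \<and> x < N \<and> (\<exists>b. x \<le> b \<and> b < N \<and> 0 < sum c {x..b})}" for m
  have fin: "finite (G m)" for m
    by (rule finite_subset[of _ "{..<N}"]) (auto simp: G_def)
  consider "m \<ge> N" | "m < N" "m \<notin> G m" | "m < N" "m \<in> G m" by linarith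
  then have "0 \<le> sum c (G m)"
  proof cases
    case 1
    then have "G m = {}" by (auto simp: G_def)
    then show ?thesis by simp
  next
    case 2
    then have "G m = G (Suc m)" unfolding G_def
      by (auto simp: Suc_le_eq le_less)
    moreover have "0 \<le> sum c (G (Suc m))"
      unfolding G_def using 2 by (intro less) auto
    ultimately show ?thesis by simp
  next
    case 3
    define P where "P b \<longleftrightarrow> m \<le> b \<and> b < N \<and> 0 < sum c {m..b}" for b
    define b where "b = (LEAST b. P b)"
    have ex: "\<exists>b. P b" using 3 by (auto simp: G_def P_def)
    then have Pb: "P b" unfolding b_def by (rule LeastI_ex)
    have sub: "x \<in> G m" if "m \<le> x" "x \<le> b" for x
    proof (cases "x = m")
      case True with 3 show ?thesis by simp
    next
      case False
      then have xm: "m < x" using that by simp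
      have "\<not> P (x - 1)" unfolding b_def
        using xm that not_less_Least[of "x - 1" P] unfolding b_def by auto
      then have "sum c {m..x-1} \<le> 0" using xm that Pb by (auto simp: P_def)
      moreover have "sum c {m..b} = sum c {m..x-1} + sum c {x..b}"
      proof -
        have "{m..b} = {m..x-1} \<union> {x..b}" "{m..x-1} \<inter> {x..b} = {}" using xm that by auto
        then show ?thesis by (simp add: sum.union_disjoint)
      qed
      ultimately have "0 < sum c {x..b}" using Pb by (auto simp: P_def)
      then show ?thesis using that Pb by (auto simp: G_def P_def)
    qed
    have "G m = {m..b} \<union> G (Suc b)"
      using sub Pb by (auto simp: P_def G_def)
    moreover have "{m..b} \<inter> G (Suc b) = {}" by (auto simp: G_def)
    ultimately have "sum c (G m) = sum c {m..b} + sum c (G (Suc b))"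
      using fin by (simp add: sum.union_disjoint)
    moreover have "0 \<le> sum c (G (Suc b))"
      unfolding G_def using 3 Pb by (intro less) (auto simp: P_def)
    ultimately show ?thesis using Pb by (auto simp: P_def)
  qed
  then show ?case by (simp add: G_def)
qed

text \<open>Mirror image of \<open>rising_sun_right\<close>: blocks are removed at the right end,
  and the greatest starting point \<open>a\<close> is used, so that the final sums over
  \<open>{Suc x..n}\<close> are nonpositive.\<close>

lemma rising_sun_left:
  fixes c :: "nat \<Rightarrow> real"
  shows "0 \<le> sum c {x. x < N \<and> (\<exists>a. a \<le> x \<and> 0 < sum c {a..x})}"
proof (induction N rule: less_induct)
  case (less N)
  define G where "G N = {x. x < N \<and> (\<exists>a. a \<le> x \<and> 0 < sum c {a..x})}" for N :: nat
  have fin: "finite (G m)" for m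
    by (rule finite_subset[of _ "{..<m}"]) (auto simp: G_def)
  have "0 \<le> sum c (G N)"
  proof (cases N)
    case 0
    then show ?thesis by (simp add: G_def)
  next
    case (Suc n)
    show ?thesis
    proof (cases "n \<in> G N")
      case False
      then have "G N = G n" unfolding G_def Suc by (auto simp: less_Suc_eq)
      moreover have "0 \<le> sum c (G n)" unfolding G_def using Suc by (intro less) auto
      ultimately show ?thesis by simp
    next
      case True
      define P where "P a \<longleftrightarrow> a \<le> n \<and> 0 < sum c {a..n}" for a
      define a where "a = (GREATEST a. P a)"
      have ex: "\<exists>a. P a" using True by (auto simp: G_def P_def)
      have Pa: "P a" unfolding a_def using ex by (rule GreatestI_ex_nat[where b = n]) (auto simp: P_def)
      have sub: "x \<in> G N" if "a \<le> x" "x \<le> n" for x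
      proof (cases "x = n")
        case True with \<open>n \<in> G N\<close> show ?thesis by simp
      next
        case False
        have "\<not> P (Suc x)"
        proof
          assume "P (Suc x)"
          then have "Suc x \<le> a" unfolding a_def by (rule Greatest_le_nat[where b = n]) (auto simp: P_def)
          then show False using that by simp
        qed
        then have "sum c {Suc x..n} \<le> 0" using that False by (auto simp: P_def)
        moreover have "sum c {a..n} = sum c {a..x} + sum c {Suc x..n}"
        proof -
          have "{a..n} = {a..x} \<union> {Suc x..n}" "{a..x} \<inter> {Suc x..n} = {}" using that by auto
          then show ?thesis by (simp add: sum.union_disjoint)
        qed
        ultimately have "0 < sum c {a..x}" using Pa by (auto simp: P_def)
        then show ?thesis using that Suc by (auto simp: G_def)
      qed
      have "G N = {a..n} \<union> G a"
        using sub Pa Suc by (auto simp: P_def G_def)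
      moreover have "{a..n} \<inter> G a = {}" by (auto simp: G_def)
      ultimately have "sum c (G N) = sum c {a..n} + sum c (G a)"
        using fin by (simp add: sum.union_disjoint)
      moreover have "0 \<le> sum c (G a)"
        unfolding G_def using Suc Pa by (intro less) (auto simp: P_def)
      ultimately show ?thesis using Pa by (auto simp: P_def)
    qed
  qed
  then show ?case by (simp add: G_def)
qed

text \<open>Averages are taken against \<open>v\<close> itself, which makes the constant the same
  for every weight. With \<open>c = h v - l v\<close>, an interval of average above
  \<open>2 * l\<close> around \<open>x\<close> has a positive sum of \<open>c\<close> on one of its
  two halves at \<open>x\<close>, and the rising sun lemmas bound the two sets of such
  points.\<close>

lemma maximal_weak:
  fixes v h :: "nat \<Rightarrow> real"
  assumes v: "\<And>x. 0 \<le> v x" and h: "\<And>x. 0 \<le> h x" and "0 < l"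
    and X: "X \<subseteq> {..<N}"
    and av: "\<And>x. x \<in> X \<Longrightarrow> \<exists>a b. a \<le> x \<and> x \<le> b \<and> b < N \<and> 2 * l * sum v {a..b} < (\<Sum>y=a..b. h y * v y)"
  shows "l * sum v X \<le> 2 * (\<Sum>y<N. h y * v y)"
proof -
  define c where "c y = h y * v y - l * v y" for y
  define R where "R = {x. 0 \<le> x \<and> x < N \<and> (\<exists>b. x \<le> b \<and> b < N \<and> 0 < sum c {x..b})}"
  define L where "L = {x. x < N \<and> (\<exists>a. a \<le> x \<and> 0 < sum c {a..x})}"
  have fin: "finite R" "finite L" "finite X"
    using X by (auto simp: R_def L_def finite_subset)
  have "0 \<le> sum c R" unfolding R_def by (rule rising_sun_right)
  have "0 \<le> sum c L" unfolding L_def by (rule rising_sun_left)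
  have sb: "sum (\<lambda>y. h y * v y) S \<le> (\<Sum>y<N. h y * v y)" if "S \<subseteq> {..<N}" for S
    using that v h by (intro sum_mono2) auto
  have *: "l * sum v S \<le> (\<Sum>y<N. h y * v y)" if "0 \<le> sum c S" "S \<subseteq> {..<N}" for S
    using that sb[of S] by (simp add: c_def sum_subtractf sum_distrib_left)
  have R: "l * sum v R \<le> (\<Sum>y<N. h y * v y)"
    by (rule *[OF \<open>0 \<le> sum c R\<close>]) (auto simp: R_def)
  have L: "l * sum v L \<le> (\<Sum>y<N. h y * v y)"
    by (rule *[OF \<open>0 \<le> sum c L\<close>]) (auto simp: L_def)
  have "X \<subseteq> R \<union> L"
  proof
    fix x assume x: "x \<in> X"
    then obtain a b where ab: "a \<le> x" "x \<le> b" "b < N" "2 * l * sum v {a..b} < (\<Sum>y=a..b. h y * v y)"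
      using av by blast
    show "x \<in> R \<union> L"
    proof (rule ccontr)
      assume "x \<notin> R \<union> L"
      then have 1: "sum c {x..b} \<le> 0" "sum c {a..x} \<le> 0"
        using ab x X by (auto simp: R_def L_def subset_iff not_less)
      have e: "{a..b} = {a..x} \<union> {x<..b}" "{a..x} \<inter> {x<..b} = {}" "{x..b} = insert x {x<..b}" using ab by auto
      have s1: "sum c {a..b} = sum c {a..x} + sum c {x<..b}" unfolding e(1) using e(2) by (simp add: sum.union_disjoint)
      have s2: "sum c {x..b} = c x + sum c {x<..b}" unfolding e(3) by simp
      \<comment> \<open>The point \<open>x\<close> lies in both halves. The double count costs at
        most \<open>l * v x\<close>, which the factor 2 in the hypothesis pays for.\<close>
      have "- c x \<le> l * v x" using v h by (simp add: c_def)
      also have "\<dots> \<le> l * sum v {a..b}" using ab v \<open>0 < l\<close> by (intro mult_left_mono member_le_sum) auto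
      finally have "sum c {a..b} \<le> l * sum v {a..b}" using s1 s2 1 by linarith
      moreover have "sum c {a..b} = (\<Sum>y=a..b. h y * v y) - l * sum v {a..b}"
        by (simp add: c_def sum_subtractf sum_distrib_left)
      ultimately show False using ab(4) by simp
    qed
  qed
  then have "sum v X \<le> sum v (R \<union> L)" using fin v by (intro sum_mono2) auto
  also have "\<dots> \<le> sum v R + sum v L" using fin v sum_nonneg[of "R \<inter> L" v] by (simp add: sum_Un)
  finally have "l * sum v X \<le> l * sum v R + l * sum v L" using \<open>0 < l\<close> by (simp flip: distrib_left)
  then show ?thesis using R L by linarith
qed

lemma has_integral_powr_cutoff:
  fixes e u L :: real
  assumes "e > -1" "0 \<le> u" "u \<le> L"
  shows "((\<lambda>s. if s < u then s powr e else 0) has_integral u powr (e + 1) / (e + 1)) {0..L}"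
proof -
  have "((\<lambda>s. s powr e) has_integral u powr (e + 1) / (e + 1)) {0..u}"
    using has_integral_powr_from_0[of e u] assms by simp
  then have "((\<lambda>s. if 0 \<le> s \<and> s < u then s powr e else 0) has_integral u powr (e + 1) / (e + 1)) {0..u}"
    by (rule has_integral_spike[of "{u}", rotated 2]) auto
  then have "((\<lambda>s. if 0 \<le> s \<and> s < u then s powr e else 0) has_integral u powr (e + 1) / (e + 1)) {0..L}"
    by (rule has_integral_on_superset) (use assms in auto)
  then show ?thesis by (rule has_integral_eq[rotated]) auto
qed

text \<open>Marcinkiewicz interpolation between the weak bound and the trivial sup bound: for
  \<open>u > 4 * l\<close> only the part of \<open>h\<close> above \<open>2 * l\<close> matters.
  Integrating the weak bound against \<open>l powr (p - 2)\<close> over the heights \<open>l\<close>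
  gives both sides by the layer-cake formula; \<open>p > 1\<close> makes this power integrable at
  0.\<close>

lemma maximal_strong:
  fixes v h u :: "nat \<Rightarrow> real" and p :: real
  assumes p: "1 < p" and vpos: "\<And>x. 0 < v x" and h: "\<And>x. 0 \<le> h x" and u: "\<And>x. 0 \<le> u x"
    and av: "\<And>x. x < N \<Longrightarrow> \<exists>a b. a \<le> x \<and> x \<le> b \<and> b < N \<and> u x * sum v {a..b} \<le> (\<Sum>y=a..b. h y * v y)"
  shows "(\<Sum>x<N. u x powr p * v x) \<le> 2 * 4 powr p * (p / (p - 1)) * (\<Sum>x<N. h x powr p * v x)"
proof -
  have v: "0 \<le> v x" for x using vpos[of x] by simp
  define L where "L = (\<Sum>x<N. u x) + (\<Sum>x<N. h x)"
  have uL: "u x \<le> L" if "x < N" for x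
    using member_le_sum[of x "{..<N}" u] that u h sum_nonneg[of "{..<N}" h] by (auto simp: L_def)
  have hL: "h x \<le> L" if "x < N" for x
    using member_le_sum[of x "{..<N}" h] that u h sum_nonneg[of "{..<N}" u] by (auto simp: L_def)
  have "L \<ge> 0" unfolding L_def using u h by (intro add_nonneg_nonneg sum_nonneg) auto
  have weak: "l * (\<Sum>x<N. if l < u x / 4 then v x else 0) \<le> 2 * (\<Sum>x<N. if l < h x / 2 then h x * v x else 0)"
    if l: "0 < l" for l
  proof -
    define h' where "h' x = (if l < h x / 2 then h x else 0)" for x
    have "l * sum v {x\<in>{..<N}. l < u x / 4} \<le> 2 * (\<Sum>y<N. h' y * v y)"
    proof (rule maximal_weak)
      fix x assume "x \<in> {x\<in>{..<N}. l < u x / 4}"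
      then have x: "x < N" "4 * l < u x" by auto
      obtain a b where ab: "a \<le> x" "x \<le> b" "b < N" "u x * sum v {a..b} \<le> (\<Sum>y=a..b. h y * v y)"
        using av x by blast
      show "\<exists>a b. a \<le> x \<and> x \<le> b \<and> b < N \<and> 2 * l * sum v {a..b} < (\<Sum>y=a..b. h' y * v y)"
      proof -
        have pos: "sum v {a..b} > 0" using vpos ab by (intro sum_pos) auto
        \<comment> \<open>What is discarded from \<open>h\<close> is at most \<open>2 * l\<close>
          pointwise, so an average above \<open>4 * l\<close> stays above
          \<open>2 * l\<close>.\<close>
        have "(\<Sum>y=a..b. h y * v y) \<le> (\<Sum>y=a..b. h' y * v y + 2 * l * v y)"
          using v l by (intro sum_mono) (auto simp: h'_def intro: mult_right_mono)
        also have "\<dots> = (\<Sum>y=a..b. h' y * v y) + 2 * l * sum v {a..b}"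
          by (simp add: sum.distrib sum_distrib_left)
        finally have "u x * sum v {a..b} \<le> (\<Sum>y=a..b. h' y * v y) + 2 * l * sum v {a..b}" using ab by simp
        moreover have "4 * l * sum v {a..b} < u x * sum v {a..b}" using x pos by simp
        ultimately have "2 * l * sum v {a..b} < (\<Sum>y=a..b. h' y * v y)" by simp
        then show ?thesis using ab(1-3) by blast
      qed
    qed (use v h l in \<open>auto simp: h'_def\<close>)
    moreover have "(\<Sum>y<N. h' y * v y) = (\<Sum>x<N. if l < h x / 2 then h x * v x else 0)"
      by (intro sum.cong) (auto simp: h'_def)
    moreover have "sum v {x\<in>{..<N}. l < u x / 4} = (\<Sum>x<N. if l < u x / 4 then v x else 0)"
      by (rule sum.inter_filter) simp
    ultimately show ?thesis by simp
  qed
  have I1: "((\<lambda>s. \<Sum>x<N. v x * (if s < u x / 4 then s powr (p - 1) else 0)) has_integral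
      (\<Sum>x<N. v x * ((u x / 4) powr p / p))) {0..L}"
  proof (intro has_integral_sum has_integral_mult_right)
    fix x assume "x \<in> {..<N}"
    then show "((\<lambda>s. if s < u x / 4 then s powr (p - 1) else 0) has_integral (u x / 4) powr p / p) {0..L}"
      using has_integral_powr_cutoff[of "p - 1" "u x / 4" L] p u[of x] uL[of x] by simp
  qed simp
  have I2: "((\<lambda>s. \<Sum>x<N. 2 * h x * v x * (if s < h x / 2 then s powr (p - 2) else 0)) has_integral
      (\<Sum>x<N. 2 * h x * v x * ((h x / 2) powr (p - 1) / (p - 1)))) {0..L}"
  proof (intro has_integral_sum has_integral_mult_right)
    fix x assume "x \<in> {..<N}"
    then show "((\<lambda>s. if s < h x / 2 then s powr (p - 2) else 0) has_integral (h x / 2) powr (p - 1) / (p - 1)) {0..L}"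
      using has_integral_powr_cutoff[of "p - 2" "h x / 2" L] p h[of x] hL[of x] by (simp add: algebra_simps)
  qed simp
  have "(\<Sum>x<N. v x * ((u x / 4) powr p / p)) \<le> (\<Sum>x<N. 2 * h x * v x * ((h x / 2) powr (p - 1) / (p - 1)))"
  proof (rule has_integral_le[OF I1 I2])
    fix s assume "s \<in> {0..L}"
    show "(\<Sum>x<N. v x * (if s < u x / 4 then s powr (p - 1) else 0))
        \<le> (\<Sum>x<N. 2 * h x * v x * (if s < h x / 2 then s powr (p - 2) else 0))"
    proof (cases "s = 0")
      case True
      then show ?thesis by (simp cong: if_cong)
    next
      case False
      then have s: "0 < s" using \<open>s \<in> {0..L}\<close> by simp
      then have "s powr (p - 1) = s powr (p - 2) * s" using powr_add[of s "p - 2" 1] by simp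
      then have "(\<Sum>x<N. v x * (if s < u x / 4 then s powr (p - 1) else 0))
          = s powr (p - 2) * (s * (\<Sum>x<N. if s < u x / 4 then v x else 0))"
        unfolding sum_distrib_left by (intro sum.cong) auto
      also have "\<dots> \<le> s powr (p - 2) * (2 * (\<Sum>x<N. if s < h x / 2 then h x * v x else 0))"
        using weak[OF s] by (intro mult_left_mono) auto
      also have "\<dots> = (\<Sum>x<N. 2 * h x * v x * (if s < h x / 2 then s powr (p - 2) else 0))"
        unfolding sum_distrib_left by (intro sum.cong) auto
      finally show ?thesis .
    qed
  qed
  also have "\<dots> = (2 * 2 powr (1 - p) / (p - 1)) * (\<Sum>x<N. h x powr p * v x)"
    unfolding sum_distrib_left
  proof (intro sum.cong refl)
    fix x
    have "h x * h x powr (p - 1) = h x powr p" using h[of x] powr_add[of "h x" 1 "p - 1"] by (cases "h x = 0") auto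
    moreover have "(h x / 2) powr (p - 1) = h x powr (p - 1) * 2 powr (1 - p)"
      using h[of x] by (simp add: powr_divide powr_diff)
    moreover have "2 * h x * v x * ((h x / 2) powr (p - 1) / (p - 1)) = 2 * (h x * h x powr (p - 1)) * v x * 2 powr (1 - p) / (p - 1)"
      unfolding calculation(2) by simp
    ultimately show "2 * h x * v x * ((h x / 2) powr (p - 1) / (p - 1)) = 2 * 2 powr (1 - p) / (p - 1) * (h x powr p * v x)"
      by simp
  qed
  also have "\<dots> \<le> (2 / (p - 1)) * (\<Sum>x<N. h x powr p * v x)"
  proof (intro mult_right_mono sum_nonneg)
    have "2 powr (1 - p) \<le> 2 powr 0" using p by (intro powr_mono) auto
    then show "2 * 2 powr (1 - p) / (p - 1) \<le> 2 / (p - 1)" using p by (simp add: divide_right_mono)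
  qed (use v in auto)
  also have "(\<Sum>x<N. v x * ((u x / 4) powr p / p)) = (\<Sum>x<N. u x powr p * v x) / (4 powr p * p)"
    unfolding sum_divide_distrib using u by (intro sum.cong) (auto simp: powr_divide)
  finally show ?thesis using p by (simp add: field_simps)
qed

section \<open>Muckenhoupt weights\<close>

text \<open>The argument of Lerner: with \<open>\<sigma> = w powr (-1/(p-1))\<close>, the quantity \<open>F powr (p-1)\<close> is bounded by a
  \<open>w\<close>-weighted maximal average of a power of a \<open>\<sigma>\<close>-weighted one, and weighted maximal operators are
  bounded for every weight.\<close>

lemma muckenhoupt:
  assumes p: "1 < p" and w: "Ap_weight p w"
  shows "\<exists>C>0. \<forall>X f F. finite X \<longrightarrow> (\<forall>y. 0 \<le> f y) \<longrightarrow> (\<forall>x. 0 \<le> F x) \<longrightarrow>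
     (\<forall>x\<in>X. \<exists>a b. a \<le> x \<and> x \<le> b \<and> F x * real (b - a + 1) \<le> sum f {a..b}) \<longrightarrow>
     summable (\<lambda>y. f y powr p * w y) \<longrightarrow>
     (\<Sum>x\<in>X. F x powr p * w x) \<le> C * (\<Sum>y. f y powr p * w y)"
proof -
  obtain K0 where K0: "\<And>n m. n \<le> m \<Longrightarrow> real (m - n + 1) powr (- p) * (\<Sum>k=n..m. w k) *
        (\<Sum>k=n..m. w k powr (- 1 / (p - 1))) powr (p - 1) \<le> K0" and wpos: "\<And>k. 0 < w k"
    using w unfolding Ap_weight_def by blast
  define K where "K = max K0 1"
  have K: "K > 0" by (simp add: K_def)
  have KK: "\<And>n m. n \<le> m \<Longrightarrow> real (m - n + 1) powr (- p) * (\<Sum>k=n..m. w k) *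
        (\<Sum>k=n..m. w k powr (- 1 / (p - 1))) powr (p - 1) \<le> K"
    using K0 unfolding K_def by (meson max.coboundedI1)
  define \<sigma> where "\<sigma> y = w y powr (- 1 / (p - 1))" for y
  have spos: "0 < \<sigma> y" for y using wpos[of y] by (simp add: \<sigma>_def)
  \<comment> \<open>The conjugate exponent: passing from \<open>p\<close> to \<open>q\<close>
    exchanges \<open>w\<close> and \<open>\<sigma>\<close>, as \<open>sw\<close> and
    \<open>ws\<close> record.\<close>
  define q where "q = p / (p - 1)"
  have q: "1 < q" using p by (simp add: q_def field_simps)
  define C1 where "C1 = 2 * 4 powr p * (p / (p - 1))"
  define C2 where "C2 = 2 * 4 powr q * (q / (q - 1))"
  have C: "C1 > 0" "C2 > 0" using p q by (auto simp: C1_def C2_def)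
  have sw: "\<sigma> y powr (1 - p) = w y" for y
  proof -
    have "(- 1 / (p - 1)) * (1 - p) = 1" using p by (simp add: divide_simps)
    then show ?thesis unfolding \<sigma>_def using wpos[of y] by (simp only: powr_powr powr_one less_imp_le)
  qed
  have ws: "w y powr (1 - q) = \<sigma> y" for y
  proof -
    have "1 - q = - 1 / (p - 1)" using p by (simp add: q_def field_simps)
    then show ?thesis by (simp add: \<sigma>_def)
  qed
  show ?thesis
  proof (intro exI[of _ "K powr q * C2 * C1"] conjI allI impI)
    show "K powr q * C2 * C1 > 0" using C K by simp
    fix X :: "nat set" and f F :: "nat \<Rightarrow> real"
    assume X: "finite X" and f: "\<forall>y. 0 \<le> f y" and F: "\<forall>x. 0 \<le> F x"
      and av: "\<forall>x\<in>X. \<exists>a b. a \<le> x \<and> x \<le> b \<and> F x * real (b - a + 1) \<le> sum f {a..b}"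
      and sm: "summable (\<lambda>y. f y powr p * w y)"
    obtain a b where ab: "\<And>x. x \<in> X \<Longrightarrow> a x \<le> x \<and> x \<le> b x \<and> F x * real (b x - a x + 1) \<le> sum f {a x..b x}"
      using av by metis
    define N where "N = Suc (\<Sum>x\<in>X. b x)"
    have bN: "b x < N" if "x \<in> X" for x
      using member_le_sum[of x X b] X that by (simp add: N_def less_Suc_eq_le)
    have XN: "X \<subseteq> {..<N}" using ab bN by fastforce
    define h where "h y = f y / \<sigma> y" for y
    have h0: "0 \<le> h y" for y using f spos[of y] by (simp add: h_def)
    have hs: "h y * \<sigma> y = f y" for y using spos[of y] by (simp add: h_def)
    define A where "A c d = (\<Sum>y=c..d. h y * \<sigma> y) / sum \<sigma> {c..d}" for c d
    define I where "I y = {(c, d). c \<le> y \<and> y \<le> d \<and> d < N}" for y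
    have Ifin: "finite (I y)" for y
      by (rule finite_subset[of _ "{..N} \<times> {..N}"]) (auto simp: I_def)
    define m where "m y = (if y < N then Max ((\<lambda>(c, d). A c d) ` I y) else 0)" for y
    have Am: "A c d \<le> m y" if "c \<le> y" "y \<le> d" "d < N" for c d y
    proof -
      have "A c d \<in> (\<lambda>(c, d). A c d) ` I y" using that by (force simp: I_def)
      then show ?thesis using that Ifin[of y] by (auto simp: m_def)
    qed
    have A0: "0 \<le> A c d" for c d
      unfolding A_def using h0 spos by (intro divide_nonneg_nonneg sum_nonneg mult_nonneg_nonneg) (auto intro: less_imp_le)
    have m0: "0 \<le> m y" for y
      using Am[of y y y] A0[of y y] by (cases "y < N") (auto simp: m_def)
    have 1: "(\<Sum>y<N. m y powr p * \<sigma> y) \<le> C1 * (\<Sum>y<N. h y powr p * \<sigma> y)"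
      unfolding C1_def
    proof (rule maximal_strong[OF p spos h0 m0])
      fix y assume y: "y < N"
      then have "(y, y) \<in> I y" by (auto simp: I_def)
      then have "Max ((\<lambda>(c, d). A c d) ` I y) \<in> (\<lambda>(c, d). A c d) ` I y"
        using Ifin[of y] by (intro Max_in) auto
      then obtain c d where cd: "c \<le> y" "y \<le> d" "d < N" "m y = A c d"
        using y by (auto simp: m_def I_def)
      have "sum \<sigma> {c..d} > 0" using cd spos by (intro sum_pos) auto
      then have "m y * sum \<sigma> {c..d} = (\<Sum>y=c..d. h y * \<sigma> y)" by (simp add: cd A_def)
      then show "\<exists>a b. a \<le> y \<and> y \<le> b \<and> b < N \<and> m y * sum \<sigma> {a..b} \<le> (\<Sum>y=a..b. h y * \<sigma> y)"
        using cd by (intro exI[of _ c] exI[of _ d]) auto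
    qed
    have hp: "h y powr p * \<sigma> y = f y powr p * w y" for y
    proof -
      have "h y powr p = f y powr p / \<sigma> y powr p" using f spos[of y] by (simp add: h_def powr_divide)
      also have "\<dots> * \<sigma> y = f y powr p * \<sigma> y powr (1 - p)" using spos[of y] by (simp add: powr_diff)
      finally show ?thesis by (simp add: sw)
    qed
    define G where "G x = (if x \<in> X then F x powr (p - 1) / K else 0)" for x
    define g where "g y = m y powr (p - 1) / w y" for y
    have 2: "(\<Sum>x<N. G x powr q * w x) \<le> C2 * (\<Sum>y<N. g y powr q * w y)"
      unfolding C2_def
    proof (rule maximal_strong[OF q wpos])
      show "0 \<le> g y" for y using wpos[of y] by (simp add: g_def)
      show "0 \<le> G x" for x using K by (simp add: G_def)
      fix x assume x: "x < N"
      show "\<exists>a b. a \<le> x \<and> x \<le> b \<and> b < N \<and> G x * sum w {a..b} \<le> (\<Sum>y=a..b. g y * w y)"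
      proof (cases "x \<in> X")
        case False
        then show ?thesis using x wpos[of x] by (intro exI[of _ x]) (auto simp: G_def g_def)
      next
        case True
        define s where "s = sum \<sigma> {a x..b x}"
        define n where "n = real (b x - a x + 1)"
        define W where "W = sum w {a x..b x}"
        have n: "n > 0" by (simp add: n_def)
        have s: "s > 0" unfolding s_def using ab[OF True] spos by (intro sum_pos) auto
        have W: "W > 0" unfolding W_def using ab[OF True] wpos by (intro sum_pos) auto
        have "A (a x) (b x) * s = sum f {a x..b x}" using s by (simp add: A_def s_def hs)
        then have "F x * n \<le> A (a x) (b x) * s"
          using ab[OF True] unfolding n_def by metis
        then have "F x \<le> A (a x) (b x) * s / n" using n by (simp add: field_simps)
        then have "F x powr (p - 1) \<le> (A (a x) (b x) * s / n) powr (p - 1)"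
          using F p by (intro powr_mono2) auto
        also have "\<dots> = A (a x) (b x) powr (p - 1) * s powr (p - 1) * n powr (- p) * n"
          using A0[of "a x" "b x"] s n by (simp add: powr_mult powr_divide powr_diff powr_minus field_simps)
        finally have "F x powr (p - 1) * W \<le> A (a x) (b x) powr (p - 1) * s powr (p - 1) * n powr (- p) * n * W"
          using W by simp
        \<comment> \<open>The first bracket is the quantity bounded by \<open>K\<close> in
          \<open>Ap_weight\<close>. What remains, \<open>n\<close> times a power of the
          \<open>\<sigma>\<close>-average, is at most the sum of \<open>g * w\<close> over the
          interval, because the average is below \<open>m\<close> at each of its points.\<close>
        also have "\<dots> = (n powr (- p) * W * s powr (p - 1)) * (n * A (a x) (b x) powr (p - 1))" by simp
        also have "\<dots> \<le> K * (n * A (a x) (b x) powr (p - 1))"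
          using KK[of "a x" "b x"] ab[OF True] n
          by (intro mult_right_mono) (auto simp: n_def W_def s_def \<sigma>_def)
        finally have "G x * W \<le> n * A (a x) (b x) powr (p - 1)"
          using K True by (simp add: G_def field_simps)
        also have "\<dots> = (\<Sum>y=a x..b x. A (a x) (b x) powr (p - 1))" using ab[OF True] by (simp add: n_def Suc_diff_le)
        also have "\<dots> \<le> (\<Sum>y=a x..b x. g y * w y)"
        proof (rule sum_mono)
          fix y assume "y \<in> {a x..b x}"
          then have "A (a x) (b x) \<le> m y" using bN[OF True] by (intro Am) auto
          then show "A (a x) (b x) powr (p - 1) \<le> g y * w y"
            using A0 p wpos[of y] by (auto simp: g_def intro!: powr_mono2)
        qed
        finally show ?thesis using ab[OF True] bN[OF True] unfolding W_def by blast
      qed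
    qed
    have gq: "g y powr q * w y = m y powr p * \<sigma> y" for y
    proof -
      have "g y powr q = m y powr p / w y powr q"
        using wpos[of y] p by (simp add: g_def powr_divide powr_powr q_def)
      also have "\<dots> * w y = m y powr p * w y powr (1 - q)" using wpos[of y] by (simp add: powr_diff)
      finally show ?thesis by (simp add: ws)
    qed
    have Gq: "F x powr p * w x = K powr q * (G x powr q * w x)" if "x \<in> X" for x
      using K p that by (simp add: G_def powr_divide powr_powr q_def)
    have "(\<Sum>x\<in>X. F x powr p * w x) = K powr q * (\<Sum>x\<in>X. G x powr q * w x)"
      by (simp add: Gq sum_distrib_left)
    also have "\<dots> \<le> K powr q * (\<Sum>x<N. G x powr q * w x)"
      using XN wpos by (intro mult_left_mono sum_mono2) (auto simp: less_imp_le)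
    also have "\<dots> \<le> K powr q * (C2 * (C1 * (\<Sum>y<N. f y powr p * w y)))"
      using order_trans[OF 2[unfolded gq] mult_left_mono[OF 1[unfolded hp], of C2]] C by (intro mult_left_mono) auto
    also have "\<dots> \<le> K powr q * (C2 * (C1 * (\<Sum>y. f y powr p * w y)))"
      using C sm wpos by (intro mult_left_mono sum_le_suminf) (auto simp: less_imp_le)
    finally show "(\<Sum>x\<in>X. F x powr p * w x) \<le> K powr q * C2 * C1 * (\<Sum>y. f y powr p * w y)"
      by (simp add: mult.assoc)
  qed
qed

text \<open>Raising the \<open>Ap_weight\<close> condition to the power \<open>1 / (p - 1)\<close>
  exchanges the roles of the weight and its dual, and the dual of the dual is
  \<open>w\<close>.\<close>

lemma Ap_weight_dual:
  assumes p: "1 < p" and w: "Ap_weight p w"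
  shows "Ap_weight (p / (p - 1)) (\<lambda>k. w k powr (- 1 / (p - 1)))"
proof -
  obtain K where K: "\<And>n m. n \<le> m \<Longrightarrow> real (m - n + 1) powr (- p) * (\<Sum>k=n..m. w k) *
        (\<Sum>k=n..m. w k powr (- 1 / (p - 1))) powr (p - 1) \<le> K" and wpos: "\<And>k. 0 < w k"
    using w unfolding Ap_weight_def by blast
  have e: "- 1 / (p / (p - 1) - 1) = 1 - p" "p / (p - 1) - 1 = 1 / (p - 1)" using p by (auto simp: field_simps)
  have s: "(w k powr (- 1 / (p - 1))) powr (1 - p) = w k" for k
  proof -
    have "(- 1 / (p - 1)) * (1 - p) = 1" using p by (simp add: divide_simps)
    then show ?thesis using wpos[of k] by (simp only: powr_powr powr_one less_imp_le)
  qed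
  show ?thesis unfolding Ap_weight_def unfolding e(1) unfolding e(2) s
  proof (intro conjI allI exI[of _ "K powr (1 / (p - 1))"] impI)
    fix n m :: nat assume nm: "n \<le> m"
    define S where "S = (\<Sum>k=n..m. w k powr (- 1 / (p - 1)))"
    define W where "W = (\<Sum>k=n..m. w k)"
    have S: "S > 0" unfolding S_def using nm wpos by (intro sum_pos) (auto simp: less_le)
    have W: "W > 0" unfolding W_def using nm wpos by (intro sum_pos) auto
    have "real (m - n + 1) powr - (p / (p - 1)) * S * W powr (1 / (p - 1))
       = (real (m - n + 1) powr (- p) * W * S powr (p - 1)) powr (1 / (p - 1))"
      using S W p by (simp add: powr_mult powr_powr)
    also have "\<dots> \<le> K powr (1 / (p - 1))"
      using K[OF nm] S W p by (intro powr_mono2) (auto simp: S_def W_def)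
    finally show "real (m - n + 1) powr - (p / (p - 1)) * (\<Sum>k=n..m. w k powr (- 1 / (p - 1))) *
       (\<Sum>k=n..m. w k) powr (1 / (p - 1)) \<le> K powr (1 / (p - 1))"
      by (simp add: S_def W_def)
  qed (use wpos in \<open>simp add: less_le\<close>)
qed

text \<open>Taking the entry at \<open>x\<close> in the maximum turns the A_1 condition into the
  pointwise form in which it is used.\<close>

lemma A1_weight_avg:
  assumes w: "A1_weight w"
  shows "\<exists>K>0. \<forall>a b x. a \<le> x \<longrightarrow> x \<le> b \<longrightarrow> sum w {a..b} \<le> K * real (b - a + 1) * w x"
proof -
  obtain K where K: "\<And>n m. n \<le> m \<Longrightarrow> (\<Sum>k=n..m. w k) / real (m - n + 1) * (MAX k\<in>{n..m}. 1 / w k) \<le> K"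
    and wpos: "\<And>k. 0 < w k"
    using w unfolding A1_weight_def by blast
  show ?thesis
  proof (intro exI[of _ "max K 1"] conjI allI impI)
    fix a b x :: nat assume ax: "a \<le> x" "x \<le> b"
    have s: "sum w {a..b} \<ge> 0" using wpos by (intro sum_nonneg) (auto intro: less_imp_le)
    have "1 / w x \<le> (MAX k\<in>{a..b}. 1 / w k)" using ax by (intro Max_ge) auto
    then have "sum w {a..b} / real (b - a + 1) * (1 / w x) \<le> sum w {a..b} / real (b - a + 1) * (MAX k\<in>{a..b}. 1 / w k)"
      using s by (intro mult_left_mono) auto
    also have "\<dots> \<le> max K 1" using K[of a b] ax by simp
    finally have "sum w {a..b} / (real (b - a + 1) * w x) \<le> max K 1" by simp
    moreover have "0 < real (b - a + 1) * w x" using wpos[of x] by simp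
    ultimately have "sum w {a..b} \<le> max K 1 * (real (b - a + 1) * w x)" by (simp only: pos_divide_le_eq)
    then show "sum w {a..b} \<le> max K 1 * real (b - a + 1) * w x" by (simp only: mult.assoc)
  qed simp
qed

text \<open>On an interval of length \<open>r\<close> and mass \<open>W\<close> the A_1 condition
  reads \<open>1 / w k \<le> K * r / W\<close>, and summing over \<open>k\<close> gives A_2. This
  makes the l^2 theory available for A_1 weights.\<close>

lemma A1_weight_imp_A2:
  assumes w: "A1_weight w"
  shows "Ap_weight 2 w"
proof -
  have wpos: "\<And>k. 0 < w k" using w unfolding A1_weight_def by blast
  obtain K where K: "K > 0" "\<And>a b x. a \<le> x \<Longrightarrow> x \<le> b \<Longrightarrow> sum w {a..b} \<le> K * real (b - a + 1) * w x"
    using A1_weight_avg[OF w] by blast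
  show ?thesis unfolding Ap_weight_def
  proof (intro conjI allI exI[of _ K] impI)
    fix n m :: nat assume nm: "n \<le> m"
    define r where "r = real (m - n + 1)"
    have r: "r > 0" by (simp add: r_def)
    define W where "W = (\<Sum>k=n..m. w k)"
    have W: "W > 0" unfolding W_def using nm wpos by (intro sum_pos) auto
    have "(\<Sum>k=n..m. w k powr (- 1)) \<le> (\<Sum>k=n..m. K * r / W)"
    proof (rule sum_mono)
      fix k assume "k \<in> {n..m}"
      then have "W \<le> K * r * w k" using K(2)[of n k m] by (simp add: W_def r_def)
      then show "w k powr (- 1) \<le> K * r / W" using wpos[of k] W by (simp add: powr_minus field_simps)
    qed
    also have "\<dots> = r * (K * r / W)" using nm by (simp add: r_def Suc_diff_le)
    finally have "r powr (- 2) * W * (\<Sum>k=n..m. w k powr (- 1)) \<le> r powr (- 2) * W * (r * (K * r / W))"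
      using W by (intro mult_left_mono) auto
    also have "\<dots> = K" using W r by (simp add: powr_minus powr_numeral field_simps power2_eq_square)
    finally show "real (m - n + 1) powr (- 2) * (\<Sum>k=n..m. w k) * (\<Sum>k=n..m. w k powr (- 1 / (2 - 1))) powr (2 - 1) \<le> K"
      using wpos by (simp add: r_def W_def sum_nonneg)
  qed (use wpos in auto)
qed

text \<open>The constant weight yields the unweighted weak type bounds from which
  \<open>bilinear_domination\<close> starts.\<close>

lemma A1_weight_one: "A1_weight (\<lambda>_. 1)"
  unfolding A1_weight_def by (auto intro!: exI[of _ 1] simp: Suc_diff_le)

section \<open>Dyadic intervals and Poisson kernels\<close>

definition dyadic :: "nat \<Rightarrow> nat \<Rightarrow> nat set" where
  "dyadic i k = {k * 2 ^ i..<Suc k * 2 ^ i}"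

text \<open>The dyadic interval with its neighbours. For \<open>k = 0\<close> the subtraction
  truncates, in accordance with the half-line: there is no left neighbour.\<close>

definition dyadic3 :: "nat \<Rightarrow> nat \<Rightarrow> nat set" where
  "dyadic3 i k = {(k - 1) * 2 ^ i..<(k + 2) * 2 ^ i}"

lemma dyadic_iff: "y \<in> dyadic i k \<longleftrightarrow> y div 2 ^ i = k"
proof -
  have "k * 2 ^ i \<le> y \<longleftrightarrow> k \<le> y div 2 ^ i" by (simp add: less_eq_div_iff_mult_less_eq)
  moreover have "y < Suc k * 2 ^ i \<longleftrightarrow> y div 2 ^ i < Suc k" by (simp only: div_less_iff_less_mult pos2 zero_less_power)
  ultimately show ?thesis unfolding dyadic_def by auto
qed

lemma two_power_square: "((2::real) ^ i)\<^sup>2 = 4 ^ i"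
  by (simp add: power2_eq_square flip: power_mult_distrib)
    
lemma card_dyadic [simp]: "card (dyadic i k) = 2 ^ i" "finite (dyadic i k)"
  by (auto simp: dyadic_def)

lemma finite_dyadic3 [simp]: "finite (dyadic3 i k)"
  by (auto simp: dyadic3_def)

lemma dyadic_subset_dyadic3: "dyadic i k \<subseteq> dyadic3 i k"
proof -
  have "(k - 1) * 2 ^ i \<le> k * 2 ^ i" by (intro mult_right_mono) auto
  then show ?thesis by (auto simp: dyadic_def dyadic3_def)
qed

lemma dyadic3_near:
  assumes "x \<in> dyadic i k" "y \<le> x + 2 ^ i" "x \<le> y + 2 ^ i"
  shows "y \<in> dyadic3 i k"
proof -
  have "(k - 1) * 2 ^ i \<le> y"
  proof (cases k)
    case (Suc k')
    with assms show ?thesis by (auto simp: dyadic_def)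
  qed simp
  moreover have "y < (k + 2) * 2 ^ i" using assms by (auto simp: dyadic_def)
  ultimately show ?thesis by (simp add: dyadic3_def)
qed

lemma dyadic3_far:
  assumes "x \<in> dyadic i k" "y \<notin> dyadic3 i k"
  shows "4 ^ i \<le> (real x - real y)\<^sup>2"
proof -
  have "x + 2 ^ i < y \<or> y + 2 ^ i < x" using dyadic3_near[OF assms(1), of y] assms(2) by linarith
  then have "real (x + 2 ^ i) < real y \<or> real (y + 2 ^ i) < real x" by (simp only: of_nat_less_iff)
  then have "2 ^ i \<le> \<bar>real x - real y\<bar>" by auto
  then have "(2 ^ i)\<^sup>2 \<le> \<bar>real x - real y\<bar>\<^sup>2" by (intro power_mono) auto
  then show ?thesis by (simp add: two_power_square)
qed

lemma dyadic3_interval: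
  assumes "x \<in> dyadic i k"
  obtains a b where "dyadic3 i k = {a..b}" "a \<le> x" "x \<le> b" "real (b - a + 1) \<le> 3 * 2 ^ i"
proof
  show "dyadic3 i k = {(k - 1) * 2 ^ i..(k + 2) * 2 ^ i - 1}"
  proof -
    have "0 < (k + 2) * 2 ^ i" by simp
    then have "y < (k + 2) * 2 ^ i \<longleftrightarrow> y \<le> (k + 2) * 2 ^ i - 1" for y by linarith
    then show ?thesis unfolding dyadic3_def atLeastLessThan_def atLeastAtMost_def lessThan_def atMost_def by simp
  qed
  have "x \<in> dyadic3 i k" using assms dyadic_subset_dyadic3 by blast
  then have x: "(k - 1) * 2 ^ i \<le> x" "x < (k + 2) * 2 ^ i" unfolding dyadic3_def by simp_all
  then show "(k - 1) * 2 ^ i \<le> x" "x \<le> (k + 2) * 2 ^ i - 1" by linarith+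
  have "(k + 2) * 2 ^ i \<le> (k - 1) * 2 ^ i + 3 * 2 ^ i" by (cases k) (auto simp: algebra_simps)
  then have "(k + 2) * 2 ^ i - 1 - (k - 1) * 2 ^ i + 1 \<le> 3 * 2 ^ i" using x by linarith
  then have "real ((k + 2) * 2 ^ i - 1 - (k - 1) * 2 ^ i + 1) \<le> real (3 * 2 ^ i)" by (simp only: of_nat_le_iff)
  then show "real ((k + 2) * 2 ^ i - 1 - (k - 1) * 2 ^ i + 1) \<le> 3 * 2 ^ i" by simp
qed

lemma dyadic_ancestor:
  assumes "i \<le> j" "x div 2 ^ i = y div (2 ^ i :: nat)"
  shows "x div 2 ^ j = y div (2 ^ j :: nat)"
proof -
  have "(2::nat) ^ j = 2 ^ i * 2 ^ (j - i)" using assms by (simp flip: power_add)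
  then show ?thesis using assms by (simp add: div_mult2_eq)
qed

text \<open>A Poisson kernel at height \<open>2 ^ i\<close> is at most a combination of normalized
  indicators of triples at the scales \<open>j \<ge> i\<close>, with geometric weights of ratio 1/2;
  hence 8 = 4 * 2. As \<open>Y\<close> is finite, scales up to one \<open>N\<close> suffice, and
  this finite range allows the largest average to be selected later.\<close>

lemma poisson_scales:
  fixes f :: "nat \<Rightarrow> real"
  assumes f: "\<And>y. 0 \<le> f y" and Y: "finite Y"
  shows "\<exists>N\<ge>i. \<forall>A. (\<forall>j\<in>{i..N}. sum f (dyadic3 j (x div 2 ^ j)) \<le> A * 2 ^ j) \<longrightarrow>
      (\<Sum>y\<in>Y. f y * (2 ^ i / (4 ^ i + (real x - real y)\<^sup>2))) \<le> 8 * A"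
proof -
  define N where "N = i + x + (\<Sum>y\<in>Y. y)"
  have "N \<ge> i" by (simp add: N_def)
  have "(\<Sum>y\<in>Y. f y * (2 ^ i / (4 ^ i + (real x - real y)\<^sup>2))) \<le> 8 * A"
    if A: "\<forall>j\<in>{i..N}. sum f (dyadic3 j (x div 2 ^ j)) \<le> A * 2 ^ j" for A
  proof -
  have pt: "2 ^ i / (4 ^ i + (real x - real y)\<^sup>2) \<le> (\<Sum>j=i..N. 4 * (2 ^ i / 4 ^ j) * of_bool (y \<in> dyadic3 j (x div 2 ^ j)))"
    if "y \<in> Y" for y
  proof -
    define P where "P j \<longleftrightarrow> i \<le> j \<and> x \<le> y + 2 ^ j \<and> y \<le> x + 2 ^ j" for j
    have "x + y \<le> N" using member_le_sum[of y Y id] that Y by (simp add: N_def)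
    also have "N \<le> 2 ^ N" by (simp add: less_imp_le)
    finally have PN: "P N" by (auto simp: P_def N_def)
    \<comment> \<open>The first scale at which \<open>x\<close> and \<open>y\<close> are within
      \<open>2 ^ j\<close>. Failure at the preceding scale gives
      \<open>2 ^ (j - 1) < \<bar>x - y\<bar>\<close>, so \<open>4 ^ j\<close> is at most 4 times the
      denominator.\<close>
    define j where "j = (LEAST j. P j)"
    have Pj: "P j" and jN: "j \<le> N" unfolding j_def using PN by (auto intro: LeastI Least_le)
    have "4 ^ j \<le> 4 * (4 ^ i + (real x - real y)\<^sup>2)"
    proof (cases "j = i")
      case False
      then have ji: "i < j" using Pj by (auto simp: P_def)
      have "\<not> P (j - 1)" using not_less_Least[of "j - 1" P] ji by (auto simp: j_def)
      then have "y + 2 ^ (j - 1) < x \<or> x + 2 ^ (j - 1) < y" using ji by (auto simp: P_def)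
      then have "real (y + 2 ^ (j - 1)) < real x \<or> real (x + 2 ^ (j - 1)) < real y" by (simp only: of_nat_less_iff)
      then have "2 ^ (j - 1) \<le> \<bar>real x - real y\<bar>" by auto
      then have "(2 ^ (j - 1))\<^sup>2 \<le> \<bar>real x - real y\<bar>\<^sup>2" by (intro power_mono) auto
      moreover have "(2 ^ (j - 1))\<^sup>2 = (4::real) ^ (j - 1)"
        by (rule two_power_square)
      moreover have "(4::real) ^ j = 4 * 4 ^ (j - 1)" using ji by (cases j) auto
      moreover have "(0::real) \<le> 4 ^ i" by simp
      ultimately show ?thesis unfolding power2_abs distrib_left by linarith
    qed simp
    moreover have "(0::real) < 4 ^ i + (real x - real y)\<^sup>2" by (simp add: add_pos_nonneg)
    ultimately have "2 ^ i / (4 ^ i + (real x - real y)\<^sup>2) \<le> 2 ^ i / (4 ^ j / 4)"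
      by (intro divide_left_mono) auto
    then have "2 ^ i / (4 ^ i + (real x - real y)\<^sup>2) \<le> 4 * (2 ^ i / 4 ^ j)" by (simp add: mult.commute)
    also have "4 * (2 ^ i / 4 ^ j) = (4::real) * (2 ^ i / 4 ^ j) * of_bool (y \<in> dyadic3 j (x div 2 ^ j))"
      using Pj dyadic3_near[of x j "x div 2 ^ j" y] by (auto simp: P_def dyadic_iff)
    also have "\<dots> \<le> (\<Sum>j=i..N. 4 * (2 ^ i / 4 ^ j) * of_bool (y \<in> dyadic3 j (x div 2 ^ j)))"
      using Pj jN by (intro member_le_sum) (auto simp: P_def)
    finally show ?thesis .
  qed
  have "(\<Sum>y\<in>Y. f y * (2 ^ i / (4 ^ i + (real x - real y)\<^sup>2)))
     \<le> (\<Sum>y\<in>Y. f y * (\<Sum>j=i..N. 4 * (2 ^ i / 4 ^ j) * of_bool (y \<in> dyadic3 j (x div 2 ^ j))))"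
    using pt f by (intro sum_mono mult_left_mono) auto
  also have "\<dots> = (\<Sum>j=i..N. 4 * (2 ^ i / 4 ^ j) * (\<Sum>y\<in>Y. f y * of_bool (y \<in> dyadic3 j (x div 2 ^ j))))"
    unfolding sum_distrib_left by (subst sum.swap) (simp add: mult_ac)
  also have "\<dots> \<le> (\<Sum>j=i..N. 4 * (2 ^ i / 4 ^ j) * (A * 2 ^ j))"
  proof (intro sum_mono mult_left_mono)
    fix j assume j: "j \<in> {i..N}"
    have "(\<Sum>y\<in>Y. f y * of_bool (y \<in> dyadic3 j (x div 2 ^ j))) = sum f (Y \<inter> dyadic3 j (x div 2 ^ j))"
      using Y by (simp add: sum.inter_restrict of_bool_def if_distrib[of "\<lambda>t. _ * t"] cong: if_cong)
    also have "\<dots> \<le> sum f (dyadic3 j (x div 2 ^ j))" using f by (intro sum_mono2) auto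
    also have "\<dots> \<le> A * 2 ^ j" using A j by auto
    finally show "(\<Sum>y\<in>Y. f y * of_bool (y \<in> dyadic3 j (x div 2 ^ j))) \<le> A * 2 ^ j" .
  qed auto
  also have "\<dots> = 4 * A * (\<Sum>j=i..N. (1/2) ^ (j - i))"
    unfolding sum_distrib_left
  proof (intro sum.cong refl)
    fix j assume "j \<in> {i..N}"
    then have "(2::real) ^ j = 2 ^ i * 2 ^ (j - i)" by (simp flip: power_add)
    moreover have "(4::real) ^ j = 2 ^ j * 2 ^ j" by (simp flip: power_mult_distrib)
    ultimately show "4 * (2 ^ i / 4 ^ j) * (A * 2 ^ j) = 4 * A * (1/2) ^ (j - i)"
      by (simp add: field_simps power_one_over)
  qed
  also have "\<dots> \<le> 4 * A * 2"
  proof (intro mult_left_mono)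
    have "(\<Sum>j=i..N. (1/2::real) ^ (j - i)) = (\<Sum>j\<le>N-i. (1/2) ^ j)"
      using \<open>N \<ge> i\<close> by (intro sum.reindex_bij_witness[of _ "\<lambda>j. j + i" "\<lambda>j. j - i"]) auto
    also have "\<dots> \<le> (\<Sum>j. (1/2) ^ j)" by (intro sum_le_suminf summable_geometric) auto
    also have "\<dots> = 2" by (subst suminf_geometric) auto
    finally show "(\<Sum>j=i..N. (1/2::real) ^ (j - i)) \<le> 2" .
    have "0 \<le> sum f (dyadic3 i (x div 2 ^ i))" using f by (intro sum_nonneg) auto
    also have "\<dots> \<le> A * 2 ^ i" using A \<open>N \<ge> i\<close> by auto
    finally have "0 \<le> A * 2 ^ i" .
    then show "0 \<le> 4 * A" using mult_neg_pos[of A "2 ^ i"] by (cases "A < 0") auto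
  qed
  finally show ?thesis by simp
  qed
  then show ?thesis using \<open>N \<ge> i\<close> by blast
qed

lemma poisson_dyadic:
  fixes f :: "nat \<Rightarrow> real"
  assumes "\<And>y. 0 \<le> f y" "finite Y" "\<And>j. i \<le> j \<Longrightarrow> sum f (dyadic3 j (x div 2 ^ j)) \<le> A * 2 ^ j"
  shows "(\<Sum>y\<in>Y. f y * (2 ^ i / (4 ^ i + (real x - real y)\<^sup>2))) \<le> 8 * A"
proof -
  obtain N where "N \<ge> i" "\<And>A. (\<forall>j\<in>{i..N}. sum f (dyadic3 j (x div 2 ^ j)) \<le> A * 2 ^ j) \<Longrightarrow>
      (\<Sum>y\<in>Y. f y * (2 ^ i / (4 ^ i + (real x - real y)\<^sup>2))) \<le> 8 * A"
    using poisson_scales[where f = f and Y = Y and i = i and x = x, OF assms(1,2)] by blast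
  then show ?thesis using assms(3) by auto
qed

lemma sqrt_dyadic_scale:
  assumes "1 \<le> \<rho>"
  obtains i :: nat where "2 ^ i \<le> sqrt \<rho>" "sqrt \<rho> < 2 * 2 ^ i"
proof -
  define P where "P i \<longleftrightarrow> sqrt \<rho> < 2 ^ Suc i" for i :: nat
  obtain n where "sqrt \<rho> < 2 ^ n" using real_arch_pow[of 2 "sqrt \<rho>"] by auto
  then have "P n" unfolding P_def by (simp add: less_le_trans[of _ "2 ^ n"])
  define i where "i = (LEAST i. P i)"
  have "P i" unfolding i_def using \<open>P n\<close> by (rule LeastI)
  moreover have "2 ^ i \<le> sqrt \<rho>"
  proof (cases i)
    case 0
    then show ?thesis using assms by simp
  next
    case (Suc j)
    then have "\<not> P j" using not_less_Least[of j P] by (simp add: i_def)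
    then show ?thesis using Suc by (simp add: P_def)
  qed
  ultimately show ?thesis using that by (simp add: P_def)
qed

text \<open>The scale with the largest average is the witness, so a single interval dominates the
  whole Poisson sum. In 48 the factor 8 is from \<open>poisson_scales\<close>, 2 from rounding
  \<open>sqrt \<rho>\<close> to a power of 2, and 3 from the length of a triple.\<close>

lemma poisson_interval:
  fixes f :: "nat \<Rightarrow> real"
  assumes f: "\<And>y. 0 \<le> f y" and Y: "finite Y" and \<rho>: "1 \<le> \<rho>"
  shows "\<exists>a b. a \<le> x \<and> x \<le> b \<and> (\<Sum>y\<in>Y. f y * (sqrt \<rho> / (\<rho> + (real x - real y)\<^sup>2))) * real (b - a + 1) \<le> 48 * sum f {a..b}"
proof -
  obtain i where i: "2 ^ i \<le> sqrt \<rho>" "sqrt \<rho> < 2 * 2 ^ i" using sqrt_dyadic_scale[OF \<rho>] by blast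
  have i2: "4 ^ i \<le> \<rho>"
  proof -
    have "(2 ^ i)\<^sup>2 \<le> (sqrt \<rho>)\<^sup>2" using i by (intro power_mono) auto
    then show ?thesis using \<rho> by (simp add: two_power_square)
  qed
  obtain N where N: "N \<ge> i" "\<And>A. (\<forall>j\<in>{i..N}. sum f (dyadic3 j (x div 2 ^ j)) \<le> A * 2 ^ j) \<Longrightarrow>
      (\<Sum>y\<in>Y. f y * (2 ^ i / (4 ^ i + (real x - real y)\<^sup>2))) \<le> 8 * A"
    using poisson_scales[where f = f and Y = Y and i = i and x = x, OF f Y] by blast
  define M where "M j = sum f (dyadic3 j (x div 2 ^ j)) / 2 ^ j" for j
  have "Max (M ` {i..N}) \<in> M ` {i..N}" using N(1) by (intro Max_in) auto
  then obtain j where j: "j \<in> {i..N}" "Max (M ` {i..N}) = M j" by auto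
  have "M l \<le> M j" if "i \<le> l" "l \<le> N" for l 
    using that unfolding j(2)[symmetric] by (intro Max_ge) auto
  then have "(\<Sum>y\<in>Y. f y * (2 ^ i / (4 ^ i + (real x - real y)\<^sup>2))) \<le> 8 * M j"
    by (intro N(2)) (auto simp: M_def field_simps)
  moreover have "(\<Sum>y\<in>Y. f y * (sqrt \<rho> / (\<rho> + (real x - real y)\<^sup>2))) \<le> (\<Sum>y\<in>Y. f y * (2 * (2 ^ i / (4 ^ i + (real x - real y)\<^sup>2))))"
  proof (intro sum_mono mult_left_mono f)
    fix y
    have "sqrt \<rho> / (\<rho> + (real x - real y)\<^sup>2) \<le> 2 * 2 ^ i / (4 ^ i + (real x - real y)\<^sup>2)"
      using i i2 by (intro frac_le) (auto simp: add_pos_nonneg)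
    then show "sqrt \<rho> / (\<rho> + (real x - real y)\<^sup>2) \<le> 2 * (2 ^ i / (4 ^ i + (real x - real y)\<^sup>2))" by simp
  qed
  moreover have "(\<Sum>y\<in>Y. f y * (2 * (2 ^ i / (4 ^ i + (real x - real y)\<^sup>2)))) = 2 * (\<Sum>y\<in>Y. f y * (2 ^ i / (4 ^ i + (real x - real y)\<^sup>2)))"
    unfolding sum_distrib_left by (intro sum.cong) auto
  ultimately have le: "(\<Sum>y\<in>Y. f y * (sqrt \<rho> / (\<rho> + (real x - real y)\<^sup>2))) \<le> 16 * M j"
    by linarith
  obtain a b where ab: "dyadic3 j (x div 2 ^ j) = {a..b}" "a \<le> x" "x \<le> b" "real (b - a + 1) \<le> 3 * 2 ^ j"
    using dyadic3_interval[of x j "x div 2 ^ j"] by (auto simp: dyadic_iff)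
  have M0: "0 \<le> M j" unfolding M_def using f by (intro divide_nonneg_nonneg sum_nonneg) auto
  have "(\<Sum>y\<in>Y. f y * (sqrt \<rho> / (\<rho> + (real x - real y)\<^sup>2))) * real (b - a + 1) \<le> 16 * M j * real (b - a + 1)"
    using le by (intro mult_right_mono) auto
  also have "\<dots> \<le> 16 * M j * (3 * 2 ^ j)" using M0 ab(4) by (intro mult_left_mono) auto
  also have "\<dots> = 48 * sum f {a..b}" by (simp add: M_def ab(1))
  finally show ?thesis using ab(2,3) by blast
qed

text \<open>\<open>poisson_interval\<close> is applied to a finite partial sum above half of the
  total, which doubles 48.\<close>

lemma poisson_interval_suminf:
  fixes f :: "nat \<Rightarrow> real"
  assumes f: "\<And>y. 0 \<le> f y" and \<rho>: "1 \<le> \<rho>"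
    and sm: "summable (\<lambda>y. f y * (sqrt \<rho> / (\<rho> + (real x - real y)\<^sup>2)))"
  shows "\<exists>a b. a \<le> x \<and> x \<le> b \<and> (\<Sum>y. f y * (sqrt \<rho> / (\<rho> + (real x - real y)\<^sup>2))) * real (b - a + 1) \<le> 96 * sum f {a..b}"
proof -
  let ?g = "\<lambda>y. f y * (sqrt \<rho> / (\<rho> + (real x - real y)\<^sup>2))"
  have g0: "0 \<le> ?g y" for y using f \<rho> by simp
  show ?thesis
  proof (cases "suminf ?g \<le> 0")
    case True
    then have "suminf ?g * real (x - x + 1) \<le> 96 * sum f {x..x}" using f[of x] by simp
    then show ?thesis by blast
  next
    case False
    have "(\<lambda>n. sum ?g {..<n}) \<longlonglongrightarrow> suminf ?g" using sm by (rule summable_LIMSEQ)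
    moreover have "suminf ?g / 2 < suminf ?g" using False by simp
    ultimately have "\<forall>\<^sub>F n in sequentially. suminf ?g / 2 < sum ?g {..<n}" by (rule order_tendstoD)
    then obtain n where n: "suminf ?g / 2 < sum ?g {..<n}" by (auto simp: eventually_sequentially)
    obtain a b where ab: "a \<le> x" "x \<le> b" "sum ?g {..<n} * real (b - a + 1) \<le> 48 * sum f {a..b}"
      using poisson_interval[where f = f and Y = "{..<n}" and x = x, OF f finite_lessThan \<rho>] by blast
    have "suminf ?g * real (b - a + 1) \<le> 2 * sum ?g {..<n} * real (b - a + 1)"
      using n by (intro mult_right_mono) auto
    also have "\<dots> \<le> 96 * sum f {a..b}" using ab(3) by linarith
    finally show ?thesis using ab by blast
  qed
qed

section \<open>Differences of heat kernels\<close>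

text \<open>Both \<open>G - F\<close> and \<open>G + F\<close> are nondecreasing. This replaces the
  integral of the absolute derivative by an increment of an explicit antiderivative.\<close>

lemma increment_le:
  fixes F G :: "real \<Rightarrow> real"
  assumes uv: "u \<le> v"
    and F: "\<And>t. u \<le> t \<Longrightarrow> t \<le> v \<Longrightarrow> (F has_real_derivative F' t) (at t)"
    and G: "\<And>t. u \<le> t \<Longrightarrow> t \<le> v \<Longrightarrow> (G has_real_derivative G' t) (at t)"
    and le: "\<And>t. u \<le> t \<Longrightarrow> t \<le> v \<Longrightarrow> \<bar>F' t\<bar> \<le> G' t"
  shows "\<bar>F v - F u\<bar> \<le> G v - G u"
proof -
  have "G u - F u \<le> G v - F v"
  proof (rule DERIV_nonneg_imp_nondecreasing[OF uv])
    fix t assume t: "u \<le> t" "t \<le> v"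
    show "\<exists>y. ((\<lambda>t. G t - F t) has_real_derivative y) (at t) \<and> 0 \<le> y"
      using DERIV_diff[OF G[OF t] F[OF t]] le[OF t] by (intro exI[of _ "G' t - F' t"]) auto
  qed
  moreover have "G u + F u \<le> G v + F v"
  proof (rule DERIV_nonneg_imp_nondecreasing[OF uv])
    fix t assume t: "u \<le> t" "t \<le> v"
    show "\<exists>y. ((\<lambda>t. G t + F t) has_real_derivative y) (at t) \<and> 0 \<le> y"
      using DERIV_add[OF G[OF t] F[OF t]] le[OF t] by (intro exI[of _ "G' t + F' t"]) auto
  qed
  ultimately show ?thesis by linarith
qed

lemma sum_telescope_int:
  fixes G :: "int \<Rightarrow> real"
  assumes "N1 \<le> N2 + 1"
  shows "(\<Sum>j\<in>{N1..N2}. G (j + 1) - G j) = G (N2 + 1) - G N1"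
proof -
  have "(\<Sum>j\<in>{N1..k - 1}. G (j + 1) - G j) = G k - G N1" if "N1 \<le> k" for k
    using that
  proof (induction k rule: int_ge_induct)
    case (step k)
    then have "{N1..k + 1 - 1} = insert k {N1..k - 1}" by auto
    then show ?case using step by simp
  qed simp
  from this[of "N2 + 1"] assms show ?thesis by simp
qed

lemma divide_cancel_sqrt:
  fixes x :: real
  assumes "0 < x"
  shows "A * sqrt x / (x * y) = A / (sqrt x * y)"
proof -
  have "A * s / (s * s * y) = A / (s * y)" if "0 < s" for s :: real using that by simp
  from this[of "sqrt x"] assms show ?thesis by (simp only: real_sqrt_mult_self abs_of_pos real_sqrt_gt_0_iff)
qed

text \<open>What the operator theory takes from the heat kernel; \<open>\<kappa> k\<close> is its
  \<open>k\<close>-th time derivative. The bounds contain \<open>1 + t\<close> instead of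
  \<open>t\<close> because the discrete kernel does not become singular as \<open>t\<close> tends to
  0.\<close>

locale heat_family =
  fixes \<kappa> :: "nat \<Rightarrow> real \<Rightarrow> nat \<Rightarrow> nat \<Rightarrow> real" and A :: real
  assumes deriv: "\<And>k t n m. ((\<lambda>t. \<kappa> k t n m) has_real_derivative \<kappa> (Suc k) t n m) (at t)"
    and bound: "\<And>k t n m. k \<le> 2 \<Longrightarrow> 0 \<le> t \<Longrightarrow>
      \<bar>\<kappa> k t n m\<bar> \<le> A * sqrt (1 + t) / ((1 + t) ^ k * (1 + t + (real n - real m)\<^sup>2))"
    and sym: "\<And>k t n m. \<kappa> k t n m = \<kappa> k t m n"
    and semigroup: "\<And>s t n m. 0 \<le> s \<Longrightarrow> 0 \<le> t \<Longrightarrow> (\<lambda>l. \<kappa> 0 s n l * \<kappa> 0 t l m) sums \<kappa> 0 (s + t) n m"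
    and A_pos: "0 < A"

locale heat_differences = heat_family +
  fixes a b :: "int \<Rightarrow> real" and B :: real
  assumes a_pos: "\<And>j. 0 < a j" and a_less: "\<And>j. a j < a (j + 1)"
    and b_le: "\<And>j. \<bar>b j\<bar> \<le> B" and B_pos: "0 < B"
begin

definition D :: "int \<Rightarrow> int \<Rightarrow> real \<Rightarrow> nat \<Rightarrow> nat \<Rightarrow> real" where
  "D N1 N2 s n m = (\<Sum>j\<in>{N1..N2}. b j * (\<kappa> 0 (a (j + 1) + s) n m - \<kappa> 0 (a j + s) n m))"

lemma a_mono: "i \<le> j \<Longrightarrow> a i \<le> a j"
proof (induction j rule: int_ge_induct)
  case (step j)
  then show ?case using a_less[of j] by linarith
qed simp

lemma D_sym: "D N1 N2 s n m = D N1 N2 s m n"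
  unfolding D_def by (subst sym, subst (2) sym) simp

text \<open>Each term is at most \<open>B\<close> times an increment of \<open>G\<close>, and these
  telescope. The bound sees only the two extreme times, not the number of terms in between.\<close>

lemma weighted_increments_le:
  fixes F G :: "real \<Rightarrow> real"
  assumes N: "N1 \<le> N2 + 1" 
    and F: "\<And>t. a N1 \<le> t \<Longrightarrow> t \<le> a (N2 + 1) \<Longrightarrow> (F has_real_derivative F' t) (at t)"
    and G: "\<And>t. a N1 \<le> t \<Longrightarrow> t \<le> a (N2 + 1) \<Longrightarrow> (G has_real_derivative G' t) (at t)"
    and le: "\<And>t. a N1 \<le> t \<Longrightarrow> t \<le> a (N2 + 1) \<Longrightarrow> \<bar>F' t\<bar> \<le> G' t"
  shows "\<bar>\<Sum>j\<in>{N1..N2}. b j * (F (a (j + 1)) - F (a j))\<bar> \<le> B * (G (a (N2 + 1)) - G (a N1))"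
proof -
  have "\<bar>\<Sum>j\<in>{N1..N2}. b j * (F (a (j + 1)) - F (a j))\<bar> \<le> (\<Sum>j\<in>{N1..N2}. \<bar>b j * (F (a (j + 1)) - F (a j))\<bar>)"
    by (rule sum_abs)
  also have "\<dots> \<le> (\<Sum>j\<in>{N1..N2}. B * (G (a (j + 1)) - G (a j)))"
  proof (rule sum_mono)
    fix j assume j: "j \<in> {N1..N2}"
    have in_range: "a N1 \<le> t" "t \<le> a (N2 + 1)" if "a j \<le> t" "t \<le> a (j + 1)" for t
      using that a_mono[of N1 j] a_mono[of "j + 1" "N2 + 1"] j by auto
    have "\<bar>F (a (j + 1)) - F (a j)\<bar> \<le> G (a (j + 1)) - G (a j)"
      by (rule increment_le[where F' = F' and G' = G']) (use a_less[of j] in_range F G le in auto)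
    then show "\<bar>b j * (F (a (j + 1)) - F (a j))\<bar> \<le> B * (G (a (j + 1)) - G (a j))"
      unfolding abs_mult using b_le[of j] by (intro mult_mono) auto
  qed
  also have "\<dots> = B * (G (a (N2 + 1)) - G (a N1))"
    using sum_telescope_int[OF N, of "\<lambda>j. G (a j)"] by (simp flip: sum_distrib_left)
  finally show ?thesis .
qed

lemma deriv_shift: "((\<lambda>t. \<kappa> k (t + s) n m) has_real_derivative \<kappa> (Suc k) (t + s) n m) (at t)"
  using deriv[of k n m "t + s"] by (simp add: DERIV_shift)

text \<open>With the spatial decay dropped, the first time derivative is at most
  \<open>A * (1 + s + t) powr (-3/2)\<close>, which has the antiderivative
  \<open>?G\<close>.\<close>

lemma D_le:
  assumes s: "0 \<le> s"
  shows "\<bar>D N1 N2 s n m\<bar> \<le> 2 * A * B / sqrt (1 + s)"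
proof (cases "N1 \<le> N2 + 1")
  case False
  then have "D N1 N2 s n m = 0" by (simp add: D_def)
  then show ?thesis using A_pos B_pos s by simp
next
  case True
  let ?G = "\<lambda>t. - (2 * A / sqrt (1 + s + t))"
  have "\<bar>D N1 N2 s n m\<bar> \<le> B * (?G (a (N2 + 1)) - ?G (a N1))"
    unfolding D_def
  proof (rule weighted_increments_le[where F = "\<lambda>t. \<kappa> 0 (t + s) n m" and G = ?G, OF True deriv_shift])
    fix t assume "a N1 \<le> t"
    then have t: "0 < t" using a_pos[of N1] by simp
    show "(?G has_real_derivative A / ((1 + s + t) * sqrt (1 + s + t))) (at t)"
      using t s by (auto intro!: derivative_eq_intros simp: field_simps power2_eq_square)
    have "\<bar>\<kappa> (Suc 0) (t + s) n m\<bar> \<le> A * sqrt (1 + (t + s)) / ((1 + (t + s)) ^ Suc 0 * (1 + (t + s) + (real n - real m)\<^sup>2))"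
      using t s by (intro bound) auto
    also have "\<dots> \<le> A * sqrt (1 + (t + s)) / ((1 + (t + s)) ^ Suc 0 * (1 + (t + s)))"
      using t s A_pos by (intro divide_left_mono mult_left_mono) (auto intro!: mult_pos_pos add_pos_nonneg)
    also have "\<dots> = A / ((1 + s + t) * sqrt (1 + s + t))"
      using t s divide_cancel_sqrt[of "1 + s + t" A "1 + s + t"] by (simp add: add_ac mult_ac)
    finally show "\<bar>\<kappa> (Suc 0) (t + s) n m\<bar> \<le> A / ((1 + s + t) * sqrt (1 + s + t))" .
  qed
  also have "\<dots> \<le> B * (2 * A / sqrt (1 + s))"
  proof (intro mult_left_mono)
    have "2 * A / sqrt (1 + s + a N1) \<le> 2 * A / sqrt (1 + s)"
      using s A_pos a_pos[of N1] by (intro divide_left_mono) auto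
    moreover have "0 \<le> 2 * A / sqrt (1 + s + a (N2 + 1))" using s A_pos a_pos[of "N2 + 1"] by auto
    ultimately show "?G (a (N2 + 1)) - ?G (a N1) \<le> 2 * A / sqrt (1 + s)" by linarith
  qed (use B_pos in auto)
  finally show ?thesis by (simp add: mult_ac)
qed

text \<open>The mean value bound with factor \<open>r / \<rho>\<close>, from \<open>k = 2\<close>,
  serves for \<open>r \<le> \<rho>\<close>, and the trivial bound with factor 2, from
  \<open>k = 1\<close>, for larger \<open>r\<close>. The common majorant
  \<open>4 * r / (r + \<rho>)\<close>, divided by \<open>sqrt \<rho>\<close>, is integrable in time
  both at 0 and at infinity.\<close>

lemma kernel_increment_le:
  assumes t: "0 \<le> t" and r: "0 < r"
  shows "\<bar>\<kappa> 1 t n m - \<kappa> 1 (t + r) n m\<bar> \<le> 4 * A * r / ((r + (1 + t)) * sqrt (1 + t) * (1 + t + (real n - real m)\<^sup>2))"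
proof -
  define \<rho> where "\<rho> = 1 + t"
  define d where "d = (real n - real m)\<^sup>2"
  have \<rho>: "\<rho> > 0" "0 \<le> d" using t by (auto simp: \<rho>_def d_def)
  have mono: "A * sqrt (\<rho> + u) / ((\<rho> + u) ^ k * (\<rho> + u + d)) \<le> A * sqrt \<rho> / (\<rho> ^ k * (\<rho> + d))"
    if "0 \<le> u" "1 \<le> k" for u and k :: nat
  proof -
    have e: "A * sqrt x / (x ^ k * (x + d)) = A / (sqrt x * x ^ (k - 1) * (x + d))" if "0 < x" for x
    proof -
      have "x ^ k * (x + d) = x * (x ^ (k - 1) * (x + d))" using \<open>1 \<le> k\<close> by (cases k) auto
      then show ?thesis using divide_cancel_sqrt[OF that, of A] by (simp only: mult.assoc)
    qed
    have "A / (sqrt (\<rho> + u) * (\<rho> + u) ^ (k - 1) * (\<rho> + u + d)) \<le> A / (sqrt \<rho> * \<rho> ^ (k - 1) * (\<rho> + d))"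
      using \<rho> that A_pos by (intro divide_left_mono mult_mono power_mono) (auto intro!: mult_pos_pos)
    then show ?thesis using e[of \<rho>] e[of "\<rho> + u"] \<rho> that by simp
  qed
  define M where "M = A * sqrt \<rho> / (\<rho> * (\<rho> + d))"
  have b1: "\<bar>\<kappa> 1 (t + u) n m\<bar> \<le> M" if "0 \<le> u" for u
    using bound[of 1 "t + u" n m] mono[of u 1] that t by (auto simp: \<rho>_def d_def M_def add_ac)
  have b2: "\<bar>\<kappa> 2 (t + u) n m\<bar> \<le> M / \<rho>" if "0 \<le> u" for u
    using bound[of 2 "t + u" n m] mono[of u 2] that t by (auto simp: \<rho>_def d_def M_def power2_eq_square add_ac mult_ac)
  have "\<bar>\<kappa> 1 (t + r) n m - \<kappa> 1 t n m\<bar> \<le> M / \<rho> * (t + r) - M / \<rho> * t"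
  proof (rule increment_le[where F = "\<lambda>t. \<kappa> 1 t n m" and F' = "\<lambda>t. \<kappa> 2 t n m" and G' = "\<lambda>_. M / \<rho>"])
    fix v assume v: "t \<le> v"
    show "((\<lambda>t. \<kappa> 1 t n m) has_real_derivative \<kappa> 2 v n m) (at v)"
      using deriv[of 1 n m v] by (simp add: numeral_2_eq_2)
    show "\<bar>\<kappa> 2 v n m\<bar> \<le> M / \<rho>" using b2[of "v - t"] v by simp
  qed (use r \<rho> in \<open>auto intro!: derivative_eq_intros\<close>)
  moreover have "M / \<rho> * (t + r) - M / \<rho> * t = M * (r / \<rho>)" by (simp add: distrib_left)
  ultimately have 1: "\<bar>\<kappa> 1 t n m - \<kappa> 1 (t + r) n m\<bar> \<le> M * (r / \<rho>)" by (simp only: abs_minus_commute)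
  have 2: "\<bar>\<kappa> 1 t n m - \<kappa> 1 (t + r) n m\<bar> \<le> M * 2" using b1[of 0] b1[of r] r by simp
  have M: "M \<ge> 0" using \<rho> A_pos by (simp add: M_def)
  have "\<bar>\<kappa> 1 t n m - \<kappa> 1 (t + r) n m\<bar> \<le> M * (4 * r / (r + \<rho>))"
  proof (cases "r \<le> \<rho>")
    case True
    have "r / \<rho> \<le> 4 * r / (r + \<rho>)" using True r \<rho> by (simp add: divide_simps) 
    then show ?thesis using 1 M by (meson mult_left_mono order_trans)
  next
    case False
    have "2 \<le> 4 * r / (r + \<rho>)" using False r \<rho> by (simp add: divide_simps) 
    then show ?thesis using 2 M by (meson mult_left_mono order_trans)
  qed
  also have "M = A / (sqrt \<rho> * (\<rho> + d))"
    unfolding M_def using \<rho> by (intro divide_cancel_sqrt) auto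
  finally show ?thesis by (simp add: \<rho>_def d_def mult_ac)
qed

text \<open>The increment bound is integrated over time:
  \<open>r / (2 * ((r + \<tau>) * sqrt \<tau>))\<close> has the antiderivative
  \<open>sqrt r * arctan (sqrt (\<tau> / r))\<close>, and the arctan varies by at most 2, whence
  \<open>sqrt r\<close> and 16 = 8 * 2. The lower bound \<open>u\<close> on the times improves the
  denominator; it is 0 for the Calderon-Zygmund condition and \<open>a N\<close> for tails.\<close>

lemma D_shift_le:
  assumes s: "0 \<le> s" and u: "0 \<le> u" and r: "0 < r" and a: "u \<le> a N1"
  shows "\<bar>D N1 N2 s n m - D N1 N2 (s + r) n m\<bar> \<le> 16 * A * B * sqrt r / (1 + s + u + (real n - real m)\<^sup>2)"
proof (cases "N1 \<le> N2 + 1")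
  case False
  then have "D N1 N2 s n m = 0" for s by (simp add: D_def)
  then show ?thesis using A_pos B_pos s u r by simp
next
  case True
  define d where "d = (real n - real m)\<^sup>2"
  define H where "H = 1 + s + u + d"
  have H: "H > 0" using s u by (simp add: H_def d_def add_pos_nonneg)
  let ?F = "\<lambda>t. \<kappa> 0 (t + s) n m - \<kappa> 0 (t + (s + r)) n m"
  let ?G = "\<lambda>t. (8 * A / H) * (sqrt r * arctan (sqrt ((1 + s + t) / r)))"
  have "D N1 N2 s n m - D N1 N2 (s + r) n m = (\<Sum>j\<in>{N1..N2}. b j * (?F (a (j + 1)) - ?F (a j)))"
    unfolding D_def by (simp add: algebra_simps flip: sum_subtractf)
  also have "\<bar>\<dots>\<bar> \<le> B * (?G (a (N2 + 1)) - ?G (a N1))"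
  proof (rule weighted_increments_le[where F = ?F and G = ?G, OF True DERIV_diff[OF deriv_shift deriv_shift]])
    fix t assume t: "a N1 \<le> t"
    define \<tau> where "\<tau> = 1 + s + t"
    have \<tau>: "\<tau> > 0" and t0: "0 < t" "u \<le> t" using a_pos[of N1] t s a by (auto simp: \<tau>_def)
    have der: "(?G has_real_derivative (8 * A / H) * (sqrt r * (inverse (1 + (sqrt (\<tau> / r))\<^sup>2) * (inverse (sqrt (\<tau> / r)) / 2 * (1 / r))))) (at t)"
      using \<tau> r H by (auto intro!: derivative_eq_intros simp: \<tau>_def divide_less_0_iff)
    have eq: "sqrt r * (inverse (1 + (sqrt (\<tau> / r))\<^sup>2) * (inverse (sqrt (\<tau> / r)) / 2 * (1 / r))) = r / (2 * ((r + \<tau>) * sqrt \<tau>))"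
    proof -
      have "inverse (1 + (sqrt (\<tau> / r))\<^sup>2) = r / (r + \<tau>)" using \<tau> r by (simp add: field_simps)
      moreover have "inverse (sqrt (\<tau> / r)) = sqrt r / sqrt \<tau>" using \<tau> r by (simp add: real_sqrt_divide)
      moreover have "sqrt r * (r / (r + \<tau>) * (sqrt r / sqrt \<tau> / 2 * (1 / r))) = (sqrt r * sqrt r) * r / (2 * ((r + \<tau>) * sqrt \<tau>) * r)"
        by simp
      ultimately show ?thesis using \<tau> r by simp
    qed
    show "(?G has_real_derivative (8 * A / H) * (r / (2 * ((r + \<tau>) * sqrt \<tau>)))) (at t)"
      using der unfolding eq .
    have "\<bar>\<kappa> (Suc 0) (t + s) n m - \<kappa> (Suc 0) (t + (s + r)) n m\<bar> \<le> 4 * A * r / ((r + \<tau>) * sqrt \<tau> * (\<tau> + d))"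
      using kernel_increment_le[of "t + s" r n m] t0 s r by (simp add: \<tau>_def d_def add_ac)
    also have "\<dots> \<le> 4 * A * r / ((r + \<tau>) * sqrt \<tau> * H)"
      using \<tau> t0 H A_pos r unfolding H_def \<tau>_def by (intro divide_left_mono mult_left_mono) (auto simp: d_def intro!: mult_pos_pos add_pos_nonneg)
    also have "\<dots> = (8 * A / H) * (r / (2 * ((r + \<tau>) * sqrt \<tau>)))" using H \<tau> r by (simp add: divide_simps)
    finally show "\<bar>\<kappa> (Suc 0) (t + s) n m - \<kappa> (Suc 0) (t + (s + r)) n m\<bar> \<le> (8 * A / H) * (r / (2 * ((r + \<tau>) * sqrt \<tau>)))" .
  qed
  also have "\<dots> \<le> B * ((8 * A / H) * (sqrt r * 2))"
  proof -
    have "arctan (sqrt ((1 + s + a (N2 + 1)) / r)) \<le> 2"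
      using arctan_ubound[of "sqrt ((1 + s + a (N2 + 1)) / r)"] pi_less_4 by linarith
    moreover have "0 \<le> arctan (sqrt ((1 + s + a N1) / r))" using s r a_pos[of N1] by simp
    ultimately have "arctan (sqrt ((1 + s + a (N2 + 1)) / r)) - arctan (sqrt ((1 + s + a N1) / r)) \<le> 2" by linarith
    then have "(8 * A / H) * (sqrt r * (arctan (sqrt ((1 + s + a (N2 + 1)) / r)) - arctan (sqrt ((1 + s + a N1) / r)))) \<le> (8 * A / H) * (sqrt r * 2)"
      using A_pos H r by (intro mult_left_mono) auto
    then show ?thesis using B_pos by (intro mult_left_mono) (auto simp: right_diff_distrib)
  qed
  finally show ?thesis by (simp add: H_def d_def mult_ac)
qed

text \<open>With \<open>s = a N\<close>, the difference is \<open>D N N2 0 - D N N2 s\<close> minus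
  the head \<open>D N1 (N - 1) s\<close>. The former involves only times beyond \<open>s\<close>;
  the latter runs over a time span of length at most \<open>s\<close>, on which the time derivative
  is at most \<open>A / (sqrt (1 + s) * H)\<close>. Together 17 = 16 + 1.\<close>

lemma D_tail_le:
  assumes N: "N1 \<le> N" "N \<le> N2 + 1"
  shows "\<bar>D N N2 0 n m - D N1 N2 (a N) n m\<bar> \<le> 17 * A * B * sqrt (1 + a N) / (1 + a N + (real n - real m)\<^sup>2)"
proof -
  define s where "s = a N"
  have s: "s > 0" using a_pos by (simp add: s_def)
  define H where "H = 1 + s + (real n - real m)\<^sup>2"
  have H: "H > 0" using s by (simp add: H_def add_pos_nonneg)
  have split: "D N1 N2 s n m = D N1 (N - 1) s n m + D N N2 s n m"
  proof -
    have "{N1..N2} = {N1..N - 1} \<union> {N..N2}" "{N1..N - 1} \<inter> {N..N2} = {}" using N by auto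
    then show ?thesis unfolding D_def by (simp add: sum.union_disjoint)
  qed
  have 1: "\<bar>D N N2 0 n m - D N N2 s n m\<bar> \<le> 16 * A * B * sqrt s / H"
    using D_shift_le[of 0 s s N N2 n m] s by (simp add: s_def H_def)
  have 2: "\<bar>D N1 (N - 1) s n m\<bar> \<le> B * (A * sqrt (1 + s) / ((1 + s) * H) * (a (N - 1 + 1)) - A * sqrt (1 + s) / ((1 + s) * H) * (a N1))"
    unfolding D_def
  proof (rule weighted_increments_le[where F = "\<lambda>t. \<kappa> 0 (t + s) n m" and G' = "\<lambda>_. A * sqrt (1 + s) / ((1 + s) * H)", OF _ deriv_shift])
    fix t assume "a N1 \<le> t"
    then have t: "0 < t" using a_pos[of N1] by simp
    have "\<bar>\<kappa> (Suc 0) (t + s) n m\<bar> \<le> A * sqrt (1 + (t + s)) / ((1 + (t + s)) * (1 + (t + s) + (real n - real m)\<^sup>2))"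
      using t s bound[of 1 "t + s" n m] by auto
    also have "\<dots> = A / (sqrt (1 + (t + s)) * (1 + (t + s) + (real n - real m)\<^sup>2))" using t s by (intro divide_cancel_sqrt) auto
    also have "\<dots> \<le> A / (sqrt (1 + s) * H)"
      unfolding H_def using t s A_pos by (intro divide_left_mono mult_mono) (auto intro!: mult_pos_pos add_pos_nonneg)
    also have "\<dots> = A * sqrt (1 + s) / ((1 + s) * H)" using s by (intro divide_cancel_sqrt[symmetric]) auto
    finally show "\<bar>\<kappa> (Suc 0) (t + s) n m\<bar> \<le> A * sqrt (1 + s) / ((1 + s) * H)" .
  qed (use N s H in \<open>auto intro!: derivative_eq_intros\<close>)
  also have "\<dots> = B * (A * sqrt (1 + s) / ((1 + s) * H) * (s - a N1))" unfolding s_def right_diff_distrib by simp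
  also have "\<dots> \<le> B * (A * sqrt (1 + s) / ((1 + s) * H) * (1 + s))"
    using s a_pos[of N1] H A_pos B_pos by (intro mult_left_mono) auto
  also have "A * sqrt (1 + s) / ((1 + s) * H) * (1 + s) = A * sqrt (1 + s) / H" using s by (auto simp: divide_simps)
  also have "B * (A * sqrt (1 + s) / H) = A * B * sqrt (1 + s) / H" by simp
  finally have 2: "\<bar>D N1 (N - 1) s n m\<bar> \<le> A * B * sqrt (1 + s) / H" .
  have "\<bar>D N N2 0 n m - D N1 N2 s n m\<bar> \<le> 16 * A * B * sqrt s / H + A * B * sqrt (1 + s) / H"
    using 1 2 unfolding split by linarith
  also have "\<dots> \<le> 16 * A * B * sqrt (1 + s) / H + A * B * sqrt (1 + s) / H"
    using H A_pos B_pos by (intro add_mono divide_right_mono mult_left_mono) auto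
  also have "\<dots> = 17 * A * B * sqrt (1 + s) / H" by (simp add: add_divide_distrib[symmetric])
  finally show ?thesis by (simp add: s_def H_def)
qed

lemma D_semigroup:
  assumes s: "0 \<le> s" and r: "0 \<le> r"
  shows "(\<lambda>l. \<kappa> 0 s n l * D N1 N2 r l m) sums D N1 N2 (s + r) n m"
proof -
  have "(\<lambda>l. \<Sum>j\<in>{N1..N2}. b j * (\<kappa> 0 s n l * \<kappa> 0 (a (j + 1) + r) l m - \<kappa> 0 s n l * \<kappa> 0 (a j + r) l m)) sums
    (\<Sum>j\<in>{N1..N2}. b j * (\<kappa> 0 (s + (a (j + 1) + r)) n m - \<kappa> 0 (s + (a j + r)) n m))"
    using s r a_pos by (intro sums_sum sums_mult sums_diff semigroup) (auto intro: less_imp_le add_nonneg_nonneg)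
  then show ?thesis unfolding D_def by (simp add: sum_distrib_left algebra_simps)
qed

end

section \<open>Calderon-Zygmund decomposition\<close>

text \<open>On \<open>X\<close> the function \<open>F\<close> is below the uncentred maximal
  function of \<open>f\<close>. A witness interval at each point avoids forming the supremum over
  all intervals.\<close>

definition interval_dominated :: "nat set \<Rightarrow> (nat \<Rightarrow> real) \<Rightarrow> (nat \<Rightarrow> real) \<Rightarrow> bool" where
  "interval_dominated X F f \<longleftrightarrow> (\<forall>x\<in>X. \<exists>a b. a \<le> x \<and> x \<le> b \<and> F x * real (b - a + 1) \<le> sum f {a..b})"

text \<open>Boundedness of the maximal operator on l^p(w), tested on finite sets of points, with
  \<open>C\<close> bounding \<open>p\<close>-th powers of norms.\<close>

definition maximal_bounded :: "real \<Rightarrow> (nat \<Rightarrow> real) \<Rightarrow> real \<Rightarrow> bool" where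
  "maximal_bounded p w C \<longleftrightarrow> (\<forall>X f F. finite X \<longrightarrow> (\<forall>y. 0 \<le> f y) \<longrightarrow> (\<forall>x. 0 \<le> F x) \<longrightarrow>
     interval_dominated X F f \<longrightarrow> summable (\<lambda>y. f y powr p * w y) \<longrightarrow>
     (\<Sum>x\<in>X. F x powr p * w x) \<le> C * (\<Sum>y. f y powr p * w y))"

lemma maximal_boundedD:
  assumes "maximal_bounded p w C" "finite X" "\<And>y. 0 \<le> f y" "\<And>x. 0 \<le> F x" "interval_dominated X F f"
    "summable (\<lambda>y. f y powr p * w y)"
  shows "(\<Sum>x\<in>X. F x powr p * w x) \<le> C * (\<Sum>y. f y powr p * w y)"
  using assms unfolding maximal_bounded_def by blast

lemma maximal_boundedD2:
  assumes "maximal_bounded 2 w C" "finite X" "\<And>y. 0 \<le> f y" "\<And>x. 0 \<le> F x" "interval_dominated X F f"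
    "summable (\<lambda>y. (f y)\<^sup>2 * w y)"
  shows "(\<Sum>x\<in>X. (F x)\<^sup>2 * w x) \<le> C * (\<Sum>y. (f y)\<^sup>2 * w y)"
proof -
  have "f y powr 2 = (f y)\<^sup>2" "F y powr 2 = (F y)\<^sup>2" for y using assms(3,4) by auto
  then show ?thesis using maximal_boundedD[OF assms(1-5)] assms(6) by simp
qed

lemma Ap_weight_maximal_bounded:
  assumes "1 < p" "Ap_weight p w"
  obtains C where "0 < C" "maximal_bounded p w C"
  using muckenhoupt[OF assms] unfolding maximal_bounded_def interval_dominated_def by blast

lemma summable_poisson:
  assumes "1 \<le> \<rho>"
  shows "summable (\<lambda>y. 1 / (\<rho> + (real x - real y)\<^sup>2))"
proof (rule summable_comparison_test_ev)
  show "summable (\<lambda>y. 4 * inverse (real y ^ 2))" by (intro summable_mult inverse_power_summable) auto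
  show "\<forall>\<^sub>F y in sequentially. norm (1 / (\<rho> + (real x - real y)\<^sup>2)) \<le> 4 * inverse (real y ^ 2)"
    using eventually_ge_at_top[of "2 * x + 1"]
  proof eventually_elim
    case (elim y)
    have "real y / 2 \<le> real y - real x" using elim by simp
    then have "(real y / 2)\<^sup>2 \<le> (real y - real x)\<^sup>2" by (intro power_mono) auto
    then have "(real y)\<^sup>2 / 4 \<le> \<rho> + (real x - real y)\<^sup>2" using assms by (simp add: power_divide power2_commute)
    moreover have "0 < (real y)\<^sup>2 / 4" using elim by simp
    ultimately have "1 / (\<rho> + (real x - real y)\<^sup>2) \<le> 1 / ((real y)\<^sup>2 / 4)" by (intro frac_le) auto
    also have "1 / ((real y)\<^sup>2 / 4) = 4 * inverse (real y ^ 2)" by (simp add: inverse_eq_divide)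
    moreover have "0 \<le> 1 / (\<rho> + (real x - real y)\<^sup>2)" using assms by simp
    ultimately show ?case by (simp only: real_norm_def abs_of_nonneg)
  qed
qed

text \<open>\<open>W s\<close> is the heat semigroup and \<open>T i s\<close> is \<open>T i 0\<close> composed with \<open>W s\<close>.\<close>

locale cz_family =
  fixes W :: "real \<Rightarrow> nat \<Rightarrow> nat \<Rightarrow> real" and T :: "'i \<Rightarrow> real \<Rightarrow> nat \<Rightarrow> nat \<Rightarrow> real" and c :: real
  assumes c_pos: "0 < c"
    and W_le: "\<And>s n m. 0 \<le> s \<Longrightarrow> \<bar>W s n m\<bar> \<le> c * (sqrt (1 + s) / (1 + s + (real n - real m)\<^sup>2))"
    and T_le: "\<And>i s n m. 0 \<le> s \<Longrightarrow> \<bar>T i s n m\<bar> \<le> c / sqrt (1 + s)"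
    and T_diff_le: "\<And>i s r n m. 0 \<le> s \<Longrightarrow> 0 < r \<Longrightarrow>
       \<bar>T i s n m - T i (s + r) n m\<bar> \<le> c * (sqrt r / (1 + s + (real n - real m)\<^sup>2))"
    and T_sym: "\<And>i s n m. T i s n m = T i s m n"
    and W_sym: "\<And>s n m. W s n m = W s m n"
    and WT: "\<And>i s r n m. 0 \<le> s \<Longrightarrow> 0 \<le> r \<Longrightarrow> (\<lambda>l. W s n l * T i r l m) sums T i (s + r) n m"
    and T_l2: "\<And>i Y f n. finite Y \<Longrightarrow> (\<Sum>l<n. (\<Sum>y\<in>Y. T i 0 l y * f y)\<^sup>2) \<le> c * (\<Sum>y\<in>Y. (f y)\<^sup>2)"
begin

text \<open>For \<open>\<xi>\<close> within \<open>sqrt s\<close> of \<open>x\<close> the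
  denominators at \<open>\<xi>\<close> and at \<open>x\<close> differ by a factor of at most 3, so
  the semigroup at any point of the parabolic region over \<open>x\<close> is controlled by a
  Poisson sum at \<open>x\<close>; 288 = 3 * 96.\<close>

lemma nontangential_interval:
  assumes s: "0 \<le> s" and \<xi>: "(real \<xi> - real x)\<^sup>2 \<le> s" and u: "\<And>l. \<bar>u l\<bar> \<le> M"
    and v: "(\<lambda>l. W s \<xi> l * u l) sums v"
  shows "\<exists>a b. a \<le> x \<and> x \<le> b \<and> \<bar>v\<bar> * real (b - a + 1) \<le> 288 * c * (\<Sum>l=a..b. \<bar>u l\<bar>)"
proof -
  define P where "P l = sqrt (1 + s) / (1 + s + (real x - real l)\<^sup>2)" for l
  have sP: "summable (\<lambda>l. \<bar>u l\<bar> * P l)"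
  proof (rule summable_comparison_test_ev)
    show "summable (\<lambda>l. M * sqrt (1 + s) * (1 / (1 + s + (real x - real l)\<^sup>2)))"
      using s by (intro summable_mult summable_poisson) auto
    show "\<forall>\<^sub>F l in sequentially. norm (\<bar>u l\<bar> * P l) \<le> M * sqrt (1 + s) * (1 / (1 + s + (real x - real l)\<^sup>2))"
    proof (rule always_eventually, rule allI)
      fix l
      have "0 \<le> P l" using s by (simp add: P_def)
      then have "norm (\<bar>u l\<bar> * P l) \<le> M * P l" using u[of l] by (simp add: abs_mult mult_right_mono)
      then show "norm (\<bar>u l\<bar> * P l) \<le> M * sqrt (1 + s) * (1 / (1 + s + (real x - real l)\<^sup>2))" by (simp add: P_def)
    qed
  qed
  have pt: "\<bar>W s \<xi> l * u l\<bar> \<le> 3 * c * (\<bar>u l\<bar> * P l)" for l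
  proof -
    \<comment> \<open>Here \<open>X\<close>, \<open>p\<close>, \<open>q\<close> are the squared
      distances from \<open>x\<close> to \<open>l\<close>, from \<open>\<xi>\<close> to
      \<open>x\<close> and from \<open>\<xi>\<close> to \<open>l\<close>; the claim is
      \<open>1 + s + X \<le> 1 + 3 * s + 2 * q \<le> 3 * (1 + s + q)\<close>.\<close>
    have aux: "(1 + s + X) / 3 \<le> 1 + s + q" if "X \<le> 2 * (p + q)" "p \<le> s" "0 \<le> q" for X p q :: real
      using that s by (simp add: field_simps)
    have "(real x - real l)\<^sup>2 \<le> 2 * ((real \<xi> - real x)\<^sup>2 + (real \<xi> - real l)\<^sup>2)"
      using sum_squares_bound[of "real \<xi> - real l" "real x - real \<xi>"] by (simp add: power2_eq_square algebra_simps)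
    then have "(1 + s + (real x - real l)\<^sup>2) / 3 \<le> 1 + s + (real \<xi> - real l)\<^sup>2"
      by (rule aux) (use \<xi> s in auto)
    moreover have "0 < 1 + s + (real x - real l)\<^sup>2" using s by (intro add_pos_nonneg) auto
    ultimately have "sqrt (1 + s) / (1 + s + (real \<xi> - real l)\<^sup>2) \<le> sqrt (1 + s) / ((1 + s + (real x - real l)\<^sup>2) / 3)"
      using s by (intro divide_left_mono) (auto intro!: mult_pos_pos add_pos_nonneg)
    also have "\<dots> = 3 * P l" by (simp add: P_def)
    finally have "\<bar>W s \<xi> l\<bar> \<le> c * (3 * P l)" using W_le[OF s, of \<xi> l] c_pos by (meson mult_left_mono less_imp_le order_trans)
    then have "\<bar>W s \<xi> l\<bar> * \<bar>u l\<bar> \<le> c * (3 * P l) * \<bar>u l\<bar>" by (intro mult_right_mono) auto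
    then show ?thesis by (simp add: abs_mult mult_ac)
  qed
  have "\<bar>v\<bar> \<le> (\<Sum>l. 3 * c * (\<bar>u l\<bar> * P l))"
  proof -
    have "v = (\<Sum>l. W s \<xi> l * u l)" using v by (simp add: sums_iff)
    then have "norm v \<le> (\<Sum>l. 3 * c * (\<bar>u l\<bar> * P l))"
      using norm_suminf_le[of "\<lambda>l. W s \<xi> l * u l" "\<lambda>l. 3 * c * (\<bar>u l\<bar> * P l)"] sP pt
      by (simp add: summable_mult)
    then show ?thesis by simp
  qed
  also have "\<dots> = 3 * c * (\<Sum>l. \<bar>u l\<bar> * P l)" by (rule suminf_mult[OF sP])
  finally have v_le: "\<bar>v\<bar> \<le> 3 * c * (\<Sum>l. \<bar>u l\<bar> * P l)" .
  have "\<exists>a b. a \<le> x \<and> x \<le> b \<and> (\<Sum>l. \<bar>u l\<bar> * P l) * real (b - a + 1) \<le> 96 * (\<Sum>l=a..b. \<bar>u l\<bar>)"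
    unfolding P_def
    by (rule poisson_interval_suminf[where f = "\<lambda>l. \<bar>u l\<bar>"]) (use s sP in \<open>auto simp: P_def\<close>)
  then obtain a b where ab: "a \<le> x" "x \<le> b" "(\<Sum>l. \<bar>u l\<bar> * P l) * real (b - a + 1) \<le> 96 * (\<Sum>l=a..b. \<bar>u l\<bar>)"
    by blast
  have "\<bar>v\<bar> * real (b - a + 1) \<le> 3 * c * (\<Sum>l. \<bar>u l\<bar> * P l) * real (b - a + 1)"
    using v_le by (intro mult_right_mono) auto
  also have "\<dots> = 3 * c * ((\<Sum>l. \<bar>u l\<bar> * P l) * real (b - a + 1))" by simp
  also have "\<dots> \<le> 3 * c * (96 * (\<Sum>l=a..b. \<bar>u l\<bar>))" using ab c_pos by (intro mult_left_mono) auto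
  also have "\<dots> = 288 * c * (\<Sum>l=a..b. \<bar>u l\<bar>)" by simp
  finally show ?thesis using ab(1,2) by blast
qed

text \<open>Chebyshev's inequality: by \<open>nontangential_interval\<close> the constant
  \<open>l / (288 * c)\<close> lies below the maximal function of \<open>u\<close> on all of
  \<open>X\<close>, and the maximal theorem for A_2 weights applies.\<close>

lemma nontangential_l2:
  assumes w: "Ap_weight 2 w"
  shows "\<exists>C>0. \<forall>X u M l K. finite X \<longrightarrow> (\<forall>x. \<bar>u x\<bar> \<le> M) \<longrightarrow> 0 < l \<longrightarrow> (\<forall>n. (\<Sum>x<n. (u x)\<^sup>2 * w x) \<le> K) \<longrightarrow>
    (\<forall>x\<in>X. \<exists>s \<xi> v. 0 \<le> s \<and> (real \<xi> - real x)\<^sup>2 \<le> s \<and> (\<lambda>l. W s \<xi> l * u l) sums v \<and> l < \<bar>v\<bar>) \<longrightarrow>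
    l\<^sup>2 * sum w X \<le> C * K"
proof -
  have wpos: "\<And>k. 0 < w k" using w unfolding Ap_weight_def by blast
  obtain C where "C > 0" and C: "maximal_bounded 2 w C"
    using Ap_weight_maximal_bounded[OF _ w] by auto
  show ?thesis
  proof (intro exI[of _ "C * (288 * c)\<^sup>2"] conjI allI impI)
    show "C * (288 * c)\<^sup>2 > 0" using \<open>C > 0\<close> c_pos by simp
    fix X u M l K
    assume X: "finite X" and u: "\<forall>x. \<bar>u x\<bar> \<le> M" and l: "0 < (l::real)" and K: "\<forall>n. (\<Sum>x<n. (u x)\<^sup>2 * w x) \<le> K"
      and h: "\<forall>x\<in>X. \<exists>s \<xi> v. 0 \<le> s \<and> (real \<xi> - real x)\<^sup>2 \<le> s \<and> (\<lambda>l. W s \<xi> l * u l) sums v \<and> l < \<bar>v\<bar>"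
    have nn: "0 \<le> (u x)\<^sup>2 * w x" for x using wpos[of x] by simp
    have sm: "summable (\<lambda>x. (u x)\<^sup>2 * w x)"
      using K nn by (intro summableI_nonneg_bounded[where x = K]) auto
    have sK: "(\<Sum>x. (u x)\<^sup>2 * w x) \<le> K" using K sm by (intro suminf_le_const) auto
    have "(\<Sum>x\<in>X. (l / (288 * c))\<^sup>2 * w x) \<le> C * (\<Sum>y. \<bar>u y\<bar>\<^sup>2 * w y)"
    proof (rule maximal_boundedD2[where f = "\<lambda>y. \<bar>u y\<bar>" and F = "\<lambda>_. l / (288 * c)", OF C])
      show "interval_dominated X (\<lambda>_. l / (288 * c)) (\<lambda>y. \<bar>u y\<bar>)"
        unfolding interval_dominated_def
      proof
        fix x assume "x \<in> X"
        with h obtain s \<xi> v where v: "0 \<le> s" "(real \<xi> - real x)\<^sup>2 \<le> s" "(\<lambda>l. W s \<xi> l * u l) sums v" "l < \<bar>v\<bar>" by blast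
        obtain a b where ab: "a \<le> x" "x \<le> b" "\<bar>v\<bar> * real (b - a + 1) \<le> 288 * c * (\<Sum>l=a..b. \<bar>u l\<bar>)"
          using nontangential_interval[OF v(1,2) spec[OF u] v(3)] by blast
        have "l * real (b - a + 1) \<le> \<bar>v\<bar> * real (b - a + 1)" using v(4) by (intro mult_right_mono) auto
        also note ab(3)
        finally have "l / (288 * c) * real (b - a + 1) \<le> (\<Sum>y=a..b. \<bar>u y\<bar>)"
          using c_pos by (simp add: pos_divide_le_eq mult_ac)
        then show "\<exists>a b. a \<le> x \<and> x \<le> b \<and> l / (288 * c) * real (b - a + 1) \<le> (\<Sum>y=a..b. \<bar>u y\<bar>)" using ab by blast
      qed
    qed (use X l c_pos sm in auto)
    also have "\<dots> \<le> C * K" using sK \<open>C > 0\<close> by simp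
    finally have "(l / (288 * c))\<^sup>2 * sum w X \<le> C * K" by (simp add: sum_distrib_left)
    then have "l\<^sup>2 * sum w X \<le> C * K * (288 * c)\<^sup>2"
      using c_pos by (simp add: power_divide pos_divide_le_eq)
    then show "l\<^sup>2 * sum w X \<le> C * (288 * c)\<^sup>2 * K" by (simp add: mult_ac)
  qed
qed

text \<open>Uniform in the index \<open>i\<close> and in the truncation \<open>n\<close>. For the
  constant weight and \<open>K = c\<close> this is the assumption \<open>T_l2\<close>.\<close>

definition l2_bounded :: "(nat \<Rightarrow> real) \<Rightarrow> real \<Rightarrow> bool" where
  "l2_bounded w K \<longleftrightarrow> (\<forall>i Y f n. finite Y \<longrightarrow> (\<Sum>l<n. (\<Sum>y\<in>Y. T i 0 l y * f y)\<^sup>2 * w l) \<le> K * (\<Sum>y\<in>Y. (f y)\<^sup>2 * w y))"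

end

section \<open>Maximal dyadic intervals of a finitely supported function at a fixed height\<close>

locale calderon_zygmund =
  fixes F :: "nat \<Rightarrow> real" and Y :: "nat set" and l :: real
  assumes F_nonneg: "\<And>y. 0 \<le> F y" and Y: "finite Y" and F_out: "\<And>y. y \<notin> Y \<Longrightarrow> F y = 0" and l_pos: "0 < l"
begin

text \<open>The family of maximal dyadic intervals is encoded by the scale \<open>J y\<close> of the
  one that contains \<open>y\<close>. Sums over the family become sums over the points of
  \<open>Om\<close>, divided by the length \<open>2 ^ J y\<close>.\<close>

definition Q where "Q j y = dyadic j (y div 2 ^ j)"
definition levels where "levels y = {j. l * 2 ^ j < sum F (Q j y)}"
definition Om where "Om = {y. levels y \<noteq> {}}"
definition J where "J y = Max (levels y)"

lemma Q_eq: "z \<in> Q j y \<Longrightarrow> j \<le> k \<Longrightarrow> Q k z = Q k y"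
  using dyadic_ancestor[of j k z y] by (simp add: Q_def dyadic_iff)

lemma Q_refl: "y \<in> Q j y" by (simp add: Q_def dyadic_iff)

lemma Q_fin [simp]: "finite (Q j y)" "card (Q j y) = 2 ^ j" by (simp_all add: Q_def)

lemma Q_sym: "z \<in> Q j y \<longleftrightarrow> y \<in> Q j z" by (auto simp: Q_def dyadic_iff)

text \<open>An interval at a scale \<open>j\<close> in \<open>levels y\<close> carries mass above
  \<open>l * 2 ^ j\<close>, whereas the total mass is \<open>sum F Y\<close>.\<close>

lemma finite_levels: "finite (levels y)"
proof -
  obtain n where n: "sum F Y / l < 2 ^ n" using real_arch_pow[of 2 "sum F Y / l"] by auto
  have "j < n" if "j \<in> levels y" for j
  proof (rule ccontr)
    assume "\<not> j < n"
    then have "(2::real) ^ n \<le> 2 ^ j" by (intro power_increasing) auto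
    then have "l * 2 ^ n \<le> l * 2 ^ j" using l_pos by (intro mult_left_mono) auto
    moreover have "sum F Y < l * 2 ^ n" using n l_pos by (simp add: pos_divide_less_eq mult.commute)
    ultimately have "sum F Y < l * 2 ^ j" by linarith
    moreover have "sum F (Q j y) \<le> sum F Y"
    proof -
      have "sum F (Q j y) = sum F (Q j y \<inter> Y)" using F_out by (intro sum.mono_neutral_right) auto
      also have "\<dots> \<le> sum F Y" using F_nonneg Y by (intro sum_mono2) auto
      finally show ?thesis .
    qed
    ultimately show False using that by (simp add: levels_def)
  qed
  then show ?thesis by (meson finite_nat_set_iff_bounded)
qed

lemma J_in: "y \<in> Om \<Longrightarrow> J y \<in> levels y"
  unfolding J_def Om_def using finite_levels by (intro Max_in) auto

lemma levels_le: "j \<in> levels y \<Longrightarrow> j \<le> J y"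
  unfolding J_def using finite_levels by (intro Max_ge) auto

text \<open>Points of one dyadic interval have the same ancestors, so their levels agree from the
  scale \<open>J y\<close> on. This is the disjointness of the maximal intervals.\<close>

lemma J_const:
  assumes y: "y \<in> Om" and z: "z \<in> Q (J y) y"
  shows "z \<in> Om" "J z = J y" "Q (J z) z = Q (J y) y"
proof -
  have eq: "Q k z = Q k y" if "J y \<le> k" for k using Q_eq[OF z that] .
  have "J y \<in> levels z" using J_in[OF y] eq[of "J y"] by (simp add: levels_def)
  then show zO: "z \<in> Om" by (auto simp: Om_def)
  have 1: "J y \<le> J z" using \<open>J y \<in> levels z\<close> by (rule levels_le)
  have "J z \<in> levels y" using J_in[OF zO] eq[OF 1] by (simp add: levels_def)
  then show "J z = J y" using levels_le 1 by (simp add: eq_iff)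
  then show "Q (J z) z = Q (J y) y" using eq by simp
qed

lemma lower: "y \<in> Om \<Longrightarrow> l * 2 ^ J y < sum F (Q (J y) y)"
  using J_in by (simp add: levels_def)

text \<open>The parent of a maximal interval is twice as long and fails the threshold.\<close>

lemma upper: "y \<in> Om \<Longrightarrow> sum F (Q (J y) y) \<le> 2 * l * 2 ^ J y"
proof -
  assume "y \<in> Om"
  have "Suc (J y) \<notin> levels y" using levels_le by fastforce
  then have "sum F (Q (Suc (J y)) y) \<le> l * 2 ^ Suc (J y)" by (simp add: levels_def)
  moreover have "Q (J y) y \<subseteq> Q (Suc (J y)) y"
  proof
    fix z assume "z \<in> Q (J y) y"
    then have "Q (Suc (J y)) z = Q (Suc (J y)) y" by (rule Q_eq) simp
    then show "z \<in> Q (Suc (J y)) y" using Q_refl[of z "Suc (J y)"] by simp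
  qed
  then have "sum F (Q (J y) y) \<le> sum F (Q (Suc (J y)) y)" using F_nonneg by (intro sum_mono2) auto
  ultimately show ?thesis by simp
qed

lemma off: "y \<notin> Om \<Longrightarrow> F y \<le> l"
proof -
  assume "y \<notin> Om"
  then have "0 \<notin> levels y" by (auto simp: Om_def)
  moreover have "Q 0 y = {y}" by (auto simp: Q_def dyadic_iff)
  ultimately show ?thesis by (simp add: levels_def)
qed

text \<open>Each maximal interval carries positive mass and therefore meets
  \<open>Y\<close>.\<close>

lemma finite_Om: "finite Om"
proof (rule finite_subset)
  show "Om \<subseteq> (\<Union>y\<in>Y \<inter> Om. Q (J y) y)"
  proof
    fix z assume z: "z \<in> Om"
    have "0 < l * 2 ^ J z" using l_pos by simp
    then have "sum F (Q (J z) z) \<noteq> 0" using lower[OF z] by simp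
    then obtain y where y: "y \<in> Q (J z) z" "F y \<noteq> 0" by (meson sum.not_neutral_contains_not_neutral)
    then have "y \<in> Y" using F_out by blast
    have "y \<in> Om" "J y = J z" using J_const[OF z y(1)] by auto
    then show "z \<in> (\<Union>y\<in>Y \<inter> Om. Q (J y) y)" using y \<open>y \<in> Y\<close> Q_sym[of y "J z" z]
      by (intro UN_I[of y]) auto
  qed
  show "finite (\<Union>y\<in>Y \<inter> Om. Q (J y) y)" using Y by auto
qed

text \<open>Both sides sum \<open>g y * h z\<close> over the pairs in a common maximal interval,
  divided by its length: averaging over the maximal intervals is self-adjoint.\<close>

lemma double_count:
  fixes g h :: "nat \<Rightarrow> real"
  shows "(\<Sum>y\<in>Om. g y * (sum h (Q (J y) y) / 2 ^ J y)) = (\<Sum>z\<in>Om. h z * (sum g (Q (J z) z) / 2 ^ J z))"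
proof -
  define R where "R y z = (if z \<in> Q (J y) y then g y * h z / 2 ^ J y else 0)" for y z
  define R' where "R' y z = (if y \<in> Q (J z) z then g y * h z / 2 ^ J z else 0)" for y z
  have sub: "Q (J y) y \<subseteq> Om" if "y \<in> Om" for y using J_const[OF that] by blast
  have RR: "R y z = R' y z" if "y \<in> Om" "z \<in> Om" for y z
  proof (cases "z \<in> Q (J y) y")
    case True
    then show ?thesis using J_const(2)[OF that(1) True] Q_sym[of z "J y" y] by (simp add: R_def R'_def)
  next
    case False
    have "y \<notin> Q (J z) z" using J_const(2)[OF that(2), of y] Q_sym[of y "J z" z] False by auto
    then show ?thesis using False by (simp add: R_def R'_def)
  qed
  have "(\<Sum>y\<in>Om. g y * (sum h (Q (J y) y) / 2 ^ J y)) = (\<Sum>y\<in>Om. \<Sum>z\<in>Om. R y z)"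
  proof (intro sum.cong refl)
    fix y assume y: "y \<in> Om"
    have "(\<Sum>z\<in>Om. R y z) = (\<Sum>z\<in>Om \<inter> Q (J y) y. g y * h z / 2 ^ J y)"
      unfolding R_def using finite_Om by (simp add: sum.inter_restrict)
    also have "Om \<inter> Q (J y) y = Q (J y) y" using sub[OF y] by blast
    finally show "g y * (sum h (Q (J y) y) / 2 ^ J y) = (\<Sum>z\<in>Om. R y z)" by (simp add: sum_distrib_left sum_divide_distrib)
  qed
  also have "\<dots> = (\<Sum>z\<in>Om. \<Sum>y\<in>Om. R' y z)"
    by (subst sum.swap) (intro sum.cong refl, simp add: RR)
  also have "\<dots> = (\<Sum>z\<in>Om. h z * (sum g (Q (J z) z) / 2 ^ J z))"
  proof (intro sum.cong refl)
    fix z assume z: "z \<in> Om"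
    have "(\<Sum>y\<in>Om. R' y z) = (\<Sum>y\<in>Om \<inter> Q (J z) z. g y * h z / 2 ^ J z)"
      unfolding R'_def using finite_Om by (simp add: sum.inter_restrict)
    also have "Om \<inter> Q (J z) z = Q (J z) z" using sub[OF z] by blast
    finally show "(\<Sum>y\<in>Om. R' y z) = h z * (sum g (Q (J z) z) / 2 ^ J z)"
      by (simp add: sum_distrib_left sum_divide_distrib mult.commute)
  qed
  finally show ?thesis .
qed

text \<open>On each maximal interval \<open>\<phi>\<close> equals its own average. By
  \<open>double_count\<close> the average moves to \<open>F\<close>, where \<open>upper\<close>
  bounds it by \<open>2 * l\<close>.\<close>

lemma avg_le:
  assumes \<phi>: "\<And>y. 0 \<le> \<phi> y" and const: "\<And>y z. y \<in> Om \<Longrightarrow> z \<in> Q (J y) y \<Longrightarrow> \<phi> z = \<phi> y"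
  shows "(\<Sum>y\<in>Om. F y * \<phi> y) \<le> 2 * l * (\<Sum>y\<in>Om. \<phi> y)"
proof -
  have "(\<Sum>y\<in>Om. F y * \<phi> y) = (\<Sum>y\<in>Om. F y * (sum \<phi> (Q (J y) y) / 2 ^ J y))"
  proof (intro sum.cong refl)
    fix y assume "y \<in> Om"
    then have "sum \<phi> (Q (J y) y) = (\<Sum>z\<in>Q (J y) y. \<phi> y)" using const by (intro sum.cong) auto
    then show "F y * \<phi> y = F y * (sum \<phi> (Q (J y) y) / 2 ^ J y)" by simp
  qed
  also have "\<dots> = (\<Sum>z\<in>Om. \<phi> z * (sum F (Q (J z) z) / 2 ^ J z))" by (rule double_count)
  also have "\<dots> \<le> (\<Sum>z\<in>Om. \<phi> z * (2 * l))"
  proof (intro sum_mono mult_left_mono \<phi>)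
    fix z assume "z \<in> Om"
    then show "sum F (Q (J z) z) / 2 ^ J z \<le> 2 * l" using upper[of z] by (simp add: pos_divide_le_eq)
  qed
  also have "\<dots> = 2 * l * (\<Sum>y\<in>Om. \<phi> y)" by (simp add: sum_distrib_left mult.commute)
  finally show ?thesis .
qed

text \<open>By \<open>lower\<close> the average of \<open>F\<close> replaces \<open>l\<close>;
  \<open>double_count\<close> moves the average to \<open>w\<close>, where the A_1 condition removes
  it.\<close>

lemma weight_Om_le:
  assumes w: "\<And>k. 0 < w k" and K: "\<And>a b x. a \<le> x \<Longrightarrow> x \<le> b \<Longrightarrow> sum w {a..b} \<le> K * real (b - a + 1) * w x"
  shows "l * sum w Om \<le> K * (\<Sum>y\<in>Om. F y * w y)"
proof -
  have "l * sum w Om \<le> (\<Sum>z\<in>Om. w z * (sum F (Q (J z) z) / 2 ^ J z))"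
    unfolding sum_distrib_left
  proof (intro sum_mono)
    fix z assume "z \<in> Om"
    then have "l \<le> sum F (Q (J z) z) / 2 ^ J z" using lower[of z] by (simp add: pos_le_divide_eq)
    then show "l * w z \<le> w z * (sum F (Q (J z) z) / 2 ^ J z)" using w[of z] by (subst mult.commute) (intro mult_left_mono, auto)
  qed
  also have "\<dots> = (\<Sum>y\<in>Om. F y * (sum w (Q (J y) y) / 2 ^ J y))" by (rule double_count)
  also have "\<dots> \<le> (\<Sum>y\<in>Om. F y * (K * w y))"
  proof (intro sum_mono mult_left_mono F_nonneg)
    fix y
    define k where "k = y div 2 ^ J y"
    have y: "y \<in> dyadic (J y) k" by (simp add: k_def dyadic_iff)
    have "{p..<q} = {p..q - 1}" if "0 < q" for p q :: nat using that by auto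
    from this[of "k * 2 ^ J y + 2 ^ J y" "k * 2 ^ J y"]
    have "dyadic (J y) k = {k * 2 ^ J y..k * 2 ^ J y + 2 ^ J y - 1}" by (simp add: dyadic_def add.commute)
    moreover have "k * 2 ^ J y + 2 ^ J y - 1 - k * 2 ^ J y + 1 = 2 ^ J y" by simp
    ultimately have "sum w (Q (J y) y) \<le> K * real (2 ^ J y) * w y"
      using K[of "k * 2 ^ J y" y "k * 2 ^ J y + 2 ^ J y - 1"] y by (simp add: Q_def flip: k_def) 
    then show "sum w (Q (J y) y) / 2 ^ J y \<le> K * w y" by (simp add: pos_divide_le_eq mult_ac)
  qed
  finally show ?thesis by (simp add: sum_distrib_left mult_ac)
qed

definition Om3 where "Om3 = (\<Union>y\<in>Om. dyadic3 (J y) (y div 2 ^ J y))"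

text \<open>The mass \<open>w x\<close> of a point of a triple is spread evenly over the
  \<open>2 ^ J y\<close> points of the middle interval. After exchanging the sums, the A_1 condition
  compares the mass of a triple, of length at most \<open>3 * 2 ^ J y\<close>, with
  \<open>w y\<close>.\<close>

lemma weight_Om3_le:
  assumes w: "\<And>k. 0 < w k" and K: "\<And>a b x. a \<le> x \<Longrightarrow> x \<le> b \<Longrightarrow> sum w {a..b} \<le> K * real (b - a + 1) * w x" "0 < K"
  shows "sum w Om3 \<le> 3 * K * sum w Om"
proof -
  define Q3 where "Q3 y = dyadic3 (J y) (y div 2 ^ J y)" for y
  have fin: "finite Om3" using finite_Om by (auto simp: Om3_def)
  have "sum w Om3 \<le> (\<Sum>x\<in>Om3. \<Sum>y\<in>Om. (if x \<in> Q3 y then w x / 2 ^ J y else 0))"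
  proof (rule sum_mono)
    fix x assume "x \<in> Om3"
    then obtain y where y: "y \<in> Om" "x \<in> Q3 y" by (auto simp: Om3_def Q3_def)
    have "w x = (\<Sum>z\<in>Q (J y) y. w x / 2 ^ J y)" by simp
    also have "\<dots> = (\<Sum>z\<in>Q (J y) y. (if x \<in> Q3 z then w x / 2 ^ J z else 0))"
    proof (intro sum.cong refl)
      fix z assume z: "z \<in> Q (J y) y"
      have "J z = J y" using J_const[OF y(1) z] by auto
      moreover have "z div 2 ^ J y = y div 2 ^ J y" using z by (simp add: Q_def dyadic_iff)
      ultimately have "Q3 z = Q3 y" "J z = J y" by (auto simp: Q3_def)
      then show "w x / 2 ^ J y = (if x \<in> Q3 z then w x / 2 ^ J z else 0)" using y by simp
    qed
    also have "\<dots> \<le> (\<Sum>z\<in>Om. (if x \<in> Q3 z then w x / 2 ^ J z else 0))"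
    proof (rule sum_mono2[OF finite_Om])
      show "Q (J y) y \<subseteq> Om" using J_const(1)[OF y(1)] by blast
    qed (use w in \<open>simp add: less_imp_le\<close>)
    finally show "w x \<le> (\<Sum>z\<in>Om. (if x \<in> Q3 z then w x / 2 ^ J z else 0))" .
  qed
  also have "\<dots> = (\<Sum>y\<in>Om. \<Sum>x\<in>Om3 \<inter> Q3 y. w x / 2 ^ J y)"
    using fin by (subst sum.swap) (simp add: sum.inter_restrict)
  also have "\<dots> \<le> (\<Sum>y\<in>Om. 3 * K * w y)"
  proof (rule sum_mono)
    fix y
    obtain a b where ab: "Q3 y = {a..b}" "a \<le> y" "y \<le> b" "real (b - a + 1) \<le> 3 * 2 ^ J y"
      using dyadic3_interval[of y "J y" "y div 2 ^ J y"] unfolding Q3_def by (auto simp: dyadic_iff)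
    have "(\<Sum>x\<in>Om3 \<inter> Q3 y. w x / 2 ^ J y) \<le> (\<Sum>x\<in>Q3 y. w x / 2 ^ J y)"
      using w by (intro sum_mono2) (auto simp: Q3_def intro: less_imp_le)
    also have "\<dots> = sum w {a..b} / 2 ^ J y" by (simp add: ab sum_divide_distrib)
    also have "\<dots> \<le> (K * real (b - a + 1) * w y) / 2 ^ J y" using K(1)[OF ab(2,3)] by (intro divide_right_mono) auto
    also have "\<dots> \<le> (K * (3 * 2 ^ J y) * w y) / 2 ^ J y"
      using ab(4) K(2) w[of y] by (intro divide_right_mono mult_right_mono mult_left_mono) auto
    finally show "(\<Sum>x\<in>Om3 \<inter> Q3 y. w x / 2 ^ J y) \<le> 3 * K * w y" by simp
  qed
  finally show ?thesis by (simp add: sum_distrib_left)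
qed

end

section \<open>Weak type bounds with A_1 weights over parabolic regions\<close>

context cz_family
begin

lemma T_bounded: "0 \<le> s \<Longrightarrow> \<bar>T i s n m\<bar> \<le> c"
proof -
  assume s: "0 \<le> s"
  have "c / sqrt (1 + s) \<le> c / 1" using s c_pos by (intro divide_left_mono) auto
  then show ?thesis using T_le[OF s, of i n m] by simp
qed

text \<open>On each maximal dyadic interval of side \<open>r\<close> the bad part \<open>b\<close> is split as \<open>W (r\<^sup>2) b + (1 - W (r\<^sup>2)) b\<close>: the
  first summand joins the good part, and the second is handled by \<open>T_diff_le\<close>.\<close>

lemma weak_type_A1:
  assumes w: "A1_weight w" and K: "l2_bounded w K"
  shows "\<exists>C>0. \<forall>i Y f X l. finite Y \<longrightarrow> finite X \<longrightarrow> 0 < l \<longrightarrow>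
    (\<forall>x\<in>X. \<exists>s \<xi>. 0 \<le> s \<and> (real \<xi> - real x)\<^sup>2 \<le> s \<and> l < \<bar>\<Sum>y\<in>Y. T i s \<xi> y * f y\<bar>) \<longrightarrow>
    l * sum w X \<le> C * (\<Sum>y\<in>Y. \<bar>f y\<bar> * w y)"
proof -
  have w2: "Ap_weight 2 w" by (rule A1_weight_imp_A2[OF w])
  have wpos: "\<And>k. 0 < w k" using w2 unfolding Ap_weight_def by blast
  obtain Kw where Kw: "0 < Kw" "\<And>a b x. a \<le> x \<Longrightarrow> x \<le> b \<Longrightarrow> sum w {a..b} \<le> Kw * real (b - a + 1) * w x"
    using A1_weight_avg[OF w] by blast
  obtain Cn where Cn: "0 < Cn" and nt: "\<And>X u M l K. finite X \<Longrightarrow> (\<forall>x. \<bar>u x\<bar> \<le> M) \<Longrightarrow> 0 < l \<Longrightarrow> (\<forall>n. (\<Sum>x<n. (u x)\<^sup>2 * w x) \<le> K) \<Longrightarrow>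
    (\<forall>x\<in>X. \<exists>s \<xi> v. 0 \<le> s \<and> (real \<xi> - real x)\<^sup>2 \<le> s \<and> (\<lambda>l. W s \<xi> l * u l) sums v \<and> l < \<bar>v\<bar>) \<Longrightarrow>
    l\<^sup>2 * sum w X \<le> Cn * K"
    using nontangential_l2[OF w2] by blast
  have "Ap_weight 2 (\<lambda>k. w k powr (- 1))" using Ap_weight_dual[OF _ w2] by simp
  moreover have "w k powr (- 1) = 1 / w k" for k using wpos[of k] by (simp add: powr_minus_divide)
  ultimately have w2': "Ap_weight 2 (\<lambda>k. 1 / w k)" by simp
  obtain Cm where Cm: "0 < Cm" "maximal_bounded 2 (\<lambda>k. 1 / w k) Cm"
    using Ap_weight_maximal_bounded[OF _ w2'] by auto
  define K' where "K' = max K 1"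
  have K': "l2_bounded w K'"
    unfolding l2_bounded_def
  proof (intro allI impI)
    fix i and Y :: "nat set" and f n assume "finite Y"
    then have "(\<Sum>l<n. (\<Sum>y\<in>Y. T i 0 l y * f y)\<^sup>2 * w l) \<le> K * (\<Sum>y\<in>Y. (f y)\<^sup>2 * w y)"
      using K unfolding l2_bounded_def by blast
    also have "\<dots> \<le> K' * (\<Sum>y\<in>Y. (f y)\<^sup>2 * w y)"
      using wpos by (intro mult_right_mono sum_nonneg) (auto simp: K'_def less_imp_le)
    finally show "(\<Sum>l<n. (\<Sum>y\<in>Y. T i 0 l y * f y)\<^sup>2 * w l) \<le> K' * (\<Sum>y\<in>Y. (f y)\<^sup>2 * w y)" .
  qed
  have K'pos: "0 < K'" by (simp add: K'_def)
  define Ch where "Ch = 24\<^sup>2 * Cm"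
  \<comment> \<open>The four terms belong to the good part \<open>X1\<close>, the smoothed bad part
    \<open>X2\<close>, the remainder \<open>X3\<close> off the triples, and the triples
    \<open>cz.Om3\<close> themselves.\<close>
  define C where "C = Cn * K' + Cn * K' * (2 * c)\<^sup>2 * (4 * Ch) * Kw + 96 * c * Kw + 3 * Kw * Kw"
  have Cpos: "0 < C" using Cn K'pos Kw(1) c_pos Cm unfolding C_def Ch_def by (intro add_pos_pos mult_pos_pos) auto
  \<comment> \<open>The level \<open>3 * l\<close> is shared equally among the good part, the
    smoothed bad part and the remainder.\<close>
  have main: "l * sum w X \<le> C * (\<Sum>y\<in>Y. \<bar>f y\<bar> * w y)"
    if Y: "finite Y" and X: "finite X" and l: "0 < l"
      and h: "\<forall>x\<in>X. \<exists>s \<xi>. 0 \<le> s \<and> (real \<xi> - real x)\<^sup>2 \<le> s \<and> 3 * l < \<bar>\<Sum>y\<in>Y. T i s \<xi> y * f y\<bar>"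
    for i Y f X l
  proof -
    define F where "F y = (if y \<in> Y then \<bar>f y\<bar> else 0)" for y
    interpret cz: calderon_zygmund F Y l by standard (use Y l in \<open>auto simp: F_def\<close>)
    let ?O = "cz.Om" and ?J = "cz.J"
    define S where "S = (\<Sum>y\<in>Y. \<bar>f y\<bar> * w y)"
    have S0: "0 \<le> S" unfolding S_def using wpos by (intro sum_nonneg mult_nonneg_nonneg) (auto simp: less_imp_le)
    define G where "G = Y - ?O"
    define B where "B = Y \<inter> ?O"
    have GB: "Y = G \<union> B" "G \<inter> B = {}" "finite G" "finite B" using Y by (auto simp: G_def B_def)
    have FwO: "(\<Sum>y\<in>?O. F y * w y) \<le> S"
    proof -
      have "(\<Sum>y\<in>?O. F y * w y) = (\<Sum>y\<in>B. F y * w y)"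
        using cz.finite_Om by (intro sum.mono_neutral_right) (auto simp: B_def F_def)
      also have "\<dots> \<le> (\<Sum>y\<in>Y. F y * w y)" using Y wpos cz.F_nonneg by (intro sum_mono2) (auto simp: B_def less_imp_le)
      also have "\<dots> = S" by (simp add: S_def F_def)
      finally show ?thesis .
    qed
    have wO: "l * sum w ?O \<le> Kw * S"
      using cz.weight_Om_le[of w Kw, OF wpos Kw(2)] mult_left_mono[OF FwO, of Kw] Kw(1) by linarith
    \<comment> \<open>The squared side of the maximal interval of \<open>y\<close>, that is, the
      time after which the semigroup has spread over that side.\<close>
    define sc where "sc y = (4::real) ^ ?J y" for y
    have sc: "0 < sc y" "1 \<le> sc y" for y by (auto simp: sc_def)
    have sqrt_sc: "sqrt (sc y) = 2 ^ ?J y" for y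
      unfolding sc_def two_power_square[symmetric] by simp
    define P where "P j x y = (2::real) ^ j / (4 ^ j + (real x - real y)\<^sup>2)" for j x y
    have Ppos: "0 < P j x y" for j x y by (auto simp: P_def intro!: divide_pos_pos add_pos_nonneg)
    have Psym: "P j x y = P j y x" for j x y by (simp add: P_def power2_commute)
    define u where "u k = (\<Sum>y\<in>B. T i (sc y) k y * f y)" for k
    define hh where "hh z = (\<Sum>y\<in>B. W (sc y) z y * f y)" for z
    define H where "H z = (\<Sum>y\<in>B. F y * P (?J y) z y)" for z
    have H0: "0 \<le> H z" for z unfolding H_def using Ppos cz.F_nonneg by (intro sum_nonneg mult_nonneg_nonneg) (auto simp: less_imp_le)
    have F_abs: "F y = \<bar>f y\<bar>" if "y \<in> B" for y using that by (simp add: F_def B_def)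
    have hh_le: "\<bar>hh z\<bar> \<le> 2 * c * H z" for z
    proof -
      have "\<bar>hh z\<bar> \<le> (\<Sum>y\<in>B. \<bar>W (sc y) z y * f y\<bar>)" unfolding hh_def by (rule sum_abs)
      also have "\<dots> \<le> (\<Sum>y\<in>B. 2 * c * (F y * P (?J y) z y))"
      proof (rule sum_mono)
        fix y assume y: "y \<in> B"
        have "1 + sc y \<le> 2\<^sup>2 * sc y" using sc(2)[of y] by simp
        then have "sqrt (1 + sc y) \<le> sqrt (2\<^sup>2 * sc y)" by (rule real_sqrt_le_mono)
        also have "\<dots> = 2 * 2 ^ ?J y" by (simp add: real_sqrt_mult sqrt_sc)
        finally have "sqrt (1 + sc y) / (1 + sc y + (real z - real y)\<^sup>2) \<le> 2 * 2 ^ ?J y / (sc y + (real z - real y)\<^sup>2)"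
          using sc[of y] by (intro frac_le) (auto intro!: add_pos_nonneg)
        also have "\<dots> = 2 * P (?J y) z y" by (simp add: P_def sc_def)
        finally have "\<bar>W (sc y) z y\<bar> \<le> c * (2 * P (?J y) z y)"
          using W_le[of "sc y" z y] sc[of y] c_pos by (meson less_imp_le mult_left_mono order_trans)
        then have "\<bar>W (sc y) z y\<bar> * \<bar>f y\<bar> \<le> c * (2 * P (?J y) z y) * \<bar>f y\<bar>" by (intro mult_right_mono) auto
        then show "\<bar>W (sc y) z y * f y\<bar> \<le> 2 * c * (F y * P (?J y) z y)" by (simp add: abs_mult F_abs[OF y] mult_ac)
      qed
      finally show ?thesis by (simp add: H_def sum_distrib_left)
    qed
    \<comment> \<open>By duality: \<open>N\<close> is the pairing of \<open>H\<close> with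
      \<open>g = H * w\<close>. The Poisson kernels move to \<open>g\<close> and give
      \<open>V\<close>; \<open>avg_le\<close> trades \<open>F\<close> for \<open>2 * l\<close>; the
      resulting linear sum is split so that half of \<open>N\<close> is absorbed.\<close>
    have H_l2: "(\<Sum>z\<in>A. (H z)\<^sup>2 * w z) \<le> 4 * Ch * l * (Kw * S)" if A: "finite A" for A
    proof -
      define g where "g z = (if z \<in> A then H z * w z else 0)" for z
      have g0: "0 \<le> g z" for z using H0 wpos by (simp add: g_def less_imp_le)
      define V where "V y = (\<Sum>z\<in>A. g z * P (?J y) y z)" for y
      have V0: "0 \<le> V y" for y unfolding V_def using g0 Ppos by (intro sum_nonneg mult_nonneg_nonneg) (auto simp: less_imp_le)
      \<comment> \<open>\<open>avg_le\<close> asks for a function constant on each maximal interval,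
        so \<open>V\<close> is replaced by its maximum there.\<close>
      define V' where "V' y = (if y \<in> ?O then Max (V ` cz.Q (?J y) y) else 0)" for y
      have V'eq: "\<exists>z\<in>cz.Q (?J y) y. V' y = V z" if "y \<in> ?O" for y
      proof -
        have "Max (V ` cz.Q (?J y) y) \<in> V ` cz.Q (?J y) y" using cz.Q_refl[of y "?J y"] by (intro Max_in) auto
        then show ?thesis using that by (auto simp: V'_def)
      qed
      have V'0: "0 \<le> V' y" for y using V'eq[of y] V0 by (cases "y \<in> ?O") (auto simp: V'_def)
      have VV': "V y \<le> V' y" if "y \<in> ?O" for y
        using that cz.Q_refl[of y "?J y"] by (auto simp: V'_def)
      have V'const: "V' z = V' y" if "y \<in> ?O" "z \<in> cz.Q (?J y) y" for y z
        using cz.J_const[OF that] that by (simp add: V'_def)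
      define N where "N = (\<Sum>z\<in>A. (H z)\<^sup>2 * w z)"
      have "N = (\<Sum>z\<in>A. g z * H z)" unfolding N_def by (intro sum.cong) (auto simp: g_def power2_eq_square)
      also have "\<dots> = (\<Sum>y\<in>B. F y * V y)"
        unfolding H_def V_def sum_distrib_left by (subst sum.swap) (intro sum.cong refl, simp add: Psym mult_ac)
      also have "\<dots> \<le> (\<Sum>y\<in>?O. F y * V y)"
        using cz.finite_Om V0 cz.F_nonneg by (intro sum_mono2) (auto simp: B_def)
      also have "\<dots> \<le> (\<Sum>y\<in>?O. F y * V' y)" using VV' cz.F_nonneg by (intro sum_mono mult_left_mono) auto
      also have "\<dots> \<le> 2 * l * (\<Sum>y\<in>?O. V' y)" by (rule cz.avg_le[OF V'0 V'const])
      finally have N1: "N \<le> 2 * l * (\<Sum>y\<in>?O. V' y)" .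
      \<comment> \<open>The interval found for the maximizing point \<open>z\<close> also contains
        \<open>y\<close>, because its scale is at least that of the maximal interval. In 24 = 8 * 3,
        8 is from \<open>poisson_scales\<close> and 3 from the length of a triple.\<close>
      have dom: "(\<Sum>y\<in>?O. (V' y / 24)\<^sup>2 * (1 / w y)) \<le> Cm * (\<Sum>z. (g z)\<^sup>2 * (1 / w z))"
      proof (rule maximal_boundedD2[OF Cm(2) cz.finite_Om g0])
        show "interval_dominated ?O (\<lambda>y. V' y / 24) g" unfolding interval_dominated_def
        proof
          fix y assume y: "y \<in> ?O"
          then obtain z where z: "z \<in> cz.Q (?J y) y" "V' y = V z" using V'eq by blast
          have Jz: "?J z = ?J y" using cz.J_const[OF y z(1)] by simp
          obtain N where N: "N \<ge> ?J z" "\<And>A'. (\<forall>j\<in>{?J z..N}. sum g (dyadic3 j (z div 2 ^ j)) \<le> A' * 2 ^ j) \<Longrightarrow>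
              (\<Sum>x\<in>A. g x * (2 ^ ?J z / (4 ^ ?J z + (real z - real x)\<^sup>2))) \<le> 8 * A'"
            using poisson_scales[where f = g and Y = A and i = "?J z" and x = z, OF g0 A] by blast
          define m where "m j = sum g (dyadic3 j (z div 2 ^ j)) / 2 ^ j" for j
          have "Max (m ` {?J z..N}) \<in> m ` {?J z..N}" using N(1) by (intro Max_in) auto
          then obtain j where j: "j \<in> {?J z..N}" "Max (m ` {?J z..N}) = m j" by auto
          have "m k \<le> m j" if "k \<in> {?J z..N}" for k
            using that unfolding j(2)[symmetric] by (intro Max_ge) auto
          then have "V z \<le> 8 * m j" unfolding V_def P_def
            by (intro N(2)) (auto simp: m_def field_simps)
          have "y \<in> dyadic (?J y) (z div 2 ^ ?J y)" using z(1) by (simp add: cz.Q_def dyadic_iff)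
          then have "y div 2 ^ ?J y = z div 2 ^ ?J y" by (simp add: dyadic_iff)
          then have "y div 2 ^ j = z div 2 ^ j" using dyadic_ancestor[of "?J y" j y z] j(1) Jz by simp
          then obtain a b where ab: "dyadic3 j (z div 2 ^ j) = {a..b}" "a \<le> y" "y \<le> b" "real (b - a + 1) \<le> 3 * 2 ^ j"
            using dyadic3_interval[of y j "z div 2 ^ j"] by (auto simp: dyadic_iff)
          have m0: "0 \<le> m j" unfolding m_def using g0 by (intro divide_nonneg_nonneg sum_nonneg) auto
          have "V' y / 24 * real (b - a + 1) \<le> (m j / 3) * real (b - a + 1)"
            using \<open>V z \<le> 8 * m j\<close> z(2) by (intro mult_right_mono) auto
          also have "\<dots> \<le> (m j / 3) * (3 * 2 ^ j)" using ab(4) m0 by (intro mult_left_mono) auto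
          also have "\<dots> = sum g {a..b}" by (simp add: m_def ab(1))
          finally show "\<exists>a b. a \<le> y \<and> y \<le> b \<and> V' y / 24 * real (b - a + 1) \<le> sum g {a..b}" using ab by blast
        qed
        show "summable (\<lambda>z. (g z)\<^sup>2 * (1 / w z))" by (rule summable_finite[OF A]) (auto simp: g_def)
      qed (use V'0 in auto)
      have "(\<Sum>z. (g z)\<^sup>2 * (1 / w z)) = (\<Sum>z\<in>A. (g z)\<^sup>2 * (1 / w z))"
        by (rule suminf_finite[OF A]) (auto simp: g_def)
      also have "\<dots> = N" unfolding N_def
      proof (intro sum.cong refl)
        fix z assume "z \<in> A"
        then show "(g z)\<^sup>2 * (1 / w z) = (H z)\<^sup>2 * w z" using wpos[of z] by (simp add: g_def power2_eq_square)
      qed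
      finally have "(\<Sum>y\<in>?O. (V' y / 24)\<^sup>2 * (1 / w y)) \<le> Cm * N" using dom by simp
      moreover have "(\<Sum>y\<in>?O. (V' y)\<^sup>2 / w y) = 24\<^sup>2 * (\<Sum>y\<in>?O. (V' y / 24)\<^sup>2 * (1 / w y))"
        unfolding sum_distrib_left by (intro sum.cong) (auto simp: power_divide)
      ultimately have V'2: "(\<Sum>y\<in>?O. (V' y)\<^sup>2 / w y) \<le> Ch * N" by (simp add: Ch_def)
      have Ch: "0 < Ch" using Cm by (simp add: Ch_def)
      \<comment> \<open>Arithmetic-geometric mean at each point: the weight
        \<open>1 / (2 * Ch)\<close> makes the quadratic term at most \<open>N / 2\<close>, and the
        rest is a multiple of \<open>l\<close> times \<open>l * sum w Om\<close>.\<close>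
      have "2 * l * (\<Sum>y\<in>?O. V' y) \<le> (\<Sum>y\<in>?O. (V' y)\<^sup>2 / w y / (2 * Ch) + 2 * Ch * l\<^sup>2 * w y)"
        unfolding sum_distrib_left
      proof (rule sum_mono)
        fix y
        have "0 \<le> (V' y / (2 * Ch * w y) - l)\<^sup>2 * (2 * Ch * w y)" using Ch wpos[of y] by simp
        also have "\<dots> = (V' y)\<^sup>2 / w y / (2 * Ch) + 2 * Ch * l\<^sup>2 * w y - 2 * l * V' y"
          using Ch wpos[of y] by (simp add: power2_eq_square field_simps)
        finally show "2 * l * V' y \<le> (V' y)\<^sup>2 / w y / (2 * Ch) + 2 * Ch * l\<^sup>2 * w y" by simp
      qed
      also have "\<dots> = (\<Sum>y\<in>?O. (V' y)\<^sup>2 / w y) / (2 * Ch) + 2 * Ch * l * (l * sum w ?O)"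
        by (simp add: sum.distrib sum_distrib_left sum_divide_distrib power2_eq_square mult_ac)
      also have "\<dots> \<le> Ch * N / (2 * Ch) + 2 * Ch * l * (Kw * S)"
        using V'2 wO Ch l by (intro add_mono divide_right_mono mult_left_mono) auto
      finally have "N \<le> N / 2 + 2 * Ch * l * (Kw * S)" using N1 Ch by simp
      then show ?thesis unfolding N_def by simp
    qed
    \<comment> \<open>\<open>u\<close> is \<open>T i 0\<close> applied to \<open>hh\<close>, which
      need not have finite support; \<open>l2_bounded\<close> is applied to truncations, followed by
      a limit.\<close>
    have u_l2: "(\<Sum>x<n. (u x)\<^sup>2 * w x) \<le> K' * ((2 * c)\<^sup>2 * (4 * Ch * l * (Kw * S)))" for n
    proof -
      have lim: "(\<lambda>k. \<Sum>y\<in>{..<k}. T i 0 x y * hh y) \<longlonglongrightarrow> u x" for x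
      proof -
        have "(\<lambda>z. T i 0 x z * W (sc y) z y) sums T i (sc y) x y" for y
        proof -
          have "(\<lambda>z. W (sc y) y z * T i 0 z x) sums T i (sc y + 0) y x" using sc[of y] by (intro WT) auto
          moreover have "W (sc y) y z * T i 0 z x = T i 0 x z * W (sc y) z y" for z
            using W_sym[of "sc y" y z] T_sym[of i 0 z x] by simp
          ultimately show ?thesis using T_sym[of i "sc y" y x] by simp
        qed
        then have "(\<lambda>z. \<Sum>y\<in>B. T i 0 x z * W (sc y) z y * f y) sums (\<Sum>y\<in>B. T i (sc y) x y * f y)"
          by (intro sums_sum sums_mult2)
        then have "(\<lambda>z. T i 0 x z * hh z) sums u x" by (simp add: hh_def u_def sum_distrib_left mult.assoc)
        then show ?thesis by (simp add: sums_def)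
      qed
      have "(\<lambda>k. \<Sum>x<n. (\<Sum>y\<in>{..<k}. T i 0 x y * hh y)\<^sup>2 * w x) \<longlonglongrightarrow> (\<Sum>x<n. (u x)\<^sup>2 * w x)"
        by (intro tendsto_intros lim)
      moreover have "(\<Sum>x<n. (\<Sum>y\<in>{..<k}. T i 0 x y * hh y)\<^sup>2 * w x) \<le> K' * ((2 * c)\<^sup>2 * (4 * Ch * l * (Kw * S)))" for k
      proof -
        have "(\<Sum>x<n. (\<Sum>y\<in>{..<k}. T i 0 x y * hh y)\<^sup>2 * w x) \<le> K' * (\<Sum>y\<in>{..<k}. (hh y)\<^sup>2 * w y)"
          using K' unfolding l2_bounded_def by blast
        also have "(\<Sum>y\<in>{..<k}. (hh y)\<^sup>2 * w y) \<le> (\<Sum>y\<in>{..<k}. (2 * c)\<^sup>2 * ((H y)\<^sup>2 * w y))"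
        proof (rule sum_mono)
          fix y
          have "\<bar>hh y\<bar>\<^sup>2 \<le> (2 * c * H y)\<^sup>2" using hh_le by (intro power_mono) auto
          then have "(hh y)\<^sup>2 \<le> (2 * c)\<^sup>2 * (H y)\<^sup>2" by (simp only: power2_abs power_mult_distrib)
          then have "(hh y)\<^sup>2 * w y \<le> (2 * c)\<^sup>2 * (H y)\<^sup>2 * w y" using wpos[of y] by (intro mult_right_mono) auto
          then show "(hh y)\<^sup>2 * w y \<le> (2 * c)\<^sup>2 * ((H y)\<^sup>2 * w y)" by (simp only: mult.assoc)
        qed
        also have "\<dots> = (2 * c)\<^sup>2 * (\<Sum>y\<in>{..<k}. (H y)\<^sup>2 * w y)" by (simp only: sum_distrib_left)
        also have "\<dots> \<le> (2 * c)\<^sup>2 * (4 * Ch * l * (Kw * S))" by (intro mult_left_mono H_l2) auto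
        finally show ?thesis using K'pos by simp
      qed
      ultimately show ?thesis by (intro LIMSEQ_le_const2) auto
    qed
    define X1 where "X1 = {x\<in>X. \<exists>s \<xi>. 0 \<le> s \<and> (real \<xi> - real x)\<^sup>2 \<le> s \<and> l < \<bar>\<Sum>y\<in>G. T i s \<xi> y * f y\<bar>}"
    define X2 where "X2 = {x\<in>X. \<exists>s \<xi>. 0 \<le> s \<and> (real \<xi> - real x)\<^sup>2 \<le> s \<and> l < \<bar>\<Sum>y\<in>B. T i (s + sc y) \<xi> y * f y\<bar>}"
    define X3 where "X3 = {x\<in>X - cz.Om3. \<exists>s \<xi>. 0 \<le> s \<and> (real \<xi> - real x)\<^sup>2 \<le> s \<and> l < \<bar>\<Sum>y\<in>B. (T i s \<xi> y - T i (s + sc y) \<xi> y) * f y\<bar>}"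
    have fin: "finite X1" "finite X2" "finite X3" "finite cz.Om3" using X cz.finite_Om by (auto simp: X1_def X2_def X3_def cz.Om3_def)
    have cover: "X \<subseteq> X1 \<union> X2 \<union> X3 \<union> cz.Om3"
    proof
      fix x assume x: "x \<in> X"
      then obtain s \<xi> where s: "0 \<le> s" "(real \<xi> - real x)\<^sup>2 \<le> s" "3 * l < \<bar>\<Sum>y\<in>Y. T i s \<xi> y * f y\<bar>" using h by blast
      have "(\<Sum>y\<in>Y. T i s \<xi> y * f y) = (\<Sum>y\<in>G. T i s \<xi> y * f y) + (\<Sum>y\<in>B. T i s \<xi> y * f y)"
        using GB by (simp add: sum.union_disjoint)
      also have "(\<Sum>y\<in>B. T i s \<xi> y * f y) = (\<Sum>y\<in>B. T i (s + sc y) \<xi> y * f y) + (\<Sum>y\<in>B. (T i s \<xi> y - T i (s + sc y) \<xi> y) * f y)"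
        by (simp add: left_diff_distrib flip: sum.distrib)
      finally have "l < \<bar>\<Sum>y\<in>G. T i s \<xi> y * f y\<bar> \<or> l < \<bar>\<Sum>y\<in>B. T i (s + sc y) \<xi> y * f y\<bar> \<or> l < \<bar>\<Sum>y\<in>B. (T i s \<xi> y - T i (s + sc y) \<xi> y) * f y\<bar>"
        using s(3) by linarith
      then show "x \<in> X1 \<union> X2 \<union> X3 \<union> cz.Om3" using x s(1,2) by (auto simp: X1_def X2_def X3_def)
    qed
    have 1: "l * sum w X1 \<le> Cn * K' * S"
    proof -
      have "l\<^sup>2 * sum w X1 \<le> Cn * (K' * (\<Sum>y\<in>G. (f y)\<^sup>2 * w y))"
      proof (rule nt[where u = "\<lambda>k. \<Sum>y\<in>G. T i 0 k y * f y" and M = "\<Sum>y\<in>G. c * \<bar>f y\<bar>"])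
        show "\<forall>x. \<bar>\<Sum>y\<in>G. T i 0 x y * f y\<bar> \<le> (\<Sum>y\<in>G. c * \<bar>f y\<bar>)"
          by (intro allI order_trans[OF sum_abs] sum_mono) (auto simp: abs_mult intro!: mult_right_mono T_bounded)
        show "\<forall>n. (\<Sum>x<n. (\<Sum>y\<in>G. T i 0 x y * f y)\<^sup>2 * w x) \<le> K' * (\<Sum>y\<in>G. (f y)\<^sup>2 * w y)"
          using K' GB(3) unfolding l2_bounded_def by blast
        show "\<forall>x\<in>X1. \<exists>s \<xi> v. 0 \<le> s \<and> (real \<xi> - real x)\<^sup>2 \<le> s \<and> (\<lambda>k. W s \<xi> k * (\<Sum>y\<in>G. T i 0 k y * f y)) sums v \<and> l < \<bar>v\<bar>"
        proof
          fix x assume "x \<in> X1"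
          then obtain s \<xi> where s: "0 \<le> s" "(real \<xi> - real x)\<^sup>2 \<le> s" "l < \<bar>\<Sum>y\<in>G. T i s \<xi> y * f y\<bar>" by (auto simp: X1_def)
          have "(\<lambda>k. \<Sum>y\<in>G. W s \<xi> k * T i 0 k y * f y) sums (\<Sum>y\<in>G. T i (s + 0) \<xi> y * f y)"
            using s by (intro sums_sum sums_mult2 WT) auto
          then have "(\<lambda>k. W s \<xi> k * (\<Sum>y\<in>G. T i 0 k y * f y)) sums (\<Sum>y\<in>G. T i s \<xi> y * f y)"
            by (simp add: sum_distrib_left mult.assoc)
          then show "\<exists>s \<xi> v. 0 \<le> s \<and> (real \<xi> - real x)\<^sup>2 \<le> s \<and> (\<lambda>k. W s \<xi> k * (\<Sum>y\<in>G. T i 0 k y * f y)) sums v \<and> l < \<bar>v\<bar>"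
            using s by blast
        qed
      qed (use fin l in auto)
      also have "\<dots> \<le> Cn * (K' * (l * S))"
      proof -
        have "(\<Sum>y\<in>G. (f y)\<^sup>2 * w y) \<le> (\<Sum>y\<in>G. l * (\<bar>f y\<bar> * w y))"
        proof (rule sum_mono)
          fix y assume "y \<in> G"
          then have "\<bar>f y\<bar> \<le> l" using cz.off[of y] by (simp add: G_def F_def)
          then have "\<bar>f y\<bar> * (\<bar>f y\<bar> * w y) \<le> l * (\<bar>f y\<bar> * w y)" using wpos[of y] by (intro mult_right_mono) auto
          then show "(f y)\<^sup>2 * w y \<le> l * (\<bar>f y\<bar> * w y)" by (simp add: power2_eq_square flip: mult.assoc)
        qed
        also have "\<dots> = l * (\<Sum>y\<in>G. \<bar>f y\<bar> * w y)" by (simp add: sum_distrib_left)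
        also have "\<dots> \<le> l * S" unfolding S_def using l Y wpos by (intro mult_left_mono sum_mono2) (auto simp: G_def less_imp_le)
        finally show ?thesis using Cn K'pos by simp
      qed
      finally have "l * (l * sum w X1) \<le> l * (Cn * K' * S)" by (simp add: power2_eq_square mult_ac)
      then show ?thesis using l by simp
    qed
    have 2: "l * sum w X2 \<le> Cn * K' * (2 * c)\<^sup>2 * (4 * Ch) * Kw * S"
    proof -
      have "l\<^sup>2 * sum w X2 \<le> Cn * (K' * ((2 * c)\<^sup>2 * (4 * Ch * l * (Kw * S))))"
      proof (rule nt[where u = u and M = "\<Sum>y\<in>B. c * \<bar>f y\<bar>"])
        show "\<forall>x. \<bar>u x\<bar> \<le> (\<Sum>y\<in>B. c * \<bar>f y\<bar>)" unfolding u_def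
          using sc by (intro allI order_trans[OF sum_abs] sum_mono) (auto simp: abs_mult less_imp_le intro!: mult_right_mono T_bounded)
        show "\<forall>n. (\<Sum>x<n. (u x)\<^sup>2 * w x) \<le> K' * ((2 * c)\<^sup>2 * (4 * Ch * l * (Kw * S)))" using u_l2 by blast
        show "\<forall>x\<in>X2. \<exists>s \<xi> v. 0 \<le> s \<and> (real \<xi> - real x)\<^sup>2 \<le> s \<and> (\<lambda>k. W s \<xi> k * u k) sums v \<and> l < \<bar>v\<bar>"
        proof
          fix x assume "x \<in> X2"
          then obtain s \<xi> where s: "0 \<le> s" "(real \<xi> - real x)\<^sup>2 \<le> s" "l < \<bar>\<Sum>y\<in>B. T i (s + sc y) \<xi> y * f y\<bar>" by (auto simp: X2_def)
          have "(\<lambda>k. \<Sum>y\<in>B. W s \<xi> k * T i (sc y) k y * f y) sums (\<Sum>y\<in>B. T i (s + sc y) \<xi> y * f y)"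
            using s sc by (intro sums_sum sums_mult2 WT) (auto simp: less_imp_le)
          then have "(\<lambda>k. W s \<xi> k * u k) sums (\<Sum>y\<in>B. T i (s + sc y) \<xi> y * f y)"
            by (simp add: sum_distrib_left mult.assoc u_def)
          then show "\<exists>s \<xi> v. 0 \<le> s \<and> (real \<xi> - real x)\<^sup>2 \<le> s \<and> (\<lambda>k. W s \<xi> k * u k) sums v \<and> l < \<bar>v\<bar>"
            using s by blast
        qed
      qed (use fin l in auto)
      then have "l * (l * sum w X2) \<le> l * (Cn * K' * (2 * c)\<^sup>2 * (4 * Ch) * Kw * S)" by (simp add: power2_eq_square mult_ac)
      then show ?thesis using l by simp
    qed
    have 3: "l * sum w X3 \<le> 96 * c * Kw * S"
    proof -
      have "l * sum w X3 \<le> (\<Sum>x\<in>X3. (\<Sum>y\<in>B. 4 * c * (F y * P (?J y) y x)) * w x)"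
        unfolding sum_distrib_left[of l]
      proof (rule sum_mono)
        fix x assume "x \<in> X3"
        then obtain s \<xi> where x: "x \<notin> cz.Om3" and s: "0 \<le> s" "(real \<xi> - real x)\<^sup>2 \<le> s"
          "l < \<bar>\<Sum>y\<in>B. (T i s \<xi> y - T i (s + sc y) \<xi> y) * f y\<bar>" by (auto simp: X3_def)
        note s(3)
        also have "\<bar>\<Sum>y\<in>B. (T i s \<xi> y - T i (s + sc y) \<xi> y) * f y\<bar> \<le> (\<Sum>y\<in>B. \<bar>(T i s \<xi> y - T i (s + sc y) \<xi> y) * f y\<bar>)"
          by (rule sum_abs)
        also have "\<dots> \<le> (\<Sum>y\<in>B. 4 * c * (F y * P (?J y) y x))"
        proof (rule sum_mono)
          fix y assume y: "y \<in> B"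
          define d where "d = (real y - real x)\<^sup>2"
          have "x \<notin> dyadic3 (?J y) (y div 2 ^ ?J y)" using x y by (auto simp: cz.Om3_def B_def)
          then have far: "sc y \<le> d" using dyadic3_far[of y "?J y" "y div 2 ^ ?J y" x] by (simp add: sc_def d_def dyadic_iff)
          \<comment> \<open>Off the triple \<open>(sc y + d) / 4 \<le> d / 2\<close>, and half of
            \<open>d\<close> is at most \<open>s\<close> plus the squared distance from
            \<open>\<xi>\<close> to \<open>y\<close>. Hence moving from \<open>x\<close> to
            \<open>\<xi>\<close> costs only a constant.\<close>
          have "d \<le> 2 * ((real \<xi> - real x)\<^sup>2 + (real \<xi> - real y)\<^sup>2)"
            using sum_squares_bound[of "real \<xi> - real y" "real x - real \<xi>"] by (simp add: d_def power2_eq_square algebra_simps)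
          then have "(sc y + d) / 4 \<le> 1 + s + (real \<xi> - real y)\<^sup>2" using s(1,2) far by simp
          then have "sqrt (sc y) / (1 + s + (real \<xi> - real y)\<^sup>2) \<le> 2 ^ ?J y / ((sc y + d) / 4)"
            using sc[of y] by (intro frac_le) (auto simp: sqrt_sc d_def intro!: add_pos_nonneg)
          also have "\<dots> = 4 * P (?J y) y x" by (simp add: P_def sc_def d_def)
          finally have "\<bar>T i s \<xi> y - T i (s + sc y) \<xi> y\<bar> \<le> c * (4 * P (?J y) y x)"
            using T_diff_le[OF s(1) sc(1)[of y], of i \<xi> y] c_pos by (meson less_imp_le mult_left_mono order_trans)
          then have "\<bar>T i s \<xi> y - T i (s + sc y) \<xi> y\<bar> * \<bar>f y\<bar> \<le> c * (4 * P (?J y) y x) * \<bar>f y\<bar>" by (intro mult_right_mono) auto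
          then show "\<bar>(T i s \<xi> y - T i (s + sc y) \<xi> y) * f y\<bar> \<le> 4 * c * (F y * P (?J y) y x)"
            by (simp add: abs_mult F_abs[OF y] mult_ac)
        qed
        finally show "l * w x \<le> (\<Sum>y\<in>B. 4 * c * (F y * P (?J y) y x)) * w x"
          using wpos[of x] by (intro mult_right_mono) auto
      qed
      also have "\<dots> = (\<Sum>y\<in>B. 4 * c * (F y * (\<Sum>x\<in>X3. w x * P (?J y) y x)))"
        unfolding sum_distrib_left sum_distrib_right by (subst sum.swap) (intro sum.cong refl, simp add: mult_ac)
      \<comment> \<open>A Poisson sum of an A_1 weight at \<open>y\<close> is at most a multiple of
        \<open>w y\<close>, because the mass of each triple is at most \<open>3 * Kw * w y\<close>
        times the side.\<close>
      also have "\<dots> \<le> (\<Sum>y\<in>B. 4 * c * (F y * (8 * (3 * Kw * w y))))"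
      proof (intro sum_mono mult_left_mono cz.F_nonneg)
        fix y
        show "(\<Sum>x\<in>X3. w x * P (?J y) y x) \<le> 8 * (3 * Kw * w y)"
          unfolding P_def
        proof (rule poisson_dyadic[OF _ fin(3)])
          fix j
          obtain a b where ab: "dyadic3 j (y div 2 ^ j) = {a..b}" "a \<le> y" "y \<le> b" "real (b - a + 1) \<le> 3 * 2 ^ j"
            using dyadic3_interval[of y j "y div 2 ^ j"] by (auto simp: dyadic_iff)
          have "sum w {a..b} \<le> Kw * real (b - a + 1) * w y" by (rule Kw(2)[OF ab(2,3)])
          also have "\<dots> \<le> Kw * (3 * 2 ^ j) * w y" using ab(4) Kw(1) wpos[of y] by (intro mult_right_mono mult_left_mono) auto
          finally show "sum w (dyadic3 j (y div 2 ^ j)) \<le> 3 * Kw * w y * 2 ^ j" by (simp add: ab(1) mult_ac)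
        qed (use wpos in \<open>simp add: less_imp_le\<close>)
      qed (use c_pos in auto)
      also have "\<dots> = 96 * c * Kw * (\<Sum>y\<in>B. \<bar>f y\<bar> * w y)"
        unfolding sum_distrib_left by (intro sum.cong) (auto simp: F_abs)
      also have "\<dots> \<le> 96 * c * Kw * S" unfolding S_def using c_pos Kw(1) Y wpos
        by (intro mult_left_mono sum_mono2) (auto simp: B_def less_imp_le)
      finally show ?thesis .
    qed
    have 4: "l * sum w cz.Om3 \<le> 3 * Kw * Kw * S"
    proof -
      have "l * sum w cz.Om3 \<le> l * (3 * Kw * sum w ?O)"
        using cz.weight_Om3_le[of w Kw, OF wpos Kw(2) Kw(1)] l by (intro mult_left_mono) auto
      also have "\<dots> = 3 * Kw * (l * sum w ?O)" by simp
      also have "\<dots> \<le> 3 * Kw * (Kw * S)" using wO Kw(1) by (intro mult_left_mono) auto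
      finally show ?thesis by (simp add: mult_ac)
    qed
    have un: "sum w (P1 \<union> P2) \<le> sum w P1 + sum w P2" if "finite P1" "finite P2" for P1 P2
      using that wpos sum_nonneg[of "P1 \<inter> P2" w] by (simp add: sum_Un less_imp_le)
    have "sum w X \<le> sum w (X1 \<union> X2 \<union> X3 \<union> cz.Om3)" using cover fin wpos by (intro sum_mono2) (auto simp: less_imp_le)
    also have "\<dots> \<le> sum w X1 + sum w X2 + sum w X3 + sum w cz.Om3"
      using un[of "X1 \<union> X2 \<union> X3" cz.Om3] un[of "X1 \<union> X2" X3] un[of X1 X2] fin by simp
    finally have "l * sum w X \<le> l * (sum w X1 + sum w X2 + sum w X3 + sum w cz.Om3)" using l by simp
    also have "\<dots> = l * sum w X1 + l * sum w X2 + l * sum w X3 + l * sum w cz.Om3" by (simp add: distrib_left)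
    also have "\<dots> \<le> C * S" using 1 2 3 4 by (simp add: C_def distrib_right)
    finally show ?thesis by (simp add: S_def)
  qed
  show ?thesis
  proof (intro exI[of _ "3 * C"] conjI allI impI)
    fix i Y f X l
    assume *: "finite Y" "finite X" "0 < (l::real)"
      "\<forall>x\<in>X. \<exists>s \<xi>. 0 \<le> s \<and> (real \<xi> - real x)\<^sup>2 \<le> s \<and> l < \<bar>\<Sum>y\<in>Y. T i s \<xi> y * f y\<bar>"
    have "(l / 3) * sum w X \<le> C * (\<Sum>y\<in>Y. \<bar>f y\<bar> * w y)"
      by (rule main[where i = i]) (use * in auto)
    then show "l * sum w X \<le> 3 * C * (\<Sum>y\<in>Y. \<bar>f y\<bar> * w y)" by simp
  qed (use Cpos in simp)
qed

end

section \<open>Weighted bounds\<close>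

text \<open>An unweighted average becomes a \<open>w\<close>-average:
  \<open>sum w I / (K * r) \<le> w y\<close> on \<open>I\<close> by the A_1 condition. Then
  \<open>maximal_weak\<close> applies with the weight \<open>w\<close>, at the level
  \<open>l / (2 * K)\<close>.\<close>

lemma maximal_weak_A1:
  assumes w: "A1_weight w"
  shows "\<exists>C>0. \<forall>X f Y l. finite X \<longrightarrow> finite Y \<longrightarrow> (\<forall>y. 0 \<le> f y) \<longrightarrow> (\<forall>y. y \<notin> Y \<longrightarrow> f y = 0) \<longrightarrow> 0 < l \<longrightarrow>
    (\<forall>x\<in>X. \<exists>a b. a \<le> x \<and> x \<le> b \<and> l * real (b - a + 1) < sum f {a..b}) \<longrightarrow>
    l * sum w X \<le> C * (\<Sum>y\<in>Y. f y * w y)"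
proof -
  have wpos: "\<And>k. 0 < w k" using w unfolding A1_weight_def by blast
  obtain K where K: "0 < K" "\<And>a b x. a \<le> x \<Longrightarrow> x \<le> b \<Longrightarrow> sum w {a..b} \<le> K * real (b - a + 1) * w x"
    using A1_weight_avg[OF w] by blast
  show ?thesis
  proof (intro exI[of _ "4 * K"] conjI allI impI)
    fix X f Y l
    assume X: "finite X" and Y: "finite Y" "\<forall>y. y \<notin> Y \<longrightarrow> f y = (0::real)" and f: "\<forall>y. 0 \<le> f y" and l: "0 < l"
      and av: "\<forall>x\<in>X. \<exists>a b. a \<le> x \<and> x \<le> b \<and> l * real (b - a + 1) < sum f {a..b}"
    obtain a b where ab: "\<And>x. x \<in> X \<Longrightarrow> a x \<le> x \<and> x \<le> b x \<and> l * real (b x - a x + 1) < sum f {a x..b x}"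
      using av by metis
    define N where "N = Suc (\<Sum>x\<in>X. b x)"
    have bN: "b x < N" if "x \<in> X" for x
      using member_le_sum[of x X b] X that by (simp add: N_def less_Suc_eq_le)
    have XN: "X \<subseteq> {..<N}" using ab bN by fastforce
    have "l / (2 * K) * sum w X \<le> 2 * (\<Sum>y<N. f y * w y)"
    proof (rule maximal_weak[OF _ _ _ XN])
      fix x assume x: "x \<in> X"
      define I where "I = {a x..b x}"
      define r where "r = real (b x - a x + 1)"
      have r: "0 < r" by (simp add: r_def)
      have W: "0 < sum w I" unfolding I_def using ab[OF x] wpos by (intro sum_pos) auto
      have "l * r < sum f I" using ab[OF x] unfolding I_def r_def by blast
      then have "l * r * (sum w I / (K * r)) < sum f I * (sum w I / (K * r))"
        using W K r by (intro mult_strict_right_mono) auto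
      also have "\<dots> = (\<Sum>y\<in>I. f y * (sum w I / (K * r)))" by (simp only: sum_distrib_right)
      also have "\<dots> \<le> (\<Sum>y\<in>I. f y * w y)"
      proof (intro sum_mono mult_left_mono)
        fix y assume "y \<in> I"
        then have "sum w I \<le> K * r * w y" using K(2)[of "a x" y "b x"] by (simp add: I_def r_def)
        then show "sum w I / (K * r) \<le> w y" using K(1) r by (simp add: pos_divide_le_eq mult_ac)
      qed (use f in auto)
      finally have "2 * (l / (2 * K)) * sum w I < (\<Sum>y\<in>I. f y * w y)" using r by simp
      then show "\<exists>a b. a \<le> x \<and> x \<le> b \<and> b < N \<and> 2 * (l / (2 * K)) * sum w {a..b} < (\<Sum>y=a..b. f y * w y)"
        using ab[OF x] bN[OF x] unfolding I_def by blast
    qed (use wpos f l K in \<open>auto simp: less_imp_le\<close>)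
    also have "(\<Sum>y<N. f y * w y) \<le> (\<Sum>y\<in>Y. f y * w y)"
    proof -
      have "(\<Sum>y<N. f y * w y) = (\<Sum>y\<in>{..<N} \<inter> Y. f y * w y)" using Y by (intro sum.mono_neutral_right) auto
      also have "\<dots> \<le> (\<Sum>y\<in>Y. f y * w y)" using Y f wpos by (intro sum_mono2) (auto simp: less_imp_le)
      finally show ?thesis .
    qed
    finally have "l / (2 * K) * sum w X \<le> 2 * (\<Sum>y\<in>Y. f y * w y)" by simp
    then show "l * sum w X \<le> 4 * K * (\<Sum>y\<in>Y. f y * w y)" using K(1) by (simp add: pos_divide_le_eq mult_ac)
  qed (use K in auto)
qed

text \<open>Keeps the recursion of \<open>bilinear_domination\<close> inside one triple, also at the
  truncated left end.\<close>

lemma dyadic3_mono: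
  assumes "i \<le> j"
  shows "dyadic3 i (x div 2 ^ i) \<subseteq> dyadic3 j (x div 2 ^ j)"
proof
  fix z assume z: "z \<in> dyadic3 i (x div 2 ^ i)"
  define p where "p = x div 2 ^ i"
  define q where "q = x div 2 ^ j"
  have "(2::nat) ^ j = 2 ^ i * 2 ^ (j - i)" using assms by (simp flip: power_add)
  then have qp: "q = p div 2 ^ (j - i)" and pw: "(2::nat) ^ j = 2 ^ (j - i) * 2 ^ i" by (simp_all add: p_def q_def div_mult2_eq)
  define e where "e = (2::nat) ^ (j - i)"
  have e: "1 \<le> e" by (simp add: e_def)
  have pq: "q * e \<le> p" "p < Suc q * e" unfolding qp e_def
    by (simp_all add: dividend_less_div_times div_times_less_eq_dividend)
  have "(q - 1) * e \<le> p - 1"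
  proof (cases q)
    case (Suc q')
    then have "q' * e + e \<le> p" using pq by simp
    then show ?thesis using e Suc by simp
  qed simp
  then have "(q - 1) * e * 2 ^ i \<le> (p - 1) * 2 ^ i" by (rule mult_right_mono) simp
  moreover have "(p + 2) * 2 ^ i \<le> (q + 2) * e * 2 ^ i"
  proof (rule mult_right_mono)
    have "Suc p \<le> q * e + e" using pq by simp
    then show "p + 2 \<le> (q + 2) * e" using e by (simp add: algebra_simps)
  qed simp
  moreover have "(p - 1) * 2 ^ i \<le> z" "z < (p + 2) * 2 ^ i" using z by (simp_all only: dyadic3_def p_def atLeastLessThan_iff)
  ultimately have "(q - 1) * e * 2 ^ i \<le> z \<and> z < (q + 2) * e * 2 ^ i" by linarith
  moreover have "dyadic3 j q = {(q - 1) * e * 2 ^ i..<(q + 2) * e * 2 ^ i}"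
    by (simp only: dyadic3_def pw e_def mult.assoc)
  ultimately show "z \<in> dyadic3 j (x div 2 ^ j)" unfolding q_def[symmetric] by simp
qed

section \<open>Domination of the bilinear form and strong weighted bounds\<close>

context cz_family
begin

text \<open>Induction on the level: off an exceptional set filling at most an eighth of the interval the weak type
  bounds apply, and the maximal dyadic intervals more than a quarter of which is exceptional carry the
  induction hypothesis.\<close>

lemma bilinear_domination:
  "\<exists>C>0. \<forall>i j k f g. (\<forall>x. 0 \<le> g x) \<longrightarrow> (\<exists>F G. (\<forall>x. 0 \<le> F x) \<and> (\<forall>x. 0 \<le> G x) \<and>
     interval_dominated (dyadic j k) F (\<lambda>y. \<bar>f y\<bar>) \<and> interval_dominated (dyadic j k) G g \<and>
     (\<Sum>x\<in>dyadic j k. \<bar>\<Sum>y\<in>dyadic3 j k. T i 0 x y * f y\<bar> * g x) \<le> C * (\<Sum>x\<in>dyadic j k. F x * G x))"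
proof -
  have "l2_bounded (\<lambda>_. 1) c" unfolding l2_bounded_def using T_l2 by simp
  then obtain C1 where C1: "0 < C1" and weakT: "\<And>i Y f X l. finite Y \<Longrightarrow> finite X \<Longrightarrow> 0 < l \<Longrightarrow>
    (\<forall>x\<in>X. \<exists>s \<xi>. 0 \<le> s \<and> (real \<xi> - real x)\<^sup>2 \<le> s \<and> l < \<bar>\<Sum>y\<in>Y. T i s \<xi> y * f y\<bar>) \<Longrightarrow>
    l * real (card X) \<le> C1 * (\<Sum>y\<in>Y. \<bar>f y\<bar>)"
    using weak_type_A1[OF A1_weight_one, of c] by auto
  obtain C2 where C2: "0 < C2" and weakM: "\<And>X f Y l. finite X \<Longrightarrow> finite Y \<Longrightarrow> (\<forall>y. 0 \<le> f y) \<Longrightarrow> (\<forall>y. y \<notin> Y \<longrightarrow> f y = 0) \<Longrightarrow> 0 < l \<Longrightarrow>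
    (\<forall>x\<in>X. \<exists>a b. a \<le> x \<and> x \<le> b \<and> l * real (b - a + 1) < sum f {a..b}) \<Longrightarrow>
    l * real (card X) \<le> C2 * (\<Sum>y\<in>Y. f y)"
    using maximal_weak_A1[OF A1_weight_one] by auto
  \<comment> \<open>Fixes the height \<open>l\<close> so that the two weak type bounds leave at most
    an eighth of the interval in the exceptional set \<open>E\<close>.\<close>
  define \<Lambda> where "\<Lambda> = 8 * (C1 + C2)"
  \<comment> \<open>In \<open>C3\<close>, 1 is from the operator at a good point,
    \<open>48 * c\<close> from the far input and \<open>3 * c\<close> from the triple. In
    \<open>C\<close>, 6 = 3 * 2 pays for the triple in the average of \<open>f\<close> and for the
    half of the interval that survives.\<close>
  define C3 where "C3 = 1 + 51 * c"
  define C where "C = 6 * C3 * \<Lambda>"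
  have pos: "0 < \<Lambda>" "1 \<le> C3" "0 < C" using C1 C2 c_pos by (auto simp: \<Lambda>_def C3_def C_def)
  have main: "\<exists>F G. (\<forall>x. 0 \<le> F x) \<and> (\<forall>x. 0 \<le> G x) \<and>
     interval_dominated (dyadic j k) F (\<lambda>y. \<bar>f y\<bar>) \<and> interval_dominated (dyadic j k) G g \<and>
     (\<Sum>x\<in>dyadic j k. \<bar>\<Sum>y\<in>dyadic3 j k. T i 0 x y * f y\<bar> * g x) \<le> C * (\<Sum>x\<in>dyadic j k. F x * G x)"
    if g: "\<forall>x. 0 \<le> g x" for i j k f g
  \<comment> \<open>There is no separate base case: for \<open>j = 0\<close> the bound on its size
    makes \<open>E\<close> empty, and then \<open>cz.Om\<close> is empty too.\<close>
  proof (induction j arbitrary: k rule: less_induct)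
    case (less j)
    define Q0 where "Q0 = dyadic j k"
    define Y where "Y = dyadic3 j k"
    define S where "S = (\<Sum>y\<in>Y. \<bar>f y\<bar>)"
    have Y: "finite Y" and Q0: "finite Q0" "card Q0 = 2 ^ j" by (simp_all add: Y_def Q0_def)
    have S0: "0 \<le> S" by (simp add: S_def sum_nonneg)
    show ?case
    proof (cases "S = 0")
      case True
      then have "\<And>y. y \<in> Y \<Longrightarrow> f y = 0" using Y by (simp add: S_def sum_nonneg_eq_0_iff)
      then have "(\<Sum>y\<in>Y. T i 0 x y * f y) = 0" for x by (intro sum.neutral) auto
      then show ?thesis using g
        by (intro exI[of _ "\<lambda>_. 0"]) (auto simp: interval_dominated_def Y_def[symmetric] intro!: sum_nonneg)
    next
      case False
      then have S: "0 < S" using S0 by simp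
      define l where "l = \<Lambda> * S / 2 ^ j"
      have l: "0 < l" using S pos by (simp add: l_def)
      define f0 where "f0 y = (if y \<in> Y then \<bar>f y\<bar> else 0)" for y
      define E1 where "E1 = {x\<in>Q0. \<exists>s \<xi>. 0 \<le> s \<and> (real \<xi> - real x)\<^sup>2 \<le> s \<and> l < \<bar>\<Sum>y\<in>Y. T i s \<xi> y * f y\<bar>}"
      define E2 where "E2 = {x\<in>Q0. \<exists>a b. a \<le> x \<and> x \<le> b \<and> l * real (b - a + 1) < sum f0 {a..b}}"
      define E where "E = E1 \<union> E2"
      have EQ: "E \<subseteq> Q0" and fin: "finite E" "finite E1" "finite E2" using Q0 by (auto simp: E_def E1_def E2_def)
      have "l * real (card E1) \<le> C1 * S"
        unfolding S_def by (rule weakT[where i = i, OF Y _ l]) (use fin in \<open>auto simp: E1_def\<close>)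
      moreover have "l * real (card E2) \<le> C2 * (\<Sum>y\<in>Y. f0 y)"
        by (rule weakM[OF _ Y _ _ l]) (use fin in \<open>auto simp: E2_def f0_def\<close>)
      moreover have "(\<Sum>y\<in>Y. f0 y) = S" by (simp add: f0_def S_def)
      moreover have "real (card E) \<le> real (card E1) + real (card E2)"
        unfolding E_def using card_Un_le[of E1 E2] by (simp flip: of_nat_add)
      then have "l * real (card E) \<le> l * real (card E1) + l * real (card E2)"
        using l by (simp flip: distrib_left)
      ultimately have "l * real (card E) \<le> (C1 + C2) * S" by (simp add: distrib_right)
      also have "\<dots> = l * (2 ^ j / 8)" by (simp add: l_def \<Lambda>_def)
      finally have cE: "real (card E) \<le> 2 ^ j / 8" using l by simp
      \<comment> \<open>Maximal intervals in which \<open>E\<close> has density above 1/4. They are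
        shorter than \<open>Q0\<close>, where the density is at most 1/8; their union fills at most
        half of \<open>Q0\<close>; by \<open>upper\<close> the density in each is at most 1/2, so
        each contains a point outside \<open>E\<close>.\<close>
      interpret cz: calderon_zygmund "\<lambda>y. of_bool (y \<in> E)" E "1/4"
        by standard (use fin in auto)
      let ?O = "cz.Om" and ?J = "cz.J"
      have sumE: "(\<Sum>y\<in>A. of_bool (y \<in> E)) = real (card (A \<inter> E))" if "finite A" for A
        using that by (simp add: of_bool_def sum.If_cases Int_def)
      have EO: "E \<subseteq> ?O" using cz.off by fastforce
      have cO: "real (card ?O) \<le> 2 ^ j / 2"
      proof -
        have "1/4 * sum (\<lambda>_. 1::real) ?O \<le> 1 * (\<Sum>y\<in>?O. of_bool (y \<in> E) * 1)"
          by (rule cz.weight_Om_le) (auto simp: Suc_diff_le)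
        then have "real (card ?O) \<le> 4 * real (card (?O \<inter> E))" using sumE[OF cz.finite_Om] by simp
        also have "real (card (?O \<inter> E)) \<le> real (card E)" using fin by (simp add: card_mono)
        finally show ?thesis using cE by simp
      qed
      have Jj: "?J y < j" if "y \<in> ?O" for y
      proof (rule ccontr)
        assume "\<not> ?J y < j"
        then have "(2::real) ^ j \<le> 2 ^ ?J y" by (intro power_increasing) auto
        moreover have "1/4 * 2 ^ ?J y < real (card (cz.Q (?J y) y \<inter> E))" using cz.lower[OF that] by (simp add: sumE)
        moreover have "real (card (cz.Q (?J y) y \<inter> E)) \<le> real (card E)" using fin by (simp add: card_mono)
        moreover have "(0::real) < 2 ^ j" by simp
        ultimately show False using cE by linarith
      qed
      have QsubQ0: "cz.Q (?J y) y \<subseteq> Q0" if "y \<in> ?O" for y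
      proof -
        have "1/4 * 2 ^ ?J y < real (card (cz.Q (?J y) y \<inter> E))" using cz.lower[OF that] by (simp add: sumE)
        moreover have "(0::real) < 1/4 * 2 ^ ?J y" by simp
        ultimately have "0 < real (card (cz.Q (?J y) y \<inter> E))" by linarith
        then obtain z where z: "z \<in> cz.Q (?J y) y" "z \<in> E" by (auto simp: card_gt_0_iff)
        then have "z div 2 ^ j = k" using EQ by (auto simp: Q0_def dyadic_iff)
        show ?thesis
        proof
          fix x assume x: "x \<in> cz.Q (?J y) y"
          have "x div 2 ^ ?J y = z div 2 ^ ?J y" using x z(1) by (simp add: cz.Q_def dyadic_iff)
          then have "x div 2 ^ j = z div 2 ^ j" using dyadic_ancestor[of "?J y" j x z] Jj[OF that] by simp
          then show "x \<in> Q0" using \<open>z div 2 ^ j = k\<close> by (simp add: Q0_def dyadic_iff)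
        qed
      qed
      have OQ: "?O \<subseteq> Q0" using QsubQ0 cz.Q_refl by blast
      define P3 where "P3 x = dyadic3 (?J x) (x div 2 ^ ?J x)" for x
      have P3Y: "P3 x \<subseteq> Y" if "x \<in> ?O" for x
      proof -
        have "x div 2 ^ j = k" using OQ that by (auto simp: Q0_def dyadic_iff)
        then show ?thesis using dyadic3_mono[of "?J x" j x] Jj[OF that] by (simp add: P3_def Y_def)
      qed
      have notE: "\<bar>\<Sum>y\<in>Y. T i s \<xi> y * f y\<bar> \<le> l" "sum f0 {a..b} \<le> l * real (b - a + 1)"
        if "x \<in> Q0" "x \<notin> E" "0 \<le> s" "(real \<xi> - real x)\<^sup>2 \<le> s" "a \<le> x" "x \<le> b" for x s \<xi> a b
        using that by (force simp: E_def E1_def E2_def not_less)+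
      \<comment> \<open>The input outside the triple is compared with what a point \<open>x0\<close>
        of the same maximal interval outside \<open>E\<close> sees. Time is shifted by the squared
        side; at the shifted time the whole input gives at most \<open>l\<close>, since
        \<open>x\<close> is in the parabolic region over \<open>x0\<close>; the triple is then
        subtracted by the size bound.\<close>
      have local: "\<bar>\<Sum>y\<in>Y - P3 x. T i 0 x y * f y\<bar> \<le> C3 * l" if x: "x \<in> ?O" for x
      proof -
        have "\<not> cz.Q (?J x) x \<subseteq> E"
        proof
          assume "cz.Q (?J x) x \<subseteq> E"
          then have "cz.Q (?J x) x \<inter> E = cz.Q (?J x) x" by blast
          then have "(2::real) ^ ?J x \<le> 2 * (1/4) * 2 ^ ?J x" using cz.upper[OF x] by (simp add: sumE)
          then show False by simp
        qed
        then obtain x0 where x0: "x0 \<in> cz.Q (?J x) x" "x0 \<notin> E" by blast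
        have x0Q: "x0 \<in> Q0" using QsubQ0[OF x] x0 by blast
        define m where "m = ?J x"
        have same: "x0 div 2 ^ m = x div 2 ^ m" using x0(1) by (simp add: cz.Q_def dyadic_iff m_def)
        define s where "s = (4::real) ^ m"
        have s: "0 < s" by (simp add: s_def)
        have dist: "(real x - real x0)\<^sup>2 \<le> s"
        proof -
          define k0 where "k0 = x div 2 ^ m"
          have "x \<in> dyadic m k0" "x0 \<in> dyadic m k0" using same by (auto simp: dyadic_iff k0_def)
          then have "x \<le> x0 + 2 ^ m" "x0 \<le> x + 2 ^ m" by (auto simp: dyadic_def)
          then have "real x \<le> real (x0 + 2 ^ m)" "real x0 \<le> real (x + 2 ^ m)" by (simp_all only: of_nat_le_iff)
          then have "\<bar>real x - real x0\<bar> \<le> 2 ^ m" by auto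
          then have "\<bar>real x - real x0\<bar>\<^sup>2 \<le> (2 ^ m)\<^sup>2" by (intro power_mono) auto
          then show ?thesis by (simp add: s_def two_power_square)
        qed
        have ss: "sqrt s = 2 ^ m" unfolding s_def two_power_square[symmetric] by simp
        have avg: "sum f0 (dyadic3 n (x div 2 ^ n)) \<le> 3 * l * 2 ^ n" if "m \<le> n" for n
        proof -
          have "x0 div 2 ^ n = x div 2 ^ n" using dyadic_ancestor[OF that same] .
          then obtain a b where ab: "dyadic3 n (x div 2 ^ n) = {a..b}" "a \<le> x0" "x0 \<le> b" "real (b - a + 1) \<le> 3 * 2 ^ n"
            using dyadic3_interval[of x0 n "x div 2 ^ n"] by (auto simp: dyadic_iff)
          have "sum f0 {a..b} \<le> l * real (b - a + 1)" using notE(2)[OF x0Q x0(2), of 0 x0 a b] ab by simp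
          also have "\<dots> \<le> l * (3 * 2 ^ n)" using ab(4) l by (intro mult_left_mono) auto
          finally show ?thesis by (simp add: ab(1))
        qed
        have P3: "P3 x = dyadic3 m (x div 2 ^ m)" by (simp add: P3_def m_def)
        have P3fin: "finite (P3 x)" by (simp add: P3)
        have i1: "\<bar>\<Sum>y\<in>Y - P3 x. (T i 0 x y - T i s x y) * f y\<bar> \<le> 48 * c * l"
        proof -
          have "\<bar>\<Sum>y\<in>Y - P3 x. (T i 0 x y - T i s x y) * f y\<bar> \<le> (\<Sum>y\<in>Y - P3 x. \<bar>(T i 0 x y - T i s x y) * f y\<bar>)"
            by (rule sum_abs)
          also have "\<dots> \<le> (\<Sum>y\<in>Y - P3 x. 2 * c * (f0 y * (2 ^ m / (4 ^ m + (real x - real y)\<^sup>2))))"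
          proof (rule sum_mono)
            fix y assume y: "y \<in> Y - P3 x"
            have "4 ^ m \<le> (real x - real y)\<^sup>2" using y dyadic3_far[of x m "x div 2 ^ m" y] by (auto simp: P3 dyadic_iff)
            then have "2 ^ m / (1 + 0 + (real x - real y)\<^sup>2) \<le> 2 ^ m / ((4 ^ m + (real x - real y)\<^sup>2) / 2)"
              by (intro frac_le) (auto intro!: add_pos_nonneg)
            also have "\<dots> = 2 * (2 ^ m / (4 ^ m + (real x - real y)\<^sup>2))" by simp
            finally have "\<bar>T i 0 x y - T i (0 + s) x y\<bar> \<le> c * (2 * (2 ^ m / (4 ^ m + (real x - real y)\<^sup>2)))"
              using T_diff_le[of 0 s i x y] s c_pos unfolding ss by (meson less_imp_le mult_left_mono order_trans order_refl)
            then have "\<bar>T i 0 x y - T i s x y\<bar> * \<bar>f y\<bar> \<le> c * (2 * (2 ^ m / (4 ^ m + (real x - real y)\<^sup>2))) * \<bar>f y\<bar>"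
              by (intro mult_right_mono) auto
            then show "\<bar>(T i 0 x y - T i s x y) * f y\<bar> \<le> 2 * c * (f0 y * (2 ^ m / (4 ^ m + (real x - real y)\<^sup>2)))"
              using y by (simp add: abs_mult f0_def mult_ac)
          qed
          also have "\<dots> = 2 * c * (\<Sum>y\<in>Y - P3 x. f0 y * (2 ^ m / (4 ^ m + (real x - real y)\<^sup>2)))" by (simp only: sum_distrib_left)
          also have "\<dots> \<le> 2 * c * (8 * (3 * l))"
            using c_pos Y avg by (intro mult_left_mono poisson_dyadic) (auto simp: f0_def)
          finally show ?thesis by simp
        qed
        have i2: "\<bar>\<Sum>y\<in>Y. T i s x y * f y\<bar> \<le> l" using notE(1)[OF x0Q x0(2), of s x x0 x0] s dist by simp
        have i3: "\<bar>\<Sum>y\<in>P3 x. T i s x y * f y\<bar> \<le> 3 * c * l"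
        proof -
          have "\<bar>\<Sum>y\<in>P3 x. T i s x y * f y\<bar> \<le> (\<Sum>y\<in>P3 x. \<bar>T i s x y * f y\<bar>)" by (rule sum_abs)
          also have "\<dots> \<le> (\<Sum>y\<in>P3 x. c / 2 ^ m * f0 y)"
          proof (rule sum_mono)
            fix y assume y: "y \<in> P3 x"
            have "sqrt s \<le> sqrt (1 + s)" by simp
            then have "c / sqrt (1 + s) \<le> c / 2 ^ m" using c_pos s unfolding ss by (intro divide_left_mono) auto
            then have "\<bar>T i s x y\<bar> \<le> c / 2 ^ m" using T_le[of s i x y] s by linarith
            then have "\<bar>T i s x y\<bar> * \<bar>f y\<bar> \<le> c / 2 ^ m * \<bar>f y\<bar>" by (intro mult_right_mono) auto
            then show "\<bar>T i s x y * f y\<bar> \<le> c / 2 ^ m * f0 y" using y P3Y[OF x] by (auto simp: abs_mult f0_def)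
          qed
          also have "\<dots> = c / 2 ^ m * sum f0 (P3 x)" by (simp only: sum_distrib_left)
          also have "\<dots> \<le> c / 2 ^ m * (3 * l * 2 ^ m)" using avg[of m] c_pos unfolding P3 by (intro mult_left_mono) auto
          finally show ?thesis by simp
        qed
        have split: "(\<Sum>y\<in>Y. T i s x y * f y) = (\<Sum>y\<in>Y - P3 x. T i s x y * f y) + (\<Sum>y\<in>P3 x. T i s x y * f y)"
          using sum.subset_diff[OF P3Y[OF x] Y] by simp
        have "(\<Sum>y\<in>Y - P3 x. T i 0 x y * f y) = (\<Sum>y\<in>Y - P3 x. (T i 0 x y - T i s x y) * f y) + (\<Sum>y\<in>Y - P3 x. T i s x y * f y)"
          by (simp add: left_diff_distrib flip: sum.distrib)
        then have "\<bar>\<Sum>y\<in>Y - P3 x. T i 0 x y * f y\<bar> \<le> 48 * c * l + l + 3 * c * l"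
          using i1 i2 i3 split by linarith
        also have "\<dots> = C3 * l" by (simp add: C3_def distrib_right)
        finally show ?thesis .
      qed
      \<comment> \<open>Packages the induction hypothesis so that one pair of functions can be
        chosen for every shorter interval; the pairs are then glued along the maximal
        intervals.\<close>
      define R where "R j' k' F G \<longleftrightarrow> (\<forall>x. 0 \<le> F x) \<and> (\<forall>x. 0 \<le> G x) \<and>
         interval_dominated (dyadic j' k') F (\<lambda>y. \<bar>f y\<bar>) \<and> interval_dominated (dyadic j' k') G g \<and>
         (\<Sum>x\<in>dyadic j' k'. \<bar>\<Sum>y\<in>dyadic3 j' k'. T i 0 x y * f y\<bar> * g x) \<le> C * (\<Sum>x\<in>dyadic j' k'. F x * G x)"
        for j' k' and F G :: "nat \<Rightarrow> real"
      have ex: "\<exists>F G. R j' k' F G" if "j' < j" for j' k' using less.IH[OF that, of k'] unfolding R_def .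
      obtain FF GG where R: "\<And>j' k'. j' < j \<Longrightarrow> R j' k' (FF j' k') (GG j' k')" using ex by metis
      note FG = R[unfolded R_def]
      define gQ where "gQ = sum g Q0"
      have gQ0: "0 \<le> gQ" using g by (simp add: gQ_def sum_nonneg)
      \<comment> \<open>Off the maximal intervals \<open>F\<close> and \<open>G\<close> are
        constants: the mass of \<open>f\<close> on the triple over three sides, and the average of
        \<open>g\<close> over the interval.\<close>
      define F where "F x = (if x \<in> ?O then FF (?J x) (x div 2 ^ ?J x) x else S / (3 * 2 ^ j))" for x
      define G where "G x = (if x \<in> ?O then GG (?J x) (x div 2 ^ ?J x) x else gQ / 2 ^ j)" for x
      have F0: "0 \<le> F x" and G0: "0 \<le> G x" for x
        using FG[OF Jj, of x] S gQ0 by (auto simp: F_def G_def)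
      have Fdom: "interval_dominated Q0 F (\<lambda>y. \<bar>f y\<bar>)" unfolding interval_dominated_def
      proof
        fix x assume x: "x \<in> Q0"
        show "\<exists>a b. a \<le> x \<and> x \<le> b \<and> F x * real (b - a + 1) \<le> (\<Sum>y=a..b. \<bar>f y\<bar>)"
        proof (cases "x \<in> ?O")
          case True
          have "x \<in> dyadic (?J x) (x div 2 ^ ?J x)" by (simp add: dyadic_iff)
          then show ?thesis using FG[OF Jj[OF True], of "x div 2 ^ ?J x"] True unfolding interval_dominated_def F_def by auto
        next
          case False
          obtain a b where ab: "Y = {a..b}" "a \<le> x" "x \<le> b" "real (b - a + 1) \<le> 3 * 2 ^ j"
            using dyadic3_interval[of x j k] x unfolding Y_def Q0_def by auto
          have "S / (3 * 2 ^ j) * real (b - a + 1) \<le> S / (3 * 2 ^ j) * (3 * 2 ^ j)"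
            using ab(4) S by (intro mult_left_mono) auto
          then have "F x * real (b - a + 1) \<le> (\<Sum>y=a..b. \<bar>f y\<bar>)" using False by (simp add: F_def S_def ab(1))
          then show ?thesis using ab by blast
        qed
      qed
      have Gdom: "interval_dominated Q0 G g" unfolding interval_dominated_def
      proof
        fix x assume x: "x \<in> Q0"
        show "\<exists>a b. a \<le> x \<and> x \<le> b \<and> G x * real (b - a + 1) \<le> sum g {a..b}"
        proof (cases "x \<in> ?O")
          case True
          have "x \<in> dyadic (?J x) (x div 2 ^ ?J x)" by (simp add: dyadic_iff)
          then show ?thesis using FG[OF Jj[OF True], of "x div 2 ^ ?J x"] True unfolding interval_dominated_def G_def by auto
        next
          case False
          define a b where "a = k * 2 ^ j" and "b = k * 2 ^ j + 2 ^ j - 1"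
          have "{p..<q} = {p..q - 1}" if "0 < q" for p q :: nat using that by auto
          from this[of "k * 2 ^ j + 2 ^ j" "k * 2 ^ j"]
          have Q0ab: "Q0 = {a..b}" by (simp add: Q0_def dyadic_def a_def b_def add.commute)
          have "b - a + 1 = 2 ^ j" by (simp add: a_def b_def)
          then have "real (b - a + 1) = 2 ^ j" by simp
          then have "G x * real (b - a + 1) \<le> sum g {a..b}" using False by (simp add: G_def gQ_def Q0ab)
          then show ?thesis using x unfolding Q0ab atLeastAtMost_iff by blast
        qed
      qed
      have part1: "(\<Sum>x\<in>Q0. C3 * l * g x) \<le> C * (\<Sum>x\<in>Q0 - ?O. F x * G x)"
      proof -
        have "card ?O + card (Q0 - ?O) = card Q0"
          using card_mono[OF Q0(1) OQ] by (simp add: card_Diff_subset[OF cz.finite_Om OQ])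
        then have "real (card ?O) + real (card (Q0 - ?O)) = 2 ^ j" unfolding Q0(2) by (metis of_nat_add of_nat_numeral of_nat_power)
        then have "2 ^ j / 2 \<le> real (card (Q0 - ?O))" using cO by linarith
        then have "C * (S / (3 * 2 ^ j) * (gQ / 2 ^ j)) * (2 ^ j / 2) \<le> C * (S / (3 * 2 ^ j) * (gQ / 2 ^ j)) * real (card (Q0 - ?O))"
          using pos S gQ0 by (intro mult_left_mono) auto
        also have "\<dots> = C * (\<Sum>x\<in>Q0 - ?O. F x * G x)"
          by (simp add: F_def G_def)
        also have "C * (S / (3 * 2 ^ j) * (gQ / 2 ^ j)) * (2 ^ j / 2) = C3 * l * gQ"
          by (simp add: C_def l_def)
        finally show ?thesis by (simp add: gQ_def sum_distrib_left)
      qed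
      define \<phi> where "\<phi> x = \<bar>\<Sum>y\<in>P3 x. T i 0 x y * f y\<bar> * g x" for x
      have part2: "(\<Sum>x\<in>?O. \<phi> x) \<le> C * (\<Sum>x\<in>?O. F x * G x)"
      proof -
        \<comment> \<open>\<open>\<pi> x\<close> names the maximal interval of \<open>x\<close>; its
          fibres in \<open>cz.Om\<close> are these intervals, and on each of them the induction
          hypothesis applies.\<close>
        define \<pi> where "\<pi> x = (?J x, x div 2 ^ ?J x)" for x
        have fibre: "{z\<in>?O. \<pi> z = \<pi> x} = dyadic (?J x) (x div 2 ^ ?J x)" if x: "x \<in> ?O" for x
        proof (intro set_eqI iffI)
          fix z assume "z \<in> {z\<in>?O. \<pi> z = \<pi> x}"
          then show "z \<in> dyadic (?J x) (x div 2 ^ ?J x)" by (auto simp: \<pi>_def dyadic_iff)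
        next
          fix z assume z: "z \<in> dyadic (?J x) (x div 2 ^ ?J x)"
          then have "z \<in> cz.Q (?J x) x" by (simp add: cz.Q_def)
          then show "z \<in> {z\<in>?O. \<pi> z = \<pi> x}" using cz.J_const[OF x, of z] z by (simp add: \<pi>_def dyadic_iff)
        qed
        have "(\<Sum>x\<in>?O. \<phi> x) = (\<Sum>p\<in>\<pi> ` ?O. \<Sum>x\<in>{x\<in>?O. \<pi> x = p}. \<phi> x)" by (rule sum.image_gen[OF cz.finite_Om])
        also have "\<dots> \<le> (\<Sum>p\<in>\<pi> ` ?O. C * (\<Sum>x\<in>{x\<in>?O. \<pi> x = p}. F x * G x))"
        proof (rule sum_mono)
          fix p assume "p \<in> \<pi> ` ?O"
          then obtain x where x: "x \<in> ?O" "p = \<pi> x" by blast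
          define j' k' where "j' = ?J x" and "k' = x div 2 ^ ?J x"
          have D: "{z\<in>?O. \<pi> z = p} = dyadic j' k'" using fibre[OF x(1)] x(2) by (simp add: j'_def k'_def)
          have z: "z \<in> ?O \<and> ?J z = j' \<and> z div 2 ^ ?J z = k'" if "z \<in> dyadic j' k'" for z
            using that unfolding D[symmetric] by (auto simp: \<pi>_def x(2) j'_def k'_def)
          have "(\<Sum>z\<in>dyadic j' k'. \<phi> z) = (\<Sum>z\<in>dyadic j' k'. \<bar>\<Sum>y\<in>dyadic3 j' k'. T i 0 z y * f y\<bar> * g z)"
          proof (intro sum.cong refl)
            fix z' assume "z' \<in> dyadic j' k'"
            from z[OF this] have "P3 z' = dyadic3 j' k'" unfolding P3_def by metis
            then show "\<phi> z' = \<bar>\<Sum>y\<in>dyadic3 j' k'. T i 0 z' y * f y\<bar> * g z'" by (simp add: \<phi>_def)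
          qed
          also have "\<dots> \<le> C * (\<Sum>z\<in>dyadic j' k'. FF j' k' z * GG j' k' z)"
            using FG[of j' k'] Jj[OF x(1)] by (simp add: j'_def)
          also have "(\<Sum>z\<in>dyadic j' k'. FF j' k' z * GG j' k' z) = (\<Sum>z\<in>dyadic j' k'. F z * G z)"
          proof (intro sum.cong refl)
            fix z' assume "z' \<in> dyadic j' k'"
            with z[OF this] have "F z' = FF j' k' z'" "G z' = GG j' k' z'" by (auto simp: F_def G_def)
            then show "FF j' k' z' * GG j' k' z' = F z' * G z'" by simp
          qed
          finally show "(\<Sum>z\<in>{z\<in>?O. \<pi> z = p}. \<phi> z) \<le> C * (\<Sum>z\<in>{z\<in>?O. \<pi> z = p}. F z * G z)" unfolding D .
        qed
        also have "\<dots> = C * (\<Sum>x\<in>?O. F x * G x)"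
          using sum.image_gen[OF cz.finite_Om, of "\<lambda>x. F x * G x" \<pi>] by (simp add: sum_distrib_left)
        finally show ?thesis .
      qed
      have "(\<Sum>x\<in>Q0. \<bar>\<Sum>y\<in>Y. T i 0 x y * f y\<bar> * g x) \<le> (\<Sum>x\<in>Q0. C3 * l * g x + (if x \<in> ?O then \<phi> x else 0))"
      proof (rule sum_mono)
        fix x assume x: "x \<in> Q0"
        show "\<bar>\<Sum>y\<in>Y. T i 0 x y * f y\<bar> * g x \<le> C3 * l * g x + (if x \<in> ?O then \<phi> x else 0)"
        proof (cases "x \<in> ?O")
          case True
          have "(\<Sum>y\<in>Y. T i 0 x y * f y) = (\<Sum>y\<in>Y - P3 x. T i 0 x y * f y) + (\<Sum>y\<in>P3 x. T i 0 x y * f y)"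
            using sum.subset_diff[OF P3Y[OF True] Y] by simp
          then have "\<bar>\<Sum>y\<in>Y. T i 0 x y * f y\<bar> \<le> C3 * l + \<bar>\<Sum>y\<in>P3 x. T i 0 x y * f y\<bar>" using local[OF True] by linarith
          then have "\<bar>\<Sum>y\<in>Y. T i 0 x y * f y\<bar> * g x \<le> (C3 * l + \<bar>\<Sum>y\<in>P3 x. T i 0 x y * f y\<bar>) * g x"
            using g by (intro mult_right_mono) auto
          then show ?thesis using True by (simp add: \<phi>_def distrib_right)
        next
          case False
          then have "x \<notin> E" using EO by blast
          then have "\<bar>\<Sum>y\<in>Y. T i 0 x y * f y\<bar> \<le> l" using notE(1)[OF x, of 0 x x x] by simp
          also have "\<dots> \<le> C3 * l" using pos l by simp
          finally show ?thesis using False g by (simp add: mult_right_mono)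
        qed
      qed
      also have "\<dots> = (\<Sum>x\<in>Q0. C3 * l * g x) + (\<Sum>x\<in>Q0 \<inter> ?O. \<phi> x)"
        using Q0 by (simp add: sum.distrib sum.inter_restrict)
      also have "Q0 \<inter> ?O = ?O" using OQ by blast
      also have "(\<Sum>x\<in>Q0. C3 * l * g x) + (\<Sum>x\<in>?O. \<phi> x) \<le> C * (\<Sum>x\<in>Q0 - ?O. F x * G x) + C * (\<Sum>x\<in>?O. F x * G x)"
        using part1 part2 by linarith
      also have "\<dots> = C * (\<Sum>x\<in>Q0. F x * G x)"
        using sum.subset_diff[OF OQ Q0(1), of "\<lambda>x. F x * G x"] by (simp add: distrib_left)
      finally show ?thesis using F0 G0 Fdom Gdom unfolding Q0_def Y_def by blast
    qed
  qed
  show ?thesis using main pos(3) by blast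
qed

text \<open>Testing against \<open>g = U powr (p - 1) * w\<close> makes the pairing equal to the sum
  \<open>N\<close> to be bounded, and the \<open>q\<close>-th power sum of \<open>g\<close> with
  weight \<open>\<sigma>\<close> is again \<open>N\<close>. Young's inequality with a small
  parameter absorbs half of \<open>N\<close>, which is a finite sum.\<close>

lemma T_lp_bounded:
  assumes p: "1 < p" and w: "Ap_weight p w"
  shows "\<exists>C>0. \<forall>i Y f n. finite Y \<longrightarrow> (\<Sum>x<n. \<bar>\<Sum>y\<in>Y. T i 0 x y * f y\<bar> powr p * w x) \<le> C * (\<Sum>y\<in>Y. \<bar>f y\<bar> powr p * w y)"
proof -
  have wpos: "\<And>k. 0 < w k" using w unfolding Ap_weight_def by blast
  define q where "q = p / (p - 1)"
  have q: "1 < q" "1 / p + 1 / q = 1" using p by (auto simp: q_def field_simps)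
  define \<sigma> where "\<sigma> k = w k powr (- 1 / (p - 1))" for k
  have spos: "0 < \<sigma> k" for k using wpos[of k] by (simp add: \<sigma>_def)
  have "Ap_weight q \<sigma>" unfolding q_def \<sigma>_def by (rule Ap_weight_dual[OF p w])
  then obtain C2 where C2: "0 < C2" "maximal_bounded q \<sigma> C2" using Ap_weight_maximal_bounded[OF q(1)] by blast
  obtain C1 where C1: "0 < C1" "maximal_bounded p w C1" using Ap_weight_maximal_bounded[OF p w] by blast
  obtain C where C: "0 < C" and bil: "\<And>i j k f g. (\<forall>x. 0 \<le> g x) \<Longrightarrow> (\<exists>F G. (\<forall>x. 0 \<le> F x) \<and> (\<forall>x. 0 \<le> G x) \<and>
     interval_dominated (dyadic j k) F (\<lambda>y. \<bar>f y\<bar>) \<and> interval_dominated (dyadic j k) G g \<and>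
     (\<Sum>x\<in>dyadic j k. \<bar>\<Sum>y\<in>dyadic3 j k. T i 0 x y * f y\<bar> * g x) \<le> C * (\<Sum>x\<in>dyadic j k. F x * G x))"
    using bilinear_domination by blast
  \<comment> \<open>Chosen so that the contribution of \<open>G\<close> is at most
    \<open>N / 2\<close>.\<close>
  define \<delta> where "\<delta> = (1 / (2 * C * C2)) powr (1 / q)"
  have \<delta>: "0 < \<delta>" "\<delta> powr q = 1 / (2 * C * C2)" using C C2 q by (auto simp: \<delta>_def powr_powr)
  define K where "K = 2 * C * \<delta> powr (- p) * C1"
  show ?thesis
  proof (intro exI[of _ K] conjI allI impI)
    show "0 < K" using C C1 \<delta> by (simp add: K_def)
    fix i and Y :: "nat set" and f :: "nat \<Rightarrow> real" and n :: nat assume Y: "finite Y"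
    \<comment> \<open>Large enough that the dyadic interval at the origin contains both
      \<open>{..<n}\<close> and \<open>Y\<close>.\<close>
    define j where "j = n + (\<Sum>y\<in>Y. y)"
    have j2: "j < 2 ^ j" by simp
    have "n \<le> j" by (simp add: j_def)
    then have nj: "n \<le> 2 ^ j" using j2 by linarith
    have Yj: "Y \<subseteq> dyadic3 j 0"
    proof
      fix y assume "y \<in> Y"
      then have "y \<le> j" using member_le_sum[of y Y "\<lambda>y. y"] Y by (simp add: j_def)
      then have "y < 2 ^ j" using j2 by linarith
      then show "y \<in> dyadic3 j 0" by (simp add: dyadic3_def)
    qed
    have D: "dyadic j 0 = {..<2 ^ j}" by (auto simp: dyadic_def)
    define f' where "f' y = (if y \<in> Y then f y else 0)" for y
    define U where "U x = \<bar>\<Sum>y\<in>Y. T i 0 x y * f y\<bar>" for x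
    have Uf': "(\<Sum>y\<in>dyadic3 j 0. T i 0 x y * f' y) = (\<Sum>y\<in>Y. T i 0 x y * f y)" for x
    proof -
      have "(\<Sum>y\<in>dyadic3 j 0. T i 0 x y * f' y) = (\<Sum>y\<in>Y. T i 0 x y * f' y)"
        using Yj by (intro sum.mono_neutral_right) (auto simp: f'_def)
      then show ?thesis by (simp add: f'_def)
    qed
    define g where "g x = (if x < 2 ^ j then U x powr (p - 1) * w x else 0)" for x
    have g0: "0 \<le> g x" for x using wpos[of x] by (simp add: g_def)
    obtain F G where FG: "\<forall>x. 0 \<le> F x" "\<forall>x. 0 \<le> G x"
      "interval_dominated (dyadic j 0) F (\<lambda>y. \<bar>f' y\<bar>)" "interval_dominated (dyadic j 0) G g"
      "(\<Sum>x\<in>dyadic j 0. \<bar>\<Sum>y\<in>dyadic3 j 0. T i 0 x y * f' y\<bar> * g x) \<le> C * (\<Sum>x\<in>dyadic j 0. F x * G x)"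
      using bil[of g j 0 f' i] g0 by blast
    define N where "N = (\<Sum>x<2 ^ j. U x powr p * w x)"
    define M where "M = (\<Sum>y\<in>Y. \<bar>f y\<bar> powr p * w y)"
    have UU: "U x * U x powr (p - 1) = U x powr p" for x
      using powr_add[of "U x" 1 "p - 1"] by (cases "U x = 0") (auto simp: U_def)
    have "N = (\<Sum>x<2 ^ j. U x * g x)"
      unfolding N_def by (intro sum.cong refl) (simp add: g_def UU flip: mult.assoc)
    also have "\<dots> \<le> C * (\<Sum>x<2 ^ j. F x * G x)" using FG(5) unfolding Uf' D U_def .
    also have "\<dots> \<le> C * (\<Sum>x<2 ^ j. \<delta> powr (- p) * (F x powr p * w x) + \<delta> powr q * (G x powr q * \<sigma> x))"
    proof (intro mult_left_mono sum_mono)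
      fix x
      define a where "a = F x / \<delta> * w x powr (1 / p)"
      define b where "b = \<delta> * G x * w x powr (- 1 / p)"
      have ab0: "0 \<le> a" "0 \<le> b" using FG(1,2) \<delta> by (auto simp: a_def b_def)
      have "w x powr (1 / p) * w x powr (- 1 / p) = 1" using wpos[of x] by (simp flip: powr_add)
      then have "F x * G x = a * b" using \<delta> by (simp add: a_def b_def)
      also have "\<dots> \<le> a powr p / p + b powr q / q" by (rule Youngs_inequality[OF p q(1,2) ab0])
      also have "\<dots> \<le> a powr p + b powr q"
      proof (rule add_mono)
        show "a powr p / p \<le> a powr p" using p divide_left_mono[of 1 p "a powr p"] by simp
        show "b powr q / q \<le> b powr q" using q divide_left_mono[of 1 q "b powr q"] by simp
      qed
      also have "a powr p = \<delta> powr (- p) * (F x powr p * w x)"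
        using FG(1) \<delta> wpos[of x] p by (simp add: a_def powr_mult powr_divide powr_powr powr_minus_divide)
      also have "b powr q = \<delta> powr q * (G x powr q * \<sigma> x)"
      proof -
        have "- 1 / p * q = - 1 / (p - 1)" using p by (simp add: q_def)
        then have "(w x powr (- 1 / p)) powr q = \<sigma> x" unfolding \<sigma>_def powr_powr by simp
        then show ?thesis using FG(2) \<delta> by (simp add: b_def powr_mult)
      qed
      finally show "F x * G x \<le> \<delta> powr (- p) * (F x powr p * w x) + \<delta> powr q * (G x powr q * \<sigma> x)" .
    qed (use C in auto)
    also have "\<dots> = C * \<delta> powr (- p) * (\<Sum>x<2 ^ j. F x powr p * w x) + C * \<delta> powr q * (\<Sum>x<2 ^ j. G x powr q * \<sigma> x)"
      by (simp add: sum.distrib sum_distrib_left distrib_left mult.assoc)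
    also have "\<dots> \<le> C * \<delta> powr (- p) * (C1 * M) + C * \<delta> powr q * (C2 * N)"
    proof (intro add_mono mult_left_mono)
      have "(\<Sum>x<2 ^ j. F x powr p * w x) \<le> C1 * (\<Sum>y. \<bar>f' y\<bar> powr p * w y)"
        using FG unfolding D by (intro maximal_boundedD[OF C1(2)] summable_finite[OF Y]) (auto simp: f'_def)
      also have "(\<Sum>y. \<bar>f' y\<bar> powr p * w y) = (\<Sum>y\<in>Y. \<bar>f' y\<bar> powr p * w y)"
        by (rule suminf_finite[OF Y]) (auto simp: f'_def)
      also have "\<dots> = M" unfolding M_def by (intro sum.cong) (auto simp: f'_def)
      finally show "(\<Sum>x<2 ^ j. F x powr p * w x) \<le> C1 * M" .
      have fin: "finite {..<2 ^ j :: nat}" by simp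
      have sm: "summable (\<lambda>y. g y powr q * \<sigma> y)" by (rule summable_finite[OF fin]) (auto simp: g_def)
      have "(\<Sum>x<2 ^ j. G x powr q * \<sigma> x) \<le> C2 * (\<Sum>y. g y powr q * \<sigma> y)"
        using FG g0 sm unfolding D by (intro maximal_boundedD[OF C2(2)]) auto
      also have "(\<Sum>y. g y powr q * \<sigma> y) = (\<Sum>y<2 ^ j. g y powr q * \<sigma> y)"
        by (rule suminf_finite[OF fin]) (auto simp: g_def)
      also have "\<dots> = N" unfolding N_def
      proof (intro sum.cong refl)
        fix y assume y: "y \<in> {..<2 ^ j :: nat}"
        have e1: "(p - 1) * q = p" using p by (simp add: q_def)
        have e2: "q + - 1 / (p - 1) = 1" using p by (simp add: q_def flip: diff_divide_distrib)
        have "g y powr q * \<sigma> y = U y powr ((p - 1) * q) * (w y powr q * w y powr (- 1 / (p - 1)))"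
          using y wpos[of y] by (simp add: g_def powr_mult powr_powr \<sigma>_def)
        also have "w y powr q * w y powr (- 1 / (p - 1)) = w y powr 1" unfolding powr_add[symmetric] e2 ..
        also have "w y powr 1 = w y" using wpos[of y] by simp
        finally show "g y powr q * \<sigma> y = U y powr p * w y" by (simp only: e1)
      qed
      finally show "(\<Sum>x<2 ^ j. G x powr q * \<sigma> x) \<le> C2 * N" .
    qed (use C in auto)
    also have "C * \<delta> powr q * (C2 * N) = N / 2" using C C2 by (simp add: \<delta>)
    finally have "N \<le> K * M" by (simp add: K_def)
    moreover have "(\<Sum>x<n. U x powr p * w x) \<le> N" unfolding N_def using nj wpos by (intro sum_mono2) (auto simp: less_imp_le)
    ultimately show "(\<Sum>x<n. \<bar>\<Sum>y\<in>Y. T i 0 x y * f y\<bar> powr p * w x) \<le> K * (\<Sum>y\<in>Y. \<bar>f y\<bar> powr p * w y)"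
      by (simp add: U_def M_def)
  qed
qed

end

text \<open>The largest of the four summands is at least a quarter of \<open>v\<close>.\<close>

lemma four_powr_sum_le:
  fixes A :: "nat \<Rightarrow> real"
  assumes "0 < p" "\<And>i. 0 \<le> A i" "0 \<le> v" "v \<le> (\<Sum>i<4. A i)"
  shows "v powr p \<le> 4 powr p * (\<Sum>i<4. A i powr p)"
proof -
  define m where "m = Max (A ` {..<4})"
  have "{..<4::nat} \<noteq> {}" by (metis lessThan_iff empty_iff zero_less_numeral)
  then have "Max (A ` {..<4}) \<in> A ` {..<4}" by (intro Max_in) auto
  then obtain j where j: "j < 4" "m = A j" unfolding m_def by auto
  have "A i \<le> m" if "i < 4" for i unfolding m_def using that by (intro Max_ge) auto
  then have "(\<Sum>i<4. A i) \<le> (\<Sum>i<(4::nat). m)" by (intro sum_mono) auto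
  then have "v \<le> 4 * A j" using assms(4) j by simp
  then have "v powr p \<le> (4 * A j) powr p" using assms by (intro powr_mono2) auto
  also have "\<dots> = 4 powr p * A j powr p" using assms(2) by (simp add: powr_mult)
  also have "A j powr p \<le> (\<Sum>i<4. A i powr p)" using j by (intro member_le_sum) auto
  finally show ?thesis by simp
qed

section \<open>The linearized maximal operator on finitely supported functions\<close>

locale heat_transform = heat_differences +
  fixes L :: real
  assumes D_l2: "\<And>N1 N2 Y f n. finite Y \<Longrightarrow> (\<Sum>l<n. (\<Sum>y\<in>Y. D N1 N2 0 l y * f y)\<^sup>2) \<le> L * (\<Sum>y\<in>Y. (f y)\<^sup>2)"
    and L_pos: "0 < L"
begin

definition c where "c = A + 16 * A * B + L"

lemma c_ge: "A \<le> c" "2 * A * B \<le> c" "16 * A * B \<le> c" "L \<le> c"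
  using A_pos B_pos L_pos mult_pos_pos[OF A_pos B_pos] by (auto simp: c_def)

text \<open>The index is the pair of summation limits, so the Calderon-Zygmund bounds are uniform
  over all partial sums.\<close>

sublocale cz_family "\<kappa> 0" "\<lambda>N. D (fst N) (snd N)" c
proof
  show "0 < c" using c_ge(1) A_pos by linarith
  fix s n m assume s: "0 \<le> (s::real)"
  have "\<bar>\<kappa> 0 s n m\<bar> \<le> A * (sqrt (1 + s) / (1 + s + (real n - real m)\<^sup>2))" using bound[of 0 s n m] s by simp
  also have "\<dots> \<le> c * (sqrt (1 + s) / (1 + s + (real n - real m)\<^sup>2))" using c_ge s by (intro mult_right_mono) auto
  finally show "\<bar>\<kappa> 0 s n m\<bar> \<le> c * (sqrt (1 + s) / (1 + s + (real n - real m)\<^sup>2))" .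
next
  fix i :: "int \<times> int" and s n m assume s: "0 \<le> (s::real)"
  have "2 * A * B / sqrt (1 + s) \<le> c / sqrt (1 + s)" using c_ge s by (intro divide_right_mono) auto
  then show "\<bar>D (fst i) (snd i) s n m\<bar> \<le> c / sqrt (1 + s)" using D_le[OF s, of "fst i" "snd i" n m] by linarith
next
  fix i :: "int \<times> int" and s r n m assume s: "0 \<le> (s::real)" and r: "0 < (r::real)"
  have "\<bar>D (fst i) (snd i) s n m - D (fst i) (snd i) (s + r) n m\<bar> \<le> 16 * A * B * (sqrt r / (1 + s + (real n - real m)\<^sup>2))"
    using D_shift_le[OF s order_refl r, of "fst i" "snd i" n m] a_pos by (simp add: less_imp_le)
  also have "\<dots> \<le> c * (sqrt r / (1 + s + (real n - real m)\<^sup>2))" using c_ge s r by (intro mult_right_mono) auto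
  finally show "\<bar>D (fst i) (snd i) s n m - D (fst i) (snd i) (s + r) n m\<bar> \<le> c * (sqrt r / (1 + s + (real n - real m)\<^sup>2))" .
next
  fix i :: "int \<times> int" and Y f n assume Y: "finite (Y::nat set)"
  have "(\<Sum>l<n. (\<Sum>y\<in>Y. D (fst i) (snd i) 0 l y * f y)\<^sup>2) \<le> L * (\<Sum>y\<in>Y. (f y)\<^sup>2)" by (rule D_l2[OF Y])
  also have "\<dots> \<le> c * (\<Sum>y\<in>Y. (f y)\<^sup>2)" using c_ge by (intro mult_right_mono sum_nonneg) auto
  finally show "(\<Sum>l<n. (\<Sum>y\<in>Y. D (fst i) (snd i) 0 l y * f y)\<^sup>2) \<le> c * (\<Sum>y\<in>Y. (f y)\<^sup>2)" .
qed (use sym D_sym D_semigroup in auto)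

text \<open>A window \<open>{N1..N2}\<close> is the difference of two tails ending at a common
  \<open>R\<close>, and \<open>D_tail_le\<close> compares each tail with the operator over
  \<open>{- R..R}\<close> at time \<open>a N1\<close> or \<open>a (N2 + 1)\<close>. That operator
  can be the same for all \<open>x\<close>; only the times vary.\<close>

lemma D_poisson:
  fixes Y :: "nat set"
  assumes N: "- R \<le> N1" "N1 \<le> N2" "N2 \<le> R" and Y: "finite Y"
  shows "\<bar>\<Sum>y\<in>Y. D N1 N2 0 x y * f y\<bar> \<le>
     \<bar>\<Sum>y\<in>Y. D (- R) R (a N1) x y * f y\<bar> + \<bar>\<Sum>y\<in>Y. D (- R) R (a (N2 + 1)) x y * f y\<bar> +
     17 * A * B * (\<Sum>y\<in>Y. \<bar>f y\<bar> * (sqrt (1 + a N1) / (1 + a N1 + (real x - real y)\<^sup>2))) +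
     17 * A * B * (\<Sum>y\<in>Y. \<bar>f y\<bar> * (sqrt (1 + a (N2 + 1)) / (1 + a (N2 + 1) + (real x - real y)\<^sup>2)))"
proof -
  have tail: "\<bar>\<Sum>y\<in>Y. D N R 0 x y * f y\<bar> \<le> \<bar>\<Sum>y\<in>Y. D (- R) R (a N) x y * f y\<bar> +
     17 * A * B * (\<Sum>y\<in>Y. \<bar>f y\<bar> * (sqrt (1 + a N) / (1 + a N + (real x - real y)\<^sup>2)))"
    if "- R \<le> N" "N \<le> R + 1" for N
  proof -
    have "\<bar>\<Sum>y\<in>Y. (D N R 0 x y - D (- R) R (a N) x y) * f y\<bar> \<le> (\<Sum>y\<in>Y. \<bar>(D N R 0 x y - D (- R) R (a N) x y) * f y\<bar>)"
      by (rule sum_abs)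
    also have "\<dots> \<le> (\<Sum>y\<in>Y. 17 * A * B * (\<bar>f y\<bar> * (sqrt (1 + a N) / (1 + a N + (real x - real y)\<^sup>2))))"
    proof (rule sum_mono)
      fix y
      have "\<bar>D N R 0 x y - D (- R) R (a N) x y\<bar> * \<bar>f y\<bar> \<le> 17 * A * B * sqrt (1 + a N) / (1 + a N + (real x - real y)\<^sup>2) * \<bar>f y\<bar>"
        by (intro mult_right_mono D_tail_le that) auto
      then show "\<bar>(D N R 0 x y - D (- R) R (a N) x y) * f y\<bar> \<le> 17 * A * B * (\<bar>f y\<bar> * (sqrt (1 + a N) / (1 + a N + (real x - real y)\<^sup>2)))"
        by (simp add: abs_mult mult_ac)
    qed
    also have "\<dots> = 17 * A * B * (\<Sum>y\<in>Y. \<bar>f y\<bar> * (sqrt (1 + a N) / (1 + a N + (real x - real y)\<^sup>2)))"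
      by (simp only: sum_distrib_left)
    finally show ?thesis by (simp add: left_diff_distrib sum_subtractf)
  qed
  have "D N1 N2 0 x y = D N1 R 0 x y - D (N2 + 1) R 0 x y" for y
  proof -
    have "{N1..R} = {N1..N2} \<union> {N2 + 1..R}" "{N1..N2} \<inter> {N2 + 1..R} = {}" using N by auto
    then show ?thesis unfolding D_def by (simp add: sum.union_disjoint)
  qed
  then have "(\<Sum>y\<in>Y. D N1 N2 0 x y * f y) = (\<Sum>y\<in>Y. D N1 R 0 x y * f y) - (\<Sum>y\<in>Y. D (N2 + 1) R 0 x y * f y)"
    by (simp add: left_diff_distrib sum_subtractf)
  then show ?thesis using tail[of N1] tail[of "N2 + 1"] N by linarith
qed

text \<open>The limits are arbitrary functions of the point, which is the linearized supremum.
  \<open>V\<close> is the absolute value of the semigroup applied to a function of absolute value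
  \<open>U\<close>, hence below a multiple of the maximal function of \<open>U\<close>, and
  \<open>U\<close> is controlled by \<open>T_lp_bounded\<close>; \<open>P\<close> is below a
  multiple of the maximal function of \<open>f\<close>.\<close>

lemma D_lp:
  assumes p: "1 < p" and w: "Ap_weight p w"
  shows "\<exists>C>0. \<forall>X Y f N1 N2. finite X \<longrightarrow> finite Y \<longrightarrow> (\<forall>x\<in>X. N1 x \<le> N2 x) \<longrightarrow>
    (\<Sum>x\<in>X. \<bar>\<Sum>y\<in>Y. D (N1 x) (N2 x) 0 x y * f y\<bar> powr p * w x) \<le> C * (\<Sum>y\<in>Y. \<bar>f y\<bar> powr p * w y)"
proof -
  have wpos: "\<And>k. 0 < w k" using w unfolding Ap_weight_def by blast
  obtain C1 where C1: "0 < C1" "maximal_bounded p w C1" using Ap_weight_maximal_bounded[OF p w] by blast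
  obtain C2 where C2: "0 < C2" and lp: "\<And>i Y f n. finite Y \<Longrightarrow>
    (\<Sum>x<n. \<bar>\<Sum>y\<in>Y. D (fst i) (snd i) 0 x y * f y\<bar> powr p * w x) \<le> C2 * (\<Sum>y\<in>Y. \<bar>f y\<bar> powr p * w y)"
    using T_lp_bounded[OF p w] by blast
  define k1 where "k1 = 288 * c"
  define k2 where "k2 = 48 * (17 * A * B)"
  have k: "0 < k1" "0 < k2" using c_pos A_pos B_pos by (auto simp: k1_def k2_def)
  define C where "C = 4 powr p * (2 * (k1 powr p * (C1 * C2)) + 2 * (k2 powr p * C1))"
  have Cpos: "0 < C" unfolding C_def using k C1 C2 by (intro mult_pos_pos add_pos_pos) auto
  show ?thesis
  proof (intro exI[of _ C] conjI allI impI Cpos)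
    fix X Y :: "nat set" and f :: "nat \<Rightarrow> real" and N1 N2 :: "nat \<Rightarrow> int"
    assume X: "finite X" and Y: "finite Y" and N: "\<forall>x\<in>X. N1 x \<le> N2 x"
    \<comment> \<open>One window that contains all those chosen at the finitely many points of
      \<open>X\<close>; the constants do not depend on it.\<close>
    define R where "R = (\<Sum>x\<in>X. \<bar>N1 x\<bar> + \<bar>N2 x\<bar>)"
    have R: "- R \<le> N1 x" "N2 x \<le> R" if "x \<in> X" for x
      using member_le_sum[of x X "\<lambda>x. \<bar>N1 x\<bar> + \<bar>N2 x\<bar>"] X that by (auto simp: R_def)
    define M where "M = (\<Sum>y\<in>Y. \<bar>f y\<bar> powr p * w y)"
    define f' where "f' y = (if y \<in> Y then \<bar>f y\<bar> else 0)" for y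
    have f'0: "0 \<le> f' y" for y by (simp add: f'_def)
    have f'M: "(\<Sum>y. f' y powr p * w y) = M" "summable (\<lambda>y. f' y powr p * w y)"
    proof -
      have "(\<Sum>y. f' y powr p * w y) = (\<Sum>y\<in>Y. f' y powr p * w y)" by (rule suminf_finite[OF Y]) (auto simp: f'_def)
      also have "\<dots> = M" by (simp add: M_def f'_def)
      finally show "(\<Sum>y. f' y powr p * w y) = M" .
      show "summable (\<lambda>y. f' y powr p * w y)" by (rule summable_finite[OF Y]) (auto simp: f'_def)
    qed
    define U where "U x = \<bar>\<Sum>y\<in>Y. D (- R) R 0 x y * f y\<bar>" for x
    have Up: "(\<Sum>x<n. U x powr p * w x) \<le> C2 * M" for n
      using lp[OF Y, where n = n and i = "(- R, R)" and f = f] by (simp add: U_def M_def)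
    have Usm: "summable (\<lambda>x. U x powr p * w x)"
      using Up wpos by (intro summableI_nonneg_bounded[where x = "C2 * M"]) (auto simp: less_imp_le)
    have UM: "(\<Sum>x. U x powr p * w x) \<le> C2 * M" using Up Usm by (intro suminf_le_const) auto
    define V where "V N x = \<bar>\<Sum>y\<in>Y. D (- R) R (a (N x)) x y * f y\<bar>" for N :: "nat \<Rightarrow> int" and x
    define P where "P N x = (\<Sum>y\<in>Y. \<bar>f y\<bar> * (sqrt (1 + a (N x)) / (1 + a (N x) + (real x - real y)\<^sup>2)))" for N :: "nat \<Rightarrow> int" and x
    have P0: "0 \<le> P N x" for N x unfolding P_def using a_pos[of "N x"] by (intro sum_nonneg) auto
    have VM: "(\<Sum>x\<in>X. V N x powr p * w x) \<le> k1 powr p * (C1 * C2) * M" for N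
    proof -
      have "(\<Sum>x\<in>X. (V N x / k1) powr p * w x) \<le> C1 * (\<Sum>x. U x powr p * w x)"
      proof (rule maximal_boundedD[OF C1(2) X])
        show "interval_dominated X (\<lambda>x. V N x / k1) U" unfolding interval_dominated_def
        proof
          fix x assume "x \<in> X"
          have s: "0 \<le> a (N x)" using a_pos by (simp add: less_imp_le)
          have "(\<lambda>l. \<Sum>y\<in>Y. \<kappa> 0 (a (N x)) x l * D (- R) R 0 l y * f y) sums (\<Sum>y\<in>Y. D (- R) R (a (N x) + 0) x y * f y)"
            using s by (intro sums_sum sums_mult2 D_semigroup) auto
          then have su: "(\<lambda>l. \<kappa> 0 (a (N x)) x l * (\<Sum>y\<in>Y. D (- R) R 0 l y * f y)) sums (\<Sum>y\<in>Y. D (- R) R (a (N x)) x y * f y)"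
            by (simp add: sum_distrib_left mult.assoc)
          have bd: "\<bar>\<Sum>y\<in>Y. D (- R) R 0 l y * f y\<bar> \<le> (\<Sum>y\<in>Y. c * \<bar>f y\<bar>)" for l
            using T_bounded[of 0 "(- R, R)"] by (intro order_trans[OF sum_abs] sum_mono) (auto simp: abs_mult intro!: mult_right_mono)
          have "(real x - real x)\<^sup>2 \<le> a (N x)" using s by simp
          from nontangential_interval[OF s this bd su]
          obtain a b where ab: "a \<le> x" "x \<le> b" "V N x * real (b - a + 1) \<le> k1 * sum U {a..b}"
            unfolding V_def U_def k1_def by blast
          then have "V N x / k1 * real (b - a + 1) \<le> sum U {a..b}" using k by (simp add: pos_divide_le_eq mult_ac)
          then show "\<exists>a b. a \<le> x \<and> x \<le> b \<and> V N x / k1 * real (b - a + 1) \<le> sum U {a..b}" using ab by blast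
        qed
      qed (use Usm k in \<open>auto simp: U_def V_def\<close>)
      also have "\<dots> \<le> C1 * (C2 * M)" using UM C1 by simp
      also have "(\<Sum>x\<in>X. (V N x / k1) powr p * w x) = (\<Sum>x\<in>X. V N x powr p * w x) / k1 powr p"
        using k by (simp add: powr_divide V_def sum_divide_distrib)
      finally show ?thesis using k by (simp add: pos_divide_le_eq mult_ac)
    qed
    have PM: "(\<Sum>x\<in>X. (17 * A * B * P N x) powr p * w x) \<le> k2 powr p * C1 * M" for N
    proof -
      have "(\<Sum>x\<in>X. (P N x / 48) powr p * w x) \<le> C1 * (\<Sum>x. f' x powr p * w x)"
      proof (rule maximal_boundedD[OF C1(2) X])
        show "interval_dominated X (\<lambda>x. P N x / 48) f'" unfolding interval_dominated_def
        proof
          fix x assume "x \<in> X"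
          have e: "P N x = (\<Sum>y\<in>Y. f' y * (sqrt (1 + a (N x)) / (1 + a (N x) + (real x - real y)\<^sup>2)))"
            by (simp add: P_def f'_def)
          have "1 \<le> 1 + a (N x)" using a_pos[of "N x"] by simp
          then obtain a b where ab: "a \<le> x" "x \<le> b" "P N x * real (b - a + 1) \<le> 48 * sum f' {a..b}"
            using poisson_interval[where f = f' and x = x, OF f'0 Y] unfolding e by blast
          from ab(3) have "P N x / 48 * real (b - a + 1) \<le> sum f' {a..b}" by simp
          with ab(1,2) show "\<exists>a b. a \<le> x \<and> x \<le> b \<and> P N x / 48 * real (b - a + 1) \<le> sum f' {a..b}"
            by blast
        qed
      qed (use f'M P0 in \<open>auto simp: f'_def\<close>)
      then have "(\<Sum>x\<in>X. (P N x / 48) powr p * w x) \<le> C1 * M" using f'M by simp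
      moreover have "(17 * A * B * P N x) powr p = k2 powr p * (P N x / 48) powr p" for x
      proof -
        have "17 * A * B * P N x = k2 * (P N x / 48)" by (simp add: k2_def)
        then show ?thesis using k P0[of N x] by (simp only: powr_mult)
      qed
      ultimately show ?thesis using k by (simp add: mult.assoc flip: sum_distrib_left)
    qed
    define Z where "Z x i = (if i = 0 then V N1 x else if i = 1 then V (\<lambda>x. N2 x + 1) x else
       if i = 2 then 17 * A * B * P N1 x else 17 * A * B * P (\<lambda>x. N2 x + 1) x)" for x and i :: nat
    have four: "(\<Sum>i<4. h i) = h 0 + h 1 + h 2 + h (3::nat)" for h :: "nat \<Rightarrow> real" by (simp add: eval_nat_numeral)
    have "(\<Sum>x\<in>X. \<bar>\<Sum>y\<in>Y. D (N1 x) (N2 x) 0 x y * f y\<bar> powr p * w x) \<le> (\<Sum>x\<in>X. 4 powr p * (\<Sum>i<4. Z x i powr p) * w x)"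
    proof (intro sum_mono mult_right_mono)
      fix x assume x: "x \<in> X"
      show "\<bar>\<Sum>y\<in>Y. D (N1 x) (N2 x) 0 x y * f y\<bar> powr p \<le> 4 powr p * (\<Sum>i<4. Z x i powr p)"
      proof (rule four_powr_sum_le)
        show "\<bar>\<Sum>y\<in>Y. D (N1 x) (N2 x) 0 x y * f y\<bar> \<le> (\<Sum>i<4. Z x i)"
          using D_poisson[of R "N1 x" "N2 x" Y x f] R[OF x] N x Y unfolding four by (simp add: Z_def V_def P_def)
        show "0 \<le> Z x i" for i using P0 A_pos B_pos by (simp add: Z_def V_def)
      qed (use p in auto)
    qed (use wpos in \<open>simp add: less_imp_le\<close>)
    also have "\<dots> = 4 powr p * ((\<Sum>x\<in>X. Z x 0 powr p * w x) + (\<Sum>x\<in>X. Z x 1 powr p * w x) + (\<Sum>x\<in>X. Z x 2 powr p * w x) + (\<Sum>x\<in>X. Z x 3 powr p * w x))"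
      unfolding four by (simp only: sum_distrib_left sum.distrib distrib_right distrib_left mult.assoc)
    also have "\<dots> \<le> 4 powr p * (k1 powr p * (C1 * C2) * M + k1 powr p * (C1 * C2) * M + k2 powr p * C1 * M + k2 powr p * C1 * M)"
      using VM PM by (intro mult_left_mono add_mono) (auto simp: Z_def)
    also have "\<dots> = C * M" by (simp add: C_def algebra_simps)
    finally show "(\<Sum>x\<in>X. \<bar>\<Sum>y\<in>Y. D (N1 x) (N2 x) 0 x y * f y\<bar> powr p * w x) \<le> C * (\<Sum>y\<in>Y. \<bar>f y\<bar> powr p * w y)"
      by (simp add: M_def)
  qed
qed

text \<open>The four terms of \<open>D_poisson\<close> share the level as \<open>l / 4\<close>. The
  weighted l^2 bound that \<open>weak_type_A1\<close> asks for is the strong bound at exponent 2, as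
  A_1 weights are A_2; the admissible pair there is \<open>s = a (N x)\<close> and
  \<open>\<xi> = x\<close>.\<close>

lemma D_weak:
  assumes w: "A1_weight w"
  shows "\<exists>C>0. \<forall>X Y f N1 N2 l. finite X \<longrightarrow> finite Y \<longrightarrow> 0 < l \<longrightarrow>
    (\<forall>x\<in>X. N1 x \<le> N2 x \<and> l < \<bar>\<Sum>y\<in>Y. D (N1 x) (N2 x) 0 x y * f y\<bar>) \<longrightarrow>
    l * sum w X \<le> C * (\<Sum>y\<in>Y. \<bar>f y\<bar> * w y)"
proof -
  have wpos: "\<And>k. 0 < w k" using w unfolding A1_weight_def by blast
  obtain K where K: "0 < K" and lp: "\<And>i Y f n. finite Y \<Longrightarrow>
    (\<Sum>x<n. \<bar>\<Sum>y\<in>Y. D (fst i) (snd i) 0 x y * f y\<bar> powr 2 * w x) \<le> K * (\<Sum>y\<in>Y. \<bar>f y\<bar> powr 2 * w y)"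
    using T_lp_bounded[OF _ A1_weight_imp_A2[OF w]] by auto
  have "l2_bounded w K" unfolding l2_bounded_def using lp by simp
  then obtain C1 where C1: "0 < C1" and wk: "\<And>i Y f X l. finite Y \<Longrightarrow> finite X \<Longrightarrow> 0 < l \<Longrightarrow>
    (\<forall>x\<in>X. \<exists>s \<xi>. 0 \<le> s \<and> (real \<xi> - real x)\<^sup>2 \<le> s \<and> l < \<bar>\<Sum>y\<in>Y. D (fst i) (snd i) s \<xi> y * f y\<bar>) \<Longrightarrow>
    l * sum w X \<le> C1 * (\<Sum>y\<in>Y. \<bar>f y\<bar> * w y)"
    using weak_type_A1[OF w] by blast
  obtain C2 where C2: "0 < C2" and mk: "\<And>X f Y l. finite X \<Longrightarrow> finite Y \<Longrightarrow> (\<forall>y. 0 \<le> f y) \<Longrightarrow> (\<forall>y. y \<notin> Y \<longrightarrow> f y = 0) \<Longrightarrow> 0 < l \<Longrightarrow>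
    (\<forall>x\<in>X. \<exists>a b. a \<le> x \<and> x \<le> b \<and> l * real (b - a + 1) < sum f {a..b}) \<Longrightarrow>
    l * sum w X \<le> C2 * (\<Sum>y\<in>Y. f y * w y)"
    using maximal_weak_A1[OF w] by blast
  define k2 where "k2 = 48 * (17 * A * B) * 4"
  have k2: "0 < k2" using A_pos B_pos by (simp add: k2_def)
  show ?thesis
  proof (intro exI[of _ "8 * C1 + 2 * (k2 * C2)"] conjI allI impI)
    show "0 < 8 * C1 + 2 * (k2 * C2)" using C1 C2 k2 by (simp add: add_pos_pos)
    fix X Y :: "nat set" and f :: "nat \<Rightarrow> real" and N1 N2 :: "nat \<Rightarrow> int" and l :: real
    assume X: "finite X" and Y: "finite Y" and l: "0 < l"
      and h: "\<forall>x\<in>X. N1 x \<le> N2 x \<and> l < \<bar>\<Sum>y\<in>Y. D (N1 x) (N2 x) 0 x y * f y\<bar>"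
    define R where "R = (\<Sum>x\<in>X. \<bar>N1 x\<bar> + \<bar>N2 x\<bar>)"
    have R: "- R \<le> N1 x" "N2 x \<le> R" if "x \<in> X" for x
      using member_le_sum[of x X "\<lambda>x. \<bar>N1 x\<bar> + \<bar>N2 x\<bar>"] X that by (auto simp: R_def)
    define M where "M = (\<Sum>y\<in>Y. \<bar>f y\<bar> * w y)"
    define f' where "f' y = (if y \<in> Y then \<bar>f y\<bar> else 0)" for y
    have f'0: "0 \<le> f' y" for y by (simp add: f'_def)
    define V where "V N x = \<bar>\<Sum>y\<in>Y. D (- R) R (a (N x)) x y * f y\<bar>" for N :: "nat \<Rightarrow> int" and x
    define P where "P N x = (\<Sum>y\<in>Y. \<bar>f y\<bar> * (sqrt (1 + a (N x)) / (1 + a (N x) + (real x - real y)\<^sup>2)))" for N :: "nat \<Rightarrow> int" and x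
    define XV where "XV N = {x\<in>X. l / 4 < V N x}" for N
    define XP where "XP N = {x\<in>X. l / 4 < 17 * A * B * P N x}" for N
    have fin: "finite (XV N)" "finite (XP N)" for N using X by (auto simp: XV_def XP_def)
    have V: "l * sum w (XV N) \<le> 4 * C1 * M" for N
    proof -
      have "l / 4 * sum w (XV N) \<le> C1 * M" unfolding M_def
      proof (rule wk[where i = "(- R, R)"])
        show "\<forall>x\<in>XV N. \<exists>s \<xi>. 0 \<le> s \<and> (real \<xi> - real x)\<^sup>2 \<le> s \<and> l / 4 < \<bar>\<Sum>y\<in>Y. D (fst (- R, R)) (snd (- R, R)) s \<xi> y * f y\<bar>"
        proof
          fix x assume "x \<in> XV N"
          then show "\<exists>s \<xi>. 0 \<le> s \<and> (real \<xi> - real x)\<^sup>2 \<le> s \<and> l / 4 < \<bar>\<Sum>y\<in>Y. D (fst (- R, R)) (snd (- R, R)) s \<xi> y * f y\<bar>"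
            using a_pos[of "N x"] by (intro exI[of _ "a (N x)"] exI[of _ x]) (auto simp: XV_def V_def)
        qed
      qed (use fin Y l in auto)
      then show ?thesis by simp
    qed
    have P: "l * sum w (XP N) \<le> k2 * C2 * M" for N
    proof -
      have "l / k2 * sum w (XP N) \<le> C2 * (\<Sum>y\<in>Y. f' y * w y)"
      proof (rule mk)
        show "\<forall>x\<in>XP N. \<exists>a b. a \<le> x \<and> x \<le> b \<and> l / k2 * real (b - a + 1) < sum f' {a..b}"
        proof
          fix x assume x: "x \<in> XP N"
          have e: "P N x = (\<Sum>y\<in>Y. f' y * (sqrt (1 + a (N x)) / (1 + a (N x) + (real x - real y)\<^sup>2)))"
            by (simp add: P_def f'_def)
          have "1 \<le> 1 + a (N x)" using a_pos[of "N x"] by simp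
          then obtain a b where ab: "a \<le> x" "x \<le> b" "P N x * real (b - a + 1) \<le> 48 * sum f' {a..b}"
            using poisson_interval[where f = f' and x = x, OF f'0 Y] unfolding e by blast
          have "l / k2 < P N x / 48" using x k2 unfolding XP_def k2_def by (simp add: field_simps)
          then have "l / k2 * real (b - a + 1) < P N x / 48 * real (b - a + 1)" by (intro mult_strict_right_mono) auto
          then have "l / k2 * real (b - a + 1) < sum f' {a..b}" using ab(3) by linarith
          then show "\<exists>a b. a \<le> x \<and> x \<le> b \<and> l / k2 * real (b - a + 1) < sum f' {a..b}" using ab by blast
        qed
      qed (use fin Y l k2 in \<open>auto simp: f'_def\<close>)
      also have "(\<Sum>y\<in>Y. f' y * w y) = M" by (simp add: M_def f'_def)
      finally show ?thesis using k2 by (simp add: pos_divide_le_eq mult_ac)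
    qed
    have cover: "X \<subseteq> XV N1 \<union> XV (\<lambda>x. N2 x + 1) \<union> XP N1 \<union> XP (\<lambda>x. N2 x + 1)"
    proof
      fix x assume x: "x \<in> X"
      have "l < V N1 x + V (\<lambda>x. N2 x + 1) x + 17 * A * B * P N1 x + 17 * A * B * P (\<lambda>x. N2 x + 1) x"
        using D_poisson[of R "N1 x" "N2 x" Y x f] R[OF x] h x Y by (fastforce simp: V_def P_def)
      then show "x \<in> XV N1 \<union> XV (\<lambda>x. N2 x + 1) \<union> XP N1 \<union> XP (\<lambda>x. N2 x + 1)"
        using x by (auto simp: XV_def XP_def)
    qed
    have un: "sum w (P1 \<union> P2) \<le> sum w P1 + sum w P2" if "finite P1" "finite P2" for P1 P2
      using that wpos sum_nonneg[of "P1 \<inter> P2" w] by (simp add: sum_Un less_imp_le)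
    have "sum w X \<le> sum w (XV N1 \<union> XV (\<lambda>x. N2 x + 1) \<union> XP N1 \<union> XP (\<lambda>x. N2 x + 1))"
      using cover fin wpos by (intro sum_mono2) (auto simp: less_imp_le)
    also have "\<dots> \<le> sum w (XV N1) + sum w (XV (\<lambda>x. N2 x + 1)) + sum w (XP N1) + sum w (XP (\<lambda>x. N2 x + 1))"
      using un[of "XV N1 \<union> XV (\<lambda>x. N2 x + 1) \<union> XP N1" "XP (\<lambda>x. N2 x + 1)"] un[of "XV N1 \<union> XV (\<lambda>x. N2 x + 1)" "XP N1"]
        un[of "XV N1" "XV (\<lambda>x. N2 x + 1)"] fin by simp
    finally have "l * sum w X \<le> l * (sum w (XV N1) + sum w (XV (\<lambda>x. N2 x + 1)) + sum w (XP N1) + sum w (XP (\<lambda>x. N2 x + 1)))"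
      using l by simp
    also have "\<dots> = l * sum w (XV N1) + l * sum w (XV (\<lambda>x. N2 x + 1)) + l * sum w (XP N1) + l * sum w (XP (\<lambda>x. N2 x + 1))"
      by (simp add: distrib_left)
    also have "\<dots> \<le> 4 * C1 * M + 4 * C1 * M + k2 * C2 * M + k2 * C2 * M" by (intro add_mono V P)
    also have "\<dots> = (8 * C1 + 2 * (k2 * C2)) * M" by (simp add: algebra_simps)
    finally show "l * sum w X \<le> (8 * C1 + 2 * (k2 * C2)) * (\<Sum>y\<in>Y. \<bar>f y\<bar> * w y)" by (simp add: M_def)
  qed
qed

section \<open>From finitely supported functions to weighted sequence spaces and to the
  supremum\<close>

definition transform :: "int \<Rightarrow> int \<Rightarrow> (nat \<Rightarrow> real) \<Rightarrow> nat \<Rightarrow> real" where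
  "transform N1 N2 f n = (\<Sum>j\<in>{N1..N2}. b j * ((\<Sum>m. f m * \<kappa> 0 (a (j + 1)) n m) - (\<Sum>m. f m * \<kappa> 0 (a j) n m)))"

text \<open>Guarantees absolute convergence of the series in \<open>transform\<close>, on which the
  meaning of \<open>suminf\<close> there depends.\<close>

definition poisson_summable :: "(nat \<Rightarrow> real) \<Rightarrow> bool" where
  "poisson_summable f \<longleftrightarrow> (\<forall>x j. summable (\<lambda>y. \<bar>f y\<bar> * (sqrt (1 + a j) / (1 + a j + (real x - real y)\<^sup>2))))"

lemma transform_limit:
  assumes f: "poisson_summable f"
  shows "(\<lambda>k. \<Sum>y<k. D N1 N2 0 n y * f y) \<longlonglongrightarrow> transform N1 N2 f n"
proof -
  have sm: "summable (\<lambda>m. f m * \<kappa> 0 (a j) n m)" for j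
  proof (rule summable_comparison_test')
    show "summable (\<lambda>y. A * (\<bar>f y\<bar> * (sqrt (1 + a j) / (1 + a j + (real n - real y)\<^sup>2))))"
      using f unfolding poisson_summable_def by (intro summable_mult) blast
    fix m
    have "\<bar>\<kappa> 0 (a j) n m\<bar> \<le> A * (sqrt (1 + a j) / (1 + a j + (real n - real m)\<^sup>2))" using bound[of 0 "a j" n m] a_pos[of j] by simp
    then have "\<bar>f m\<bar> * \<bar>\<kappa> 0 (a j) n m\<bar> \<le> \<bar>f m\<bar> * (A * (sqrt (1 + a j) / (1 + a j + (real n - real m)\<^sup>2)))" by (intro mult_left_mono) auto
    then show "norm (f m * \<kappa> 0 (a j) n m) \<le> A * (\<bar>f m\<bar> * (sqrt (1 + a j) / (1 + a j + (real n - real m)\<^sup>2)))"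
      by (simp add: abs_mult mult_ac)
  qed
  have "(\<lambda>k. \<Sum>j\<in>{N1..N2}. b j * ((\<Sum>m<k. f m * \<kappa> 0 (a (j + 1)) n m) - (\<Sum>m<k. f m * \<kappa> 0 (a j) n m))) \<longlonglongrightarrow> transform N1 N2 f n"
    unfolding transform_def by (intro tendsto_intros summable_LIMSEQ sm)
  moreover have "(\<Sum>j\<in>{N1..N2}. b j * ((\<Sum>m<k. f m * \<kappa> 0 (a (j + 1)) n m) - (\<Sum>m<k. f m * \<kappa> 0 (a j) n m))) = (\<Sum>y<k. D N1 N2 0 n y * f y)" for k
  proof -
    have "(\<Sum>y<k. D N1 N2 0 n y * f y) = (\<Sum>y<k. \<Sum>j\<in>{N1..N2}. b j * (f y * \<kappa> 0 (a (j + 1)) n y - f y * \<kappa> 0 (a j) n y))"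
      unfolding D_def sum_distrib_right by (simp add: algebra_simps)
    also have "\<dots> = (\<Sum>j\<in>{N1..N2}. \<Sum>y<k. b j * (f y * \<kappa> 0 (a (j + 1)) n y - f y * \<kappa> 0 (a j) n y))" by (rule sum.swap)
    finally show ?thesis by (simp add: sum_subtractf flip: sum_distrib_left)
  qed
  ultimately show ?thesis by simp
qed

text \<open>Partial Poisson sums at one point are dominated by interval averages, and the maximal
  theorem on the one-point set \<open>{x}\<close> bounds these uniformly.\<close>

lemma poisson_summable_lp:
  assumes p: "1 < p" and w: "Ap_weight p w" and f: "summable (\<lambda>y. \<bar>f y\<bar> powr p * w y)"
  shows "poisson_summable f"
  unfolding poisson_summable_def
proof (intro allI)
  fix x :: nat and j
  have wpos: "\<And>k. 0 < w k" using w unfolding Ap_weight_def by blast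
  obtain C where C: "0 < C" "maximal_bounded p w C" using Ap_weight_maximal_bounded[OF p w] by blast
  let ?P = "\<lambda>y. sqrt (1 + a j) / (1 + a j + (real x - real y)\<^sup>2)"
  define S where "S = (\<Sum>y. \<bar>f y\<bar> powr p * w y)"
  have P0: "0 \<le> ?P y" for y using a_pos[of j] by auto
  show "summable (\<lambda>y. \<bar>f y\<bar> * ?P y)"
  proof (rule summableI_nonneg_bounded)
    show "0 \<le> \<bar>f y\<bar> * ?P y" for y by (intro mult_nonneg_nonneg P0) auto
    fix n
    define s where "s = (\<Sum>y<n. \<bar>f y\<bar> * ?P y)"
    have s0: "0 \<le> s" unfolding s_def using P0 by (intro sum_nonneg mult_nonneg_nonneg) auto
    have "(\<Sum>x\<in>{x}. (s / 48) powr p * w x) \<le> C * (\<Sum>y. \<bar>f y\<bar> powr p * w y)"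
    proof (rule maximal_boundedD[OF C(2)])
      have "1 \<le> 1 + a j" using a_pos[of j] by simp
      then obtain a b where ab: "a \<le> x" "x \<le> b" "s * real (b - a + 1) \<le> 48 * (\<Sum>y=a..b. \<bar>f y\<bar>)"
        using poisson_interval[where f = "\<lambda>y. \<bar>f y\<bar>" and x = x, OF abs_ge_zero finite_lessThan] unfolding s_def by blast
      then have "s / 48 * real (b - a + 1) \<le> (\<Sum>y=a..b. \<bar>f y\<bar>)" by simp
      then show "interval_dominated {x} (\<lambda>_. s / 48) (\<lambda>y. \<bar>f y\<bar>)" using ab unfolding interval_dominated_def by blast
    qed (use f s0 in auto)
    then have "(s / 48) powr p \<le> C * S / w x" using wpos[of x] by (simp add: S_def pos_le_divide_eq)
    then have "((s / 48) powr p) powr (1 / p) \<le> (C * S / w x) powr (1 / p)" using p by (intro powr_mono2) auto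
    then show "(\<Sum>y<n. \<bar>f y\<bar> * ?P y) \<le> 48 * (C * S / w x) powr (1 / p)"
      using s0 p by (simp add: powr_powr s_def)
  qed
qed

text \<open>For an interval of length \<open>r\<close> around \<open>x\<close>, \<open>w x\<close>
  is at most its mass, which is at most \<open>K * r * w y\<close> at each of its points
  \<open>y\<close>. So an interval average of \<open>\<bar>f\<bar>\<close> times \<open>w x\<close>
  is at most \<open>K\<close> times the norm of \<open>f\<close>.\<close>

lemma poisson_summable_l1:
  assumes w: "A1_weight w" and f: "summable (\<lambda>y. \<bar>f y\<bar> * w y)"
  shows "poisson_summable f"
  unfolding poisson_summable_def
proof (intro allI)
  fix x :: nat and j
  have wpos: "\<And>k. 0 < w k" using w unfolding A1_weight_def by blast
  obtain K where K: "0 < K" "\<And>a b x. a \<le> x \<Longrightarrow> x \<le> b \<Longrightarrow> sum w {a..b} \<le> K * real (b - a + 1) * w x"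
    using A1_weight_avg[OF w] by blast
  let ?P = "\<lambda>y. sqrt (1 + a j) / (1 + a j + (real x - real y)\<^sup>2)"
  define S where "S = (\<Sum>y. \<bar>f y\<bar> * w y)"
  have P0: "0 \<le> ?P y" for y using a_pos[of j] by auto
  show "summable (\<lambda>y. \<bar>f y\<bar> * ?P y)"
  proof (rule summableI_nonneg_bounded)
    show "0 \<le> \<bar>f y\<bar> * ?P y" for y by (intro mult_nonneg_nonneg P0) auto
    fix n
    define s where "s = (\<Sum>y<n. \<bar>f y\<bar> * ?P y)"
    have s0: "0 \<le> s" unfolding s_def using P0 by (intro sum_nonneg mult_nonneg_nonneg) auto
    have "1 \<le> 1 + a j" using a_pos[of j] by simp
    then obtain a b where ab: "a \<le> x" "x \<le> b" "s * real (b - a + 1) \<le> 48 * (\<Sum>y=a..b. \<bar>f y\<bar>)"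
      using poisson_interval[where f = "\<lambda>y. \<bar>f y\<bar>" and x = x, OF abs_ge_zero finite_lessThan] unfolding s_def by blast
    define r where "r = real (b - a + 1)"
    have r: "0 < r" by (simp add: r_def)
    have "s * r * w x \<le> 48 * (\<Sum>y=a..b. \<bar>f y\<bar>) * w x" using ab(3) wpos[of x] unfolding r_def by (intro mult_right_mono) auto
    also have "\<dots> \<le> 48 * (\<Sum>y=a..b. \<bar>f y\<bar>) * sum w {a..b}"
      using ab wpos by (intro mult_left_mono member_le_sum sum_nonneg mult_nonneg_nonneg) (auto simp: less_imp_le)
    also have "\<dots> = 48 * (\<Sum>y=a..b. \<bar>f y\<bar> * sum w {a..b})" by (simp add: sum_distrib_right)
    also have "\<dots> \<le> 48 * (\<Sum>y=a..b. \<bar>f y\<bar> * (K * r * w y))"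
      using K(2) unfolding r_def by (intro mult_left_mono sum_mono) auto
    also have "\<dots> = 48 * K * r * (\<Sum>y=a..b. \<bar>f y\<bar> * w y)" unfolding sum_distrib_left by (intro sum.cong) auto
    also have "(\<Sum>y=a..b. \<bar>f y\<bar> * w y) \<le> S"
      unfolding S_def using f wpos by (intro sum_le_suminf) (auto simp: less_imp_le)
    finally have "s * r * w x \<le> 48 * K * r * S" using K r by simp
    then have "r * (s * w x) \<le> r * (48 * K * S)" by (simp add: mult_ac)
    then have "s * w x \<le> 48 * K * S" using r by simp
    then show "(\<Sum>y<n. \<bar>f y\<bar> * ?P y) \<le> 48 * K * S / w x" using wpos[of x] by (simp add: pos_le_divide_eq s_def)
  qed
qed

lemma transform_lp:
  assumes p: "1 < p" and w: "Ap_weight p w"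
  shows "\<exists>C>0. \<forall>X f N1 N2. finite X \<longrightarrow> summable (\<lambda>y. \<bar>f y\<bar> powr p * w y) \<longrightarrow> (\<forall>x\<in>X. N1 x \<le> N2 x) \<longrightarrow>
    (\<Sum>x\<in>X. \<bar>transform (N1 x) (N2 x) f x\<bar> powr p * w x) \<le> C * (\<Sum>y. \<bar>f y\<bar> powr p * w y)"
proof -
  have wpos: "\<And>k. 0 < w k" using w unfolding Ap_weight_def by blast
  obtain C where C: "0 < C" "\<And>X Y f N1 N2. finite X \<Longrightarrow> finite Y \<Longrightarrow> (\<forall>x\<in>X. N1 x \<le> N2 x) \<Longrightarrow>
    (\<Sum>x\<in>X. \<bar>\<Sum>y\<in>Y. D (N1 x) (N2 x) 0 x y * f y\<bar> powr p * w x) \<le> C * (\<Sum>y\<in>Y. \<bar>f y\<bar> powr p * w y)"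
    using D_lp[OF p w] by blast
  show ?thesis
  proof (intro exI[of _ C] conjI allI impI C(1))
    fix X f and N1 N2 :: "nat \<Rightarrow> int" assume X: "finite X" and f: "summable (\<lambda>y. \<bar>f y\<bar> powr p * w y)" and N: "\<forall>x\<in>X. N1 x \<le> N2 x"
    have "(\<lambda>k. \<Sum>x\<in>X. \<bar>\<Sum>y<k. D (N1 x) (N2 x) 0 x y * f y\<bar> powr p * w x) \<longlonglongrightarrow> (\<Sum>x\<in>X. \<bar>transform (N1 x) (N2 x) f x\<bar> powr p * w x)"
      using p by (intro tendsto_sum tendsto_mult tendsto_const tendsto_powr' tendsto_rabs transform_limit poisson_summable_lp[OF p w f]) auto
    moreover have "(\<Sum>x\<in>X. \<bar>\<Sum>y<k. D (N1 x) (N2 x) 0 x y * f y\<bar> powr p * w x) \<le> C * (\<Sum>y. \<bar>f y\<bar> powr p * w y)" for k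
    proof -
      have "(\<Sum>x\<in>X. \<bar>\<Sum>y<k. D (N1 x) (N2 x) 0 x y * f y\<bar> powr p * w x) \<le> C * (\<Sum>y<k. \<bar>f y\<bar> powr p * w y)"
        by (rule C(2)[OF X _ N]) simp
      also have "\<dots> \<le> C * (\<Sum>y. \<bar>f y\<bar> powr p * w y)"
        using C(1) f wpos by (intro mult_left_mono sum_le_suminf) (auto simp: less_imp_le)
      finally show ?thesis .
    qed
    ultimately show "(\<Sum>x\<in>X. \<bar>transform (N1 x) (N2 x) f x\<bar> powr p * w x) \<le> C * (\<Sum>y. \<bar>f y\<bar> powr p * w y)"
      by (intro LIMSEQ_le_const2) auto
  qed
qed

text \<open>The inequality at level \<open>l\<close> is strict, so at finitely many points it
  already holds for one common partial sum, to which \<open>D_weak\<close> applies.\<close>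

lemma transform_weak:
  assumes w: "A1_weight w"
  shows "\<exists>C>0. \<forall>X f N1 N2 l. finite X \<longrightarrow> summable (\<lambda>y. \<bar>f y\<bar> * w y) \<longrightarrow> 0 < l \<longrightarrow>
    (\<forall>x\<in>X. N1 x \<le> N2 x \<and> l < \<bar>transform (N1 x) (N2 x) f x\<bar>) \<longrightarrow> l * sum w X \<le> C * (\<Sum>y. \<bar>f y\<bar> * w y)"
proof -
  have wpos: "\<And>k. 0 < w k" using w unfolding A1_weight_def by blast
  obtain C where C: "0 < C" "\<And>X Y f N1 N2 l. finite X \<Longrightarrow> finite Y \<Longrightarrow> 0 < l \<Longrightarrow>
    (\<forall>x\<in>X. N1 x \<le> N2 x \<and> l < \<bar>\<Sum>y\<in>Y. D (N1 x) (N2 x) 0 x y * f y\<bar>) \<Longrightarrow>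
    l * sum w X \<le> C * (\<Sum>y\<in>Y. \<bar>f y\<bar> * w y)"
    using D_weak[OF w] by blast
  show ?thesis
  proof (intro exI[of _ C] conjI allI impI C(1))
    fix X f l and N1 N2 :: "nat \<Rightarrow> int" assume X: "finite X" and f: "summable (\<lambda>y. \<bar>f y\<bar> * w y)" and l: "0 < (l::real)"
      and h: "\<forall>x\<in>X. N1 x \<le> N2 x \<and> l < \<bar>transform (N1 x) (N2 x) f x\<bar>"
    have "\<forall>\<^sub>F k in sequentially. \<forall>x\<in>X. l < \<bar>\<Sum>y<k. D (N1 x) (N2 x) 0 x y * f y\<bar>"
    proof (rule eventually_ball_finite[OF X], rule ballI)
      fix x assume "x \<in> X"
      then show "\<forall>\<^sub>F k in sequentially. l < \<bar>\<Sum>y<k. D (N1 x) (N2 x) 0 x y * f y\<bar>"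
        using h by (intro order_tendstoD(1)[OF tendsto_rabs[OF transform_limit]] poisson_summable_l1[OF w f]) auto
    qed
    then obtain k where k: "\<forall>x\<in>X. l < \<bar>\<Sum>y<k. D (N1 x) (N2 x) 0 x y * f y\<bar>" by (auto simp: eventually_sequentially)
    have "\<forall>x\<in>X. N1 x \<le> N2 x \<and> l < \<bar>\<Sum>y<k. D (N1 x) (N2 x) 0 x y * f y\<bar>" using h k by blast
    then have "l * sum w X \<le> C * (\<Sum>y<k. \<bar>f y\<bar> * w y)" by (intro C(2)[OF X _ l]) auto
    also have "\<dots> \<le> C * (\<Sum>y. \<bar>f y\<bar> * w y)"
      using C(1) f wpos by (intro mult_left_mono sum_le_suminf) (auto simp: less_imp_le)
    finally show "l * sum w X \<le> C * (\<Sum>y. \<bar>f y\<bar> * w y)" .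
  qed
qed

end

text \<open>At each of finitely many points an index is chosen that attains the supremum up to a
  factor \<open>\<theta> < 1\<close>; letting \<open>\<theta>\<close> tend to 1 loses nothing.
  Finiteness of the supremum comes from one-point sets.\<close>

lemma strong_type_sup:
  fixes V :: "'i \<Rightarrow> nat \<Rightarrow> real"
  assumes p: "0 < p" and w: "\<And>k. 0 < w k" and I: "I \<noteq> {}" and V: "\<And>i x. 0 \<le> V i x"
    and h: "\<And>X N. finite X \<Longrightarrow> (\<forall>x\<in>X. N x \<in> I) \<Longrightarrow> (\<Sum>x\<in>X. V (N x) x powr p * w x) \<le> K"
  defines "M \<equiv> \<lambda>x. SUP i\<in>I. V i x"
  shows "bdd_above ((\<lambda>i. V i x) ` I)" "summable (\<lambda>x. \<bar>M x\<bar> powr p * w x)" "(\<Sum>x. \<bar>M x\<bar> powr p * w x) \<le> K"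
proof -
  show bdd: "bdd_above ((\<lambda>i. V i x) ` I)" for x
  proof (rule bdd_aboveI2)
    fix i assume i: "i \<in> I"
    have "V i x powr p * w x \<le> K" using h[of "{x}" "\<lambda>_. i"] i by simp
    then have "V i x powr p \<le> K / w x" using w[of x] by (simp add: pos_le_divide_eq)
    then have "(V i x powr p) powr (1 / p) \<le> (K / w x) powr (1 / p)" using p by (intro powr_mono2) auto
    then show "V i x \<le> (K / w x) powr (1 / p)" using p V[of i x] by (simp add: powr_powr)
  qed
  have M0: "0 \<le> M x" for x
    using I V bdd[of x] unfolding M_def by (meson cSUP_upper2 ex_in_conv)
  have part: "(\<Sum>x\<in>X. \<bar>M x\<bar> powr p * w x) \<le> K" if X: "finite X" for X
  proof (rule field_le_mult_one_interval)
    fix z :: real assume z: "0 < z" "z < 1"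
    define \<theta> where "\<theta> = z powr (1 / p)"
    have \<theta>: "0 < \<theta>" "\<theta> < 1" "\<theta> powr p = z"
      using z p powr_less_mono2[of "1 / p" z 1] by (auto simp: \<theta>_def powr_powr)
    have "\<exists>i\<in>I. \<theta> * M x \<le> V i x" for x
    proof (cases "M x = 0")
      case True
      then show ?thesis using I V by auto
    next
      case False
      then have "\<theta> * M x < M x" using \<theta> M0[of x] by simp
      then show ?thesis unfolding M_def using less_cSUP_iff[OF I bdd[of x]] by (meson less_imp_le)
    qed
    then obtain N where N: "\<And>x. N x \<in> I" "\<And>x. \<theta> * M x \<le> V (N x) x" by metis
    have "z * (\<Sum>x\<in>X. \<bar>M x\<bar> powr p * w x) = (\<Sum>x\<in>X. (\<theta> * M x) powr p * w x)"
      using \<theta> M0 by (simp add: sum_distrib_left powr_mult mult.assoc)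
    also have "\<dots> \<le> (\<Sum>x\<in>X. V (N x) x powr p * w x)"
      using w p \<theta> M0 N by (intro sum_mono mult_right_mono powr_mono2) (auto simp: less_imp_le)
    also have "\<dots> \<le> K" using h[OF X] N by simp
    finally show "z * (\<Sum>x\<in>X. \<bar>M x\<bar> powr p * w x) \<le> K" .
  qed
  show sm: "summable (\<lambda>x. \<bar>M x\<bar> powr p * w x)"
    using part w by (intro summableI_nonneg_bounded[where x = K]) (auto simp: less_imp_le)
  show "(\<Sum>x. \<bar>M x\<bar> powr p * w x) \<le> K" using part sm by (intro suminf_le_const) auto
qed

text \<open>Strict level sets fit the supremum: a number below the supremum is below one of the
  values, so no factor is lost.\<close>

lemma weak_type_sup:
  fixes V :: "'i \<Rightarrow> nat \<Rightarrow> real"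
  assumes w: "\<And>k. 0 < w k" and I: "I \<noteq> {}" and V: "\<And>i x. 0 \<le> V i x"
    and h: "\<And>X N l. finite X \<Longrightarrow> 0 < l \<Longrightarrow> (\<forall>x\<in>X. N x \<in> I \<and> l < V (N x) x) \<Longrightarrow> l * sum w X \<le> K"
  defines "M \<equiv> \<lambda>x. SUP i\<in>I. V i x"
  shows "bdd_above ((\<lambda>i. V i x) ` I)"
    and "0 < s \<Longrightarrow> summable (\<lambda>x. if \<bar>M x\<bar> > s then w x else 0)"
    and "0 < s \<Longrightarrow> s * (\<Sum>x. if \<bar>M x\<bar> > s then w x else 0) \<le> K"
proof -
  show bdd: "bdd_above ((\<lambda>i. V i x) ` I)" for x
  proof (rule bdd_aboveI2)
    fix i assume i: "i \<in> I"
    show "V i x \<le> K / w x"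
    proof (rule ccontr)
      assume "\<not> V i x \<le> K / w x"
      then have lt: "K / w x < V i x" by simp
      have K: "0 \<le> K" using h[of "{}" 1] by simp
      then have "0 \<le> K / w x" using w[of x] by (simp add: less_imp_le)
      then obtain l where l: "0 < l" and lV: "l < V i x" and lK: "K / w x < l"
        using dense[OF lt] by (meson le_less_trans)
      have "l * w x \<le> K" using h[of "{x}" l "\<lambda>_. i"] i l lV by simp
      moreover have "K < l * w x" using lK w[of x] by (simp add: pos_divide_less_eq)
      ultimately show False by simp
    qed
  qed
  have M0: "0 \<le> M x" for x
    using I V bdd[of x] unfolding M_def by (meson cSUP_upper2 ex_in_conv)
  have part: "s * (\<Sum>x\<in>X. if \<bar>M x\<bar> > s then w x else 0) \<le> K" if X: "finite X" and s: "0 < s" for X s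
  proof -
    define X' where "X' = {x\<in>X. M x > s}"
    have "\<exists>i\<in>I. s < V i x" if "x \<in> X'" for x
      using that less_cSUP_iff[OF I bdd[of x]] by (auto simp: X'_def M_def)
    then obtain N where N: "\<And>x. x \<in> X' \<Longrightarrow> N x \<in> I \<and> s < V (N x) x" by metis
    have "(\<Sum>x\<in>X. if \<bar>M x\<bar> > s then w x else 0) = sum w X'"
      unfolding X'_def using X M0 by (simp add: sum.inter_filter)
    then show ?thesis using h[of X' s N] X s N by (simp add: X'_def)
  qed
  assume s: "0 < s"
  show sm: "summable (\<lambda>x. if \<bar>M x\<bar> > s then w x else 0)"
  proof (rule summableI_nonneg_bounded)
    fix n
    show "0 \<le> (if \<bar>M n\<bar> > s then w n else 0)" using w[of n] by simp
    show "(\<Sum>x<n. if \<bar>M x\<bar> > s then w x else 0) \<le> K / s" using part[of "{..<n}" s] s by (simp add: pos_le_divide_eq mult.commute)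
  qed
  have "(\<Sum>x. if \<bar>M x\<bar> > s then w x else 0) \<le> K / s"
  proof (rule suminf_le_const[OF sm])
    fix n
    show "(\<Sum>x<n. if \<bar>M x\<bar> > s then w x else 0) \<le> K / s" using part[of "{..<n}" s] s by (simp add: pos_le_divide_eq mult.commute)
  qed
  then show "s * (\<Sum>x. if \<bar>M x\<bar> > s then w x else 0) \<le> K" using s by (simp add: pos_le_divide_eq mult.commute)
qed

section \<open>Heat kernels of orthonormal polynomials\<close>

locale orthonormal_basis = finite_measure M for M :: "real measure" +
  fixes p :: "nat \<Rightarrow> real poly"
  assumes sets_M: "sets M = sets borel"
    and supp: "AE x in M. x \<in> {-1..1}"
    and deg: "\<And>n. degree (p n) = n" "\<And>n. p n \<noteq> 0"
    and orth: "\<And>n m. (\<integral>x. poly (p n) x * poly (p m) x \<partial>M) = (if n = m then 1 else 0)"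
begin

lemma integrable_cont:
  fixes f :: "real \<Rightarrow> real"
  assumes "continuous_on UNIV f"
  shows "integrable M f"
proof -
  have "compact (f ` {-1..1})"
    using assms by (intro compact_continuous_image) (auto intro: continuous_on_subset)
  then obtain B where B: "\<And>x. x \<in> {-1..1} \<Longrightarrow> norm (f x) \<le> B"
    by (meson compact_imp_bounded bounded_iff imageI)
  have "f \<in> borel_measurable M"
    using borel_measurable_continuous_onI[OF assms] measurable_cong_sets[OF sets_M refl] by blast
  moreover have "AE x in M. norm (f x) \<le> B" using supp by eventually_elim (rule B)
  ultimately show ?thesis using integrable_const_bound by blast
qed

text \<open>Induction on a strict degree bound, expressed by vanishing coefficients so that
  \<open>L = 0\<close> means \<open>q = 0\<close>. A multiple of \<open>p L\<close> is subtracted to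
  remove the top coefficient.\<close>

lemma expand:
  assumes "\<And>i. L \<le> i \<Longrightarrow> coeff q i = 0"
  shows "q = (\<Sum>l<L. smult (\<integral>x. poly q x * poly (p l) x \<partial>M) (p l))"
  using assms
proof (induction L arbitrary: q)
  case 0
  then show ?case by (simp add: poly_eq_iff)
next
  case (Suc L)
  define c where "c = coeff q L / coeff (p L) L"
  define q' where "q' = q - smult c (p L)"
  have lc: "coeff (p L) L \<noteq> 0" using deg[of L] by (metis leading_coeff_0_iff)
  have "coeff q' i = 0" if "L \<le> i" for i
  proof (cases "i = L")
    case True
    then show ?thesis using lc by (simp add: q'_def c_def)
  next
    case False
    then have "coeff (p L) i = 0" using that deg(1)[of L] by (intro coeff_eq_0) auto
    then show ?thesis using False that Suc.prems[of i] by (simp add: q'_def)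
  qed
  from Suc.IH[OF this] have q': "q' = (\<Sum>l<L. smult (\<integral>x. poly q' x * poly (p l) x \<partial>M) (p l))" .
  have q: "q = q' + smult c (p L)" by (simp add: q'_def)
  have int: "integrable M (\<lambda>x. poly r x * poly s x)" for r s :: "real poly"
    by (intro integrable_cont continuous_intros)
  have q'L: "(\<integral>x. poly q' x * poly (p L) x \<partial>M) = 0"
  proof -
    have "poly q' x * poly (p L) x = (\<Sum>l<L. (\<integral>x. poly q' x * poly (p l) x \<partial>M) * (poly (p l) x * poly (p L) x))" for x
      by (subst q') (simp add: poly_sum sum_distrib_right mult.assoc)
    then show ?thesis using int by (simp add: orth)
  qed
  have co: "(\<integral>x. poly q x * poly (p l) x \<partial>M) = (\<integral>x. poly q' x * poly (p l) x \<partial>M) + c * (if l = L then 1 else 0)" for l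
  proof -
    have "(\<integral>x. poly q x * poly (p l) x \<partial>M) = (\<integral>x. poly q' x * poly (p l) x + c * (poly (p L) x * poly (p l) x) \<partial>M)"
      by (subst q) (simp add: algebra_simps)
    also have "\<dots> = (\<integral>x. poly q' x * poly (p l) x \<partial>M) + c * (\<integral>x. poly (p L) x * poly (p l) x \<partial>M)"
      using int by (subst Bochner_Integration.integral_add) auto
    finally show ?thesis by (auto simp: orth)
  qed
  have "(\<Sum>l<Suc L. smult (\<integral>x. poly q x * poly (p l) x \<partial>M) (p l)) = (\<Sum>l<L. smult (\<integral>x. poly q' x * poly (p l) x \<partial>M) (p l)) + smult c (p L)"
    by (simp add: co q'L)
  also have "\<dots> = q" unfolding q'[symmetric] using q by simp
  finally show ?case by simp
qed

lemma orth_low: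
  assumes "\<And>i. L \<le> i \<Longrightarrow> coeff q i = 0" "L \<le> m"
  shows "(\<integral>x. poly q x * poly (p m) x \<partial>M) = 0"
proof -
  have int: "integrable M (\<lambda>x. poly r x * poly s x)" for r s :: "real poly"
    by (intro integrable_cont continuous_intros)
  define c where "c l = (\<integral>x. poly q x * poly (p l) x \<partial>M)" for l
  have q: "q = (\<Sum>l<L. smult (c l) (p l))" unfolding c_def by (rule expand[OF assms(1)])
  have "poly q x * poly (p m) x = (\<Sum>l<L. c l * (poly (p l) x * poly (p m) x))" for x
    by (subst q) (simp add: poly_sum sum_distrib_right mult.assoc)
  then show ?thesis using int assms(2) by (simp add: orth)
qed

end

section \<open>Completeness, semigroup law and on-diagonal size of the heat kernels\<close>

locale orthonormal_polys = orthonormal_basis +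
  fixes A0 :: real
  assumes diag: "\<And>t n. 0 \<le> t \<Longrightarrow> (\<integral>x. exp (t * (x - 1)) * (poly (p n) x)\<^sup>2 \<partial>M) \<le> A0 / sqrt (1 + t)"
    and A0_pos: "0 < A0"
begin

lemma bessel:
  assumes f: "continuous_on UNIV f"
  shows "(\<integral>x. (f x - (\<Sum>l<L. (\<integral>x. f x * poly (p l) x \<partial>M) * poly (p l) x))\<^sup>2 \<partial>M)
     = (\<integral>x. (f x)\<^sup>2 \<partial>M) - (\<Sum>l<L. (\<integral>x. f x * poly (p l) x \<partial>M)\<^sup>2)"
proof -
  define c where "c l = (\<integral>x. f x * poly (p l) x \<partial>M)" for l
  have i1: "integrable M (\<lambda>x. (f x)\<^sup>2)" and i2: "integrable M (\<lambda>x. f x * poly (p l) x)"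
    and i3: "integrable M (\<lambda>x. poly (p l) x * poly (p m) x)" for l m
    by (intro integrable_cont continuous_intros f)+
  have "(f x - (\<Sum>l<L. c l * poly (p l) x))\<^sup>2 = (f x)\<^sup>2 - 2 * (\<Sum>l<L. c l * (f x * poly (p l) x))
      + (\<Sum>l<L. \<Sum>m<L. c l * c m * (poly (p l) x * poly (p m) x))" for x
  proof -
    have "(\<Sum>l<L. c l * poly (p l) x) * (\<Sum>l<L. c l * poly (p l) x) = (\<Sum>l<L. \<Sum>m<L. c l * c m * (poly (p l) x * poly (p m) x))"
      unfolding sum_product by (intro sum.cong refl) (simp add: mult_ac)
    moreover have "f x * (\<Sum>l<L. c l * poly (p l) x) = (\<Sum>l<L. c l * (f x * poly (p l) x))"
      unfolding sum_distrib_left by (intro sum.cong refl) (simp add: mult_ac)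
    moreover have "(f x - s)\<^sup>2 = (f x)\<^sup>2 - 2 * (f x * s) + s * s" for s by (simp add: power2_eq_square algebra_simps)
    ultimately show ?thesis by simp
  qed
  then have "(\<integral>x. (f x - (\<Sum>l<L. c l * poly (p l) x))\<^sup>2 \<partial>M) = (\<integral>x. (f x)\<^sup>2 \<partial>M) - 2 * (\<Sum>l<L. c l * c l)
      + (\<Sum>l<L. \<Sum>m<L. c l * c m * (if l = m then 1 else 0))"
    using i1 i2 i3 by (simp add: c_def orth)
  also have "(\<Sum>l<L. \<Sum>m<L. c l * c m * (if l = m then 1 else 0)) = (\<Sum>l<L. c l * c l)"
    by (intro sum.cong refl) (simp add: if_distrib[of "\<lambda>t. _ * t"] sum.delta cong: if_cong)
  finally show ?thesis by (simp add: c_def power2_eq_square)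
qed

lemma bessel_le:
  assumes f: "continuous_on UNIV f"
  shows "(\<Sum>l<L. (\<integral>x. f x * poly (p l) x \<partial>M)\<^sup>2) \<le> (\<integral>x. (f x)\<^sup>2 \<partial>M)"
proof -
  have "0 \<le> (\<integral>x. (f x - (\<Sum>l<L. (\<integral>x. f x * poly (p l) x \<partial>M) * poly (p l) x))\<^sup>2 \<partial>M)"
    by (intro integral_nonneg_AE) auto
  then show ?thesis unfolding bessel[OF f] by simp
qed

text \<open>By Stone-Weierstrass \<open>f\<close> is a polynomial up to a small remainder
  \<open>r\<close>. The partial expansion reproduces the polynomial, so the error \<open>u\<close>
  is that of \<open>r\<close>, and Bessel bounds its norm by the norm of \<open>r\<close>. The
  purpose is the semigroup law of the kernels.\<close>

lemma parseval:
  assumes f: "continuous_on UNIV f" and g: "continuous_on UNIV g"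
  shows "(\<lambda>l. (\<integral>x. f x * poly (p l) x \<partial>M) * (\<integral>x. g x * poly (p l) x \<partial>M)) sums (\<integral>x. f x * g x \<partial>M)"
  unfolding sums_def
proof (rule LIMSEQ_I)
  fix e :: real assume e: "0 < e"
  define G where "G = (\<integral>x. (g x)\<^sup>2 \<partial>M)"
  have G: "0 \<le> G" unfolding G_def by (intro integral_nonneg_AE) auto
  define W where "W = measure M (space M)"
  have W: "0 \<le> W" by (simp add: W_def)
  \<comment> \<open>Makes the final bound \<open>\<delta> * (W + G)\<close> smaller than
    \<open>e\<close>.\<close>
  define \<delta> where "\<delta> = e / (W + G + 1)"
  have \<delta>: "0 < \<delta>" using e G W by (simp add: \<delta>_def add_nonneg_pos)
  obtain h where h: "real_polynomial_function h" "\<And>x. x \<in> {-1..1} \<Longrightarrow> \<bar>f x - h x\<bar> < \<delta>"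
    using Stone_Weierstrass_real_polynomial_function[of "{-1..1::real}" f \<delta>] f \<delta> by (auto intro: continuous_on_subset)
  obtain a N where "h = (\<lambda>x. \<Sum>i\<le>N. a i * x ^ i)" using h(1) unfolding real_polynomial_function_iff_sum by blast
  define q where "q = (\<Sum>i\<le>N. monom (a i) i)"
  have q: "h x = poly q x" for x by (simp add: q_def \<open>h = _\<close> poly_sum poly_monom)
  have qN: "coeff q i = 0" if "Suc N \<le> i" for i
    using that by (auto simp: q_def coeff_sum intro!: sum.neutral)
  show "\<exists>no. \<forall>n\<ge>no. norm ((\<Sum>l<n. (\<integral>x. f x * poly (p l) x \<partial>M) * (\<integral>x. g x * poly (p l) x \<partial>M)) - (\<integral>x. f x * g x \<partial>M)) < e"
  proof (intro exI[of _ "Suc N"] allI impI)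
    fix L assume L: "Suc N \<le> L"
    define c where "c l = (\<integral>x. f x * poly (p l) x \<partial>M)" for l
    define r where "r x = f x - poly q x" for x
    have r: "continuous_on UNIV r" unfolding r_def by (intro continuous_intros f)
    define u where "u x = f x - (\<Sum>l<L. c l * poly (p l) x)" for x
    have u: "continuous_on UNIV u" unfolding u_def by (intro continuous_intros f)
    define d where "d l = (\<integral>x. poly q x * poly (p l) x \<partial>M)" for l
    have "q = (\<Sum>l<L. smult (d l) (p l))" unfolding d_def by (rule expand) (use qN L in auto)
    then have qx: "poly q x = (\<Sum>l<L. d l * poly (p l) x)" for x by (metis (no_types, lifting) poly_smult poly_sum sum.cong)
    have rl: "(\<integral>x. r x * poly (p l) x \<partial>M) = c l - d l" for l
    proof -
      have "(\<integral>x. r x * poly (p l) x \<partial>M) = (\<integral>x. f x * poly (p l) x - poly q x * poly (p l) x \<partial>M)"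
        by (simp add: r_def left_diff_distrib)
      also have "\<dots> = c l - d l" unfolding c_def d_def
        by (intro Bochner_Integration.integral_diff integrable_cont continuous_intros f)
      finally show ?thesis .
    qed
    have ur: "u x = r x - (\<Sum>l<L. (\<integral>x. r x * poly (p l) x \<partial>M) * poly (p l) x)" for x
      unfolding rl u_def by (simp add: r_def qx left_diff_distrib sum_subtractf)
    have "(\<integral>x. (u x)\<^sup>2 \<partial>M) \<le> (\<integral>x. (r x)\<^sup>2 \<partial>M)"
      unfolding ur bessel[OF r] by (simp add: sum_nonneg)
    also have "\<dots> \<le> (\<integral>x. \<delta>\<^sup>2 \<partial>M)"
    proof (rule integral_mono_AE)
      show "AE x in M. (r x)\<^sup>2 \<le> \<delta>\<^sup>2"
        using supp
      proof eventually_elim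
        case (elim x)
        then have "\<bar>r x\<bar> \<le> \<delta>" using h(2)[of x] by (simp add: r_def q)
        then have "\<bar>r x\<bar>\<^sup>2 \<le> \<delta>\<^sup>2" by (intro power_mono) auto
        then show ?case by simp
      qed
    qed (auto intro!: integrable_cont continuous_intros r)
    also have "\<dots> = \<delta>\<^sup>2 * W" by (simp add: W_def)
    finally have uW: "(\<integral>x. (u x)\<^sup>2 \<partial>M) \<le> \<delta>\<^sup>2 * W" .
    have eq: "(\<Sum>l<L. c l * (\<integral>x. g x * poly (p l) x \<partial>M)) - (\<integral>x. f x * g x \<partial>M) = - (\<integral>x. u x * g x \<partial>M)"
    proof -
      have "(\<integral>x. u x * g x \<partial>M) = (\<integral>x. f x * g x - (\<Sum>l<L. c l * (g x * poly (p l) x)) \<partial>M)"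
        unfolding u_def left_diff_distrib sum_distrib_right by (simp add: mult_ac)
      also have "\<dots> = (\<integral>x. f x * g x \<partial>M) - (\<integral>x. (\<Sum>l<L. c l * (g x * poly (p l) x)) \<partial>M)"
        by (intro Bochner_Integration.integral_diff integrable_cont continuous_intros f g)
      also have "(\<integral>x. (\<Sum>l<L. c l * (g x * poly (p l) x)) \<partial>M) = (\<Sum>l<L. \<integral>x. c l * (g x * poly (p l) x) \<partial>M)"
        by (intro Bochner_Integration.integral_sum integrable_cont continuous_intros g)
      finally show ?thesis by simp
    qed
    have "\<bar>\<integral>x. u x * g x \<partial>M\<bar> \<le> (\<integral>x. (u x)\<^sup>2 / \<delta> + \<delta> * (g x)\<^sup>2 \<partial>M)"
    proof (rule order_trans[OF integral_abs_bound], rule integral_mono)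
      fix x
      have "0 \<le> (\<bar>u x\<bar> / \<delta> - \<bar>g x\<bar>)\<^sup>2 * \<delta> + (u x)\<^sup>2 / \<delta> + \<delta> * (g x)\<^sup>2" using \<delta> by (intro add_nonneg_nonneg mult_nonneg_nonneg) auto
      also have "\<dots> = 2 * ((u x)\<^sup>2 / \<delta> + \<delta> * (g x)\<^sup>2 - \<bar>u x\<bar> * \<bar>g x\<bar>)"
        using \<delta> by (simp add: power2_diff power_divide field_simps power2_eq_square)
      finally show "\<bar>u x * g x\<bar> \<le> (u x)\<^sup>2 / \<delta> + \<delta> * (g x)\<^sup>2" by (simp add: abs_mult)
    qed (auto intro!: integrable_cont continuous_intros u g simp: \<delta>[THEN less_imp_neq, symmetric])
    also have "\<dots> = (\<integral>x. (u x)\<^sup>2 \<partial>M) / \<delta> + \<delta> * G"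
      unfolding G_def using \<delta> by (subst Bochner_Integration.integral_add) (auto intro!: integrable_cont continuous_intros u g)
    also have "\<dots> \<le> \<delta> * W + \<delta> * G" using uW \<delta> by (simp add: pos_divide_le_eq power2_eq_square mult_ac)
    also have "\<dots> = \<delta> * (W + G)" by (simp add: distrib_left)
    also have "\<dots> < e" using e G W by (simp add: \<delta>_def pos_divide_less_eq add_nonneg_pos)
    finally show "norm ((\<Sum>l<L. (\<integral>x. f x * poly (p l) x \<partial>M) * (\<integral>x. g x * poly (p l) x \<partial>M)) - (\<integral>x. f x * g x \<partial>M)) < e"
      using eq unfolding c_def by simp
  qed
qed

definition \<kappa> :: "nat \<Rightarrow> real \<Rightarrow> nat \<Rightarrow> nat \<Rightarrow> real" where
  "\<kappa> k t n m = (\<integral>x. (x - 1) ^ k * exp (t * (x - 1)) * poly (p n) x * poly (p m) x \<partial>M)"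

lemma \<kappa>_sym: "\<kappa> k t n m = \<kappa> k t m n"
  by (simp add: \<kappa>_def mult_ac)

lemma \<kappa>_semigroup: "(\<lambda>l. \<kappa> 0 s n l * \<kappa> 0 t l m) sums \<kappa> 0 (s + t) n m"
proof -
  have "(\<lambda>l. (\<integral>x. exp (s * (x - 1)) * poly (p n) x * poly (p l) x \<partial>M) * (\<integral>x. exp (t * (x - 1)) * poly (p m) x * poly (p l) x \<partial>M))
     sums (\<integral>x. (exp (s * (x - 1)) * poly (p n) x) * (exp (t * (x - 1)) * poly (p m) x) \<partial>M)"
    by (intro parseval continuous_intros)
  moreover have "(exp (s * (x - 1)) * poly (p n) x) * (exp (t * (x - 1)) * poly (p m) x) = exp ((s + t) * (x - 1)) * poly (p n) x * poly (p m) x" for x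
    by (simp add: distrib_right exp_add)
  ultimately show ?thesis using \<kappa>_sym[of 0 t _ m] by (simp add: \<kappa>_def)
qed

text \<open>Taylor remainder of second order, uniform for \<open>\<bar>y\<bar> \<le> 2\<close>,
  which covers \<open>y = x - 1\<close> on the support. It lets \<open>\<kappa>_deriv\<close>
  differentiate under the integral with an error of order \<open>h ^ 2\<close>.\<close>

lemma exp_taylor1:
  fixes y t h :: real
  assumes "\<bar>y\<bar> \<le> 2" "\<bar>h\<bar> \<le> 1"
  shows "\<bar>exp ((t + h) * y) - exp (t * y) - h * (y * exp (t * y))\<bar> \<le> 4 * exp (2 * (\<bar>t\<bar> + 1)) * h\<^sup>2"
proof -
  define C where "C = exp (2 * (\<bar>t\<bar> + 1))"
  have le: "exp (s * y) \<le> C" if "\<bar>s - t\<bar> \<le> \<bar>h\<bar>" for s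
  proof -
    have "s * y \<le> \<bar>s\<bar> * \<bar>y\<bar>" by (metis abs_ge_self abs_mult)
    also have "\<dots> \<le> (\<bar>t\<bar> + 1) * 2" using that assms by (intro mult_mono) auto
    finally show ?thesis by (simp add: C_def)
  qed
  define I where "I = {t - \<bar>h\<bar>..t + \<bar>h\<bar>}"
  have I: "convex I" "t \<in> I" "t + h \<in> I" by (auto simp: I_def)
  have 1: "\<bar>exp (s * y) - exp (t * y)\<bar> \<le> C * \<bar>y\<bar> * \<bar>h\<bar>" if s: "s \<in> I" for s
  proof -
    have "norm (exp (s * y) - exp (t * y)) \<le> C * \<bar>y\<bar> * norm (s - t)"
    proof (rule field_differentiable_bound[OF I(1) _ _ s I(2)])
      fix z assume z: "z \<in> I"
      show "((\<lambda>s. exp (s * y)) has_field_derivative exp (z * y) * y) (at z within I)" by (auto intro!: derivative_eq_intros)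
      have "\<bar>z - t\<bar> \<le> \<bar>h\<bar>" using z by (auto simp: I_def)
      then show "norm (exp (z * y) * y) \<le> C * \<bar>y\<bar>" using le[of z] by (simp add: abs_mult mult_right_mono)
    qed
    also have "\<dots> \<le> C * \<bar>y\<bar> * \<bar>h\<bar>" using s by (intro mult_left_mono) (auto simp: I_def C_def)
    finally show ?thesis by simp
  qed
  have "norm ((exp ((t + h) * y) - (t + h) * (y * exp (t * y))) - (exp (t * y) - t * (y * exp (t * y)))) \<le> (C * \<bar>y\<bar> * \<bar>h\<bar> * \<bar>y\<bar>) * norm ((t + h) - t)"
  proof (rule field_differentiable_bound[OF I(1) _ _ I(3) I(2), where f = "\<lambda>s. exp (s * y) - s * (y * exp (t * y))"])
    fix z assume z: "z \<in> I"
    show "((\<lambda>s. exp (s * y) - s * (y * exp (t * y))) has_field_derivative (exp (z * y) - exp (t * y)) * y) (at z within I)"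
      by (auto intro!: derivative_eq_intros simp: algebra_simps)
    show "norm ((exp (z * y) - exp (t * y)) * y) \<le> C * \<bar>y\<bar> * \<bar>h\<bar> * \<bar>y\<bar>"
      using 1[OF z] by (simp add: abs_mult mult_right_mono)
  qed
  also have "\<dots> = C * (\<bar>y\<bar> * \<bar>y\<bar>) * h\<^sup>2"
  proof -
    have "norm ((t + h) - t) = \<bar>h\<bar>" "h\<^sup>2 = \<bar>h\<bar> * \<bar>h\<bar>" by (simp_all add: power2_eq_square)
    then show ?thesis by (simp only: mult_ac)
  qed
  also have "\<dots> \<le> C * (2 * 2) * h\<^sup>2" using assms by (intro mult_right_mono mult_left_mono mult_mono) (auto simp: C_def)
  finally show ?thesis by (simp add: C_def algebra_simps)
qed

lemma \<kappa>_deriv: "((\<lambda>t. \<kappa> k t n m) has_real_derivative \<kappa> (Suc k) t n m) (at t)"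
proof -
  define g where "g x = (x - 1) ^ k * poly (p n) x * poly (p m) x" for x
  have g: "continuous_on UNIV g" unfolding g_def by (intro continuous_intros)
  have \<kappa>: "\<kappa> k t n m = (\<integral>x. exp (t * (x - 1)) * g x \<partial>M)" "\<kappa> (Suc k) t n m = (\<integral>x. (x - 1) * exp (t * (x - 1)) * g x \<partial>M)" for t
    unfolding \<kappa>_def g_def by (simp_all add: mult_ac)
  define K where "K = (\<integral>x. 4 * exp (2 * (\<bar>t\<bar> + 1)) * \<bar>g x\<bar> \<partial>M)"
  have rem: "\<bar>\<kappa> k (t + h) n m - \<kappa> k t n m - h * \<kappa> (Suc k) t n m\<bar> \<le> K * h\<^sup>2" if h: "\<bar>h\<bar> \<le> 1" for h
  proof -
    have "\<kappa> k (t + h) n m - \<kappa> k t n m - h * \<kappa> (Suc k) t n m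
       = (\<integral>x. exp ((t + h) * (x - 1)) * g x \<partial>M) - (\<integral>x. exp (t * (x - 1)) * g x \<partial>M) - (\<integral>x. h * ((x - 1) * exp (t * (x - 1)) * g x) \<partial>M)"
      unfolding \<kappa> by simp
    also have "\<dots> = (\<integral>x. exp ((t + h) * (x - 1)) * g x - exp (t * (x - 1)) * g x - h * ((x - 1) * exp (t * (x - 1)) * g x) \<partial>M)"
    proof -
      have i: "integrable M (\<lambda>x. exp ((t + h) * (x - 1)) * g x)" "integrable M (\<lambda>x. exp (t * (x - 1)) * g x)"
        "integrable M (\<lambda>x. h * ((x - 1) * exp (t * (x - 1)) * g x))"
        by (intro integrable_cont continuous_intros g)+
      show ?thesis using i by (simp only: Bochner_Integration.integral_diff Bochner_Integration.integrable_diff)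
    qed
    also have "\<dots> = (\<integral>x. (exp ((t + h) * (x - 1)) - exp (t * (x - 1)) - h * ((x - 1) * exp (t * (x - 1)))) * g x \<partial>M)"
      by (simp add: algebra_simps)
    finally have eq: "\<kappa> k (t + h) n m - \<kappa> k t n m - h * \<kappa> (Suc k) t n m = \<dots>" .
    have "\<bar>\<kappa> k (t + h) n m - \<kappa> k t n m - h * \<kappa> (Suc k) t n m\<bar> \<le> (\<integral>x. \<bar>(exp ((t + h) * (x - 1)) - exp (t * (x - 1)) - h * ((x - 1) * exp (t * (x - 1)))) * g x\<bar> \<partial>M)"
      unfolding eq by (rule integral_abs_bound)
    also have "\<dots> \<le> (\<integral>x. h\<^sup>2 * (4 * exp (2 * (\<bar>t\<bar> + 1)) * \<bar>g x\<bar>) \<partial>M)"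
    proof (rule integral_mono_AE)
      show "AE x in M. \<bar>(exp ((t + h) * (x - 1)) - exp (t * (x - 1)) - h * ((x - 1) * exp (t * (x - 1)))) * g x\<bar> \<le> h\<^sup>2 * (4 * exp (2 * (\<bar>t\<bar> + 1)) * \<bar>g x\<bar>)"
        using supp
      proof eventually_elim
        case (elim x)
        then have "\<bar>exp ((t + h) * (x - 1)) - exp (t * (x - 1)) - h * ((x - 1) * exp (t * (x - 1)))\<bar> * \<bar>g x\<bar> \<le> 4 * exp (2 * (\<bar>t\<bar> + 1)) * h\<^sup>2 * \<bar>g x\<bar>"
          using h by (intro mult_right_mono exp_taylor1) auto
        then show ?case by (simp add: abs_mult mult_ac)
      qed
    qed (intro integrable_cont continuous_intros g)+
    also have "\<dots> = K * h\<^sup>2" by (simp add: K_def)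
    finally show ?thesis .
  qed
  have K: "0 \<le> K" unfolding K_def by (intro integral_nonneg_AE) auto
  have "(\<lambda>h. (\<kappa> k (t + h) n m - \<kappa> k t n m) / h - \<kappa> (Suc k) t n m) \<midarrow>0\<rightarrow> 0"
  proof (rule Lim_null_comparison)
    show "\<forall>\<^sub>F h in at 0. norm ((\<kappa> k (t + h) n m - \<kappa> k t n m) / h - \<kappa> (Suc k) t n m) \<le> K * \<bar>h\<bar>"
      unfolding eventually_at
    proof (intro exI[of _ 1] conjI ballI impI)
      fix h :: real assume h: "h \<noteq> 0 \<and> dist h 0 < 1"
      have "(\<kappa> k (t + h) n m - \<kappa> k t n m) / h - \<kappa> (Suc k) t n m = (\<kappa> k (t + h) n m - \<kappa> k t n m - h * \<kappa> (Suc k) t n m) / h"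
        using h by (simp add: diff_divide_distrib)
      also have "norm \<dots> \<le> K * h\<^sup>2 / \<bar>h\<bar>" using rem[of h] h by (simp add: divide_right_mono)
      also have "\<dots> = K * \<bar>h\<bar>" using h by (simp add: power2_eq_square abs_if)
      finally show "norm ((\<kappa> k (t + h) n m - \<kappa> k t n m) / h - \<kappa> (Suc k) t n m) \<le> K * \<bar>h\<bar>" .
    qed simp
    show "(\<lambda>h. K * \<bar>h\<bar>) \<midarrow>0\<rightarrow> 0" by (auto intro!: tendsto_eq_intros)
  qed
  then show ?thesis unfolding DERIV_def by (simp add: LIM_zero_iff)
qed

text \<open>Half of the exponential pays for the powers of \<open>l = 1 - x\<close>: with
  \<open>y = 1 + t * l / 2\<close> one has \<open>(1 + t) * l \<le> 2 * y\<close> and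
  \<open>y ^ k \<le> fact k * exp y\<close>. By the arithmetic-geometric mean the other half gives
  on-diagonal kernels at time \<open>t / 2\<close>.\<close>

lemma \<kappa>_diag_bound:
  assumes t: "0 \<le> t"
  shows "\<bar>\<kappa> k t n m\<bar> \<le> exp 1 * 2 ^ k * fact k * 2 * A0 / ((1 + t) ^ k * sqrt (1 + t))"
proof -
  define c where "c = exp 1 * 2 ^ k * fact k / (1 + t) ^ k"
  have c: "0 < c" using t by (simp add: c_def)
  have pt: "\<bar>x - 1\<bar> ^ k * exp (t * (x - 1)) \<le> c * exp (t / 2 * (x - 1))" if x: "x \<in> {-1..1}" for x
  proof -
    define l where "l = 1 - x"
    have l: "0 \<le> l" "l \<le> 2" using x by (auto simp: l_def)
    define y where "y = (2 + t * l) / 2"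
    have y: "0 \<le> y" using l t by (simp add: y_def)
    have "((1 + t) * l) ^ k \<le> (2 * y) ^ k" using l t by (intro power_mono) (auto simp: y_def algebra_simps)
    also have "\<dots> = 2 ^ k * (y ^ k)" by (simp add: power_mult_distrib)
    also have "y ^ k \<le> fact k * exp y"
    proof -
      have "(\<Sum>i\<in>{k}. y ^ i /\<^sub>R fact i) \<le> (\<Sum>i. y ^ i /\<^sub>R fact i)" using y by (intro sum_le_suminf summable_exp_generic) auto
      then have "y ^ k / fact k \<le> exp y" by (simp add: exp_def divide_inverse mult.commute)
      then show ?thesis by (simp add: pos_divide_le_eq mult.commute)
    qed
    finally have "((1 + t) * l) ^ k \<le> 2 ^ k * (fact k * exp y)" by simp
    then have "l ^ k \<le> 2 ^ k * (fact k * exp y) / (1 + t) ^ k" using t by (simp add: pos_le_divide_eq power_mult_distrib mult.commute)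
    also have "exp y = exp 1 * exp (t * l / 2)" unfolding y_def by (simp add: add_divide_distrib flip: exp_add)
    finally have "l ^ k \<le> c * exp (t * l / 2)" by (simp add: c_def mult_ac)
    then have "l ^ k * exp (t * (x - 1)) \<le> c * exp (t * l / 2) * exp (t * (x - 1))" by (intro mult_right_mono) auto
    also have "\<dots> = c * exp (t / 2 * (x - 1))" by (simp add: l_def algebra_simps flip: exp_add) (simp add: field_simps)
    finally show ?thesis using x by (simp add: l_def)
  qed
  let ?I = "\<lambda>n. \<integral>x. exp (t / 2 * (x - 1)) * (poly (p n) x)\<^sup>2 \<partial>M"
  have "\<bar>\<kappa> k t n m\<bar> \<le> (\<integral>x. \<bar>(x - 1) ^ k * exp (t * (x - 1)) * poly (p n) x * poly (p m) x\<bar> \<partial>M)"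
    unfolding \<kappa>_def by (rule integral_abs_bound)
  also have "\<dots> \<le> (\<integral>x. c / 2 * (exp (t / 2 * (x - 1)) * (poly (p n) x)\<^sup>2) + c / 2 * (exp (t / 2 * (x - 1)) * (poly (p m) x)\<^sup>2) \<partial>M)"
  proof (rule integral_mono_AE)
    show "AE x in M. \<bar>(x - 1) ^ k * exp (t * (x - 1)) * poly (p n) x * poly (p m) x\<bar>
      \<le> c / 2 * (exp (t / 2 * (x - 1)) * (poly (p n) x)\<^sup>2) + c / 2 * (exp (t / 2 * (x - 1)) * (poly (p m) x)\<^sup>2)"
      using supp
    proof eventually_elim
      case (elim x)
      define a b where "a = poly (p n) x" and "b = poly (p m) x"
      have ab: "\<bar>a * b\<bar> \<le> (a\<^sup>2 + b\<^sup>2) / 2" using sum_squares_bound[of "\<bar>a\<bar>" "\<bar>b\<bar>"] by (simp add: abs_mult)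
      have "\<bar>(x - 1) ^ k * exp (t * (x - 1)) * a * b\<bar> = (\<bar>x - 1\<bar> ^ k * exp (t * (x - 1))) * \<bar>a * b\<bar>"
        by (simp add: abs_mult power_abs)
      also have "\<dots> \<le> (c * exp (t / 2 * (x - 1))) * ((a\<^sup>2 + b\<^sup>2) / 2)"
        by (rule mult_mono[OF pt[OF elim] ab]) (use c in auto)
      finally show ?case by (simp add: a_def b_def algebra_simps)
    qed
  qed (intro integrable_cont continuous_intros)+
  also have "\<dots> = c / 2 * ?I n + c / 2 * ?I m"
    by (subst Bochner_Integration.integral_add) (auto intro!: integrable_cont continuous_intros)
  also have "\<dots> \<le> c / 2 * (A0 / sqrt (1 + t / 2)) + c / 2 * (A0 / sqrt (1 + t / 2))"
    using diag[of "t / 2"] t c by (intro add_mono mult_left_mono) auto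
  also have "\<dots> = c * (A0 / sqrt (1 + t / 2))" by (simp add: field_simps)
  also have "\<dots> \<le> c * (A0 * 2 / sqrt (1 + t))"
  proof (intro mult_left_mono)
    have "sqrt (1 + t) \<le> sqrt (4 * (1 + t / 2))" using t by simp
    also have "\<dots> = 2 * sqrt (1 + t / 2)" by (simp only: real_sqrt_mult real_sqrt_four)
    finally have "sqrt (1 + t) / 2 \<le> sqrt (1 + t / 2)" by simp
    then have "A0 / sqrt (1 + t / 2) \<le> A0 / (sqrt (1 + t) / 2)"
      using A0_pos t by (intro divide_left_mono mult_pos_pos) auto
    then show "A0 / sqrt (1 + t / 2) \<le> A0 * 2 / sqrt (1 + t)" by simp
  qed (use c in auto)
  finally show ?thesis by (simp add: c_def mult_ac)
qed

end

lemma power_add_one_le: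
  fixes a :: real
  assumes "0 \<le> a"
  shows "(a + 1) ^ k \<le> 2 ^ k * (a ^ k + 1)"
proof (cases "a \<le> 1")
  case True
  then have "(a + 1) ^ k \<le> 2 ^ k" using assms by (intro power_mono) auto
  also have "\<dots> \<le> 2 ^ k * (a ^ k + 1)" using assms by simp
  finally show ?thesis .
next
  case False
  then have "(a + 1) ^ k \<le> (2 * a) ^ k" using assms by (intro power_mono) auto
  also have "\<dots> \<le> 2 ^ k * (a ^ k + 1)" by (simp add: power_mult_distrib)
  finally show ?thesis .
qed

lemma power_diff_le:
  fixes a b :: real
  assumes "0 \<le> a" "0 \<le> b" "\<bar>a - b\<bar> \<le> 1"
  shows "\<bar>a ^ Suc k - b ^ Suc k\<bar> \<le> real (Suc k) * (a + 1) ^ k"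
proof -
  have "\<bar>b ^ Suc k - a ^ Suc k\<bar> \<le> real (Suc k) * (a + 1) ^ k * \<bar>b - a\<bar>"
  proof -
    have "norm (b ^ Suc k - a ^ Suc k) \<le> real (Suc k) * (a + 1) ^ k * norm (b - a)"
    proof (rule field_differentiable_bound[of "{0..a+1}"])
      fix z assume z: "z \<in> {0..a+1}"
      show "((\<lambda>x. x ^ Suc k) has_field_derivative real (Suc k) * z ^ k) (at z within {0..a+1})"
        by (rule derivative_eq_intros refl)+ simp
      show "norm (real (Suc k) * z ^ k) \<le> real (Suc k) * (a + 1) ^ k"
      proof -
        have "real (Suc k) * z ^ k \<le> real (Suc k) * (a + 1) ^ k" using z by (intro mult_left_mono power_mono) auto
        moreover have "0 \<le> real (Suc k) * z ^ k" using z by simp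
        ultimately show ?thesis by (simp only: real_norm_def abs_of_nonneg)
      qed
    qed (use assms in auto)
    then show ?thesis by simp
  qed
  also have "\<dots> \<le> real (Suc k) * (a + 1) ^ k * 1" using assms by (intro mult_left_mono) auto
  finally show ?thesis by (simp add: abs_minus_commute)
qed

definition tent :: "nat \<Rightarrow> nat \<Rightarrow> nat \<Rightarrow> real" where
  "tent n R l = min \<bar>real l - real n\<bar> (max 0 (real R - \<bar>real l - real n\<bar>))"

lemma tent_nonneg: "0 \<le> tent n R l" by (simp add: tent_def)

lemma tent_self: "tent n R n = 0" by (simp add: tent_def)

lemma tent_out: "n + R \<le> l \<Longrightarrow> tent n R l = 0"
  by (auto simp: tent_def)

lemma tent_Suc: "\<bar>tent n R l - tent n R (Suc l)\<bar> \<le> 1"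
  by (auto simp: tent_def min_def max_def abs_if)

lemma tent_eq: "2 * \<bar>real l - real n\<bar> \<le> real R \<Longrightarrow> tent n R l = \<bar>real l - real n\<bar>"
  by (simp add: tent_def)

section \<open>Off-diagonal decay by a weighted energy\<close>

context orthonormal_polys
begin

text \<open>Entries of the matrix of multiplication by \<open>x\<close>, before the identity is
  subtracted.\<close>

definition X where "X l m = (\<integral>x. x * poly (p l) x * poly (p m) x \<partial>M)"

lemma X_sym: "X l m = X m l" by (simp add: X_def mult_ac)

lemma X_zero: "l + 1 < m \<Longrightarrow> X l m = 0"
proof -
  assume lm: "l + 1 < m"
  have "(\<integral>x. poly (pCons 0 (p l)) x * poly (p m) x \<partial>M) = 0"
  proof (rule orth_low[where L = "l + 2"])
    fix i assume "l + 2 \<le> i"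
    then show "coeff (pCons 0 (p l)) i = 0" using deg(1)[of l] by (cases i) (auto intro!: coeff_eq_0)
  qed (use lm in auto)
  then show ?thesis by (simp add: X_def)
qed

lemma X_le: "\<bar>X l m\<bar> \<le> 1"
proof -
  have "\<bar>X l m\<bar> \<le> (\<integral>x. \<bar>x * poly (p l) x * poly (p m) x\<bar> \<partial>M)" unfolding X_def by (rule integral_abs_bound)
  also have "\<dots> \<le> (\<integral>x. (1/2) * (poly (p l) x * poly (p l) x) + (1/2) * (poly (p m) x * poly (p m) x) \<partial>M)"
  proof (rule integral_mono_AE)
    show "AE x in M. \<bar>x * poly (p l) x * poly (p m) x\<bar> \<le> (1/2) * (poly (p l) x * poly (p l) x) + (1/2) * (poly (p m) x * poly (p m) x)"
      using supp
    proof eventually_elim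
      case (elim x)
      define a b where "a = poly (p l) x" and "b = poly (p m) x"
      have "\<bar>x\<bar> * \<bar>a * b\<bar> \<le> 1 * \<bar>a * b\<bar>" using elim by (intro mult_right_mono) auto
      also have "\<dots> \<le> (1/2) * (a * a) + (1/2) * (b * b)"
        using sum_squares_bound[of "\<bar>a\<bar>" "\<bar>b\<bar>"] by (simp add: abs_mult power2_eq_square)
      finally show ?case by (simp add: a_def b_def abs_mult mult_ac)
    qed
  qed (intro integrable_cont continuous_intros)+
  also have "\<dots> = 1"
    by (subst Bochner_Integration.integral_add) (auto intro!: integrable_cont continuous_intros simp: orth)
  finally show ?thesis .
qed

text \<open>For \<open>l < L\<close> the polynomial \<open>x p_l\<close> has degree at most
  \<open>L\<close>, so the generator acts on this entry by a finite sum over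
  \<open>{..L}\<close>.\<close>

lemma \<kappa>_recurrence:
  assumes "l < L"
  shows "\<kappa> 1 t n l = (\<Sum>m\<le>L. X l m * \<kappa> 0 t n m) - \<kappa> 0 t n l"
proof -
  define q where "q = pCons 0 (p l)"
  have "coeff q i = 0" if "Suc L \<le> i" for i
    using that assms deg(1)[of l] unfolding q_def by (cases i) (auto intro!: coeff_eq_0)
  then have q: "q = (\<Sum>m<Suc L. smult (\<integral>x. poly q x * poly (p m) x \<partial>M) (p m))" by (rule expand)
  have "(\<integral>x. poly q x * poly (p m) x \<partial>M) = X l m" for m by (simp add: q_def X_def)
  with q have "q = (\<Sum>m\<le>L. smult (X l m) (p m))" by (simp add: lessThan_Suc_atMost)
  then have "poly q x = poly (\<Sum>m\<le>L. smult (X l m) (p m)) x" for x by simp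
  then have qx: "x * poly (p l) x = (\<Sum>m\<le>L. X l m * poly (p m) x)" for x by (simp add: q_def poly_sum)
  have i: "integrable M (\<lambda>x. exp (t * (x - 1)) * poly (p n) x * poly (p m) x)" for m
    by (intro integrable_cont continuous_intros)
  have "(x - 1) ^ 1 * exp (t * (x - 1)) * poly (p n) x * poly (p l) x
     = (\<Sum>m\<le>L. X l m * (exp (t * (x - 1)) * poly (p n) x * poly (p m) x)) - exp (t * (x - 1)) * poly (p n) x * poly (p l) x" for x
  proof -
    define e where "e = exp (t * (x - 1)) * poly (p n) x"
    have "(x - 1) ^ 1 * exp (t * (x - 1)) * poly (p n) x * poly (p l) x = e * (x * poly (p l) x) - e * poly (p l) x"
      by (simp add: e_def algebra_simps)
    also have "e * (x * poly (p l) x) = (\<Sum>m\<le>L. X l m * (e * poly (p m) x))"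
      unfolding qx sum_distrib_left by (intro sum.cong refl) simp
    finally show ?thesis by (simp add: e_def)
  qed
  then have "\<kappa> 1 t n l = (\<integral>x. (\<Sum>m\<le>L. X l m * (exp (t * (x - 1)) * poly (p n) x * poly (p m) x)) - exp (t * (x - 1)) * poly (p n) x * poly (p l) x \<partial>M)"
    unfolding \<kappa>_def by presburger
  also have "\<dots> = (\<integral>x. (\<Sum>m\<le>L. X l m * (exp (t * (x - 1)) * poly (p n) x * poly (p m) x)) \<partial>M) - \<kappa> 0 t n l"
    using i by (subst Bochner_Integration.integral_diff) (auto simp: \<kappa>_def)
  also have "(\<integral>x. (\<Sum>m\<le>L. X l m * (exp (t * (x - 1)) * poly (p n) x * poly (p m) x)) \<partial>M) = (\<Sum>m\<le>L. X l m * \<kappa> 0 t n m)"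
    using i by (subst Bochner_Integration.integral_sum) (auto simp: \<kappa>_def)
  finally show ?thesis .
qed

text \<open>The matrix is at most the identity because \<open>x \<le> 1\<close> on the support; this
  is the dissipativity of the generator.\<close>

lemma X_form_le: "(\<Sum>l\<le>L. \<Sum>m\<le>L. X l m * v l * v m) \<le> (\<Sum>l\<le>L. (v l)\<^sup>2)"
proof -
  define q where "q x = (\<Sum>l\<le>L. v l * poly (p l) x)" for x
  have i: "integrable M (\<lambda>x. x * poly (p l) x * poly (p m) x)" "integrable M (\<lambda>x. poly (p l) x * poly (p m) x)" for l m
    by (intro integrable_cont continuous_intros)+
  have q2: "(q x)\<^sup>2 = (\<Sum>l\<le>L. \<Sum>m\<le>L. v l * v m * (poly (p l) x * poly (p m) x))" for x
    unfolding q_def power2_eq_square sum_product by (intro sum.cong refl) (simp add: mult_ac)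
  have xq2: "x * (q x)\<^sup>2 = (\<Sum>l\<le>L. \<Sum>m\<le>L. v l * v m * (x * poly (p l) x * poly (p m) x))" for x
    unfolding q2 sum_distrib_left by (intro sum.cong refl) (simp add: mult_ac)
  have cq: "continuous_on UNIV q" unfolding q_def by (intro continuous_intros)
  have "(\<integral>x. x * (q x)\<^sup>2 \<partial>M) \<le> (\<integral>x. (q x)\<^sup>2 \<partial>M)"
  proof (rule integral_mono_AE)
    show "AE x in M. x * (q x)\<^sup>2 \<le> (q x)\<^sup>2"
      using supp
    proof eventually_elim
      case (elim x)
      then show ?case using mult_right_mono[of x 1 "(q x)\<^sup>2"] by simp
    qed
  qed (intro integrable_cont continuous_intros cq)+
  also have "(\<integral>x. x * (q x)\<^sup>2 \<partial>M) = (\<Sum>l\<le>L. \<Sum>m\<le>L. v l * v m * X l m)"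
    unfolding xq2 X_def using i by simp
  also have "(\<integral>x. (q x)\<^sup>2 \<partial>M) = (\<Sum>l\<le>L. \<Sum>m\<le>L. v l * v m * (if l = m then 1 else 0))"
    unfolding q2 using i by (simp add: orth)
  also have "\<dots> = (\<Sum>l\<le>L. (v l)\<^sup>2)"
    by (intro sum.cong refl) (simp add: if_distrib[of "\<lambda>t. _ * t"] sum.delta power2_eq_square cong: if_cong)
  finally show ?thesis by (simp add: mult_ac)
qed

text \<open>After symmetrizing in \<open>l\<close> and \<open>m\<close>, the weight is
  \<open>2 * \<psi> l * \<psi> m\<close> plus the squared difference of \<open>\<psi>\<close>. The
  product part is dissipative by \<open>X_form_le\<close>; the squared difference survives only
  between neighbours, with matrix entries at most 1. The last row, out of reach of
  \<open>\<kappa>_recurrence\<close>, is multiplied by \<open>\<psi> L = 0\<close>.\<close>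

lemma energy_deriv_le:
  fixes \<psi> :: "nat \<Rightarrow> real"
  assumes \<psi>L: "\<psi> L = 0" and \<delta>: "\<And>l. l \<le> L \<Longrightarrow> \<delta> l \<ge> 0"
    and lip: "\<And>l. Suc l \<le> L \<Longrightarrow> (\<psi> l - \<psi> (Suc l))\<^sup>2 \<le> \<delta> l \<and> (\<psi> l - \<psi> (Suc l))\<^sup>2 \<le> \<delta> (Suc l)"
  shows "(\<Sum>l\<le>L. 2 * (\<psi> l)\<^sup>2 * (\<kappa> 0 t n l * \<kappa> 1 t n l)) \<le> 2 * (\<Sum>l\<le>L. \<delta> l * (\<kappa> 0 t n l)\<^sup>2)"
proof -
  define u where "u l = \<kappa> 0 t n l" for l
  have "(\<Sum>l\<le>L. 2 * (\<psi> l)\<^sup>2 * (u l * \<kappa> 1 t n l)) = (\<Sum>l\<le>L. 2 * (\<psi> l)\<^sup>2 * (u l * ((\<Sum>m\<le>L. X l m * u m) - u l)))"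
  proof (intro sum.cong refl)
    fix l assume "l \<in> {..L}"
    then show "2 * (\<psi> l)\<^sup>2 * (u l * \<kappa> 1 t n l) = 2 * (\<psi> l)\<^sup>2 * (u l * ((\<Sum>m\<le>L. X l m * u m) - u l))"
      using \<psi>L \<kappa>_recurrence[of l L t n] by (cases "l = L") (auto simp: u_def)
  qed
  also have "\<dots> = 2 * (\<Sum>l\<le>L. \<Sum>m\<le>L. (\<psi> l)\<^sup>2 * (X l m * u l * u m)) - 2 * (\<Sum>l\<le>L. (\<psi> l * u l)\<^sup>2)"
    unfolding right_diff_distrib sum_subtractf sum_distrib_left by (simp add: power2_eq_square mult_ac)
  also have "2 * (\<Sum>l\<le>L. \<Sum>m\<le>L. (\<psi> l)\<^sup>2 * (X l m * u l * u m))
     = (\<Sum>l\<le>L. \<Sum>m\<le>L. ((\<psi> l)\<^sup>2 + (\<psi> m)\<^sup>2) * (X l m * u l * u m))"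
  proof -
    have "(\<Sum>l\<le>L. \<Sum>m\<le>L. (\<psi> l)\<^sup>2 * (X l m * u l * u m)) = (\<Sum>l\<le>L. \<Sum>m\<le>L. (\<psi> m)\<^sup>2 * (X l m * u l * u m))"
      by (subst sum.swap) (intro sum.cong refl, simp add: X_sym mult_ac)
    then show ?thesis by (simp add: distrib_right sum.distrib)
  qed
  also have "\<dots> = 2 * (\<Sum>l\<le>L. \<Sum>m\<le>L. X l m * (\<psi> l * u l) * (\<psi> m * u m)) + (\<Sum>l\<le>L. \<Sum>m\<le>L. (\<psi> l - \<psi> m)\<^sup>2 * (X l m * u l * u m))"
    unfolding sum_distrib_left sum.distrib[symmetric] by (intro sum.cong refl) (simp add: power2_eq_square algebra_simps)
  also have "\<dots> - 2 * (\<Sum>l\<le>L. (\<psi> l * u l)\<^sup>2) \<le> (\<Sum>l\<le>L. \<Sum>m\<le>L. (\<psi> l - \<psi> m)\<^sup>2 * (X l m * u l * u m))"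
    using X_form_le[of "\<lambda>l. \<psi> l * u l" L] by simp
  also have "\<dots> \<le> (\<Sum>l\<le>L. \<Sum>m\<le>L. (if m = Suc l \<or> l = Suc m then (\<delta> l * (u l)\<^sup>2 + \<delta> m * (u m)\<^sup>2) / 2 else 0))"
  proof (intro sum_mono)
    fix l m assume lm: "l \<in> {..L}" "m \<in> {..L}"
    show "(\<psi> l - \<psi> m)\<^sup>2 * (X l m * u l * u m) \<le> (if m = Suc l \<or> l = Suc m then (\<delta> l * (u l)\<^sup>2 + \<delta> m * (u m)\<^sup>2) / 2 else 0)"
    proof (cases "m = Suc l \<or> l = Suc m")
      case False
      have "l = m \<or> X l m = 0"
        using X_zero[of l m] X_zero[of m l] X_sym[of l m] False by linarith
      then show ?thesis using False by auto
    next
      case True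
      have d: "(\<psi> l - \<psi> m)\<^sup>2 \<le> \<delta> l" "(\<psi> l - \<psi> m)\<^sup>2 \<le> \<delta> m"
        using True lip[of l] lip[of m] lm by (auto simp: power2_commute)
      have "X l m * u l * u m \<le> \<bar>X l m\<bar> * \<bar>u l * u m\<bar>" by (metis abs_ge_self abs_mult mult.assoc)
      also have "\<dots> \<le> 1 * \<bar>u l * u m\<bar>" by (intro mult_right_mono X_le) auto
      also have "\<dots> \<le> ((u l)\<^sup>2 + (u m)\<^sup>2) / 2" using sum_squares_bound[of "\<bar>u l\<bar>" "\<bar>u m\<bar>"] by (simp add: abs_mult)
      finally have "(\<psi> l - \<psi> m)\<^sup>2 * (X l m * u l * u m) \<le> (\<psi> l - \<psi> m)\<^sup>2 * (((u l)\<^sup>2 + (u m)\<^sup>2) / 2)" by (intro mult_left_mono) auto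
      also have "\<dots> = ((\<psi> l - \<psi> m)\<^sup>2 * (u l)\<^sup>2 + (\<psi> l - \<psi> m)\<^sup>2 * (u m)\<^sup>2) / 2" by (simp add: distrib_left)
      also have "\<dots> \<le> (\<delta> l * (u l)\<^sup>2 + \<delta> m * (u m)\<^sup>2) / 2" using d by (intro divide_right_mono add_mono mult_right_mono) auto
      finally show ?thesis using True by simp
    qed
  qed
  \<comment> \<open>Each index has at most two neighbours, and every pair is counted in both
    orders.\<close>
  also have "\<dots> \<le> (\<Sum>l\<le>L. 2 * (\<delta> l * (u l)\<^sup>2))"
  proof -
    define w where "w l = \<delta> l * (u l)\<^sup>2" for l
    have w: "0 \<le> w l" if "l \<le> L" for l using \<delta>[OF that] by (simp add: w_def)
    define S where "S f = (\<Sum>l\<le>L. \<Sum>m\<le>L. (if m = Suc l \<or> l = Suc m then f l m else (0::real)))" for f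
    have "S (\<lambda>l m. (w l + w m) / 2) = S (\<lambda>l m. w l / 2) + S (\<lambda>l m. w m / 2)"
      unfolding S_def sum.distrib[symmetric] by (intro sum.cong refl) (simp add: add_divide_distrib)
    also have "S (\<lambda>l m. w m / 2) = S (\<lambda>l m. w l / 2)"
      unfolding S_def by (subst sum.swap) (intro sum.cong refl, auto)
    also have "S (\<lambda>l m. w l / 2) \<le> (\<Sum>l\<le>L. w l)"
      unfolding S_def
    proof (rule sum_mono)
      fix l assume l: "l \<in> {..L}"
      have "(\<Sum>m\<le>L. (if m = Suc l \<or> l = Suc m then w l / 2 else 0)) = (\<Sum>m\<in>{m\<in>{..L}. m = Suc l \<or> l = Suc m}. w l / 2)"
        by (rule sum.inter_filter[symmetric]) simp
      also have "\<dots> = real (card {m\<in>{..L}. m = Suc l \<or> l = Suc m}) * (w l / 2)" by simp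
      also have "\<dots> \<le> 2 * (w l / 2)"
      proof (rule mult_right_mono)
        have "{m\<in>{..L}. m = Suc l \<or> l = Suc m} \<subseteq> {Suc l, l - 1}" by auto
        then have "card {m\<in>{..L}. m = Suc l \<or> l = Suc m} \<le> card {Suc l, l - 1}" by (intro card_mono) auto
        also have "\<dots> \<le> 2" by (simp add: card_insert_if)
        finally show "real (card {m\<in>{..L}. m = Suc l \<or> l = Suc m}) \<le> 2" by simp
      qed (use w[of l] l in auto)
      finally show "(\<Sum>m\<le>L. (if m = Suc l \<or> l = Suc m then w l / 2 else 0)) \<le> w l" by simp
    qed
    finally have "S (\<lambda>l m. (w l + w m) / 2) \<le> (\<Sum>l\<le>L. 2 * w l)" by (simp flip: sum_distrib_left)
    then show ?thesis unfolding S_def w_def .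
  qed
  finally show ?thesis by (simp add: u_def sum_distrib_left)
qed

lemma \<kappa>_l2: "0 \<le> t \<Longrightarrow> (\<Sum>l<L. (\<kappa> 0 t n l)\<^sup>2) \<le> A0 / sqrt (1 + t)"
proof -
  assume t: "0 \<le> t"
  have "(\<Sum>l<L. (\<integral>x. exp (t * (x - 1)) * poly (p n) x * poly (p l) x \<partial>M)\<^sup>2) \<le> (\<integral>x. (exp (t * (x - 1)) * poly (p n) x)\<^sup>2 \<partial>M)"
    by (intro bessel_le continuous_intros)
  also have "(\<integral>x. (exp (t * (x - 1)) * poly (p n) x)\<^sup>2 \<partial>M) = (\<integral>x. exp (2 * t * (x - 1)) * (poly (p n) x)\<^sup>2 \<partial>M)"
    by (simp add: power_mult_distrib mult.assoc flip: exp_double)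
  also have "\<dots> \<le> A0 / sqrt (1 + 2 * t)" using t by (intro diag) auto
  also have "\<dots> \<le> A0 / sqrt (1 + t)" using t A0_pos by (intro divide_left_mono) auto
  finally show ?thesis by (simp add: \<kappa>_def)
qed

lemma inverse_sqrt_powr: "0 \<le> t \<Longrightarrow> A0 / sqrt (1 + t) = A0 * (1 + t) powr (- (1/2))" for t :: real
  by (simp add: powr_minus_divide powr_half_sqrt)

text \<open>The weight \<open>tent\<close> is the distance to \<open>n\<close>, cut off so that every sum is finite. It changes by at most 1 between
  neighbours, so its commutator with the tridiagonal matrix lowers the power of the weight.\<close>

lemma energy_bound:
  "\<exists>C>0. \<forall>n R t. 0 \<le> t \<longrightarrow> (\<Sum>l\<le>n + R. tent n R l ^ (2 * j) * (\<kappa> 0 t n l)\<^sup>2) \<le> C * (1 + t) powr (real j - 1/2)"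
proof (induction j)
  case 0
  show ?case
  proof (intro exI[of _ A0] conjI A0_pos allI impI)
    fix n R :: nat and t :: real assume t: "0 \<le> t"
    show "(\<Sum>l\<le>n + R. tent n R l ^ (2 * 0) * (\<kappa> 0 t n l)\<^sup>2) \<le> A0 * (1 + t) powr (real 0 - 1/2)"
      using \<kappa>_l2[OF t, of n "Suc (n + R)"] unfolding inverse_sqrt_powr[OF t] by (simp add: lessThan_Suc_atMost)
  qed
next
  case (Suc j)
  then obtain C where C: "0 < C" "\<And>n R t. 0 \<le> t \<Longrightarrow> (\<Sum>l\<le>n + R. tent n R l ^ (2 * j) * (\<kappa> 0 t n l)\<^sup>2) \<le> C * (1 + t) powr (real j - 1/2)" by blast
  \<comment> \<open>\<open>power_diff_le\<close> bounds the jump of \<open>\<psi>\<close> by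
    \<open>Suc j\<close> times \<open>(a + 1) ^ j\<close>, and \<open>power_add_one_le\<close> opens
    the square of that bound.\<close>
  define c where "c = (real (Suc j))\<^sup>2 * 2 ^ (2 * j)"
  define C' where "C' = 2 * c * (C + A0) / (real j + 1/2)"
  have c: "0 < c" by (simp add: c_def)
  show ?case
  proof (intro exI[of _ C'] conjI allI impI)
    show "0 < C'" using c C A0_pos by (simp add: C'_def add_nonneg_pos)
    fix n R :: nat and t :: real assume t: "0 \<le> t"
    define \<psi> where "\<psi> l = tent n R l ^ Suc j" for l
    define E where "E s = (\<Sum>l\<le>n + R. (\<psi> l)\<^sup>2 * (\<kappa> 0 s n l)\<^sup>2)" for s
    \<comment> \<open>A majorant whose derivative is the bound obtained for that of
      \<open>E\<close>. It starts above \<open>E\<close>: at time 0 the kernel is the identity and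
      the weight vanishes at \<open>n\<close>, so \<open>E 0 = 0\<close>.\<close>
    define G where "G s = C' * (1 + s) powr (real j + 1/2)" for s
    have "G 0 - E 0 \<le> G t - E t"
    proof (rule DERIV_nonneg_imp_nondecreasing[OF t])
      fix s assume s: "0 \<le> s" "s \<le> t"
      have dE: "(E has_real_derivative (\<Sum>l\<le>n + R. 2 * (\<psi> l)\<^sup>2 * (\<kappa> 0 s n l * \<kappa> 1 s n l))) (at s)"
        unfolding E_def using \<kappa>_deriv[of 0] by (auto intro!: derivative_eq_intros simp: mult_ac)
      have dG: "(G has_real_derivative C' * ((real j + 1/2) * (1 + s) powr (real j - 1/2))) (at s)"
        unfolding G_def using s by (auto intro!: derivative_eq_intros simp: field_simps)
      have "(\<Sum>l\<le>n + R. 2 * (\<psi> l)\<^sup>2 * (\<kappa> 0 s n l * \<kappa> 1 s n l)) \<le> 2 * (\<Sum>l\<le>n + R. (c * (tent n R l ^ (2 * j) + 1)) * (\<kappa> 0 s n l)\<^sup>2)"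
      proof (rule energy_deriv_le)
        show "\<psi> (n + R) = 0" by (simp add: \<psi>_def tent_out)
        show "0 \<le> c * (tent n R l ^ (2 * j) + 1)" for l using c tent_nonneg by simp
        have key: "(a ^ Suc j - b ^ Suc j)\<^sup>2 \<le> c * (a ^ (2 * j) + 1)" if "0 \<le> a" "0 \<le> b" "\<bar>a - b\<bar> \<le> 1" for a b :: real
        proof -
          have "\<bar>a ^ Suc j - b ^ Suc j\<bar>\<^sup>2 \<le> (real (Suc j) * (a + 1) ^ j)\<^sup>2" using power_diff_le[OF that, of j] by (intro power_mono) auto
          also have "\<dots> = (real (Suc j))\<^sup>2 * (a + 1) ^ (2 * j)" by (simp only: power_mult_distrib power_mult[symmetric] mult.commute)
          also have "\<dots> \<le> (real (Suc j))\<^sup>2 * (2 ^ (2 * j) * (a ^ (2 * j) + 1))" using that by (intro mult_left_mono power_add_one_le) auto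
          finally show ?thesis by (simp add: c_def mult.assoc)
        qed
        show "(\<psi> l - \<psi> (Suc l))\<^sup>2 \<le> c * (tent n R l ^ (2 * j) + 1) \<and> (\<psi> l - \<psi> (Suc l))\<^sup>2 \<le> c * (tent n R (Suc l) ^ (2 * j) + 1)" for l
          using key[OF tent_nonneg tent_nonneg tent_Suc[of n R l]] key[OF tent_nonneg tent_nonneg, of n R "Suc l" n R l] tent_Suc[of n R l]
          unfolding \<psi>_def by (simp add: power2_commute abs_minus_commute)
      qed
      also have "\<dots> = 2 * c * ((\<Sum>l\<le>n + R. tent n R l ^ (2 * j) * (\<kappa> 0 s n l)\<^sup>2) + (\<Sum>l\<le>n + R. (\<kappa> 0 s n l)\<^sup>2))"
        by (simp add: sum_distrib_left sum.distrib[symmetric] algebra_simps)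
      also have "\<dots> \<le> 2 * c * (C * (1 + s) powr (real j - 1/2) + A0 * (1 + s) powr (real j - 1/2))"
      proof (intro mult_left_mono add_mono C(2) s)
        have "(\<Sum>l\<le>n + R. (\<kappa> 0 s n l)\<^sup>2) \<le> A0 * (1 + s) powr (- (1/2))"
          using \<kappa>_l2[OF s(1), of n "Suc (n + R)"] unfolding inverse_sqrt_powr[OF s(1)] by (simp add: lessThan_Suc_atMost)
        also have "\<dots> \<le> A0 * (1 + s) powr (real j - 1/2)" using A0_pos s by (intro mult_left_mono powr_mono) auto
        finally show "(\<Sum>l\<le>n + R. (\<kappa> 0 s n l)\<^sup>2) \<le> A0 * (1 + s) powr (real j - 1/2)" .
      qed (use c in auto)
      also have "\<dots> = C' * ((real j + 1/2) * (1 + s) powr (real j - 1/2))"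
      proof -
        have "real j + 1/2 \<noteq> 0" by simp
        moreover have "a / b * b = a" if "b \<noteq> 0" for a b :: real using that by simp
        ultimately have "C' * (real j + 1/2) = 2 * c * (C + A0)" unfolding C'_def by blast
        then show ?thesis by (simp only: mult.assoc[symmetric] distrib_right[symmetric])
      qed
      finally show "\<exists>y. ((\<lambda>s. G s - E s) has_real_derivative y) (at s) \<and> 0 \<le> y"
        using DERIV_diff[OF dG dE] by (intro exI conjI) auto
    qed
    moreover have "E 0 = 0" unfolding E_def
    proof (intro sum.neutral ballI)
      fix l
      have "\<kappa> 0 0 n l = (if n = l then 1 else 0)" by (simp add: \<kappa>_def orth)
      then show "(\<psi> l)\<^sup>2 * (\<kappa> 0 0 n l)\<^sup>2 = 0" by (auto simp: \<psi>_def tent_self)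
    qed
    moreover have "0 \<le> G 0" using c C A0_pos by (simp add: G_def C'_def)
    ultimately have "E t \<le> G t" by simp
    moreover have "(\<psi> l)\<^sup>2 = tent n R l ^ (2 * Suc j)" for l unfolding \<psi>_def by (simp only: power_mult[symmetric] mult.commute)
    moreover have "real (Suc j) - 1/2 = real j + 1/2" by simp
    ultimately show "(\<Sum>l\<le>n + R. tent n R l ^ (2 * Suc j) * (\<kappa> 0 t n l)\<^sup>2) \<le> C' * (1 + t) powr (real (Suc j) - 1/2)"
      unfolding E_def G_def by (simp only:)
  qed
qed

end

section \<open>Pointwise kernel bounds by interpolation in time\<close>

context orthonormal_polys
begin

lemma power8_dist: "(real n - real m) ^ 8 \<le> 128 * ((real l - real n) ^ 8 + (real l - real m) ^ 8)"
proof -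
  have two: "(a + b)\<^sup>2 \<le> 2 * (a\<^sup>2 + b\<^sup>2)" for a b :: real
    using sum_squares_bound[of a b] by (simp add: power2_sum)
  have four: "(a + b) ^ 4 \<le> 8 * (a ^ 4 + b ^ 4)" if "0 \<le> a" "0 \<le> b" for a b :: real
  proof -
    have "((a + b)\<^sup>2)\<^sup>2 \<le> (2 * (a\<^sup>2 + b\<^sup>2))\<^sup>2" using two by (intro power_mono) auto
    also have "\<dots> = 4 * (a\<^sup>2 + b\<^sup>2)\<^sup>2" by (simp only: power_mult_distrib) simp
    also have "\<dots> \<le> 4 * (2 * ((a\<^sup>2)\<^sup>2 + (b\<^sup>2)\<^sup>2))" by (intro mult_left_mono two) auto
    finally show ?thesis by (simp flip: power_mult)
  qed
  have "(real n - real m)\<^sup>2 \<le> 2 * ((real l - real n)\<^sup>2 + (real l - real m)\<^sup>2)"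
    using two[of "real n - real l" "real l - real m"] by (simp add: power2_commute)
  then have "((real n - real m)\<^sup>2) ^ 4 \<le> (2 * ((real l - real n)\<^sup>2 + (real l - real m)\<^sup>2)) ^ 4" by (intro power_mono) auto
  also have "\<dots> = 16 * ((real l - real n)\<^sup>2 + (real l - real m)\<^sup>2) ^ 4" by (simp only: power_mult_distrib) simp
  also have "\<dots> \<le> 16 * (8 * (((real l - real n)\<^sup>2) ^ 4 + ((real l - real m)\<^sup>2) ^ 4))" by (intro mult_left_mono four) auto
  finally show ?thesis by (simp flip: power_mult)
qed

text \<open>The semigroup law writes the kernel at time \<open>2 * t\<close> through two kernels at
  time \<open>t\<close>. The distance from \<open>n\<close> to \<open>m\<close> is shared between
  them; the moment of order 16 from \<open>energy_bound\<close> controls the factor that carries the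
  distance, \<open>\<kappa>_l2\<close> the other, and the powers \<open>\<rho> ^ 4\<close> balance
  the two.\<close>

lemma \<kappa>_decay: "\<exists>C>0. \<forall>n m t. 0 \<le> t \<longrightarrow> (real n - real m) ^ 8 * \<bar>\<kappa> 0 t n m\<bar> \<le> C * (1 + t) ^ 3 * sqrt (1 + t)"
proof -
  obtain C where C: "0 < C" "\<And>n R t. 0 \<le> t \<Longrightarrow> (\<Sum>l\<le>n + R. tent n R l ^ (2 * 8) * (\<kappa> 0 t n l)\<^sup>2) \<le> C * (1 + t) powr (real 8 - 1/2)"
    using energy_bound[of 8] by auto
  have half: "(1 + t) powr (real 8 - 1/2) = (1 + t) ^ 8 / sqrt (1 + t)" if "0 \<le> t" for t :: real
    using that unfolding powr_diff by (simp add: powr_half_sqrt)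
  have moment: "(\<Sum>l<N. (real l - real n) ^ 16 * (\<kappa> 0 t n l)\<^sup>2) \<le> C * ((1 + t) ^ 8 / sqrt (1 + t))" if t: "0 \<le> t" for t n N
  proof -
    define R where "R = 2 * (n + N)"
    have "(\<Sum>l<N. (real l - real n) ^ 16 * (\<kappa> 0 t n l)\<^sup>2) = (\<Sum>l<N. tent n R l ^ (2 * 8) * (\<kappa> 0 t n l)\<^sup>2)"
    proof (intro sum.cong refl)
      fix l assume "l \<in> {..<N}"
      then have "real l < real N" by simp
      then have "2 * \<bar>real l - real n\<bar> \<le> real R" by (simp add: R_def abs_if)
      then have "tent n R l = \<bar>real l - real n\<bar>" by (rule tent_eq)
      then show "(real l - real n) ^ 16 * (\<kappa> 0 t n l)\<^sup>2 = tent n R l ^ (2 * 8) * (\<kappa> 0 t n l)\<^sup>2" by simp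
    qed
    also have "\<dots> \<le> (\<Sum>l\<le>n + R. tent n R l ^ (2 * 8) * (\<kappa> 0 t n l)\<^sup>2)"
      by (intro sum_mono2) (auto simp: R_def tent_nonneg)
    also have "\<dots> \<le> C * ((1 + t) ^ 8 / sqrt (1 + t))" using C(2)[OF t] half[OF t] by simp
    finally show ?thesis .
  qed
  define C' where "C' = 128 * (C + A0)"
  have step: "(real n - real m) ^ 8 * \<bar>\<kappa> 0 (t + t) n m\<bar> \<le> C' * ((1 + t) ^ 4 / sqrt (1 + t))" if t: "0 \<le> t" for t n m
  proof -
    define \<rho> where "\<rho> = 1 + t"
    have \<rho>: "0 < \<rho>" using t by (simp add: \<rho>_def)
    define u v where "u l = \<kappa> 0 t n l" and "v l = \<kappa> 0 t m l" for l
    have "(\<lambda>l. u l * v l) sums \<kappa> 0 (t + t) n m" using \<kappa>_semigroup[of t n t m] \<kappa>_sym[of 0 t _ m] by (simp add: u_def v_def)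
    then have "(\<lambda>N. (real n - real m) ^ 8 * \<bar>\<Sum>l<N. u l * v l\<bar>) \<longlonglongrightarrow> (real n - real m) ^ 8 * \<bar>\<kappa> 0 (t + t) n m\<bar>"
      unfolding sums_def by (intro tendsto_intros)
    moreover have "(real n - real m) ^ 8 * \<bar>\<Sum>l<N. u l * v l\<bar> \<le> C' * ((1 + t) ^ 4 / sqrt (1 + t))" for N
    proof -
      have am: "a ^ 8 * \<bar>x * y\<bar> \<le> (a ^ 16 * x\<^sup>2 / \<rho> ^ 4 + \<rho> ^ 4 * y\<^sup>2) / 2" for a x y :: real
      proof -
        have "0 \<le> (a ^ 8 * \<bar>x\<bar> / \<rho> ^ 4 - \<bar>y\<bar>)\<^sup>2 * \<rho> ^ 4" using \<rho> by simp
        also have "\<dots> = (a ^ 8)\<^sup>2 * x\<^sup>2 / \<rho> ^ 4 + \<rho> ^ 4 * y\<^sup>2 - 2 * (a ^ 8 * (\<bar>x\<bar> * \<bar>y\<bar>))"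
          using \<rho> by (simp add: power2_diff power_divide power_mult_distrib field_simps power2_eq_square)
        finally show ?thesis by (simp add: abs_mult flip: power_mult)
      qed
      have "(real n - real m) ^ 8 * \<bar>\<Sum>l<N. u l * v l\<bar> \<le> (real n - real m) ^ 8 * (\<Sum>l<N. \<bar>u l * v l\<bar>)"
        by (intro mult_left_mono sum_abs) simp
      also have "\<dots> = (\<Sum>l<N. (real n - real m) ^ 8 * \<bar>u l * v l\<bar>)" by (rule sum_distrib_left)
      also have "\<dots> \<le> (\<Sum>l<N. 64 * ((real l - real n) ^ 16 * (u l)\<^sup>2 / \<rho> ^ 4 + \<rho> ^ 4 * (v l)\<^sup>2)
          + 64 * ((real l - real m) ^ 16 * (v l)\<^sup>2 / \<rho> ^ 4 + \<rho> ^ 4 * (u l)\<^sup>2))"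
      proof (rule sum_mono)
        fix l
        have "(real n - real m) ^ 8 * \<bar>u l * v l\<bar> \<le> 128 * ((real l - real n) ^ 8 + (real l - real m) ^ 8) * \<bar>u l * v l\<bar>"
          by (intro mult_right_mono power8_dist) auto
        also have "\<dots> = 128 * ((real l - real n) ^ 8 * \<bar>u l * v l\<bar>) + 128 * ((real l - real m) ^ 8 * \<bar>v l * u l\<bar>)" by (simp add: algebra_simps)
        also have "\<dots> \<le> 128 * (((real l - real n) ^ 16 * (u l)\<^sup>2 / \<rho> ^ 4 + \<rho> ^ 4 * (v l)\<^sup>2) / 2) + 128 * (((real l - real m) ^ 16 * (v l)\<^sup>2 / \<rho> ^ 4 + \<rho> ^ 4 * (u l)\<^sup>2) / 2)"
          by (intro add_mono mult_left_mono am) auto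
        finally have "(real n - real m) ^ 8 * \<bar>u l * v l\<bar> \<le> \<dots>" .
        moreover have "128 * (z / 2) = 64 * z" for z :: real by simp
        ultimately show "(real n - real m) ^ 8 * \<bar>u l * v l\<bar> \<le> 64 * ((real l - real n) ^ 16 * (u l)\<^sup>2 / \<rho> ^ 4 + \<rho> ^ 4 * (v l)\<^sup>2)
          + 64 * ((real l - real m) ^ 16 * (v l)\<^sup>2 / \<rho> ^ 4 + \<rho> ^ 4 * (u l)\<^sup>2)" by (simp only:)
      qed
      also have "\<dots> = 64 * ((\<Sum>l<N. (real l - real n) ^ 16 * (u l)\<^sup>2) / \<rho> ^ 4 + \<rho> ^ 4 * (\<Sum>l<N. (v l)\<^sup>2))
          + 64 * ((\<Sum>l<N. (real l - real m) ^ 16 * (v l)\<^sup>2) / \<rho> ^ 4 + \<rho> ^ 4 * (\<Sum>l<N. (u l)\<^sup>2))"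
        by (simp only: sum.distrib sum_distrib_left[symmetric] sum_divide_distrib)
      also have "\<dots> \<le> 64 * (C * (\<rho> ^ 8 / sqrt \<rho>) / \<rho> ^ 4 + \<rho> ^ 4 * (A0 / sqrt \<rho>)) + 64 * (C * (\<rho> ^ 8 / sqrt \<rho>) / \<rho> ^ 4 + \<rho> ^ 4 * (A0 / sqrt \<rho>))"
        using \<rho> moment[OF t] \<kappa>_l2[OF t] unfolding u_def v_def \<rho>_def
        by (intro add_mono mult_left_mono divide_right_mono) auto
      also have "\<rho> ^ 8 / sqrt \<rho> = \<rho> ^ 4 * (\<rho> ^ 4 / sqrt \<rho>)" by (simp flip: power_add)
      also have "64 * (C * (\<rho> ^ 4 * (\<rho> ^ 4 / sqrt \<rho>)) / \<rho> ^ 4 + \<rho> ^ 4 * (A0 / sqrt \<rho>)) + 64 * (C * (\<rho> ^ 4 * (\<rho> ^ 4 / sqrt \<rho>)) / \<rho> ^ 4 + \<rho> ^ 4 * (A0 / sqrt \<rho>)) = C' * (\<rho> ^ 4 / sqrt \<rho>)"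
        using \<rho> by (simp add: C'_def field_simps)
      finally show ?thesis by (simp add: \<rho>_def)
    qed
    ultimately show ?thesis by (intro LIMSEQ_le_const2) auto
  qed
  have C': "0 < C'" using C A0_pos by (simp add: C'_def)
  show ?thesis
  proof (intro exI[of _ C'] conjI allI impI C')
    fix n m and t :: real assume t: "0 \<le> t"
    have "(real n - real m) ^ 8 * \<bar>\<kappa> 0 t n m\<bar> \<le> C' * ((1 + t / 2) ^ 4 / sqrt (1 + t / 2))"
      using step[of "t / 2" n m] t by simp
    also have "(1 + t / 2) ^ 4 / sqrt (1 + t / 2) = (1 + t / 2) ^ 3 * sqrt (1 + t / 2)"
    proof -
      have "x ^ 4 / sqrt x = x ^ 3 * sqrt x" if "0 < x" for x :: real
        using that by (simp add: field_simps power4_eq_xxxx power3_eq_cube)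
      then show ?thesis using t by simp
    qed
    also have "C' * ((1 + t / 2) ^ 3 * sqrt (1 + t / 2)) \<le> C' * ((1 + t) ^ 3 * sqrt (1 + t))"
      using t C' by (intro mult_left_mono mult_mono power_mono) auto
    finally show "(real n - real m) ^ 8 * \<bar>\<kappa> 0 t n m\<bar> \<le> C' * (1 + t) ^ 3 * sqrt (1 + t)" by (simp add: mult.assoc)
  qed
qed

text \<open>Two mean values: at some point of the step \<open>f'\<close> is small by the size of
  \<open>f\<close>, and from there it changes by at most \<open>h * H\<close>. The step
  \<open>h\<close> stays free for optimization.\<close>

lemma landau_kolmogorov:
  fixes f :: "real \<Rightarrow> real"
  assumes h: "0 < h" and f: "\<And>s. t \<le> s \<Longrightarrow> s \<le> t + h \<Longrightarrow> (f has_real_derivative f' s) (at s)"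
    and f': "\<And>s. t \<le> s \<Longrightarrow> s \<le> t + h \<Longrightarrow> (f' has_real_derivative f'' s) (at s)"
    and F: "\<bar>f t\<bar> \<le> F" "\<bar>f (t + h)\<bar> \<le> F" and H: "\<And>s. t \<le> s \<Longrightarrow> s \<le> t + h \<Longrightarrow> \<bar>f'' s\<bar> \<le> H"
  shows "\<bar>f' t\<bar> \<le> 2 * F / h + h * H"
proof -
  obtain s where s: "t < s" "s < t + h" "f (t + h) - f t = (t + h - t) * f' s"
    using MVT2[of t "t + h" f f'] h f by auto
  then have "f' s = (f (t + h) - f t) / h" using h by simp
  then have "\<bar>f' s\<bar> = \<bar>f (t + h) - f t\<bar> / h" using h by simp
  also have "\<dots> \<le> 2 * F / h" using F h by (intro divide_right_mono) auto
  finally have 1: "\<bar>f' s\<bar> \<le> 2 * F / h" .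
  obtain r where r: "t < r" "r < s" "f' s - f' t = (s - t) * f'' r"
    using MVT2[of t s f' f''] f' s by auto
  have "\<bar>f' s - f' t\<bar> = (s - t) * \<bar>f'' r\<bar>" using r s by (simp add: abs_mult)
  also have "\<dots> \<le> h * H" using H[of r] r s by (intro mult_mono) auto
  finally show ?thesis using 1 by linarith
qed

text \<open>For \<open>d \<le> \<rho>\<close> the on-diagonal bound suffices. Otherwise
  \<open>landau_kolmogorov\<close> combines the decay of \<open>\<kappa> k\<close> with the
  on-diagonal bound for \<open>\<kappa> (k + 2)\<close> into decay of
  \<open>\<kappa> (k + 1)\<close>, with half the power of |n - m|: 8, 4, 2. Hence on-diagonal bounds
  up to \<open>k = 3\<close> enter.\<close>

lemma \<kappa>_bound:
  "\<exists>A>0. \<forall>k n m t. k \<le> 2 \<longrightarrow> 0 \<le> t \<longrightarrow> \<bar>\<kappa> k t n m\<bar> \<le> A * sqrt (1 + t) / ((1 + t) ^ k * (1 + t + (real n - real m)\<^sup>2))"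
proof -
  obtain C0 where C0: "0 < C0" "\<And>n m t. 0 \<le> t \<Longrightarrow> (real n - real m) ^ 8 * \<bar>\<kappa> 0 t n m\<bar> \<le> C0 * (1 + t) ^ 3 * sqrt (1 + t)"
    using \<kappa>_decay by blast
  define B where "B = exp 1 * 2 ^ 3 * fact 3 * 2 * A0"
  have B: "0 < B" using A0_pos by (simp add: B_def)
  have diagB: "\<bar>\<kappa> k t n m\<bar> \<le> B / ((1 + t) ^ k * sqrt (1 + t))" if "k \<le> 3" "0 \<le> t" for k t n m
  proof -
    have "exp 1 * 2 ^ k * fact k * 2 * A0 \<le> B" unfolding B_def
      using that A0_pos by (intro mult_right_mono mult_mono power_increasing fact_mono) auto
    then have "exp 1 * 2 ^ k * fact k * 2 * A0 / ((1 + t) ^ k * sqrt (1 + t)) \<le> B / ((1 + t) ^ k * sqrt (1 + t))"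
      using that by (intro divide_right_mono) auto
    then show ?thesis using \<kappa>_diag_bound[OF that(2), of k n m] by linarith
  qed
  define C1 where "C1 = 32 * C0 + B"
  define C2 where "C2 = 4 * C1 + B"
  have C12: "0 < C1" "0 < C2" using C0 B by (auto simp: C1_def C2_def)
  have sq: "sqrt x * sqrt x = x" if "0 \<le> x" for x :: real using that by simp
  have mono: "B / ((1 + s) ^ k * sqrt (1 + s)) \<le> B / ((1 + t) ^ k * sqrt (1 + t))" if "0 \<le> t" "t \<le> s" for s t k
    using that B by (intro divide_left_mono mult_mono power_mono) (auto intro!: mult_pos_pos)
  have one: "(real n - real m) ^ 4 * \<bar>\<kappa> 1 t n m\<bar> \<le> C1 * sqrt (1 + t)" if t: "0 \<le> t" for t n m
  proof -
    define \<rho> where "\<rho> = 1 + t"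
    define d where "d = (real n - real m)\<^sup>2"
    have \<rho>: "1 \<le> \<rho>" using t by (simp add: \<rho>_def)
    have d4: "(real n - real m) ^ 4 = d\<^sup>2" "(real n - real m) ^ 8 = d ^ 4" unfolding d_def by (simp_all flip: power_mult)
    have d0: "0 \<le> d" by (simp add: d_def)
    have r: "sqrt \<rho> * sqrt \<rho> = \<rho>" "0 < sqrt \<rho>" using \<rho> by auto
    show ?thesis
    proof (cases "d \<le> \<rho>")
      case True
      have "d\<^sup>2 * \<bar>\<kappa> 1 t n m\<bar> \<le> \<rho>\<^sup>2 * (B / (\<rho> * sqrt \<rho>))"
        using True d0 diagB[of 1 t n m] t \<rho> by (intro mult_mono power_mono) (auto simp: \<rho>_def)
      also have "\<dots> = B * sqrt \<rho>"
      proof -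
        have "\<rho>\<^sup>2 * (B / (\<rho> * sqrt \<rho>)) = B * (\<rho> / sqrt \<rho>)" using \<rho> by (simp add: power2_eq_square)
        also have "\<rho> / sqrt \<rho> = sqrt \<rho>" using \<rho> by (simp add: real_div_sqrt)
        finally show ?thesis .
      qed
      also have "\<dots> \<le> C1 * sqrt \<rho>" using C0(1) \<rho> by (intro mult_right_mono) (auto simp: C1_def)
      finally show ?thesis by (simp add: d4 \<rho>_def)
    next
      case False
      then have d: "\<rho> < d" by simp
      \<comment> \<open>Balances the two terms of \<open>landau_kolmogorov\<close>. It is at most
        \<open>\<rho>\<close>, so all times in the step are comparable with
        \<open>1 + t\<close>.\<close>
      define h where "h = \<rho> ^ 3 / d\<^sup>2"
      have h: "0 < h" "h \<le> \<rho>"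
      proof -
        show "0 < h" using \<rho> d by (simp add: h_def)
        have "\<rho> ^ 3 = \<rho> * \<rho>\<^sup>2" by (simp add: power3_eq_cube power2_eq_square)
        also have "\<dots> \<le> \<rho> * d\<^sup>2" using \<rho> d by (intro mult_left_mono power_mono) auto
        finally show "h \<le> \<rho>" using \<rho> d by (simp add: h_def pos_divide_le_eq)
      qed
      define F where "F = C0 * (2 * \<rho>) ^ 3 * (2 * sqrt \<rho>) / d ^ 4"
      have FF: "\<bar>\<kappa> 0 s n m\<bar> \<le> F" if "t \<le> s" "s \<le> t + h" for s
      proof -
        have s: "0 \<le> s" "1 + s \<le> 2 * \<rho>" using that t h by (auto simp: \<rho>_def)
        have "sqrt (1 + s) \<le> sqrt (2\<^sup>2 * \<rho>)" using s \<rho> by (intro real_sqrt_le_mono) auto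
        then have s2: "sqrt (1 + s) \<le> 2 * sqrt \<rho>" by (simp add: real_sqrt_mult)
        have "d ^ 4 * \<bar>\<kappa> 0 s n m\<bar> \<le> C0 * (1 + s) ^ 3 * sqrt (1 + s)" using C0(2)[OF s(1), of n m] by (simp add: d4)
        also have "\<dots> \<le> C0 * (2 * \<rho>) ^ 3 * (2 * sqrt \<rho>)" using C0(1) s s2 \<rho> by (intro mult_mono power_mono) auto
        finally show ?thesis using \<rho> d by (simp add: F_def pos_le_divide_eq mult.commute)
      qed
      have "\<bar>\<kappa> 1 t n m\<bar> \<le> 2 * F / h + h * (B / (\<rho>\<^sup>2 * sqrt \<rho>))"
      proof (rule landau_kolmogorov[OF h(1), where f = "\<lambda>t. \<kappa> 0 t n m" and f' = "\<lambda>t. \<kappa> 1 t n m" and f'' = "\<lambda>t. \<kappa> 2 t n m"])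
        show "((\<lambda>t. \<kappa> 0 t n m) has_real_derivative \<kappa> 1 s n m) (at s)" for s using \<kappa>_deriv[of 0 n m s] by simp
        show "((\<lambda>t. \<kappa> 1 t n m) has_real_derivative \<kappa> 2 s n m) (at s)" for s using \<kappa>_deriv[of 1 n m s] by (simp add: numeral_2_eq_2)
        show "\<bar>\<kappa> 2 s n m\<bar> \<le> B / (\<rho>\<^sup>2 * sqrt \<rho>)" if "t \<le> s" for s
          using diagB[of 2 s n m] mono[OF t that, of 2] that t by (simp add: \<rho>_def)
      qed (use FF h in auto)
      then have "d\<^sup>2 * \<bar>\<kappa> 1 t n m\<bar> \<le> d\<^sup>2 * (2 * F / h + h * (B / (\<rho>\<^sup>2 * sqrt \<rho>)))" by (intro mult_left_mono) auto
      also have "\<dots> = d\<^sup>2 * (2 * F / h) + d\<^sup>2 * h * (B / (\<rho>\<^sup>2 * sqrt \<rho>))" by (simp add: distrib_left)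
      also have "d\<^sup>2 * h = \<rho> ^ 3" using d \<rho> by (simp add: h_def)
      also have "\<rho> ^ 3 * (B / (\<rho>\<^sup>2 * sqrt \<rho>)) = B * sqrt \<rho>"
      proof -
        have "\<rho> ^ 3 * (B / (\<rho>\<^sup>2 * sqrt \<rho>)) = B * (\<rho> / sqrt \<rho>)" using \<rho> by (simp add: power2_eq_square power3_eq_cube)
        also have "\<rho> / sqrt \<rho> = sqrt \<rho>" using \<rho> by (simp add: real_div_sqrt)
        finally show ?thesis .
      qed
      also have "d\<^sup>2 * (2 * F / h) = 32 * C0 * sqrt \<rho>"
      proof -
        have "2 * F / h = (2 * (C0 * 8 * 2 * sqrt \<rho>)) * (\<rho> ^ 3 / d ^ 4 * (d\<^sup>2 / \<rho> ^ 3))" by (simp add: F_def h_def power_mult_distrib)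
        also have "\<rho> ^ 3 / d ^ 4 * (d\<^sup>2 / \<rho> ^ 3) = 1 / d\<^sup>2" using \<rho> d by (simp add: power4_eq_xxxx power2_eq_square)
        finally show ?thesis using \<rho> d by simp
      qed
      finally show ?thesis by (simp add: d4 C1_def \<rho>_def distrib_right)
    qed
  qed
  have two: "(real n - real m)\<^sup>2 * \<bar>\<kappa> 2 t n m\<bar> \<le> C2 / ((1 + t) * sqrt (1 + t))" if t: "0 \<le> t" for t n m
  proof -
    define \<rho> where "\<rho> = 1 + t"
    define d where "d = (real n - real m)\<^sup>2"
    have \<rho>: "1 \<le> \<rho>" using t by (simp add: \<rho>_def)
    have d4: "(real n - real m) ^ 4 = d\<^sup>2" unfolding d_def by (simp_all flip: power_mult)
    have d0: "0 \<le> d" by (simp add: d_def)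
    show ?thesis
    proof (cases "d \<le> \<rho>")
      case True
      have "d * \<bar>\<kappa> 2 t n m\<bar> \<le> \<rho> * (B / (\<rho>\<^sup>2 * sqrt \<rho>))"
        using True d0 diagB[of 2 t n m] t \<rho> by (intro mult_mono) (auto simp: \<rho>_def)
      also have "\<dots> = B / (\<rho> * sqrt \<rho>)" using \<rho> by (simp add: power2_eq_square)
      also have "\<dots> \<le> C2 / (\<rho> * sqrt \<rho>)" using C12 \<rho> by (intro divide_right_mono) (auto simp: C2_def)
      finally show ?thesis by (simp add: d_def \<rho>_def)
    next
      case False
      then have d: "\<rho> < d" by simp
      \<comment> \<open>The balancing step again, now for the decay of the first derivative against
        the on-diagonal bound of the third.\<close>
      define h where "h = \<rho>\<^sup>2 / d"
      have h: "0 < h" "h \<le> \<rho>"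
        using \<rho> d by (auto simp: h_def pos_divide_le_eq power2_eq_square)
      define F where "F = C1 * (2 * sqrt \<rho>) / d\<^sup>2"
      have FF: "\<bar>\<kappa> 1 s n m\<bar> \<le> F" if "t \<le> s" "s \<le> t + h" for s
      proof -
        have s: "0 \<le> s" "1 + s \<le> 2 * \<rho>" using that t h by (auto simp: \<rho>_def)
        have "sqrt (1 + s) \<le> sqrt (2\<^sup>2 * \<rho>)" using s \<rho> by (intro real_sqrt_le_mono) auto
        then have s2: "sqrt (1 + s) \<le> 2 * sqrt \<rho>" by (simp add: real_sqrt_mult)
        have "d\<^sup>2 * \<bar>\<kappa> 1 s n m\<bar> \<le> C1 * sqrt (1 + s)" using one[OF s(1), of n m] by (simp add: d4)
        also have "\<dots> \<le> C1 * (2 * sqrt \<rho>)" using C12(1) s2 by (intro mult_left_mono) auto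
        finally show ?thesis using \<rho> d by (simp add: F_def pos_le_divide_eq mult.commute)
      qed
      have "\<bar>\<kappa> 2 t n m\<bar> \<le> 2 * F / h + h * (B / (\<rho> ^ 3 * sqrt \<rho>))"
      proof (rule landau_kolmogorov[OF h(1), where f = "\<lambda>t. \<kappa> 1 t n m" and f' = "\<lambda>t. \<kappa> 2 t n m" and f'' = "\<lambda>t. \<kappa> 3 t n m"])
        show "((\<lambda>t. \<kappa> 1 t n m) has_real_derivative \<kappa> 2 s n m) (at s)" for s using \<kappa>_deriv[of 1 n m s] by (simp add: numeral_2_eq_2)
        show "((\<lambda>t. \<kappa> 2 t n m) has_real_derivative \<kappa> 3 s n m) (at s)" for s using \<kappa>_deriv[of 2 n m s] by (simp add: numeral_3_eq_3 numeral_2_eq_2)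
        show "\<bar>\<kappa> 3 s n m\<bar> \<le> B / (\<rho> ^ 3 * sqrt \<rho>)" if "t \<le> s" for s
          using diagB[of 3 s n m] mono[OF t that, of 3] that t by (simp add: \<rho>_def)
      qed (use FF h in auto)
      then have "d * \<bar>\<kappa> 2 t n m\<bar> \<le> d * (2 * F / h + h * (B / (\<rho> ^ 3 * sqrt \<rho>)))" using d0 by (intro mult_left_mono) auto
      also have "\<dots> = d * (2 * F / h) + d * h * (B / (\<rho> ^ 3 * sqrt \<rho>))" by (simp add: distrib_left)
      also have "d * h = \<rho>\<^sup>2" using d \<rho> by (simp add: h_def)
      also have "\<rho>\<^sup>2 * (B / (\<rho> ^ 3 * sqrt \<rho>)) = B / (\<rho> * sqrt \<rho>)"
        using \<rho> by (simp add: power2_eq_square power3_eq_cube)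
      also have "d * (2 * F / h) = 4 * C1 / (\<rho> * sqrt \<rho>)"
      proof -
        have "d * (2 * F / h) = 4 * C1 * (sqrt \<rho> / \<rho>\<^sup>2)" using d \<rho> by (simp add: F_def h_def power2_eq_square)
        also have "sqrt \<rho> / \<rho>\<^sup>2 = 1 / (\<rho> * sqrt \<rho>)" using \<rho> by (simp add: power2_eq_square divide_simps)
        finally show ?thesis by simp
      qed
      finally show ?thesis by (simp add: d_def C2_def \<rho>_def add_divide_distrib)
    qed
  qed
  define A where "A = B + C0 + C1 + C2"
  have A: "0 < A" using B C0 C12 by (simp add: A_def)
  have fin: "\<bar>k\<bar> \<le> 2 * A * sqrt \<rho> / (\<rho> ^ j * (\<rho> + d))"
    if \<rho>: "1 \<le> \<rho>" and d: "0 \<le> d" and 1: "\<bar>k\<bar> \<le> B / (\<rho> ^ j * sqrt \<rho>)" and 2: "\<rho> < d \<Longrightarrow> \<bar>k\<bar> \<le> A * sqrt \<rho> / (\<rho> ^ j * d)" for k \<rho> d :: real and j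
  proof (cases "d \<le> \<rho>")
    case True
    have "B / (\<rho> ^ j * sqrt \<rho>) = B * sqrt \<rho> / (\<rho> ^ j * \<rho>)"
    proof -
      have "\<rho> = sqrt \<rho> * sqrt \<rho>" "sqrt \<rho> \<noteq> 0" using \<rho> by auto
      then show ?thesis by (metis (no_types, lifting) mult.assoc mult_divide_mult_cancel_right)
    qed
    also have "\<dots> \<le> 2 * A * sqrt \<rho> / (\<rho> ^ j * (2 * \<rho>))"
    proof -
      have "B * sqrt \<rho> / (\<rho> ^ j * \<rho>) \<le> A * sqrt \<rho> / (\<rho> ^ j * \<rho>)"
        using \<rho> B C0 C12 by (intro divide_right_mono mult_right_mono) (auto simp: A_def)
      then show ?thesis by simp
    qed
    also have "\<dots> \<le> 2 * A * sqrt \<rho> / (\<rho> ^ j * (\<rho> + d))"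
      using \<rho> True d A by (intro divide_left_mono mult_left_mono) (auto intro!: mult_pos_pos)
    finally show ?thesis using 1 by linarith
  next
    case False
    then have "\<bar>k\<bar> \<le> 2 * A * sqrt \<rho> / (\<rho> ^ j * (2 * d))" using 2 by simp
    also have "\<dots> \<le> 2 * A * sqrt \<rho> / (\<rho> ^ j * (\<rho> + d))"
      using \<rho> False d A by (intro divide_left_mono mult_left_mono) (auto intro!: mult_pos_pos)
    finally show ?thesis .
  qed
  show ?thesis
  proof (intro exI[of _ "2 * A"] conjI allI impI)
    show "0 < 2 * A" using A by simp
    fix k n m :: nat and t :: real assume k: "k \<le> 2" and t: "0 \<le> t"
    define \<rho> where "\<rho> = 1 + t"
    define d where "d = (real n - real m)\<^sup>2"
    have \<rho>: "1 \<le> \<rho>" using t by (simp add: \<rho>_def)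
    have d4: "(real n - real m) ^ 4 = d\<^sup>2" "(real n - real m) ^ 8 = d ^ 4" unfolding d_def by (simp_all flip: power_mult)
    have "\<bar>\<kappa> k t n m\<bar> \<le> 2 * A * sqrt \<rho> / (\<rho> ^ k * (\<rho> + d))"
    proof (rule fin[OF \<rho>])
      show "0 \<le> d" by (simp add: d_def)
      show "\<bar>\<kappa> k t n m\<bar> \<le> B / (\<rho> ^ k * sqrt \<rho>)" using diagB[of k t n m] k t by (simp add: \<rho>_def)
      assume d: "\<rho> < d"
      consider "k = 0" | "k = 1" | "k = 2" using k by linarith
      then show "\<bar>\<kappa> k t n m\<bar> \<le> A * sqrt \<rho> / (\<rho> ^ k * d)"
      proof cases
        case 1
        have "d ^ 3 * (d * \<bar>\<kappa> 0 t n m\<bar>) = d ^ 4 * \<bar>\<kappa> 0 t n m\<bar>" by (simp add: power4_eq_xxxx power3_eq_cube)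
        also have "\<dots> \<le> C0 * \<rho> ^ 3 * sqrt \<rho>" using C0(2)[OF t, of n m] by (simp add: d4 \<rho>_def)
        also have "\<dots> \<le> C0 * d ^ 3 * sqrt \<rho>" using C0 \<rho> d by (intro mult_right_mono mult_left_mono power_mono) auto
        finally have "d ^ 3 * (d * \<bar>\<kappa> 0 t n m\<bar>) \<le> d ^ 3 * (C0 * sqrt \<rho>)" by (simp add: mult_ac)
        then have "d * \<bar>\<kappa> 0 t n m\<bar> \<le> C0 * sqrt \<rho>" using d \<rho> by simp
        also have "\<dots> \<le> A * sqrt \<rho>" using B C12 \<rho> by (intro mult_right_mono) (auto simp: A_def)
        finally show ?thesis using 1 d \<rho> by (simp add: pos_le_divide_eq mult.commute)
      next
        case 2
        have "d * (\<rho> * (d * \<bar>\<kappa> 1 t n m\<bar>)) = \<rho> * (d\<^sup>2 * \<bar>\<kappa> 1 t n m\<bar>)" by (simp add: power2_eq_square)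
        also have "\<dots> \<le> \<rho> * (C1 * sqrt \<rho>)" using one[OF t, of n m] \<rho> by (intro mult_left_mono) (auto simp: d4 \<rho>_def)
        also have "\<dots> \<le> d * (C1 * sqrt \<rho>)" using C12 \<rho> d by (intro mult_right_mono) auto
        finally have "\<rho> * (d * \<bar>\<kappa> 1 t n m\<bar>) \<le> C1 * sqrt \<rho>" using d \<rho> by simp
        also have "\<dots> \<le> A * sqrt \<rho>" using B C12 C0 \<rho> by (intro mult_right_mono) (auto simp: A_def)
        finally show ?thesis using 2 d \<rho> by (simp add: pos_le_divide_eq mult_ac)
      next
        case 3
        have "d * \<bar>\<kappa> 2 t n m\<bar> \<le> C2 / (\<rho> * sqrt \<rho>)" using two[OF t, of n m] by (simp add: d_def \<rho>_def)
        also have "\<dots> \<le> A / (\<rho> * sqrt \<rho>)" using B C12 C0 \<rho> by (intro divide_right_mono) (auto simp: A_def)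
        also have "\<dots> = A * sqrt \<rho> / \<rho>\<^sup>2"
          using \<rho> by (simp add: power2_eq_square divide_simps)
        finally show ?thesis using 3 d \<rho> by (simp add: pos_le_divide_eq pos_divide_le_eq mult_ac)
      qed
    qed
    then show "\<bar>\<kappa> k t n m\<bar> \<le> 2 * A * sqrt (1 + t) / ((1 + t) ^ k * (1 + t + (real n - real m)\<^sup>2))"
      by (simp add: \<rho>_def d_def)
  qed
qed

text \<open>In the spectral variable the operator is multiplication by \<open>\<phi>\<close>:
  Bessel's inequality handles \<open>\<phi> * F\<close>, and orthonormality identifies the norm of
  \<open>F\<close> with that of \<open>f\<close>.\<close>

lemma multiplier_l2:
  assumes \<phi>: "continuous_on UNIV \<phi>" "\<And>x. x \<in> {-1..1} \<Longrightarrow> \<bar>\<phi> x\<bar> \<le> B" and Y: "finite Y"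
  shows "(\<Sum>l<N. (\<Sum>y\<in>Y. (\<integral>x. \<phi> x * poly (p l) x * poly (p y) x \<partial>M) * f y)\<^sup>2) \<le> B\<^sup>2 * (\<Sum>y\<in>Y. (f y)\<^sup>2)"
proof -
  define F where "F x = (\<Sum>y\<in>Y. f y * poly (p y) x)" for x
  have cF: "continuous_on UNIV F" unfolding F_def by (intro continuous_intros)
  have "(\<Sum>y\<in>Y. (\<integral>x. \<phi> x * poly (p l) x * poly (p y) x \<partial>M) * f y) = (\<integral>x. (\<phi> x * F x) * poly (p l) x \<partial>M)" for l
  proof -
    have "(\<phi> x * F x) * poly (p l) x = (\<Sum>y\<in>Y. f y * (\<phi> x * poly (p l) x * poly (p y) x))" for x
      unfolding F_def sum_distrib_left sum_distrib_right by (intro sum.cong refl) simp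
    then have "(\<integral>x. (\<phi> x * F x) * poly (p l) x \<partial>M) = (\<integral>x. (\<Sum>y\<in>Y. f y * (\<phi> x * poly (p l) x * poly (p y) x)) \<partial>M)" by presburger
    also have "\<dots> = (\<Sum>y\<in>Y. \<integral>x. f y * (\<phi> x * poly (p l) x * poly (p y) x) \<partial>M)"
      by (intro Bochner_Integration.integral_sum integrable_cont continuous_intros \<phi>)
    finally show ?thesis by (simp add: mult.commute)
  qed
  then have "(\<Sum>l<N. (\<Sum>y\<in>Y. (\<integral>x. \<phi> x * poly (p l) x * poly (p y) x \<partial>M) * f y)\<^sup>2) = (\<Sum>l<N. (\<integral>x. (\<phi> x * F x) * poly (p l) x \<partial>M)\<^sup>2)"
    by presburger
  also have "\<dots> \<le> (\<integral>x. (\<phi> x * F x)\<^sup>2 \<partial>M)" by (intro bessel_le continuous_intros \<phi> cF)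
  also have "\<dots> \<le> (\<integral>x. B\<^sup>2 * (F x)\<^sup>2 \<partial>M)"
  proof (rule integral_mono_AE)
    show "AE x in M. (\<phi> x * F x)\<^sup>2 \<le> B\<^sup>2 * (F x)\<^sup>2"
      using supp
    proof eventually_elim
      case (elim x)
      have "\<bar>\<phi> x\<bar>\<^sup>2 \<le> B\<^sup>2" using \<phi>(2)[OF elim] by (intro power_mono) auto
      then show ?case by (simp add: power_mult_distrib mult_right_mono)
    qed
  qed (intro integrable_cont continuous_intros \<phi> cF)+
  also have "\<dots> = B\<^sup>2 * (\<integral>x. (F x)\<^sup>2 \<partial>M)" by simp
  also have "(\<integral>x. (F x)\<^sup>2 \<partial>M) = (\<Sum>y\<in>Y. (f y)\<^sup>2)"
  proof -
    have i: "integrable M (\<lambda>x. poly (p l) x * poly (p m) x)" for l m by (intro integrable_cont continuous_intros)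
    have "(F x)\<^sup>2 = (\<Sum>l\<in>Y. \<Sum>m\<in>Y. f l * f m * (poly (p l) x * poly (p m) x))" for x
      unfolding F_def power2_eq_square sum_product by (intro sum.cong refl) (simp add: mult_ac)
    then have "(\<integral>x. (F x)\<^sup>2 \<partial>M) = (\<Sum>l\<in>Y. \<Sum>m\<in>Y. f l * f m * (if l = m then 1 else 0))"
      using i by (simp add: orth)
    also have "\<dots> = (\<Sum>y\<in>Y. (f y)\<^sup>2)"
      using Y by (intro sum.cong refl) (simp add: if_distrib[of "\<lambda>t. _ * t"] sum.delta power2_eq_square cong: if_cong)
    finally show ?thesis .
  qed
  finally show ?thesis .
qed

end

section \<open>Jacobi polynomials\<close>

text \<open>The polynomial factor of the \<open>k\<close>-th derivative of
  \<open>(1 - x) powr a * (1 + x) powr b\<close>, once both powers lowered by \<open>k\<close> are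
  split off; the recursion is the product rule.\<close>

primrec rodrigues_poly :: "real \<Rightarrow> real \<Rightarrow> nat \<Rightarrow> real poly" where
  "rodrigues_poly a b 0 = 1"
| "rodrigues_poly a b (Suc k) = [:b - a, 2 * real k - a - b:] * rodrigues_poly a b k + [:1, 0, -1:] * pderiv (rodrigues_poly a b k)"

lemma rodrigues_poly_deriv:
  fixes x :: real
  assumes x: "-1 < x" "x < 1"
  shows "((\<lambda>y. (1 - y) powr (a - real k) * (1 + y) powr (b - real k) * poly (rodrigues_poly a b k) y) has_real_derivative
     (1 - x) powr (a - real (Suc k)) * (1 + x) powr (b - real (Suc k)) * poly (rodrigues_poly a b (Suc k)) x) (at x)"
proof -
  define c d where "c = a - real k" and "d = b - real k"
  define S where "S = rodrigues_poly a b k"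
  have p: "(1 - x) powr c = (1 - x) powr (c - 1) * (1 - x)" "(1 + x) powr d = (1 + x) powr (d - 1) * (1 + x)"
    using x powr_add[of "1 - x" "c - 1" 1] powr_add[of "1 + x" "d - 1" 1] by auto
  have "((\<lambda>y. (1 - y) powr c * (1 + y) powr d * poly S y) has_real_derivative
     (- (c * (1 - x) powr (c - 1)) * (1 + x) powr d + (1 - x) powr c * (d * (1 + x) powr (d - 1))) * poly S x
       + (1 - x) powr c * (1 + x) powr d * poly (pderiv S) x) (at x)"
    using x by (auto intro!: derivative_eq_intros)
  also have "(- (c * (1 - x) powr (c - 1)) * (1 + x) powr d + (1 - x) powr c * (d * (1 + x) powr (d - 1))) * poly S x
       + (1 - x) powr c * (1 + x) powr d * poly (pderiv S) x
     = (1 - x) powr (c - 1) * (1 + x) powr (d - 1) * ((d - c + (2 * real k - a - b) * x) * poly S x + (1 - x\<^sup>2) * poly (pderiv S) x)"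
    unfolding p by (simp add: c_def d_def algebra_simps power2_eq_square)
  also have "(d - c + (2 * real k - a - b) * x) * poly S x + (1 - x\<^sup>2) * poly (pderiv S) x = poly (rodrigues_poly a b (Suc k)) x"
    by (simp add: S_def c_def d_def algebra_simps power2_eq_square)
  finally show ?thesis by (simp add: c_def d_def S_def algebra_simps)
qed

lemma rodrigues_poly_higher_deriv:
  fixes x :: real
  assumes x: "-1 < x" "x < 1"
  shows "(deriv ^^ k) (\<lambda>y. (1 - y) powr a * (1 + y) powr b) x
     = (1 - x) powr (a - real k) * (1 + x) powr (b - real k) * poly (rodrigues_poly a b k) x"
  using x
proof (induction k arbitrary: x)
  case 0
  then show ?case by simp
next
  case (Suc k)
  have "(deriv ^^ Suc k) (\<lambda>y. (1 - y) powr a * (1 + y) powr b) x = deriv ((deriv ^^ k) (\<lambda>y. (1 - y) powr a * (1 + y) powr b)) x"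
    by simp
  also have "\<dots> = deriv (\<lambda>y. (1 - y) powr (a - real k) * (1 + y) powr (b - real k) * poly (rodrigues_poly a b k) y) x"
  proof (rule deriv_cong_ev)
    have "\<forall>\<^sub>F y in nhds x. y \<in> {-1<..<1}" using Suc.prems by (intro eventually_nhds_in_open) auto
    then show "\<forall>\<^sub>F y in nhds x. (deriv ^^ k) (\<lambda>y. (1 - y) powr a * (1 + y) powr b) y
       = (1 - y) powr (a - real k) * (1 + y) powr (b - real k) * poly (rodrigues_poly a b k) y"
      by eventually_elim (rule Suc.IH, auto)
  qed simp
  also have "\<dots> = (1 - x) powr (a - real (Suc k)) * (1 + x) powr (b - real (Suc k)) * poly (rodrigues_poly a b (Suc k)) x"
    by (rule DERIV_imp_deriv) (rule rodrigues_poly_deriv[OF Suc.prems])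
  finally show ?case .
qed

lemma coeff_linear_mult: "coeff ([:u, v:] * q) (Suc i) = u * coeff q (Suc i) + v * coeff q i"
  by (simp add: mult_pCons_left)

lemma coeff_rodrigues_poly_step:
  "coeff (rodrigues_poly a b (Suc k)) (Suc i) =
     (b - a) * coeff (rodrigues_poly a b k) (Suc i) + (2 * real k - a - b - real i) * coeff (rodrigues_poly a b k) i
       + (real i + 2) * coeff (rodrigues_poly a b k) (i + 2)"
proof -
  have "coeff ([:1, 0, -1:] * r) (Suc i) = coeff r (Suc i) - (if i = 0 then 0 else coeff r (i - 1))" for r :: "real poly"
    by (cases i) (simp_all add: mult_pCons_left)
  then show ?thesis
    unfolding rodrigues_poly.simps coeff_add coeff_linear_mult
    by (cases i) (simp_all add: coeff_pderiv algebra_simps)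
qed

lemma coeff_rodrigues_poly_zero: "k < i \<Longrightarrow> coeff (rodrigues_poly a b k) i = 0"
proof (induction k arbitrary: i)
  case 0
  then show ?case by (simp add: coeff_eq_0)
next
  case (Suc k)
  then obtain j where i: "i = Suc j" "k < j" by (cases i) auto
  then show ?case unfolding i(1) coeff_rodrigues_poly_step using Suc.IH by simp
qed

text \<open>Step \<open>k\<close> multiplies the leading coefficient by
  \<open>- (a + b - k)\<close>. For the Jacobi exponents, raised by the degree, none of these
  factors vanishes.\<close>

lemma lead_coeff_rodrigues_poly:
  assumes "\<And>j. j < k \<Longrightarrow> a + b \<noteq> real j"
  shows "coeff (rodrigues_poly a b k) k \<noteq> 0"
  using assms
proof (induction k)
  case (Suc k)
  have "coeff (rodrigues_poly a b (Suc k)) (Suc k) = - (a + b - real k) * coeff (rodrigues_poly a b k) k"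
    unfolding coeff_rodrigues_poly_step by (simp add: coeff_rodrigues_poly_zero algebra_simps)
  moreover have "coeff (rodrigues_poly a b k) k \<noteq> 0" using Suc by simp
  moreover have "a + b \<noteq> real k" using Suc.prems by simp
  ultimately show ?case by (simp del: rodrigues_poly.simps)
qed simp

lemma continuous_on_endpoint_powr:
  fixes e :: real
  assumes "0 < e"
  shows "continuous_on {-1..1} (\<lambda>x::real. (1 - x) powr e)" "continuous_on {-1..1} (\<lambda>x::real. (1 + x) powr e)"
proof -
  show "continuous_on {-1..1} (\<lambda>x::real. (1 - x) powr e)"
    by (rule continuous_on_powr') (use assms in \<open>auto intro: continuous_on_diff continuous_on_const continuous_on_id\<close>)
  show "continuous_on {-1..1} (\<lambda>x::real. (1 + x) powr e)"
    by (rule continuous_on_powr') (use assms in \<open>auto intro: continuous_on_add continuous_on_const continuous_on_id\<close>)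
qed

section \<open>Jacobi polynomials as polynomials, their measure and orthogonality\<close>

locale jacobi =
  fixes \<alpha> \<beta> :: real
  assumes \<alpha>: "-1/2 \<le> \<alpha>" and \<beta>: "-1/2 \<le> \<beta>"
begin

abbreviation w where "w \<equiv> jacobi_density \<alpha> \<beta>"

definition P :: "nat \<Rightarrow> real poly" where
  "P n = smult ((-1) ^ n / (2 ^ n * fact n)) (rodrigues_poly (\<alpha> + real n) (\<beta> + real n) n)"

lemma jacobi_P_eq: "-1 < x \<Longrightarrow> x < 1 \<Longrightarrow> jacobi_P \<alpha> \<beta> n x = poly (P n) x"
  unfolding jacobi_P_def P_def by (subst rodrigues_poly_higher_deriv) (auto simp: powr_minus field_simps)

lemma P_coeff: "n < i \<Longrightarrow> coeff (P n) i = 0" "coeff (P n) n \<noteq> 0"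
proof -
  show "n < i \<Longrightarrow> coeff (P n) i = 0" by (simp add: P_def coeff_rodrigues_poly_zero)
  have "\<alpha> + real n + (\<beta> + real n) \<noteq> real j" if "j < n" for j
  proof -
    have "real j + 1 \<le> real n" using that by linarith
    then show ?thesis using \<alpha> \<beta> by linarith
  qed
  then have "coeff (rodrigues_poly (\<alpha> + real n) (\<beta> + real n) n) n \<noteq> 0" by (rule lead_coeff_rodrigues_poly)
  then show "coeff (P n) n \<noteq> 0" by (simp add: P_def)
qed

lemma P_degree: "degree (P n) = n" "P n \<noteq> 0"
proof -
  show "P n \<noteq> 0" using P_coeff(2)[of n] by auto
  show "degree (P n) = n" using P_coeff(1)[of n] P_coeff(2)[of n] by (intro order_antisym degree_le le_degree) auto
qed

definition M :: "real measure" where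
  "M = density lborel (\<lambda>x. ennreal (indicator {-1<..<1} x * w x))"

lemma sets_M: "sets M = sets borel" by (simp add: M_def)

lemma w_nonneg: "0 \<le> w x" by (simp add: jacobi_density_def)

lemma w_measurable [measurable]: "w \<in> borel_measurable borel"
  unfolding jacobi_density_def by measurable

lemma AE_M: "AE x in M. x \<in> {-1..1}"
  unfolding M_def by (subst AE_density) (auto simp: indicator_def)

lemma arcsin_integral: "((\<lambda>x. inverse (sqrt (1 - x\<^sup>2))) has_integral pi) {-1..1::real}"
proof -
  have "((\<lambda>x. inverse (sqrt (1 - x\<^sup>2))) has_integral arcsin 1 - arcsin (-1)) {-1..1::real}"
    by (rule fundamental_theorem_of_calculus_interior)
      (auto intro!: continuous_intros DERIV_arcsin simp: has_real_derivative_iff_has_vector_derivative[symmetric])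
  then show ?thesis by simp
qed

text \<open>Comparison with the arcsine density, of finite integral \<open>pi\<close>; the exponents
  \<open>\<alpha> + 1/2\<close> and \<open>\<beta> + 1/2\<close> left over are nonnegative.\<close>

lemma w_le: "-1 < x \<Longrightarrow> x < 1 \<Longrightarrow> w x \<le> 2 powr (\<alpha> + 1/2) * 2 powr (\<beta> + 1/2) * inverse (sqrt (1 - x\<^sup>2))"
proof -
  assume x: "-1 < x" "x < 1"
  have "1 - x\<^sup>2 = (1 - x) * (1 + x)" by (simp add: power2_eq_square algebra_simps)
  then have s: "sqrt (1 - x\<^sup>2) = (1 - x) powr (1/2) * (1 + x) powr (1/2)"
    using x by (simp add: real_sqrt_mult powr_half_sqrt)
  have e: "(1 - x) powr \<alpha> = (1 - x) powr (\<alpha> + 1/2) / (1 - x) powr (1/2)" "(1 + x) powr \<beta> = (1 + x) powr (\<beta> + 1/2) / (1 + x) powr (1/2)"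
    by (simp_all flip: powr_diff)
  have "w x = (1 - x) powr (\<alpha> + 1/2) * (1 + x) powr (\<beta> + 1/2) * inverse (sqrt (1 - x\<^sup>2))"
    unfolding s jacobi_density_def e by (simp only: divide_inverse inverse_mult_distrib mult_ac)
  also have "\<dots> \<le> 2 powr (\<alpha> + 1/2) * 2 powr (\<beta> + 1/2) * inverse (sqrt (1 - x\<^sup>2))"
  proof (intro mult_right_mono mult_mono)
    show "(1 - x) powr (\<alpha> + 1/2) \<le> 2 powr (\<alpha> + 1/2)" using x \<alpha> by (intro powr_mono2) auto
    show "(1 + x) powr (\<beta> + 1/2) \<le> 2 powr (\<beta> + 1/2)" using x \<beta> by (intro powr_mono2) auto
    show "0 \<le> inverse (sqrt (1 - x\<^sup>2))" unfolding s by simp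
  qed auto
  finally show ?thesis .
qed

lemma finite_M: "finite_measure M"
proof (rule finite_measureI)
  define C where "C = 2 powr (\<alpha> + 1/2) * 2 powr (\<beta> + 1/2)"
  have "emeasure M (space M) = (\<integral>\<^sup>+ x. ennreal (indicator {-1<..<1} x * w x) \<partial>lborel)"
    unfolding M_def by (subst emeasure_density) auto
  also have "\<dots> \<le> (\<integral>\<^sup>+ x. ennreal (indicator {-1..1} x * (C * inverse (sqrt (1 - x\<^sup>2)))) \<partial>lborel)"
  proof (intro nn_integral_mono ennreal_leI)
    fix x :: real
    show "indicator {-1<..<1} x * w x \<le> indicator {-1..1} x * (C * inverse (sqrt (1 - x\<^sup>2)))"
    proof (cases "x \<in> {-1<..<1}")
      case True
      then show ?thesis using w_le[of x] by (auto simp: C_def)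
    next
      case False
      have "0 \<le> indicator {-1..1} x * (C * inverse (sqrt (1 - x\<^sup>2)))"
        by (auto simp: indicator_def C_def abs_square_le_1[of x, unfolded abs_le_iff] intro!: mult_nonneg_nonneg)
      then show ?thesis using False by simp
    qed
  qed
  also have "\<dots> = ennreal (C * pi)"
  proof (rule nn_integral_has_integral_lebesgue)
    show "((\<lambda>x. C * inverse (sqrt (1 - x\<^sup>2))) has_integral C * pi) {-1..1}" by (intro has_integral_mult_right arcsin_integral)
    fix x :: real assume "x \<in> {-1..1}"
    then have "x\<^sup>2 \<le> 1" by (simp add: abs_square_le_1 abs_le_iff)
    then show "0 \<le> C * inverse (sqrt (1 - x\<^sup>2))" by (simp add: C_def)
  qed
  finally show "emeasure M (space M) \<noteq> \<infinity>" by (auto simp: top_unique)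
qed

lemma integrable_cont_M:
  assumes "continuous_on UNIV (f :: real \<Rightarrow> real)"
  shows "integrable M f"
proof -
  interpret finite_measure M by (rule finite_M)
  have "compact (f ` {-1..1})"
    using assms by (intro compact_continuous_image) (auto intro: continuous_on_subset)
  then obtain B where B: "\<And>x. x \<in> {-1..1} \<Longrightarrow> norm (f x) \<le> B"
    by (meson compact_imp_bounded bounded_iff imageI)
  have "f \<in> borel_measurable M"
    using borel_measurable_continuous_onI[OF assms] measurable_cong_sets[OF sets_M refl] by blast
  moreover have "AE x in M. norm (f x) \<le> B" using AE_M by eventually_elim (rule B)
  ultimately show ?thesis using integrable_const_bound by blast
qed

lemma M_integral_eq:
  assumes "f \<in> borel_measurable borel"
  shows "(\<integral>x. f x \<partial>M) = (\<integral>x. (indicator {-1<..<1} x * w x) * f x \<partial>lborel)"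
  unfolding M_def by (subst integral_real_density) (use assms w_nonneg in auto)

lemma M_has_integral:
  assumes f: "continuous_on UNIV (f :: real \<Rightarrow> real)"
  shows "((\<lambda>x. w x * f x) has_integral (\<integral>x. f x \<partial>M)) {-1..1}"
proof -
  have fb: "f \<in> borel_measurable borel" by (rule borel_measurable_continuous_onI[OF f])
  have "integrable (density lborel (\<lambda>x. ennreal (indicator {-1<..<1} x * w x))) f"
    using integrable_cont_M[OF f] by (simp add: M_def)
  then have "integrable lborel (\<lambda>x. (indicator {-1<..<1} x * w x) *\<^sub>R f x)"
    using fb w_nonneg by (subst (asm) integrable_density) auto
  then have "((\<lambda>x. (indicator {-1<..<1} x * w x) * f x) has_integral (\<integral>x. f x \<partial>M)) UNIV"
    unfolding M_integral_eq[OF fb] using has_integral_integral_lborel by force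
  then have "((\<lambda>x. if x \<in> {-1..1} then w x * f x else 0) has_integral (\<integral>x. f x \<partial>M)) UNIV"
    by (rule has_integral_spike[of "{-1,1}", rotated 2]) (auto simp: indicator_def)
  then show ?thesis by (simp only: has_integral_restrict_UNIV)
qed

text \<open>Each integration by parts removes one derivative from the Rodrigues factor and
  differentiates \<open>q\<close>. The boundary terms vanish because the exponents at the stages
  below \<open>n\<close> are positive, and finally the derivative of \<open>q\<close> is
  zero.\<close>

lemma rodrigues_orth:
  assumes k: "k \<le> n" "1 \<le> k" and q: "\<And>i. k \<le> i \<Longrightarrow> coeff q i = 0"
  shows "((\<lambda>x. (1 - x) powr (\<alpha> + real n - real k) * (1 + x) powr (\<beta> + real n - real k)
     * poly (rodrigues_poly (\<alpha> + real n) (\<beta> + real n) k) x * poly q x) has_integral 0) {-1..1}"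
  using assms
proof (induction k arbitrary: q)
  case (Suc k)
  define G where "G k x = (1 - x) powr (\<alpha> + real n - real k) * (1 + x) powr (\<beta> + real n - real k)
     * poly (rodrigues_poly (\<alpha> + real n) (\<beta> + real n) k) x" for k and x :: real
  have kn: "real k + 1 \<le> real n" using Suc.prems by linarith
  have pos: "0 < \<alpha> + real n - real k" "0 < \<beta> + real n - real k" using kn \<alpha> \<beta> by linarith+
  have cont: "continuous_on {-1..1} (\<lambda>x. G k x * poly q x)"
    unfolding G_def using continuous_on_endpoint_powr pos
    by (intro continuous_on_mult continuous_on_poly continuous_on_id) auto
  have "((\<lambda>x. G (Suc k) x * poly q x + G k x * poly (pderiv q) x) has_integral (G k 1 * poly q 1 - G k (-1) * poly q (-1))) {-1..1}"
  proof (rule fundamental_theorem_of_calculus_interior[OF _ cont])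
    fix x :: real assume "x \<in> {-1<..<1}"
    then have x: "-1 < x" "x < 1" by auto
    have "(G k has_real_derivative G (Suc k) x) (at x)"
      unfolding G_def by (rule rodrigues_poly_deriv[OF x])
    then have "((\<lambda>x. G k x * poly q x) has_real_derivative G (Suc k) x * poly q x + G k x * poly (pderiv q) x) (at x)"
      by (auto intro!: derivative_eq_intros)
    then show "((\<lambda>x. G k x * poly q x) has_vector_derivative G (Suc k) x * poly q x + G k x * poly (pderiv q) x) (at x)"
      by (simp add: has_real_derivative_iff_has_vector_derivative)
  qed auto
  moreover have "G k 1 = 0" "G k (-1) = 0" by (simp_all add: G_def)
  ultimately have 1: "((\<lambda>x. G (Suc k) x * poly q x + G k x * poly (pderiv q) x) has_integral 0) {-1..1}" by simp
  have 2: "((\<lambda>x. G k x * poly (pderiv q) x) has_integral 0) {-1..1}"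
  proof (cases k)
    case 0
    have "pderiv q = 0" using Suc.prems(3) 0 by (intro poly_eqI) (simp add: coeff_pderiv)
    then show ?thesis by simp
  next
    case (Suc j)
    then show ?thesis unfolding G_def using Suc.prems by (intro Suc.IH) (auto simp: coeff_pderiv)
  qed
  have "((\<lambda>x. G (Suc k) x * poly q x) has_integral 0) {-1..1}"
    using has_integral_diff[OF 1 2] by simp
  then show ?case unfolding G_def .
qed simp

lemma P_orth:
  assumes q: "\<And>i. n \<le> i \<Longrightarrow> coeff q i = 0"
  shows "(\<integral>x. poly (P n) x * poly q x \<partial>M) = 0"
proof (cases n)
  case 0
  then have "q = 0" using q by (intro poly_eqI) simp
  then show ?thesis by simp
next
  case (Suc n')
  have 1: "((\<lambda>x. w x * (poly (P n) x * poly q x)) has_integral (\<integral>x. poly (P n) x * poly q x \<partial>M)) {-1..1}"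
    by (intro M_has_integral continuous_intros)
  have 2: "((\<lambda>x. w x * (poly (P n) x * poly q x)) has_integral ((-1) ^ n / (2 ^ n * fact n) * 0)) {-1..1}"
  proof -
    have "((\<lambda>x. (-1) ^ n / (2 ^ n * fact n) * ((1 - x) powr (\<alpha> + real n - real n) * (1 + x) powr (\<beta> + real n - real n)
     * poly (rodrigues_poly (\<alpha> + real n) (\<beta> + real n) n) x * poly q x)) has_integral ((-1) ^ n / (2 ^ n * fact n) * 0)) {-1..1}"
      using Suc q by (intro has_integral_mult_right rodrigues_orth) auto
    then show ?thesis by (simp add: P_def jacobi_density_def mult_ac)
  qed
  show ?thesis using has_integral_unique[OF 1 2] by simp
qed

definition N :: "nat \<Rightarrow> real" where "N n = (\<integral>x. (poly (P n) x)\<^sup>2 \<partial>M)"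

lemma N_pos: "0 < N n"
proof (rule ccontr)
  assume "\<not> 0 < N n"
  moreover have "0 \<le> N n" unfolding N_def by (intro integral_nonneg_AE) auto
  ultimately have "N n = 0" by simp
  moreover have "integrable M (\<lambda>x. (poly (P n) x)\<^sup>2)" by (intro integrable_cont_M continuous_intros)
  ultimately have "AE x in M. (poly (P n) x)\<^sup>2 = 0"
    unfolding N_def by (subst (asm) integral_nonneg_eq_0_iff_AE) auto
  then have "AE x in lborel. 0 < ennreal (indicator {-1<..<1} x * w x) \<longrightarrow> poly (P n) x = 0"
    unfolding M_def by (subst (asm) AE_density) auto
  moreover have "0 < ennreal (indicator {-1<..<1} x * w x)" if "x \<in> {-1<..<1}" for x
    using that by (auto simp: jacobi_density_def)
  ultimately have "AE x in lborel. x \<in> {-1<..<1} \<longrightarrow> poly (P n) x = 0"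
    by (auto elim!: eventually_mono)
  moreover have "AE x in lborel. x \<notin> {x. poly (P n) x = 0}"
  proof -
    have "finite {x. poly (P n) x = 0}" using P_degree(2) by (rule poly_roots_finite)
    then show ?thesis by (intro AE_not_in finite_imp_null_set_lborel)
  qed
  ultimately have "AE x in lborel. x \<notin> {-1<..<1::real}" by eventually_elim auto
  then have "emeasure lborel {-1<..<1::real} = 0"
    by (subst (asm) AE_iff_measurable[of "{-1<..<1}"]) auto
  then show False by simp
qed

definition p :: "nat \<Rightarrow> real poly" where "p n = smult (1 / sqrt (N n)) (P n)"

lemma P_integral:
  "(\<integral>x. poly (P n) x * poly (P m) x \<partial>M) = (if n = m then N n else 0)"
proof -
  have *: "(\<integral>x. poly (P n) x * poly (P m) x \<partial>M) = 0" if "m < n" for n m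
    using that P_coeff(1)[of m] by (intro P_orth) auto
  show ?thesis using *[of m n] *[of n m] by (cases n m rule: linorder_cases) (auto simp: N_def power2_eq_square mult.commute)
qed

sublocale orthonormal_basis M p
proof (intro orthonormal_basis.intro finite_M orthonormal_basis_axioms.intro sets_M AE_M)
  fix n m
  show "degree (p n) = n" "p n \<noteq> 0" using N_pos[of n] P_degree by (auto simp: p_def)
  have "(\<integral>x. poly (p n) x * poly (p m) x \<partial>M) = (\<integral>x. (1 / sqrt (N n) * (1 / sqrt (N m))) * (poly (P n) x * poly (P m) x) \<partial>M)"
    by (simp add: p_def)
  also have "\<dots> = (1 / sqrt (N n) * (1 / sqrt (N m))) * (if n = m then N n else 0)" by (simp only: integral_mult_right_zero P_integral)
  also have "\<dots> = (if n = m then 1 else 0)" using N_pos[of m] by auto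
  finally show "(\<integral>x. poly (p n) x * poly (p m) x \<partial>M) = (if n = m then 1 else 0)" .
qed

lemma LBINT_eq:
  assumes "continuous_on UNIV f" and "\<And>x. -1 < x \<Longrightarrow> x < 1 \<Longrightarrow> g x = f x * w x"
  shows "(LBINT x:{-1<..<1}. g x) = (\<integral>x. f x \<partial>M)"
  unfolding M_integral_eq[OF borel_measurable_continuous_onI[OF assms(1)]] set_lebesgue_integral_def
  by (intro Bochner_Integration.integral_cong) (auto simp: indicator_def assms(2))

lemma jacobi_norm_sq_eq: "jacobi_norm_sq \<alpha> \<beta> n = N n"
  unfolding jacobi_norm_sq_def N_def
  by (intro LBINT_eq continuous_intros) (simp add: jacobi_P_eq)

lemma jacobi_p_eq: "-1 < x \<Longrightarrow> x < 1 \<Longrightarrow> jacobi_p \<alpha> \<beta> n x = poly (p n) x"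
  by (simp add: jacobi_p_def jacobi_P_eq jacobi_norm_sq_eq p_def)

lemma jacobi_heat_kernel_eq:
  "jacobi_heat_kernel \<alpha> \<beta> t n m = (\<integral>x. exp (t * (x - 1)) * poly (p n) x * poly (p m) x \<partial>M)"
  unfolding jacobi_heat_kernel_def
  by (intro LBINT_eq continuous_intros) (simp add: jacobi_p_eq algebra_simps)

section \<open>The Jacobi differential operator and its eigenvalues\<close>

definition R :: "real poly \<Rightarrow> real poly" where
  "R q = [:1, 0, -1:] * pderiv (pderiv q) + [:\<beta> - \<alpha>, - (\<alpha> + \<beta> + 2):] * pderiv q"

text \<open>The integrand times \<open>w\<close> is the derivative of
  \<open>(1 - x^2) w q' r\<close>, the function \<open>g\<close> of the proof, which vanishes at
  both endpoints.\<close>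

lemma R_by_parts: "(\<integral>x. poly (R q) x * poly r x + (1 - x\<^sup>2) * poly (pderiv q) x * poly (pderiv r) x \<partial>M) = 0"
proof -
  define g where "g x = (1 - x) powr (\<alpha> + 1) * (1 + x) powr (\<beta> + 1) * poly (pderiv q) x * poly r x" for x :: real
  define f where "f x = poly (R q) x * poly r x + (1 - x\<^sup>2) * poly (pderiv q) x * poly (pderiv r) x" for x
  have ex: "0 < \<alpha> + 1" "0 < \<beta> + 1" using \<alpha> \<beta> by linarith+
  have 1: "((\<lambda>x. w x * f x) has_integral g 1 - g (-1)) {-1..1}"
  proof (rule fundamental_theorem_of_calculus_interior)
    show "continuous_on {-1..1} g" unfolding g_def using continuous_on_endpoint_powr ex
      by (intro continuous_on_mult continuous_on_poly continuous_on_id) auto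
    fix x :: real assume "x \<in> {-1<..<1}"
    then have x: "-1 < x" "x < 1" by auto
    have pw: "(1 - x) powr (\<alpha> + 1) = (1 - x) powr \<alpha> * (1 - x)" "(1 + x) powr (\<beta> + 1) = (1 + x) powr \<beta> * (1 + x)"
      using x by (simp_all add: powr_add)
    have "(g has_real_derivative (- ((\<alpha> + 1) * (1 - x) powr \<alpha>) * (1 + x) powr (\<beta> + 1) + (1 - x) powr (\<alpha> + 1) * ((\<beta> + 1) * (1 + x) powr \<beta>)) * poly (pderiv q) x * poly r x
       + (1 - x) powr (\<alpha> + 1) * (1 + x) powr (\<beta> + 1) * (poly (pderiv (pderiv q)) x * poly r x + poly (pderiv q) x * poly (pderiv r) x)) (at x)"
      unfolding g_def using x by (auto intro!: derivative_eq_intros simp: algebra_simps)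
    also have "(- ((\<alpha> + 1) * (1 - x) powr \<alpha>) * (1 + x) powr (\<beta> + 1) + (1 - x) powr (\<alpha> + 1) * ((\<beta> + 1) * (1 + x) powr \<beta>)) * poly (pderiv q) x * poly r x
       + (1 - x) powr (\<alpha> + 1) * (1 + x) powr (\<beta> + 1) * (poly (pderiv (pderiv q)) x * poly r x + poly (pderiv q) x * poly (pderiv r) x) = w x * f x"
      unfolding pw f_def R_def jacobi_density_def by (simp add: algebra_simps power2_eq_square)
    finally show "(g has_vector_derivative w x * f x) (at x)" by (simp add: has_real_derivative_iff_has_vector_derivative)
  qed simp
  have 0: "g 1 = 0" "g (-1) = 0" by (simp_all add: g_def)
  have 2: "((\<lambda>x. w x * f x) has_integral (\<integral>x. f x \<partial>M)) {-1..1}"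
    unfolding f_def by (intro M_has_integral continuous_intros)
  have "(\<integral>x. f x \<partial>M) = 0" using has_integral_unique[OF 2 1] 0 by simp
  then show ?thesis by (simp add: f_def)
qed

lemma R_symmetric: "(\<integral>x. poly (R q) x * poly r x \<partial>M) = - (\<integral>x. (1 - x\<^sup>2) * poly (pderiv q) x * poly (pderiv r) x \<partial>M)"
proof -
  have "(\<integral>x. poly (R q) x * poly r x \<partial>M) + (\<integral>x. (1 - x\<^sup>2) * poly (pderiv q) x * poly (pderiv r) x \<partial>M) = 0"
    unfolding R_by_parts[of q r, symmetric]
    by (intro Bochner_Integration.integral_add[symmetric] integrable_cont continuous_intros)
  then show ?thesis by simp
qed

lemma R_coeff_zero:
  assumes "\<And>i. n < i \<Longrightarrow> coeff q i = 0" "n < i"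
  shows "coeff (R q) i = 0"
  using assms(2)
  by (cases i; cases "i - 1") (auto simp: R_def mult_pCons_left coeff_pderiv assms(1))

lemma R_coeff_lead:
  assumes "\<And>i. n < i \<Longrightarrow> coeff q i = 0"
  shows "coeff (R q) n = - (real n * (real n + \<alpha> + \<beta> + 1)) * coeff q n"
  by (cases n; cases "n - 1") (auto simp: R_def mult_pCons_left coeff_pderiv assms algebra_simps)

definition ev :: "nat \<Rightarrow> real" where "ev n = real n * (real n + \<alpha> + \<beta> + 1)"

text \<open>\<open>R\<close> is symmetric and does not raise degrees, so \<open>R (p n)\<close> is
  orthogonal to all lower \<open>p l\<close> and is a multiple of \<open>p n\<close>; the leading
  coefficient identifies the factor.\<close>

lemma R_p: "R (p n) = smult (- ev n) (p n)"
proof -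
  have pc: "coeff (p l) i = 0" if "l < i" for l i using that deg(1)[of l] by (intro coeff_eq_0) auto
  have Rc: "coeff (R (p l)) i = 0" if "l < i" for l i using R_coeff_zero[OF pc that] by blast
  have zero: "(\<integral>x. poly (R (p n)) x * poly (p l) x \<partial>M) = 0" if "l < n" for l
  proof -
    have "(\<integral>x. poly (R (p n)) x * poly (p l) x \<partial>M) = (\<integral>x. poly (R (p l)) x * poly (p n) x \<partial>M)"
      unfolding R_symmetric by (simp add: mult_ac)
    also have "\<dots> = 0" by (rule orth_low[of n]) (use Rc that in auto)
    finally show ?thesis .
  qed
  define c where "c = (\<integral>x. poly (R (p n)) x * poly (p n) x \<partial>M)"
  have "R (p n) = (\<Sum>l<Suc n. smult (\<integral>x. poly (R (p n)) x * poly (p l) x \<partial>M) (p l))"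
    by (rule expand) (use Rc in auto)
  also have "\<dots> = smult c (p n)" by (simp add: zero c_def)
  finally have eq: "R (p n) = smult c (p n)" .
  have "coeff (R (p n)) n = - ev n * coeff (p n) n" unfolding ev_def by (rule R_coeff_lead) (use pc in auto)
  moreover have "coeff (p n) n \<noteq> 0" using deg[of n] by (metis leading_coeff_0_iff)
  moreover have "coeff (R (p n)) n = c * coeff (p n) n" unfolding eq by simp
  ultimately have "c = - ev n" by (metis mult_right_cancel)
  then show ?thesis using eq by simp
qed

lemma p_ode: "(1 - x\<^sup>2) * poly (pderiv (pderiv (p n))) x + (\<beta> - \<alpha> - (\<alpha> + \<beta> + 2) * x) * poly (pderiv (p n)) x = - ev n * poly (p n) x"
proof -
  have "poly (R (p n)) x = - ev n * poly (p n) x" by (simp add: R_p)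
  then show ?thesis by (simp add: R_def power2_eq_square algebra_simps)
qed

lemma p_deriv_norm: "(\<integral>x. (1 - x\<^sup>2) * (poly (pderiv (p n)) x)\<^sup>2 \<partial>M) = ev n"
proof -
  have "(\<integral>x. (1 - x\<^sup>2) * poly (pderiv (p n)) x * poly (pderiv (p n)) x \<partial>M) = - (\<integral>x. poly (R (p n)) x * poly (p n) x \<partial>M)"
    unfolding R_symmetric by simp
  also have "\<dots> = ev n" by (simp add: R_p orth mult.assoc)
  finally show ?thesis by (simp add: power2_eq_square mult.assoc)
qed

end

section \<open>Pointwise bounds for Jacobi polynomials\<close>

context jacobi
begin

text \<open>\<open>q\<close> is \<open>w\<close> times \<open>sqrt (1 - x^2)\<close>, the weight of
  the bound to be proved, and \<open>m / (1 - x^2)\<close> is minus its logarithmic derivative.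
  \<open>c0\<close> bounds \<open>m\<close> and the linear function in \<open>h_le\<close> on
  \<open>{-1..1}\<close>.\<close>

definition q :: "real \<Rightarrow> real" where "q x = (1 - x) powr (\<alpha> + 1/2) * (1 + x) powr (\<beta> + 1/2)"
definition m :: "real \<Rightarrow> real" where "m x = (\<alpha> - \<beta>) + (\<alpha> + \<beta> + 1) * x"
definition c0 :: real where "c0 = \<bar>\<alpha> - \<beta>\<bar> + \<bar>\<alpha> + \<beta> + 1\<bar> + 1"
text \<open>Small enough that the slope factor
  \<open>2 * \<Lambda> * 2 powr \<bar>\<beta>\<bar>\<close> times the width
  \<open>e2 / \<Lambda>\<close> of the last layer is 1/2.\<close>

definition e2 :: real where "e2 = 1 / (4 * 2 powr \<bar>\<beta>\<bar>)"
text \<open>\<open>15 * exp 1\<close> bounds the energy divided by \<open>\<Lambda>\<close> up to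
  distance \<open>c0^2 / \<Lambda>\<close> from 1, and the power is the growth from there to
  distance \<open>e2 / \<Lambda>\<close>; the 2 in it covers small \<open>\<Lambda>\<close>.\<close>

definition CE :: real where "CE = 15 * exp 1 * (2 * c0\<^sup>2 / e2) powr c0"

lemma c0_ge: "1 \<le> c0" by (simp add: c0_def)

lemma m_le: "\<bar>x\<bar> \<le> 1 \<Longrightarrow> \<bar>m x\<bar> \<le> c0"
proof -
  assume x: "\<bar>x\<bar> \<le> 1"
  have "\<bar>m x\<bar> \<le> \<bar>\<alpha> - \<beta>\<bar> + \<bar>\<alpha> + \<beta> + 1\<bar> * \<bar>x\<bar>" unfolding m_def by (rule order_trans[OF abs_triangle_ineq]) (simp add: abs_mult)
  also have "\<dots> \<le> \<bar>\<alpha> - \<beta>\<bar> + \<bar>\<alpha> + \<beta> + 1\<bar> * 1" using x by (intro add_mono mult_left_mono) auto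
  finally show ?thesis by (simp add: c0_def)
qed

lemma h_le: "\<bar>x\<bar> \<le> 1 \<Longrightarrow> \<bar>(\<alpha> + \<beta> + 1) + (\<alpha> - \<beta>) * x\<bar> \<le> c0"
proof -
  assume x: "\<bar>x\<bar> \<le> 1"
  have "\<bar>(\<alpha> + \<beta> + 1) + (\<alpha> - \<beta>) * x\<bar> \<le> \<bar>\<alpha> + \<beta> + 1\<bar> + \<bar>\<alpha> - \<beta>\<bar> * \<bar>x\<bar>" by (rule order_trans[OF abs_triangle_ineq]) (simp add: abs_mult)
  also have "\<dots> \<le> \<bar>\<alpha> + \<beta> + 1\<bar> + \<bar>\<alpha> - \<beta>\<bar> * 1" using x by (intro add_mono mult_left_mono) auto
  finally show ?thesis by (simp add: c0_def)
qed

lemma e2: "0 < e2" "e2 \<le> 1/4"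
proof -
  have "1 \<le> 2 powr \<bar>\<beta>\<bar>" by (rule ge_one_powr_ge_zero) auto
  then show "0 < e2" "e2 \<le> 1/4" by (auto simp: e2_def field_simps)
qed

lemma q_pos: "-1 < x \<Longrightarrow> x < 1 \<Longrightarrow> 0 < q x" by (simp add: q_def)

lemma one_minus_square_pos: "-1 < x \<Longrightarrow> x < 1 \<Longrightarrow> 0 < 1 - x\<^sup>2" for x :: real
  using mult_pos_pos[of "1 - x" "1 + x"] by (simp add: power2_eq_square algebra_simps)

lemma w_sqrt: "-1 < x \<Longrightarrow> x < 1 \<Longrightarrow> w x * sqrt (1 - x\<^sup>2) = q x"
proof -
  assume x: "-1 < x" "x < 1"
  have "1 - x\<^sup>2 = (1 - x) * (1 + x)" by (simp add: power2_eq_square algebra_simps)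
  then have "sqrt (1 - x\<^sup>2) = (1 - x) powr (1/2) * (1 + x) powr (1/2)"
    using x by (simp add: real_sqrt_mult powr_half_sqrt)
  then show ?thesis unfolding jacobi_density_def q_def powr_add by simp
qed

lemma q_deriv:
  assumes x: "-1 < x" "x < 1"
  shows "(q has_real_derivative - (q x * m x / (1 - x\<^sup>2))) (at x)"
proof -
  define u v where "u = (1 - x) powr (\<alpha> + 1/2)" and "v = (1 + x) powr (\<beta> + 1/2)"
  have p: "(1 - x) powr (\<alpha> + 1/2 - 1) = u / (1 - x)" "(1 + x) powr (\<beta> + 1/2 - 1) = v / (1 + x)"
    using x unfolding u_def v_def by (simp_all only: powr_diff powr_one less_imp_le diff_gt_0_iff_gt)
  have "(q has_real_derivative - ((\<alpha> + 1/2) * (1 - x) powr (\<alpha> + 1/2 - 1)) * v + u * ((\<beta> + 1/2) * (1 + x) powr (\<beta> + 1/2 - 1))) (at x)"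
    unfolding q_def u_def v_def using x by (auto intro!: derivative_eq_intros)
  also have "- ((\<alpha> + 1/2) * (1 - x) powr (\<alpha> + 1/2 - 1)) * v + u * ((\<beta> + 1/2) * (1 + x) powr (\<beta> + 1/2 - 1)) = - (q x * m x / (1 - x\<^sup>2))"
  proof -
    have S: "1 - x\<^sup>2 = (1 - x) * (1 + x)" by (simp add: power2_eq_square algebra_simps)
    have ne: "1 - x \<noteq> 0" "1 + x \<noteq> 0" using x by auto
    have "- ((\<alpha> + 1/2) * (u / (1 - x))) * v + u * ((\<beta> + 1/2) * (v / (1 + x)))
       = u * v * (- (\<alpha> + 1/2) * (1 + x) + (\<beta> + 1/2) * (1 - x)) / ((1 - x) * (1 + x))"
      using ne by (simp add: field_simps)
    also have "- (\<alpha> + 1/2) * (1 + x) + (\<beta> + 1/2) * (1 - x) = - m x" by (simp add: m_def field_simps)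
    finally show ?thesis unfolding p S by (simp add: q_def u_def v_def)
  qed
  finally show ?thesis .
qed

text \<open>The energy \<open>E\<close> has a derivative that is not integrable up to 1; subtracting the term \<open>q m Y Y'\<close> gives \<open>F\<close>, which
  is comparable to \<open>E\<close> while \<open>1 - x \<ge> c0\<^sup>2 / \<Lambda>\<close> and there has a logarithmic derivative of integral
  \<open>O(1)\<close>. Up to distance \<open>e2 / \<Lambda>\<close> from 1 the energy grows by a bounded factor, and in the remaining layer the
  Sturm-Liouville form of the equation keeps \<open>Y\<close> within a factor 2 of its value at the edge.\<close>

lemma pointwise_bound:
  fixes y :: "real poly" and \<Lambda> :: real
  assumes \<Lambda>: "1 \<le> \<Lambda>"
    and ode: "\<And>x. (1 - x\<^sup>2) * poly (pderiv (pderiv y)) x + (\<beta> - \<alpha> - (\<alpha> + \<beta> + 2) * x) * poly (pderiv y) x = - \<Lambda> * poly y x"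
    and norm: "((\<lambda>x. w x * ((1 - x\<^sup>2) * (poly (pderiv y) x)\<^sup>2 + \<Lambda> * (poly y x)\<^sup>2)) has_integral 2 * \<Lambda>) {-1..1}"
    and x: "1/2 \<le> x" "x < 1"
  shows "q x * (poly y x)\<^sup>2 \<le> 4 * 2 powr (\<beta> + 1/2) * CE"
proof -
  define Y Y1 where "Y = poly y" and "Y1 = poly (pderiv y)"
  define K where "K x = (1 - x\<^sup>2) * (Y1 x)\<^sup>2 + \<Lambda> * (Y x)\<^sup>2" for x
  define E where "E x = q x * K x" for x
  have sl: "1 \<le> sqrt \<Lambda>" "sqrt \<Lambda> * sqrt \<Lambda> = \<Lambda>" using \<Lambda> by auto
  have dY: "(Y has_real_derivative Y1 x) (at x)" for x unfolding Y_def Y1_def by (rule poly_DERIV)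
  have dY1: "(Y1 has_real_derivative poly (pderiv (pderiv y)) x) (at x)" for x unfolding Y1_def by (rule poly_DERIV)
  have S: "0 < 1 - x\<^sup>2" if "0 \<le> x" "x < 1" for x :: real using that by (intro one_minus_square_pos) auto
  have K0: "0 \<le> K x" if "0 \<le> x" "x < 1" for x using S[OF that] \<Lambda> by (simp add: K_def)
  have E0: "0 \<le> E x" if "0 \<le> x" "x < 1" for x using K0[OF that] q_pos[of x] that by (simp add: E_def)
  have dK: "(K has_real_derivative 2 * m x * (Y1 x)\<^sup>2) (at x)" for x
  proof -
    have "(K has_real_derivative - 2 * x * (Y1 x)\<^sup>2 + 2 * Y1 x * ((1 - x\<^sup>2) * poly (pderiv (pderiv y)) x) + 2 * \<Lambda> * Y x * Y1 x) (at x)"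
      unfolding K_def by (auto intro!: derivative_eq_intros dY dY1 simp: algebra_simps power2_eq_square)
    also have "(1 - x\<^sup>2) * poly (pderiv (pderiv y)) x = - \<Lambda> * Y x - (\<beta> - \<alpha> - (\<alpha> + \<beta> + 2) * x) * Y1 x"
      using ode[of x] by (simp add: Y_def Y1_def)
    also have "- 2 * x * (Y1 x)\<^sup>2 + 2 * Y1 x * (- \<Lambda> * Y x - (\<beta> - \<alpha> - (\<alpha> + \<beta> + 2) * x) * Y1 x) + 2 * \<Lambda> * Y x * Y1 x = 2 * m x * (Y1 x)\<^sup>2"
      by (simp add: m_def algebra_simps power2_eq_square)
    finally show ?thesis .
  qed
  have dE: "(E has_real_derivative q x * m x / (1 - x\<^sup>2) * ((1 - x\<^sup>2) * (Y1 x)\<^sup>2 - \<Lambda> * (Y x)\<^sup>2)) (at x)" if "0 \<le> x" "x < 1" for x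
  proof -
    have "(E has_real_derivative - (q x * m x / (1 - x\<^sup>2)) * K x + q x * (2 * m x * (Y1 x)\<^sup>2)) (at x)"
      unfolding E_def using that by (auto intro!: derivative_eq_intros q_deriv dK)
    also have "- (q x * m x / (1 - x\<^sup>2)) * K x + q x * (2 * m x * (Y1 x)\<^sup>2) = q x * m x / (1 - x\<^sup>2) * ((1 - x\<^sup>2) * (Y1 x)\<^sup>2 - \<Lambda> * (Y x)\<^sup>2)"
      unfolding K_def using S[OF that] by (simp add: divide_simps) (simp add: algebra_simps)
    finally show ?thesis .
  qed
  have cross: "2 * (sqrt (1 - x\<^sup>2) * sqrt \<Lambda> * \<bar>Y x * Y1 x\<bar>) \<le> K x" if "0 \<le> x" "x < 1" for x
  proof -
    have "2 * \<bar>sqrt (1 - x\<^sup>2) * Y1 x\<bar> * \<bar>sqrt \<Lambda> * Y x\<bar> \<le> \<bar>sqrt (1 - x\<^sup>2) * Y1 x\<bar>\<^sup>2 + \<bar>sqrt \<Lambda> * Y x\<bar>\<^sup>2"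
      by (rule sum_squares_bound)
    also have "\<dots> = K x" using S[OF that] \<Lambda> by (simp add: K_def power_mult_distrib)
    finally show ?thesis using S[OF that] \<Lambda> by (simp add: abs_mult mult_ac)
  qed
  \<comment> \<open>The integral of \<open>w * K\<close> is \<open>2 * \<Lambda>\<close>, whereas
    \<open>E > 5 * \<Lambda>\<close> throughout \<open>{0..1/2}\<close> would make it at least
    \<open>5 / 2 * \<Lambda>\<close>, because \<open>q \<le> w\<close>.\<close>
  have "\<exists>x0. 0 \<le> x0 \<and> x0 \<le> 1/2 \<and> E x0 \<le> 5 * \<Lambda>"
  proof (rule ccontr)
    assume "\<not> ?thesis"
    then have big: "5 * \<Lambda> < E x" if "0 \<le> x" "x \<le> 1/2" for x using that by (meson not_le)
    have "((\<lambda>x::real. 5 * \<Lambda>) has_integral 5 * \<Lambda> * (1/2 - 0)) {0..1/2}" using has_integral_const_real[of "5 * \<Lambda>" 0 "1/2"] by (simp add: mult.commute)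
    moreover have cont: "continuous_on {0..1/2} (\<lambda>x. w x * K x)"
      unfolding jacobi_density_def K_def Y_def Y1_def by (intro continuous_intros) auto
    then have I: "((\<lambda>x. w x * K x) has_integral integral {0..1/2} (\<lambda>x. w x * K x)) {0..1/2}"
      by (intro integrable_integral integrable_continuous_real)
    ultimately have "5 * \<Lambda> * (1/2 - 0) \<le> integral {0..1/2} (\<lambda>x. w x * K x)"
    proof (rule has_integral_le)
      fix x :: real assume "x \<in> {0..1/2}"
      then have x: "0 \<le> x" "x \<le> 1/2" by auto
      have "q x \<le> w x * 1" unfolding w_sqrt[symmetric, of x, OF order_less_le_trans[of "-1" 0, OF _ x(1), simplified] order_le_less_trans[OF x(2), of 1, simplified]]
        using w_nonneg by (intro mult_left_mono) auto
      then have "E x \<le> w x * K x" using K0[of x] x unfolding E_def by (intro mult_right_mono) auto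
      then show "5 * \<Lambda> \<le> w x * K x" using big[OF x] by simp
    qed
    also have "\<dots> \<le> 2 * \<Lambda>"
    proof (rule has_integral_subset_le[OF _ I])
      show "((\<lambda>x. w x * K x) has_integral 2 * \<Lambda>) {-1..1}" using norm by (simp add: K_def Y_def Y1_def)
      show "\<forall>x\<in>{-1..1}. 0 \<le> w x * K x"
      proof
        fix x :: real assume "x \<in> {-1..1}"
        then have "0 \<le> 1 - x\<^sup>2" by (simp add: abs_square_le_1 abs_le_iff)
        then show "0 \<le> w x * K x" using \<Lambda> w_nonneg by (simp add: K_def)
      qed
    qed auto
    finally show False using \<Lambda> by simp
  qed
  then obtain x0 where x0: "0 \<le> x0" "x0 \<le> 1/2" "E x0 \<le> 5 * \<Lambda>" by blast
  \<comment> \<open>The derivative of \<open>E\<close> is at most \<open>c0 * E / (1 - x)\<close>,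
    so \<open>E * (1 - x) powr c0\<close> is nonincreasing.\<close>
  have growth: "E v \<le> E u * ((1 - u) / (1 - v)) powr c0" if uv: "0 \<le> u" "u \<le> v" "v < 1" for u v
  proof -
    have "E v * (1 - v) powr c0 \<le> E u * (1 - u) powr c0"
    proof (rule DERIV_nonpos_imp_nonincreasing[OF uv(2)])
      fix x assume "u \<le> x" "x \<le> v"
      then have x: "0 \<le> x" "x < 1" using uv by auto
      define E' where "E' = q x * m x / (1 - x\<^sup>2) * ((1 - x\<^sup>2) * (Y1 x)\<^sup>2 - \<Lambda> * (Y x)\<^sup>2)"
      have E': "E' \<le> c0 * E x / (1 - x)"
      proof -
        have "E' \<le> \<bar>E'\<bar>" by simp
        also have "\<dots> = q x * \<bar>m x\<bar> / (1 - x\<^sup>2) * \<bar>(1 - x\<^sup>2) * (Y1 x)\<^sup>2 - \<Lambda> * (Y x)\<^sup>2\<bar>"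
          using q_pos[of x] S[OF x] x by (simp add: E'_def abs_mult)
        also have "\<dots> \<le> q x * c0 / (1 - x) * K x"
        proof (intro mult_mono frac_le)
          have "0 \<le> (1 - x\<^sup>2) * (Y1 x)\<^sup>2" "0 \<le> \<Lambda> * (Y x)\<^sup>2" using S[OF x] \<Lambda> by auto
          then show "\<bar>(1 - x\<^sup>2) * (Y1 x)\<^sup>2 - \<Lambda> * (Y x)\<^sup>2\<bar> \<le> K x" unfolding K_def by linarith
          show "\<bar>m x\<bar> \<le> c0" using x by (intro m_le) auto
          have "x * x \<le> 1 * x" using x by (intro mult_right_mono) auto
          then show "1 - x \<le> 1 - x\<^sup>2" by (simp add: power2_eq_square)
        qed (use q_pos[of x] x c0_ge in \<open>auto simp: less_imp_le\<close>)
        finally show ?thesis by (simp add: E_def mult_ac)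
      qed
      have d: "((\<lambda>x. E x * (1 - x) powr c0) has_real_derivative E' * (1 - x) powr c0 + E x * (- (c0 * (1 - x) powr (c0 - 1)))) (at x)"
        using x by (auto intro!: derivative_eq_intros dE[OF x] simp: E'_def)
      have "(1 - x) powr (c0 - 1) = (1 - x) powr c0 / (1 - x)" using x by (simp add: powr_diff)
      then have "E' * (1 - x) powr c0 + E x * (- (c0 * (1 - x) powr (c0 - 1))) = (E' - c0 * E x / (1 - x)) * (1 - x) powr c0"
        by (simp add: left_diff_distrib)
      also have "\<dots> \<le> 0" using E' by (simp add: mult_nonpos_nonneg)
      finally show "\<exists>y. ((\<lambda>x. E x * (1 - x) powr c0) has_real_derivative y) (at x) \<and> y \<le> 0" using d by blast
    qed
    then show ?thesis using uv by (simp add: powr_divide pos_le_divide_eq)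
  qed
  define F where "F x = q x * (K x - m x * (Y x * Y1 x))" for x
  \<comment> \<open>The squares of \<open>Y\<close> and \<open>Y1\<close> cancel and only the
    product \<open>Y * Y1\<close> remains. By \<open>cross\<close> it is smaller than
    \<open>K\<close> by a factor of order \<open>sqrt ((1 - x^2) * \<Lambda>)\<close>, which is the
    gain over the derivative of \<open>E\<close>.\<close>
  have dF: "(F has_real_derivative - (((\<alpha> + \<beta> + 1) + (\<alpha> - \<beta>) * x) * (q x * (Y x * Y1 x)) / (1 - x\<^sup>2))) (at x)" if "0 \<le> x" "x < 1" for x
  proof -
    define S' where "S' = 1 - x\<^sup>2"
    define Y2 where "Y2 = poly (pderiv (pderiv y)) x"
    have S'0: "S' \<noteq> 0" using S[OF that] by (simp add: S'_def)
    have V: "S' * Y2 = - \<Lambda> * Y x - (\<beta> - \<alpha> - (\<alpha> + \<beta> + 2) * x) * Y1 x" using ode[of x] by (simp add: Y_def Y1_def Y2_def S'_def)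
    have dm: "(m has_real_derivative (\<alpha> + \<beta> + 1)) (at x)" unfolding m_def by (auto intro!: derivative_eq_intros)
    have "(F has_real_derivative - (q x * m x / S') * (K x - m x * (Y x * Y1 x)) + q x * (2 * m x * (Y1 x)\<^sup>2 - ((\<alpha> + \<beta> + 1) * (Y x * Y1 x) + m x * (Y1 x * Y1 x + Y x * Y2)))) (at x)"
      unfolding F_def S'_def Y2_def using that by (auto intro!: derivative_eq_intros q_deriv dK dm dY dY1 simp: algebra_simps diff_divide_distrib)
    also have "- (q x * m x / S') * (K x - m x * (Y x * Y1 x)) + q x * (2 * m x * (Y1 x)\<^sup>2 - ((\<alpha> + \<beta> + 1) * (Y x * Y1 x) + m x * (Y1 x * Y1 x + Y x * Y2)))
      = q x * (- (m x * (K x - m x * (Y x * Y1 x))) + S' * (2 * m x * (Y1 x)\<^sup>2) - (S' * (\<alpha> + \<beta> + 1) * (Y x * Y1 x) + m x * (S' * (Y1 x * Y1 x) + Y x * (S' * Y2)))) / S'"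
      using S'0 by (simp add: divide_simps) (simp add: algebra_simps)
    also have "- (m x * (K x - m x * (Y x * Y1 x))) + S' * (2 * m x * (Y1 x)\<^sup>2) - (S' * (\<alpha> + \<beta> + 1) * (Y x * Y1 x) + m x * (S' * (Y1 x * Y1 x) + Y x * (S' * Y2)))
      = - (((\<alpha> + \<beta> + 1) + (\<alpha> - \<beta>) * x) * (Y x * Y1 x))"
      unfolding V unfolding K_def S'_def m_def by (simp add: algebra_simps power2_eq_square)
    finally show ?thesis by (simp add: S'_def mult_ac)
  qed
  define x2 where "x2 = 1 - e2 / \<Lambda>"
  have el: "0 < e2 / \<Lambda>" "e2 / \<Lambda> \<le> 1/4"
  proof -
    show "0 < e2 / \<Lambda>" using e2 \<Lambda> by simp
    have "e2 / \<Lambda> \<le> e2 / 1" using e2 \<Lambda> by (intro divide_left_mono) auto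
    then show "e2 / \<Lambda> \<le> 1/4" using e2 by linarith
  qed
  have x2: "3/4 \<le> x2" "x2 < 1" using el by (auto simp: x2_def)
  have base: "1 \<le> 2 * c0\<^sup>2 / e2"
  proof -
    have "1 \<le> c0\<^sup>2" using c0_ge by (simp add: one_le_power)
    then show ?thesis using e2 by (simp add: pos_le_divide_eq)
  qed
  have CEpos: "0 < CE" "15 * exp 1 \<le> CE"
  proof -
    have "1 \<le> (2 * c0\<^sup>2 / e2) powr c0" using base c0_ge by (intro ge_one_powr_ge_zero) auto
    then show "15 * exp 1 \<le> CE" by (simp add: CE_def)
    then show "0 < CE" using exp_gt_zero[of "1::real"] by linarith
  qed
  have Ebound: "E x \<le> CE * \<Lambda>" if x: "1/2 \<le> x" "x \<le> x2" for x
  proof (cases "c0\<^sup>2 / \<Lambda> \<le> 1/2")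
    \<comment> \<open>Small \<open>\<Lambda>\<close>, below \<open>2 * c0^2\<close>: growth from
      \<open>x0\<close> alone is enough, since
      \<open>(1 - x0) / (1 - x) \<le> \<Lambda> / e2\<close>.\<close>
    case False
    have "E x \<le> E x0 * ((1 - x0) / (1 - x)) powr c0" using x x0 x2 by (intro growth) auto
    also have "\<dots> \<le> 5 * \<Lambda> * (2 * c0\<^sup>2 / e2) powr c0"
    proof (intro mult_mono powr_mono2)
      have "\<Lambda> < 2 * c0\<^sup>2" using False \<Lambda> by (simp add: pos_divide_le_eq not_le)
      have "(1 - x0) / (1 - x) \<le> 1 / (e2 / \<Lambda>)" using x x0 x2 el by (intro frac_le) (auto simp: x2_def)
      also have "\<dots> = \<Lambda> / e2" by simp
      also have "\<dots> \<le> 2 * c0\<^sup>2 / e2" using \<open>\<Lambda> < 2 * c0\<^sup>2\<close> e2 by (intro divide_right_mono) auto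
      finally show "(1 - x0) / (1 - x) \<le> 2 * c0\<^sup>2 / e2" .
    qed (use x x0 x2 c0_ge \<Lambda> in auto)
    also have "\<dots> = 5 * (2 * c0\<^sup>2 / e2) powr c0 * \<Lambda>" by simp
    also have "\<dots> \<le> CE * \<Lambda>"
    proof (intro mult_right_mono)
      have "5 * (2 * c0\<^sup>2 / e2) powr c0 \<le> 15 * exp 1 * (2 * c0\<^sup>2 / e2) powr c0"
        using exp_ge_add_one_self[of 1] by (intro mult_right_mono) auto
      then show "5 * (2 * c0\<^sup>2 / e2) powr c0 \<le> CE" by (simp add: CE_def)
    qed (use \<Lambda> in auto)
    finally show ?thesis .
  next
    case True
    \<comment> \<open>Up to \<open>x1\<close> the product
      \<open>sqrt (1 - z^2) * sqrt \<Lambda>\<close> is at least \<open>c0\<close>, so the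
      correction in \<open>F\<close> is at most half of the energy.\<close>
    define x1 where "x1 = 1 - c0\<^sup>2 / \<Lambda>"
    have c2: "0 < c0\<^sup>2 / \<Lambda>" using c0_ge \<Lambda> by simp
    have x1: "1/2 \<le> x1" "x1 < 1" using True c2 by (auto simp: x1_def)
    have s_ge: "c0 \<le> sqrt (1 - z\<^sup>2) * sqrt \<Lambda>" if "0 \<le> z" "z \<le> x1" for z
    proof -
      have "z * z \<le> 1 * z" using that x1 by (intro mult_right_mono) auto
      then have "c0\<^sup>2 / \<Lambda> \<le> 1 - z\<^sup>2" using that by (simp add: x1_def power2_eq_square)
      then have "c0\<^sup>2 \<le> (1 - z\<^sup>2) * \<Lambda>" using \<Lambda> by (simp add: pos_divide_le_eq)
      then have "sqrt (c0\<^sup>2) \<le> sqrt ((1 - z\<^sup>2) * \<Lambda>)" by (rule real_sqrt_le_mono)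
      then show ?thesis using c0_ge by (simp add: real_sqrt_mult)
    qed
    have small: "\<bar>m z * (Y z * Y1 z)\<bar> \<le> K z / 2" if z: "0 \<le> z" "z \<le> x1" for z
    proof -
      have z1: "z < 1" using z x1 by simp
      have "\<bar>m z * (Y z * Y1 z)\<bar> \<le> c0 * \<bar>Y z * Y1 z\<bar>" unfolding abs_mult[of "m z"] using z z1 by (intro mult_right_mono m_le) auto
      also have "\<dots> \<le> (sqrt (1 - z\<^sup>2) * sqrt \<Lambda>) * \<bar>Y z * Y1 z\<bar>" by (intro mult_right_mono s_ge z) auto
      also have "\<dots> \<le> K z / 2" using cross[OF z(1) z1] by simp
      finally show ?thesis .
    qed
    have FE: "E z / 2 \<le> F z" "F z \<le> 3 / 2 * E z" if z: "0 \<le> z" "z \<le> x1" for z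
    proof -
      have qz: "0 < q z" using z x1 by (intro q_pos) auto
      have "K z / 2 \<le> K z - m z * (Y z * Y1 z)" "K z - m z * (Y z * Y1 z) \<le> 3 / 2 * K z" using small[OF z] by linarith+
      then have "q z * (K z / 2) \<le> q z * (K z - m z * (Y z * Y1 z))" "q z * (K z - m z * (Y z * Y1 z)) \<le> q z * (3 / 2 * K z)"
        using qz by (intro mult_left_mono; simp)+
      then show "E z / 2 \<le> F z" "F z \<le> 3 / 2 * E z" by (simp_all add: E_def F_def)
    qed
    \<comment> \<open>\<open>T\<close> has derivative \<open>(1 - z^2) powr (-3/2)\<close>, so
      \<open>k * T\<close> bounds the integral of the logarithmic derivative of \<open>F\<close>,
      and \<open>k * T z \<le> 1\<close> up to \<open>x1\<close>.\<close>
    define T where "T z = z / sqrt (1 - z\<^sup>2)" for z :: real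
    define k where "k = c0 / sqrt \<Lambda>"
    have k: "0 \<le> k" using c0_ge \<Lambda> by (simp add: k_def)
    \<comment> \<open>15 = (3/2) * 5 * 2: passing from \<open>E\<close> to \<open>F\<close> at
      \<open>x0\<close>, the value of \<open>E\<close> there, and passing back at
      \<open>z\<close>.\<close>
    have near: "E z \<le> 15 * exp 1 * \<Lambda>" if z: "1/2 \<le> z" "z \<le> x1" for z
    proof -
      have "F z * exp (- (k * T z)) \<le> F x0 * exp (- (k * T x0))"
      proof (rule DERIV_nonpos_imp_nonincreasing[where f = "\<lambda>x. F x * exp (- (k * T x))"])
        show "x0 \<le> z" using x0 z by simp
        fix v assume "x0 \<le> v" "v \<le> z"
        then have v: "0 \<le> v" "v \<le> x1" "v < 1" using x0 z x1 by auto
        define s where "s = sqrt (1 - v\<^sup>2)"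
        have s: "0 < s" "s\<^sup>2 = 1 - v\<^sup>2" using S[OF v(1,3)] by (auto simp: s_def)
        have dT: "(T has_real_derivative 1 / (s\<^sup>2 * s)) (at v)"
        proof -
          have "(T has_real_derivative (1 * sqrt (1 - v\<^sup>2) - v * (inverse (sqrt (1 - v\<^sup>2)) / 2 * (- (2 * v)))) / (sqrt (1 - v\<^sup>2) * sqrt (1 - v\<^sup>2))) (at v)"
            unfolding T_def using S[OF v(1,3)] by (auto intro!: derivative_eq_intros)
          also have "(1 * sqrt (1 - v\<^sup>2) - v * (inverse (sqrt (1 - v\<^sup>2)) / 2 * (- (2 * v)))) / (sqrt (1 - v\<^sup>2) * sqrt (1 - v\<^sup>2)) = (s\<^sup>2 + v\<^sup>2) / (s\<^sup>2 * s)"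
            unfolding s_def[symmetric] using s by (simp add: field_simps power2_eq_square)
          also have "s\<^sup>2 + v\<^sup>2 = 1" using s by simp
          finally show ?thesis .
        qed
        define F' where "F' = - (((\<alpha> + \<beta> + 1) + (\<alpha> - \<beta>) * v) * (q v * (Y v * Y1 v)) / (1 - v\<^sup>2))"
        have F': "F' \<le> k * F v / (s\<^sup>2 * s)"
        proof -
          have qv: "0 < q v" using v by (intro q_pos) auto
          have "F' \<le> \<bar>F'\<bar>" by simp
          also have "\<dots> = \<bar>(\<alpha> + \<beta> + 1) + (\<alpha> - \<beta>) * v\<bar> * (q v * \<bar>Y v * Y1 v\<bar>) / s\<^sup>2"
            using qv s S[OF v(1,3)] by (simp add: F'_def abs_mult)
          also have "\<dots> \<le> c0 * (q v * (K v / (2 * (s * sqrt \<Lambda>)))) / s\<^sup>2"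
          proof (intro divide_right_mono mult_mono h_le)
            have "\<bar>Y v * Y1 v\<bar> * (2 * (s * sqrt \<Lambda>)) \<le> K v" using cross[OF v(1,3)] by (simp add: s_def mult_ac)
            then show "\<bar>Y v * Y1 v\<bar> \<le> K v / (2 * (s * sqrt \<Lambda>))" using s sl by (simp add: pos_le_divide_eq)
          qed (use qv v c0_ge in auto)
          also have "\<dots> = k * (E v / 2) / (s\<^sup>2 * s)" using s sl by (simp add: k_def E_def)
          also have "\<dots> \<le> k * F v / (s\<^sup>2 * s)" using FE(1)[OF v(1,2)] k s(1) by (intro divide_right_mono mult_left_mono) auto
          finally show ?thesis .
        qed
        have "((\<lambda>x. F x * exp (- (k * T x))) has_real_derivative F' * exp (- (k * T v)) + F v * (exp (- (k * T v)) * (- (k * (1 / (s\<^sup>2 * s)))))) (at v)"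
          using dF[OF v(1,3)] dT by (auto intro!: derivative_eq_intros simp: F'_def)
        moreover have "F' * exp (- (k * T v)) + F v * (exp (- (k * T v)) * (- (k * (1 / (s\<^sup>2 * s))))) = (F' - k * F v / (s\<^sup>2 * s)) * exp (- (k * T v))"
          by (simp add: algebra_simps)
        moreover have "\<dots> \<le> 0" using F' by (simp add: mult_nonpos_nonneg)
        ultimately show "\<exists>y. ((\<lambda>x. F x * exp (- (k * T x))) has_real_derivative y) (at v) \<and> y \<le> 0" by force
      qed
      also have "\<dots> \<le> F x0 * 1"
      proof (rule mult_left_mono)
        have "0 \<le> T x0" using x0 S[of x0] by (simp add: T_def)
        then show "exp (- (k * T x0)) \<le> 1" using k by simp
        show "0 \<le> F x0" using FE(1)[of x0] E0[of x0] x0 x1 by simp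
      qed
      finally have "F z * exp (- (k * T z)) * exp (k * T z) \<le> F x0 * exp (k * T z)" by simp
      then have "F z \<le> F x0 * exp (k * T z)" by (simp add: mult.assoc flip: exp_add)
      also have "\<dots> \<le> (3 / 2 * (5 * \<Lambda>)) * exp 1"
      proof (intro mult_mono)
        show "F x0 \<le> 3 / 2 * (5 * \<Lambda>)" using FE(2)[of x0] x0 x1 by simp
        have s: "0 < sqrt (1 - z\<^sup>2)" using S[of z] z x1 by simp
        have "k * T z \<le> k * (1 / sqrt (1 - z\<^sup>2))" unfolding T_def using k s z x1 by (intro mult_left_mono divide_right_mono) auto
        also have "\<dots> = c0 / (sqrt (1 - z\<^sup>2) * sqrt \<Lambda>)" by (simp add: k_def mult.commute)
        also have "\<dots> \<le> 1" using s_ge[of z] z s sl by (simp add: pos_divide_le_eq)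
        finally show "exp (k * T z) \<le> exp 1" by simp
      qed (use \<Lambda> in auto)
      finally have "F z \<le> 15 / 2 * exp 1 * \<Lambda>" by (simp add: mult_ac)
      then show ?thesis using FE(1)[of z] z by simp
    qed
    show ?thesis
    proof (cases "x \<le> x1")
      case True
      have "15 * exp 1 * \<Lambda> \<le> CE * \<Lambda>" using CEpos \<Lambda> by (intro mult_right_mono) auto
      then show ?thesis using near[OF x(1) True] by simp
    next
      case False
      have "E x \<le> E x1 * ((1 - x1) / (1 - x)) powr c0" using x x1 x2 False by (intro growth) auto
      also have "\<dots> \<le> 15 * exp 1 * \<Lambda> * (2 * c0\<^sup>2 / e2) powr c0"
      proof (intro mult_mono powr_mono2)
        show "E x1 \<le> 15 * exp 1 * \<Lambda>" using near[of x1] x1 by simp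
        have "(1 - x1) / (1 - x) \<le> (c0\<^sup>2 / \<Lambda>) / (e2 / \<Lambda>)" using x x1 x2 el c2 by (intro frac_le) (auto simp: x2_def x1_def)
        also have "\<dots> = c0\<^sup>2 / e2" using \<Lambda> by simp
        also have "\<dots> \<le> 2 * c0\<^sup>2 / e2" using e2 by (intro divide_right_mono) auto
        finally show "(1 - x1) / (1 - x) \<le> 2 * c0\<^sup>2 / e2" .
      qed (use x x1 x2 c0_ge \<Lambda> False in auto)
      also have "\<dots> = CE * \<Lambda>" by (simp add: CE_def)
      finally show ?thesis .
    qed
  qed
  have UE: "q x * (Y x)\<^sup>2 \<le> CE" if x: "1/2 \<le> x" "x \<le> x2" for x
  proof -
    have "0 \<le> q x * ((1 - x\<^sup>2) * (Y1 x)\<^sup>2)" using q_pos[of x] S[of x] x x2 by simp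
    then have "\<Lambda> * (q x * (Y x)\<^sup>2) \<le> E x" by (simp add: E_def K_def algebra_simps)
    also have "\<dots> \<le> \<Lambda> * CE" using Ebound[OF x] by (simp add: mult.commute)
    finally show ?thesis using \<Lambda> by simp
  qed
  have b1: "1 \<le> 2 powr (\<beta> + 1/2)" using \<beta> by (intro ge_one_powr_ge_zero) auto
  show ?thesis
  proof (cases "x \<le> x2")
    case True
    have "CE * 1 \<le> CE * (4 * 2 powr (\<beta> + 1/2))" using b1 CEpos by (intro mult_left_mono) auto
    then show ?thesis using UE[OF x(1) True] by (simp add: Y_def mult_ac)
  next
    case False
    \<comment> \<open>The last layer: the maximum of \<open>\<bar>Y\<bar>\<close> on it is compared
      with the value at its left end \<open>x2\<close>, where the energy bound still holds.\<close>
    have "compact {x2..1}" by simp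
    moreover have "continuous_on {x2..1} (\<lambda>z. \<bar>Y z\<bar>)" unfolding Y_def by (intro continuous_intros)
    ultimately obtain xm where xm: "xm \<in> {x2..1}" "\<And>z. z \<in> {x2..1} \<Longrightarrow> \<bar>Y z\<bar> \<le> \<bar>Y xm\<bar>"
      using continuous_attains_sup[of "{x2..1}" "\<lambda>z. \<bar>Y z\<bar>"] x2 by auto
    \<comment> \<open>The factor 2 compensates \<open>\<alpha> + 1 \<ge> 1/2\<close>, and
      \<open>2 powr \<bar>\<beta>\<bar>\<close> bounds \<open>(1 + v) powr \<beta>\<close>. With
      them \<open>\<kappa> * (1 - z) powr (\<alpha> + 1)\<close> falls at least as fast as the flux
      \<open>pp * Y1\<close> can change.\<close>
    define \<kappa> where "\<kappa> = 2 * \<Lambda> * 2 powr \<bar>\<beta>\<bar> * \<bar>Y xm\<bar>"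
    have \<kappa>0: "0 \<le> \<kappa>" using \<Lambda> by (simp add: \<kappa>_def)
    define pp where "pp z = (1 - z) powr (\<alpha> + 1) * (1 + z) powr (\<beta> + 1)" for z :: real
    have ab: "0 < \<alpha> + 1" "0 < \<beta> + 1" "1/2 \<le> \<alpha> + 1" using \<alpha> \<beta> by linarith+
    have dpp: "((\<lambda>z. pp z * Y1 z) has_real_derivative - \<Lambda> * (w z * Y z)) (at z)" if z: "-1 < z" "z < 1" for z
    proof -
      have pw: "(1 - z) powr (\<alpha> + 1) = (1 - z) powr \<alpha> * (1 - z)" "(1 + z) powr (\<beta> + 1) = (1 + z) powr \<beta> * (1 + z)"
        using z by (simp_all add: powr_add)
      have "((\<lambda>z. pp z * Y1 z) has_real_derivative (- ((\<alpha> + 1) * (1 - z) powr \<alpha>) * (1 + z) powr (\<beta> + 1) + (1 - z) powr (\<alpha> + 1) * ((\<beta> + 1) * (1 + z) powr \<beta>)) * Y1 z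
         + (1 - z) powr (\<alpha> + 1) * (1 + z) powr (\<beta> + 1) * poly (pderiv (pderiv y)) z) (at z)"
        unfolding pp_def using z by (auto intro!: derivative_eq_intros dY1 simp: algebra_simps)
      also have "(- ((\<alpha> + 1) * (1 - z) powr \<alpha>) * (1 + z) powr (\<beta> + 1) + (1 - z) powr (\<alpha> + 1) * ((\<beta> + 1) * (1 + z) powr \<beta>)) * Y1 z
         + (1 - z) powr (\<alpha> + 1) * (1 + z) powr (\<beta> + 1) * poly (pderiv (pderiv y)) z
         = w z * ((1 - z\<^sup>2) * poly (pderiv (pderiv y)) z + (\<beta> - \<alpha> - (\<alpha> + \<beta> + 2) * z) * Y1 z)"
        unfolding pw jacobi_density_def by (simp add: algebra_simps power2_eq_square)
      also have "(1 - z\<^sup>2) * poly (pderiv (pderiv y)) z + (\<beta> - \<alpha> - (\<alpha> + \<beta> + 2) * z) * Y1 z = - \<Lambda> * Y z"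
        unfolding Y_def Y1_def by (rule ode)
      finally show ?thesis by (simp add: mult_ac)
    qed
    \<comment> \<open>Both sides vanish at 1. For either sign \<open>\<epsilon>\<close> the function
      \<open>H\<close> has nonpositive derivative and value 0 at 1, hence is nonnegative before
      1.\<close>
    have slope: "\<bar>pp z * Y1 z\<bar> \<le> \<kappa> * (1 - z) powr (\<alpha> + 1)" if z: "x2 \<le> z" "z < 1" for z
    proof -
      have gen: "0 \<le> \<kappa> * (1 - z) powr (\<alpha> + 1) + \<epsilon> * (pp z * Y1 z)" if \<epsilon>: "\<bar>\<epsilon>\<bar> = 1" for \<epsilon> :: real
      proof -
        define H where "H v = \<kappa> * (1 - v) powr (\<alpha> + 1) + \<epsilon> * (pp v * Y1 v)" for v
        have cH: "continuous_on {z..1} H"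
        proof -
          have "{z..1} \<subseteq> {-1..1}" using z x2 by auto
          then have "continuous_on {z..1} (\<lambda>x::real. (1 - x) powr (\<alpha> + 1))" "continuous_on {z..1} (\<lambda>x::real. (1 + x) powr (\<beta> + 1))"
            using continuous_on_endpoint_powr ab by (meson continuous_on_subset)+
          then show ?thesis unfolding H_def pp_def Y1_def
            by (intro continuous_on_mult continuous_on_poly continuous_on_id continuous_on_add continuous_on_const)
        qed
        define H' where "H' v = \<kappa> * (- ((\<alpha> + 1) * (1 - v) powr \<alpha>)) + \<epsilon> * (- \<Lambda> * (w v * Y v))" for v
        have dH: "(H has_real_derivative H' v) (at v)" if "z < v" "v < 1" for v
          unfolding H_def H'_def
        proof (intro DERIV_add DERIV_cmult)
          show "((\<lambda>v. (1 - v) powr (\<alpha> + 1)) has_real_derivative - ((\<alpha> + 1) * (1 - v) powr \<alpha>)) (at v)"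
            using that by (auto intro!: derivative_eq_intros)
        show "((\<lambda>v. pp v * Y1 v) has_real_derivative - \<Lambda> * (w v * Y v)) (at v)" using that z x2 by (intro dpp) auto
        qed
        have H'0: "H' v \<le> 0" if v: "z < v" "v < 1" for v
        proof -
          have v0: "0 \<le> v" "x2 \<le> v" using v z x2 by auto
          have "(1 + v) powr \<beta> \<le> (1 + v) powr \<bar>\<beta>\<bar>" using v0 by (intro powr_mono) auto
          also have "\<dots> \<le> 2 powr \<bar>\<beta>\<bar>" using v v0 by (intro powr_mono2) auto
          finally have wv: "w v \<le> (1 - v) powr \<alpha> * 2 powr \<bar>\<beta>\<bar>" unfolding jacobi_density_def by (intro mult_left_mono) auto
          have "\<bar>\<epsilon> * (- \<Lambda> * (w v * Y v))\<bar> = \<Lambda> * (w v * \<bar>Y v\<bar>)" using \<epsilon> \<Lambda> w_nonneg[of v] by (simp add: abs_mult)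
          also have "\<dots> \<le> \<Lambda> * ((1 - v) powr \<alpha> * 2 powr \<bar>\<beta>\<bar> * \<bar>Y xm\<bar>)"
            using wv xm(2)[of v] v v0 \<Lambda> by (intro mult_left_mono mult_mono) auto
          also have "\<dots> = \<kappa> * ((1/2) * (1 - v) powr \<alpha>)" by (simp add: \<kappa>_def)
          also have "\<dots> \<le> \<kappa> * ((\<alpha> + 1) * (1 - v) powr \<alpha>)" using \<kappa>0 ab by (intro mult_left_mono mult_right_mono) auto
          finally show ?thesis unfolding H'_def by linarith
        qed
        obtain l v where v: "z < v" "v < 1" "(H has_real_derivative l) (at v)" "H 1 - H z = (1 - z) * l"
          using MVT[OF z(2) cH] dH by (metis real_differentiable_def)
        have "l = H' v" using DERIV_unique[OF v(3) dH[OF v(1,2)]] .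
        then have "H 1 - H z \<le> 0" using v(4) H'0[OF v(1,2)] z by (simp add: mult_nonneg_nonpos)
        moreover have "H 1 = 0" by (simp add: H_def pp_def)
        ultimately have "0 \<le> H z" by linarith
        then show ?thesis by (simp add: H_def)
      qed
      show ?thesis using gen[of 1] gen[of "-1"] by (simp add: abs_le_iff)
    qed
    have Y1_le: "\<bar>Y1 z\<bar> \<le> \<kappa>" if z: "x2 \<le> z" "z < 1" for z
    proof -
      have "1 \<le> (1 + z) powr (\<beta> + 1)" using z x2 ab by (intro ge_one_powr_ge_zero) auto
      then have "(1 - z) powr (\<alpha> + 1) * 1 \<le> pp z" unfolding pp_def by (intro mult_left_mono) auto
      then have "(1 - z) powr (\<alpha> + 1) * \<bar>Y1 z\<bar> \<le> pp z * \<bar>Y1 z\<bar>" by (intro mult_right_mono) auto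
      also have "\<dots> = \<bar>pp z * Y1 z\<bar>" by (simp add: abs_mult pp_def)
      also have "\<dots> \<le> (1 - z) powr (\<alpha> + 1) * \<kappa>" using slope[OF z] by (simp add: mult.commute)
      finally show ?thesis using z by simp
    qed
    have "\<bar>Y xm - Y x2\<bar> \<le> \<bar>Y xm\<bar> / 2"
    proof (cases "xm = x2")
      case False
      then have lt: "x2 < xm" "xm \<le> 1" using xm by auto
      obtain z where z: "x2 < z" "z < xm" "Y xm - Y x2 = (xm - x2) * Y1 z" using MVT2[of x2 xm Y Y1] lt dY by auto
      have "\<bar>Y xm - Y x2\<bar> = (xm - x2) * \<bar>Y1 z\<bar>" using z lt by (simp add: abs_mult)
      also have "\<dots> \<le> (e2 / \<Lambda>) * \<kappa>" using Y1_le[of z] z lt by (intro mult_mono) (auto simp: x2_def)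
      also have "\<dots> = \<bar>Y xm\<bar> / 2" using \<Lambda> by (simp add: \<kappa>_def e2_def)
      finally show ?thesis .
    qed simp
    then have Ym: "\<bar>Y xm\<bar> \<le> 2 * \<bar>Y x2\<bar>" by linarith
    have "\<bar>Y x\<bar> \<le> 2 * \<bar>Y x2\<bar>" using xm(2)[of x] Ym x False by simp
    then have "\<bar>Y x\<bar>\<^sup>2 \<le> (2 * \<bar>Y x2\<bar>)\<^sup>2" by (intro power_mono) auto
    then have Y2: "(Y x)\<^sup>2 \<le> 4 * (Y x2)\<^sup>2" by (simp add: power_mult_distrib)
    have "q x \<le> 2 powr (\<beta> + 1/2) * q x2"
    proof -
      have "(1 - x) powr (\<alpha> + 1/2) \<le> (1 - x2) powr (\<alpha> + 1/2)" using x False \<alpha> by (intro powr_mono2) auto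
      moreover have "(1 + x) powr (\<beta> + 1/2) \<le> 2 powr (\<beta> + 1/2)" using x \<beta> by (intro powr_mono2) auto
      ultimately have "q x \<le> (1 - x2) powr (\<alpha> + 1/2) * 2 powr (\<beta> + 1/2)" unfolding q_def by (intro mult_mono) auto
      also have "\<dots> \<le> ((1 - x2) powr (\<alpha> + 1/2) * (1 + x2) powr (\<beta> + 1/2)) * 2 powr (\<beta> + 1/2)"
      proof (intro mult_right_mono)
        have "1 \<le> (1 + x2) powr (\<beta> + 1/2)" using x2 \<beta> by (intro ge_one_powr_ge_zero) auto
        then show "(1 - x2) powr (\<alpha> + 1/2) \<le> (1 - x2) powr (\<alpha> + 1/2) * (1 + x2) powr (\<beta> + 1/2)"
          using mult_left_mono[of 1 "(1 + x2) powr (\<beta> + 1/2)" "(1 - x2) powr (\<alpha> + 1/2)"] by simp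
      qed auto
      finally show ?thesis by (simp add: q_def mult.commute)
    qed
    then have "q x * (Y x)\<^sup>2 \<le> (2 powr (\<beta> + 1/2) * q x2) * (4 * (Y x2)\<^sup>2)"
      using Y2 q_pos[of x2] x2 by (intro mult_mono) auto
    also have "\<dots> = 4 * 2 powr (\<beta> + 1/2) * (q x2 * (Y x2)\<^sup>2)" by simp
    also have "\<dots> \<le> 4 * 2 powr (\<beta> + 1/2) * CE" using UE[of x2] x2 by (intro mult_left_mono) auto
    finally show ?thesis by (simp add: Y_def)
  qed
qed

end

lemma powr_neg_half: "0 < x \<Longrightarrow> x powr (-1/2) = inverse (sqrt x)" for x :: real
  using powr_minus[of x "1/2"] by (simp add: powr_half_sqrt)

text \<open>The substitution \<open>sqrt (1 - x)\<close> produces the arctan. The integral, of order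
  \<open>1 / sqrt t\<close>, is the mass near 1 of the singular bound
  \<open>(1 - x) powr (-1/2)\<close> damped by the heat factor.\<close>

lemma heat_mass_integral:
  fixes t :: real
  assumes t: "1 \<le> t"
  shows "((\<lambda>x. (1 - x) powr (-1/2) / (1 + t * (1 - x))) has_integral 2 / sqrt t * arctan (sqrt t * sqrt (1/2))) {1/2..1}"
proof -
  have "((\<lambda>x. (1 - x) powr (-1/2) / (1 + t * (1 - x))) has_integral
     - (2 / sqrt t * arctan (sqrt t * sqrt (1 - 1))) - (- (2 / sqrt t * arctan (sqrt t * sqrt (1 - 1/2))))) {1/2..1}"
  proof (rule fundamental_theorem_of_calculus_interior)
    show "continuous_on {1/2..1} (\<lambda>x. - (2 / sqrt t * arctan (sqrt t * sqrt (1 - x))))"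
      by (intro continuous_intros)
    fix x :: real assume "x \<in> {1/2<..<1}"
    then have x: "0 < 1 - x" by simp
    define s r where "s = sqrt (1 - x)" and "r = sqrt t"
    have s: "0 < s" "s\<^sup>2 = 1 - x" using x by (auto simp: s_def)
    have r: "0 < r" "r\<^sup>2 = t" using t by (auto simp: r_def)
    have eq: "2 / r * (u * (r * (v / 2 * -1))) = - (u * v)" for u v
      using r(1) by simp
    have "((\<lambda>x. - (2 / r * arctan (r * sqrt (1 - x)))) has_real_derivative
        - (2 / r * (inverse (1 + (r * s)\<^sup>2) * (r * (inverse s / 2 * -1))))) (at x)"
      unfolding s_def using x r(1) by (auto intro!: derivative_eq_intros)
    also have "- (2 / r * (inverse (1 + (r * s)\<^sup>2) * (r * (inverse s / 2 * -1)))) = inverse s / (1 + t * s\<^sup>2)"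
      unfolding eq minus_minus power_mult_distrib r(2) by (simp only: divide_inverse mult.commute)
    also have "inverse s = (1 - x) powr (-1/2)" unfolding s_def using x by (simp only: powr_neg_half)
    finally show "((\<lambda>x. - (2 / sqrt t * arctan (sqrt t * sqrt (1 - x)))) has_vector_derivative (1 - x) powr (-1/2) / (1 + t * (1 - x))) (at x)"
      by (simp add: s r_def has_real_derivative_iff_has_vector_derivative)
  qed simp
  then show ?thesis by simp
qed

text \<open>Replaces the heat factor by the rational function in \<open>heat_mass_integral\<close>,
  which has an elementary antiderivative.\<close>

lemma exp_neg_le: "0 \<le> u \<Longrightarrow> exp (- u) \<le> 1 / (1 + u)" for u :: real
  using exp_ge_add_one_self[of u] by (simp add: exp_minus field_simps)

section \<open>The on-diagonal heat kernel bound\<close>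

context jacobi
begin

text \<open>The integral of the energy is \<open>2 * ev n\<close>: half from
  \<open>p_deriv_norm\<close>, half from the normalization. For \<open>n \<ge> 1\<close> the
  eigenvalue is at least 1, as \<open>pointwise_bound\<close> requires.\<close>

lemma ode_bound:
  "1 \<le> n \<Longrightarrow> 1/2 \<le> x \<Longrightarrow> x < 1 \<Longrightarrow> q x * (poly (p n) x)\<^sup>2 \<le> 4 * 2 powr (\<beta> + 1/2) * CE"
proof (rule pointwise_bound)
  assume n: "1 \<le> n" and x: "1/2 \<le> x" "x < 1"
  have "1 * 1 \<le> real n * (real n + \<alpha> + \<beta> + 1)" using n \<alpha> \<beta> by (intro mult_mono) auto
  then show "1 \<le> ev n" by (simp add: ev_def)
  show "(1 - x\<^sup>2) * poly (pderiv (pderiv (p n))) x + (\<beta> - \<alpha> - (\<alpha> + \<beta> + 2) * x) * poly (pderiv (p n)) x = - ev n * poly (p n) x" for x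
    using p_ode[of x n] by simp
  have "((\<lambda>x. w x * ((1 - x\<^sup>2) * (poly (pderiv (p n)) x)\<^sup>2 + ev n * (poly (p n) x)\<^sup>2)) has_integral
     (\<integral>x. (1 - x\<^sup>2) * (poly (pderiv (p n)) x)\<^sup>2 + ev n * (poly (p n) x)\<^sup>2 \<partial>M)) {-1..1}"
    by (intro M_has_integral continuous_intros)
  also have "(\<integral>x. (1 - x\<^sup>2) * (poly (pderiv (p n)) x)\<^sup>2 + ev n * (poly (p n) x)\<^sup>2 \<partial>M)
     = (\<integral>x. (1 - x\<^sup>2) * (poly (pderiv (p n)) x)\<^sup>2 \<partial>M) + (\<integral>x. ev n * (poly (p n) x)\<^sup>2 \<partial>M)"
    by (intro Bochner_Integration.integral_add integrable_cont_M continuous_intros)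
  also have "\<dots> = 2 * ev n" using p_deriv_norm[of n] orth[of n n] by (simp add: power2_eq_square mult.assoc)
  finally show "((\<lambda>x. w x * ((1 - x\<^sup>2) * (poly (pderiv (p n)) x)\<^sup>2 + ev n * (poly (p n) x)\<^sup>2)) has_integral 2 * ev n) {-1..1}" .
  show "1/2 \<le> x" "x < 1" by (rule x)+
qed

text \<open>The eigenvalue of \<open>p 0\<close> is 0, out of reach of
  \<open>pointwise_bound\<close>; the constant polynomial is bounded directly.\<close>

lemma uniform_bound: "\<exists>C>0. \<forall>n x. 1/2 \<le> x \<longrightarrow> x < 1 \<longrightarrow> q x * (poly (p n) x)\<^sup>2 \<le> C"
proof -
  define C1 where "C1 = 4 * 2 powr (\<beta> + 1/2) * CE"
  define C0 where "C0 = 2 powr (\<alpha> + 1/2) * 2 powr (\<beta> + 1/2) * (poly (p 0) 0)\<^sup>2"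
  have C: "0 \<le> C1" "0 \<le> C0" using c0_ge e2 by (auto simp: C1_def C0_def CE_def)
  have "q x * (poly (p n) x)\<^sup>2 \<le> C1 + C0 + 1" if x: "1/2 \<le> x" "x < 1" for n x
  proof (cases "n = 0")
    case True
    have "degree (p 0) = 0" using deg(1)[of 0] by simp
    then obtain c where c: "p 0 = [:c:]" by (auto elim: degree_eq_zeroE)
    have "(1 - x) powr (\<alpha> + 1/2) \<le> 2 powr (\<alpha> + 1/2)" "(1 + x) powr (\<beta> + 1/2) \<le> 2 powr (\<beta> + 1/2)"
      using x \<alpha> \<beta> by (auto intro!: powr_mono2)
    then have "q x \<le> 2 powr (\<alpha> + 1/2) * 2 powr (\<beta> + 1/2)" unfolding q_def by (intro mult_mono) auto
    then have "q x * c\<^sup>2 \<le> 2 powr (\<alpha> + 1/2) * 2 powr (\<beta> + 1/2) * c\<^sup>2" by (intro mult_right_mono) auto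
    then show ?thesis using True C by (simp add: C0_def c)
  next
    case False
    then show ?thesis using ode_bound[of n x] x C by (simp add: C1_def)
  qed
  then show ?thesis using C by (intro exI[of _ "C1 + C0 + 1"]) auto
qed

text \<open>Left of 1/2 the exponential is at most \<open>exp (- t / 2)\<close> and the total mass
  is 1; right of it \<open>w\<close> times the squared polynomial is at most
  \<open>C / sqrt (1 - x)\<close> by \<open>uniform_bound\<close>. For \<open>t \<le> 1\<close> the
  total mass is enough.\<close>

lemma diag_bound: "\<exists>A0>0. \<forall>n t. 0 \<le> t \<longrightarrow> (\<integral>x. exp (t * (x - 1)) * (poly (p n) x)\<^sup>2 \<partial>M) \<le> A0 / sqrt (1 + t)"
proof -
  obtain C where C: "0 < C" "\<And>n x. 1/2 \<le> x \<Longrightarrow> x < 1 \<Longrightarrow> q x * (poly (p n) x)\<^sup>2 \<le> C" using uniform_bound by blast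
  define A0 where "A0 = 2 * (2 + 4 * C)"
  have norm1: "(\<integral>x. (poly (p n) x)\<^sup>2 \<partial>M) = 1" for n using orth[of n n] by (simp add: power2_eq_square)
  have hI: "((\<lambda>x. w x * (exp (t * (x - 1)) * (poly (p n) x)\<^sup>2)) has_integral (\<integral>x. exp (t * (x - 1)) * (poly (p n) x)\<^sup>2 \<partial>M)) {-1..1}" for t n
    by (intro M_has_integral continuous_intros)
  have h1: "((\<lambda>x. w x * (poly (p n) x)\<^sup>2) has_integral 1) {-1..1}" for n
    using M_has_integral[of "\<lambda>x. (poly (p n) x)\<^sup>2"] by (simp add: norm1 continuous_on_power continuous_on_poly)
  have "(\<integral>x. exp (t * (x - 1)) * (poly (p n) x)\<^sup>2 \<partial>M) \<le> A0 / sqrt (1 + t)" if t0: "0 \<le> t" for n t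
  proof (cases "t \<le> 1")
    case True
    have "(\<integral>x. exp (t * (x - 1)) * (poly (p n) x)\<^sup>2 \<partial>M) \<le> 1"
    proof (rule has_integral_le[OF hI h1])
      fix x :: real assume "x \<in> {-1..1}"
      then have "exp (t * (x - 1)) \<le> 1" using t0 by (simp add: mult_nonneg_nonpos)
      then have "exp (t * (x - 1)) * (poly (p n) x)\<^sup>2 \<le> 1 * (poly (p n) x)\<^sup>2" by (intro mult_right_mono) auto
      then show "w x * (exp (t * (x - 1)) * (poly (p n) x)\<^sup>2) \<le> w x * (poly (p n) x)\<^sup>2" using w_nonneg by (intro mult_left_mono) auto
    qed
    also have "\<dots> \<le> A0 / sqrt (1 + t)"
    proof -
      have "sqrt (1 + t) \<le> sqrt 4" using True by (intro real_sqrt_le_mono) simp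
      also have "\<dots> \<le> A0" using C by (simp add: A0_def)
      finally show ?thesis using t0 by (simp add: pos_le_divide_eq)
    qed
    finally show ?thesis .
  next
    case False
    then have t: "1 \<le> t" by simp
    have st: "0 < sqrt t" using t by simp
    define I where "I = 2 / sqrt t * arctan (sqrt t * sqrt (1/2))"
    have I: "((\<lambda>x. (1 - x) powr (-1/2) / (1 + t * (1 - x))) has_integral I) {1/2..1}"
      unfolding I_def by (rule heat_mass_integral[OF t])
    have "((\<lambda>x. if x \<in> {1/2..1} then C * ((1 - x) powr (-1/2) / (1 + t * (1 - x))) else 0) has_integral C * I) {-1..1}"
      using has_integral_mult_right[OF I, of C] by (subst has_integral_restrict) auto
    from has_integral_add[OF has_integral_mult_right[OF h1[of n], of "exp (- (t/2))"] this]
    have h2: "((\<lambda>x. exp (- (t/2)) * (w x * (poly (p n) x)\<^sup>2) + (if x \<in> {1/2..1} then C * ((1 - x) powr (-1/2) / (1 + t * (1 - x))) else 0))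
       has_integral exp (- (t/2)) * 1 + C * I) {-1..1}" .
    \<comment> \<open>The uniform bound holds only for \<open>x < 1\<close>, so the value of the
      integrand at 1 is set to 0.\<close>
    have h3: "((\<lambda>x. if x = 1 then 0 else w x * (exp (t * (x - 1)) * (poly (p n) x)\<^sup>2)) has_integral (\<integral>x. exp (t * (x - 1)) * (poly (p n) x)\<^sup>2 \<partial>M)) {-1..1}"
      by (rule has_integral_spike_finite[OF _ _ hI[of t n], of "{1}"]) auto
    have "(\<integral>x. exp (t * (x - 1)) * (poly (p n) x)\<^sup>2 \<partial>M) \<le> exp (- (t/2)) * 1 + C * I"
    proof (rule has_integral_le[OF h3 h2])
      fix x :: real assume x: "x \<in> {-1..1}"
      have W: "0 \<le> w x * (poly (p n) x)\<^sup>2" using w_nonneg by simp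
      have T: "0 \<le> (1 - x) powr (-1/2) / (1 + t * (1 - x))" using x t by simp
      show "(if x = 1 then 0 else w x * (exp (t * (x - 1)) * (poly (p n) x)\<^sup>2))
         \<le> exp (- (t/2)) * (w x * (poly (p n) x)\<^sup>2) + (if x \<in> {1/2..1} then C * ((1 - x) powr (-1/2) / (1 + t * (1 - x))) else 0)"
      proof (cases "x \<le> 1/2")
        case True
        have "t * (x - 1) \<le> t * (- (1/2))" using True t by (intro mult_left_mono) auto
        then have "exp (t * (x - 1)) \<le> exp (- (t/2))" by simp
        then have "exp (t * (x - 1)) * (w x * (poly (p n) x)\<^sup>2) \<le> exp (- (t/2)) * (w x * (poly (p n) x)\<^sup>2)" using W by (rule mult_right_mono)
        moreover have "0 \<le> C * ((1 - x) powr (-1/2) / (1 + t * (1 - x)))" by (rule mult_nonneg_nonneg[OF less_imp_le[OF C(1)] T])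
        ultimately show ?thesis using True by (auto simp: mult_ac)
      next
        case False
        have E: "0 \<le> exp (- (t/2)) * (w x * (poly (p n) x)\<^sup>2)" using W by simp
        show ?thesis
        proof (cases "x = 1")
          case True
          then show ?thesis using E by simp
        next
          case neq: False
          then have x: "1/2 < x" "x < 1" using x False by auto
          have s0: "0 < sqrt (1 - x)" using x by simp
          have "x * x \<le> 1 * x" using x by (intro mult_right_mono) auto
          then have "sqrt (1 - x) \<le> sqrt (1 - x\<^sup>2)" by (intro real_sqrt_le_mono) (simp add: power2_eq_square)
          then have "w x * (poly (p n) x)\<^sup>2 * sqrt (1 - x) \<le> w x * (poly (p n) x)\<^sup>2 * sqrt (1 - x\<^sup>2)" using W by (rule mult_left_mono)
          also have "\<dots> = q x * (poly (p n) x)\<^sup>2" using w_sqrt[of x] x by (simp add: mult_ac)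
          also have "\<dots> \<le> C" using C(2)[of x n] x by simp
          finally have "w x * (poly (p n) x)\<^sup>2 \<le> C / sqrt (1 - x)" using s0 by (simp add: pos_le_divide_eq)
          also have "\<dots> = C * (1 - x) powr (-1/2)" using x by (subst powr_neg_half) (simp_all add: inverse_eq_divide)
          finally have 1: "w x * (poly (p n) x)\<^sup>2 \<le> C * (1 - x) powr (-1/2)" .
          have 2: "exp (t * (x - 1)) \<le> 1 / (1 + t * (1 - x))" using exp_neg_le[of "t * (1 - x)"] x t by (simp add: algebra_simps)
          have "w x * (poly (p n) x)\<^sup>2 * exp (t * (x - 1)) \<le> C * (1 - x) powr (-1/2) * (1 / (1 + t * (1 - x)))"
            using C by (intro mult_mono[OF 1 2]) auto
          then show ?thesis using x E by (simp add: mult_ac)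
        qed
      qed
    qed
    also have "\<dots> \<le> (2 + 4 * C) / sqrt t"
    proof -
      have "1 * sqrt t \<le> sqrt t * sqrt t" using t by (intro mult_right_mono) auto
      then have "sqrt t \<le> t" using t by simp
      have "exp (- (t/2)) \<le> 1 / (1 + t/2)" using exp_neg_le[of "t/2"] t by simp
      also have "\<dots> \<le> 1 / (sqrt t / 2)" using \<open>sqrt t \<le> t\<close> st by (intro divide_left_mono) auto
      finally have 1: "exp (- (t/2)) \<le> 2 / sqrt t" by simp
      have "arctan (sqrt t * sqrt (1/2)) \<le> 2" using arctan_ubound[of "sqrt t * sqrt (1/2)"] pi_less_4 by linarith
      then have "I \<le> 2 / sqrt t * 2" unfolding I_def using st by (intro mult_left_mono) auto
      then have "C * I \<le> C * (4 / sqrt t)" using C by (intro mult_left_mono) auto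
      then show ?thesis using 1 by (simp add: add_divide_distrib mult.commute)
    qed
    also have "\<dots> \<le> (2 + 4 * C) / (sqrt (1 + t) / 2)"
    proof (intro divide_left_mono)
      have "sqrt (1 + t) \<le> sqrt (4 * t)" using t by (intro real_sqrt_le_mono) simp
      then show "sqrt (1 + t) / 2 \<le> sqrt t" by (simp add: real_sqrt_mult)
    qed (use C t in auto)
    also have "\<dots> = A0 / sqrt (1 + t)" by (simp add: A0_def)
    finally show ?thesis .
  qed
  then show ?thesis using C by (intro exI[of _ A0]) (auto simp: A0_def)
qed

end

section \<open>Boundedness of the differential transforms\<close>

context orthonormal_polys
begin

text \<open>The partial sum is the multiplier with symbol \<open>\<phi>\<close>. For
  \<open>x \<le> 1\<close> the exponentials do not increase along \<open>a\<close>, so the absolute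
  values telescope to at most \<open>B\<close>, and \<open>multiplier_l2\<close> gives the constant
  \<open>B ^ 2\<close>.\<close>

lemma heat_transform_kernel:
  fixes a b :: "int \<Rightarrow> real"
  assumes a: "\<And>j. 0 < a j" "\<And>j. a j < a (j + 1)" and b: "\<And>j. \<bar>b j\<bar> \<le> B" "0 < B"
  shows "\<exists>A. heat_transform \<kappa> A a b B (B\<^sup>2)"
proof -
  obtain A where A: "0 < A" "\<And>k n m t. k \<le> 2 \<Longrightarrow> 0 \<le> t \<Longrightarrow> \<bar>\<kappa> k t n m\<bar> \<le> A * sqrt (1 + t) / ((1 + t) ^ k * (1 + t + (real n - real m)\<^sup>2))"
    using \<kappa>_bound by blast
  interpret hd: heat_differences \<kappa> A a b B
    by unfold_locales (intro \<kappa>_deriv A a b \<kappa>_sym \<kappa>_semigroup; assumption)+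
  have "heat_transform \<kappa> A a b B (B\<^sup>2)"
  proof
    fix N1 N2 Y f n
    assume Y: "finite (Y :: nat set)"
    define \<phi> where "\<phi> x = (\<Sum>j\<in>{N1..N2}. b j * (exp (a (j + 1) * (x - 1)) - exp (a j * (x - 1))))" for x
    have D: "hd.D N1 N2 0 l y = (\<integral>x. \<phi> x * poly (p l) x * poly (p y) x \<partial>M)" for l y
    proof -
      have "(\<integral>x. \<phi> x * poly (p l) x * poly (p y) x \<partial>M)
        = (\<integral>x. (\<Sum>j\<in>{N1..N2}. b j * (exp (a (j + 1) * (x - 1)) * poly (p l) x * poly (p y) x - exp (a j * (x - 1)) * poly (p l) x * poly (p y) x)) \<partial>M)"
        unfolding \<phi>_def sum_distrib_right by (intro Bochner_Integration.integral_cong sum.cong refl) (simp add: algebra_simps)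
      also have "\<dots> = (\<Sum>j\<in>{N1..N2}. \<integral>x. b j * (exp (a (j + 1) * (x - 1)) * poly (p l) x * poly (p y) x - exp (a j * (x - 1)) * poly (p l) x * poly (p y) x) \<partial>M)"
        by (intro Bochner_Integration.integral_sum integrable_cont continuous_intros)
      also have "\<dots> = hd.D N1 N2 0 l y"
        unfolding hd.D_def \<kappa>_def integral_mult_right_zero
        by (subst Bochner_Integration.integral_diff) (auto intro!: integrable_cont continuous_intros)
      finally show ?thesis ..
    qed
    have \<phi>B: "\<bar>\<phi> x\<bar> \<le> B" if x: "x \<in> {-1..1}" for x
    proof (cases "N1 \<le> N2 + 1")
      case True
      have le: "exp (a (j + 1) * (x - 1)) \<le> exp (a j * (x - 1))" for j
        using a(2)[of j] x by (simp add: mult_right_mono_neg)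
      have "\<bar>\<phi> x\<bar> \<le> (\<Sum>j\<in>{N1..N2}. \<bar>b j * (exp (a (j + 1) * (x - 1)) - exp (a j * (x - 1)))\<bar>)"
        unfolding \<phi>_def by (rule sum_abs)
      also have "\<dots> \<le> (\<Sum>j\<in>{N1..N2}. B * (exp (a j * (x - 1)) - exp (a (j + 1) * (x - 1))))"
        unfolding abs_mult using b le by (intro sum_mono mult_mono) auto
      also have "\<dots> = B * (\<Sum>j\<in>{N1..N2}. - exp (a (j + 1) * (x - 1)) - - exp (a j * (x - 1)))"
        by (simp add: sum_distrib_left)
      also have "\<dots> = B * (exp (a N1 * (x - 1)) - exp (a (N2 + 1) * (x - 1)))"
        using sum_telescope_int[OF True, of "\<lambda>j. - exp (a j * (x - 1))"] by simp
      also have "\<dots> \<le> B * 1"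
      proof (intro mult_left_mono)
        have "exp (a N1 * (x - 1)) \<le> 1" using x a(1)[of N1] by (simp add: mult_nonneg_nonpos)
        then show "exp (a N1 * (x - 1)) - exp (a (N2 + 1) * (x - 1)) \<le> 1" using exp_gt_zero[of "a (N2 + 1) * (x - 1)"] by linarith
      qed (use b in simp)
      finally show ?thesis by simp
    qed (use b in \<open>simp add: \<phi>_def\<close>)
    have "continuous_on UNIV \<phi>" unfolding \<phi>_def by (intro continuous_intros)
    then show "(\<Sum>l<n. (\<Sum>y\<in>Y. hd.D N1 N2 0 l y * f y)\<^sup>2) \<le> B\<^sup>2 * (\<Sum>y\<in>Y. (f y)\<^sup>2)"
      unfolding D using \<phi>B Y by (rule multiplier_l2)
  qed (use b in simp)
  then show ?thesis by blast
qed

end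

text \<open>The place where the abstract theory meets the Jacobi case: \<open>diag_bound\<close>
  makes the Jacobi system an instance of \<open>orthonormal_polys\<close>, and its kernels then form
  a \<open>heat_transform\<close>.\<close>

lemma diff_transform_eq:
  assumes "-1/2 \<le> \<alpha>" "-1/2 \<le> \<beta>"
    and a: "\<And>j. 0 < a j" "\<And>j. a j < a (j + 1)" and b: "\<And>j. \<bar>b j\<bar> \<le> B" "0 < B"
  shows "\<exists>\<kappa> A L. heat_transform \<kappa> A a b B L \<and> diff_transform \<alpha> \<beta> a b = heat_transform.transform \<kappa> a b"
proof -
  interpret J: jacobi \<alpha> \<beta> using assms by unfold_locales
  obtain A0 where "0 < A0" "\<And>n t. 0 \<le> t \<Longrightarrow> (\<integral>x. exp (t * (x - 1)) * (poly (J.p n) x)\<^sup>2 \<partial>J.M) \<le> A0 / sqrt (1 + t)"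
    using J.diag_bound by blast
  then interpret O: orthonormal_polys J.M J.p A0 by unfold_locales
  obtain A where "heat_transform O.\<kappa> A a b B (B\<^sup>2)" using O.heat_transform_kernel[of a b B] a b by blast
  then interpret T: heat_transform O.\<kappa> A a b B "B\<^sup>2" .
  have "jacobi_heat_kernel \<alpha> \<beta> t n m = O.\<kappa> 0 t n m" for t n m
    by (simp add: J.jacobi_heat_kernel_eq O.\<kappa>_def)
  then have "diff_transform \<alpha> \<beta> a b = T.transform"
    by (intro ext) (simp add: diff_transform_def jacobi_heat_def T.transform_def)
  then show ?thesis using T.heat_transform_axioms by blast
qed

theorem theorem1p2:
  fixes \<alpha> \<beta> \<rho> :: real and a b :: "int \<Rightarrow> real"
  assumes "\<alpha> \<ge> -1/2" and "\<beta> \<ge> -1/2"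
    and "\<rho> > 1" and "lacunary \<rho> a"
    and "\<exists>B. \<forall>j. \<bar>b j\<bar> \<le> B"
  shows
   "(\<forall>p w. 1 < p \<longrightarrow> Ap_weight p w \<longrightarrow>
      (\<exists>C>0. \<forall>f. in_lp p w f \<longrightarrow>
         (\<forall>n. bdd_above ((\<lambda>N. \<bar>diff_transform \<alpha> \<beta> a b (fst N) (snd N) f n\<bar>) ` {(N1, N2). N1 < N2}))
         \<and> in_lp p w (diff_transform_max \<alpha> \<beta> a b f)
         \<and> lp_norm p w (diff_transform_max \<alpha> \<beta> a b f) \<le> C * lp_norm p w f))
    \<and>
    (\<forall>w. A1_weight w \<longrightarrow>
      (\<exists>C>0. \<forall>f. in_lp 1 w f \<longrightarrow>
         (\<forall>n. bdd_above ((\<lambda>N. \<bar>diff_transform \<alpha> \<beta> a b (fst N) (snd N) f n\<bar>) ` {(N1, N2). N1 < N2}))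
         \<and> (\<forall>s>0. summable (\<lambda>n. if \<bar>diff_transform_max \<alpha> \<beta> a b f n\<bar> > s then w n else 0)
                 \<and> s * level_weight w (diff_transform_max \<alpha> \<beta> a b f) s \<le> C * lp_norm 1 w f)))"
proof -
  obtain B0 where B0: "\<And>j. \<bar>b j\<bar> \<le> B0" using assms(5) by blast
  \<comment> \<open>The added 1 makes the bound on the coefficients strictly positive, as
    \<open>heat_differences\<close> asks.\<close>
  have b: "\<bar>b j\<bar> \<le> \<bar>B0\<bar> + 1" "0 < \<bar>B0\<bar> + 1" for j using B0[of j] by linarith+
  have a: "0 < a j" "a j < a (j + 1)" for j
  proof -
    show a0: "0 < a j" using assms(4) by (simp add: lacunary_def)
    \<comment> \<open>Lacunarity enters as strict growth of the times.\<close>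
    have "1 < a (j + 1) / a j" using assms(3,4) unfolding lacunary_def by (meson less_le_trans)
    then show "a j < a (j + 1)" using a0 by (simp add: pos_less_divide_eq)
  qed
  obtain \<kappa> A L where ht: "heat_transform \<kappa> A a b (\<bar>B0\<bar> + 1) L" and eq: "diff_transform \<alpha> \<beta> a b = heat_transform.transform \<kappa> a b"
    using diff_transform_eq[OF assms(1,2), of a b "\<bar>B0\<bar> + 1"] a b by blast
  interpret heat_transform \<kappa> A a b "\<bar>B0\<bar> + 1" L by (rule ht)
  define I :: "(int \<times> int) set" where "I = {(N1, N2). N1 < N2}"
  define V where "V f N n = \<bar>transform (fst N) (snd N) f n\<bar>" for f N n
  have I: "I \<noteq> {}" by (auto simp: I_def intro: exI[of _ 0] exI[of _ 1])
  have I_le: "fst N \<le> snd N" if "N \<in> I" for N using that by (auto simp: I_def)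
  have max_eq: "diff_transform_max \<alpha> \<beta> a b f = (\<lambda>n. SUP N\<in>I. V f N n)" for f
    by (simp add: diff_transform_max_def eq V_def I_def fun_eq_iff)
  have bdd_eq: "(\<lambda>N. \<bar>diff_transform \<alpha> \<beta> a b (fst N) (snd N) f n\<bar>) ` {(N1, N2). N1 < N2} = (\<lambda>N. V f N n) ` I" for f n
    by (simp add: eq V_def I_def)
  have V0: "0 \<le> V f N n" for f N n by (simp add: V_def)
  show ?thesis unfolding max_eq bdd_eq
  proof (intro conjI allI impI)
    fix p :: real and w assume p: "1 < p" and w: "Ap_weight p w"
    have wpos: "0 < w k" for k using w by (simp add: Ap_weight_def)
    obtain C where C: "0 < C" "\<And>X f N1 N2. finite X \<Longrightarrow> summable (\<lambda>y. \<bar>f y\<bar> powr p * w y) \<Longrightarrow> (\<forall>x\<in>X. N1 x \<le> N2 x) \<Longrightarrow>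
      (\<Sum>x\<in>X. \<bar>transform (N1 x) (N2 x) f x\<bar> powr p * w x) \<le> C * (\<Sum>y. \<bar>f y\<bar> powr p * w y)"
      using transform_lp[OF p w] by blast
    show "\<exists>C>0. \<forall>f. in_lp p w f \<longrightarrow> (\<forall>n. bdd_above ((\<lambda>N. V f N n) ` I))
       \<and> in_lp p w (\<lambda>n. SUP N\<in>I. V f N n) \<and> lp_norm p w (\<lambda>n. SUP N\<in>I. V f N n) \<le> C * lp_norm p w f"
    \<comment> \<open>\<open>C\<close> bounds sums of \<open>p\<close>-th powers; the norms need its
      \<open>p\<close>-th root.\<close>
    proof (intro exI[of _ "C powr (1 / p)"] conjI allI impI)
      show "0 < C powr (1 / p)" using C by simp
      fix f assume "in_lp p w f"
      then have f: "summable (\<lambda>y. \<bar>f y\<bar> powr p * w y)" by (simp add: in_lp_def)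
      have h: "(\<Sum>x\<in>X. V f (N x) x powr p * w x) \<le> C * (\<Sum>y. \<bar>f y\<bar> powr p * w y)" if "finite X" "\<forall>x\<in>X. N x \<in> I" for X N
        unfolding V_def using that I_le by (intro C(2)[where ?N1.0 = "\<lambda>x. fst (N x)" and ?N2.0 = "\<lambda>x. snd (N x)"] f) auto
      have p0: "0 < p" using p by simp
      note S = strong_type_sup[where V = "V f", OF p0 wpos I V0 h]
      show "bdd_above ((\<lambda>N. V f N n) ` I)" for n using S(1) .
      show "in_lp p w (\<lambda>n. SUP N\<in>I. V f N n)" unfolding in_lp_def using S(2) .
      have F0: "0 \<le> (\<Sum>y. \<bar>f y\<bar> powr p * w y)" using f wpos by (intro suminf_nonneg) (auto simp: less_imp_le)
      have "0 \<le> (\<Sum>x. \<bar>SUP N\<in>I. V f N x\<bar> powr p * w x)" using S(2) wpos by (intro suminf_nonneg) (auto simp: less_imp_le)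
      then have "lp_norm p w (\<lambda>n. SUP N\<in>I. V f N n) \<le> (C * (\<Sum>y. \<bar>f y\<bar> powr p * w y)) powr (1 / p)"
        unfolding lp_norm_def using S(3) p by (intro powr_mono2) auto
      also have "\<dots> = C powr (1 / p) * lp_norm p w f" using C F0 by (simp add: lp_norm_def powr_mult)
      finally show "lp_norm p w (\<lambda>n. SUP N\<in>I. V f N n) \<le> C powr (1 / p) * lp_norm p w f" .
    qed
  next
    fix w assume w: "A1_weight w"
    have wpos: "0 < w k" for k using w by (simp add: A1_weight_def)
    obtain C where C: "0 < C" "\<And>X f N1 N2 l. finite X \<Longrightarrow> summable (\<lambda>y. \<bar>f y\<bar> * w y) \<Longrightarrow> 0 < l \<Longrightarrow>
      (\<forall>x\<in>X. N1 x \<le> N2 x \<and> l < \<bar>transform (N1 x) (N2 x) f x\<bar>) \<Longrightarrow> l * sum w X \<le> C * (\<Sum>y. \<bar>f y\<bar> * w y)"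
      using transform_weak[OF w] by blast
    show "\<exists>C>0. \<forall>f. in_lp 1 w f \<longrightarrow> (\<forall>n. bdd_above ((\<lambda>N. V f N n) ` I))
       \<and> (\<forall>s>0. summable (\<lambda>n. if \<bar>SUP N\<in>I. V f N n\<bar> > s then w n else 0)
            \<and> s * level_weight w (\<lambda>n. SUP N\<in>I. V f N n) s \<le> C * lp_norm 1 w f)"
    proof (intro exI[of _ C] conjI allI impI)
      show "0 < C" by (rule C(1))
      fix f assume "in_lp 1 w f"
      then have f: "summable (\<lambda>y. \<bar>f y\<bar> * w y)" by (simp add: in_lp_def)
      have h: "l * sum w X \<le> C * (\<Sum>y. \<bar>f y\<bar> * w y)" if "finite X" "0 < l" "\<forall>x\<in>X. N x \<in> I \<and> l < V f (N x) x" for X N l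
        using that I_le unfolding V_def by (intro C(2)[where ?N1.0 = "\<lambda>x. fst (N x)" and ?N2.0 = "\<lambda>x. snd (N x)"] f) auto
      note S = weak_type_sup[where V = "V f", OF wpos I V0 h]
      show "bdd_above ((\<lambda>N. V f N n) ` I)" for n using S(1) .
      fix s :: real assume s: "0 < s"
      show "summable (\<lambda>n. if \<bar>SUP N\<in>I. V f N n\<bar> > s then w n else 0)" using S(2)[OF _ _ _ s] .
      have "0 \<le> (\<Sum>y. \<bar>f y\<bar> * w y)" using f wpos by (intro suminf_nonneg) (auto simp: less_imp_le)
      then have "lp_norm 1 w f = (\<Sum>y. \<bar>f y\<bar> * w y)" by (simp add: lp_norm_def)
      then show "s * level_weight w (\<lambda>n. SUP N\<in>I. V f N n) s \<le> C * lp_norm 1 w f"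
        unfolding level_weight_def using S(3)[OF _ _ _ s] by simp
    qed
  qed
qed

end
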